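(* Let $\|\cdot\|_{\mathcal P}$ be a norm on $\mathbb{R}^2$ for which the unit ball $\mathcal{P}$ is a quadrilateral, and let $G$ be a finite simple graph with a group action $\theta:\mathbb{Z}_n\to \mathrm{Aut}(G)$, where $\mathbb{Z}_n=\langle\gamma\rangle$ and $n\in\{2,4\}$. (A) Let $n=2$. The following statements are equivalent. (i) There exist a representation $\tau:\mathbb{Z}_2\to \mathrm{GL}(\mathbb{R}^2)$ and a point $p$ such that the bar-joint framework $(G,p)$ is well-positioned and isostatic in $(\mathbb{R}^2,\|\cdot\|_{\mathcal P})$ and $\mathbb{Z}_2$-symmetric with respect to $\theta$ and $\tau$, where the symmetry operation $\gamma$ is a reflection which preserves the facets of $\mathcal{P}$. (ii) $G$ is expressible as a union of two edge-disjoint spanning trees, both of which are $\mathbb{Z}_2$-symmetric with respect to $\theta$, and no edge of $G$ is fixed by $\gamma$. (B) Let $n=2$. The following statements are equivalent. (i) There exist a representation $\tau:\mathbb{Z}_2\to \mathrm{GL}(\mathbb{R}^2)$ and a point $p$ such that the bar-joint framework $(G,p)$ is well-positioned and isostatic in $(\mathbb{R}^2,\|\cdot\|_{\mathcal P})$ and $\mathbb{Z}_2$-symmetric with respect to $\theta$ and $\tau$, where the symmetry operation $\gamma$ is a reflection which swaps the facets of $\mathcal{P}$. (ii) $G$ is expressible as a union of two edge-disjoint spanning trees $G_1$ and $G_2$ such that $G_1=\gamma(G_2)$ and $G_2=\gamma(G_1)$, and no edge of $G$ is fixed by $\gamma$. (C) Let $n=2$. The following statements are equivalent. (i) There exist a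 representation $\tau:\mathbb{Z}_2\to \mathrm{GL}(\mathbb{R}^2)$ and a point $p$ such that the bar-joint framework $(G,p)$ is well-positioned and isostatic in $(\mathbb{R}^2,\|\cdot\|_{\mathcal P})$ and $\mathbb{Z}_2$-symmetric with respect to $\theta$ and $\tau$, where the symmetry operation $\gamma$ is a half-turn rotation. (ii) $G$ is expressible as a union of two edge-disjoint spanning trees, both of which are $\mathbb{Z}_2$-symmetric with respect to $\theta$, and either no edge or (exactly) two edges of $G$ are fixed by $\gamma$. (D) Let $n=4$. The following statements are equivalent. (i) There exist a representation $\tau:\mathbb{Z}_4\to \mathrm{GL}(\mathbb{R}^2)$ and a point $p$ such that the bar-joint framework $(G,p)$ is well-positioned and isostatic in $(\mathbb{R}^2,\|\cdot\|_{\mathcal P})$ and $\mathbb{Z}_4$-symmetric with respect to $\theta$ and $\tau$, where the symmetry operation $\gamma$ is a quarter-turn rotation. (ii) $G$ is expressible as a union of two edge-disjoint spanning trees $G_1$ and $G_2$ such that $G_1=\gamma(G_2)$ and $G_2=\gamma(G_1)$, and either no edge or (exactly) two edges of $G$ are fixed by $\gamma^2$.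
   Context: Graphs. $\mathrm{Aut}(G)$ is the group of permutations $\pi$ of $V(G)$ such that $\pi(v)\pi(w)\in E(G)$ iff $vw\in E(G)$. An action of a group $\Gamma$ on $G$ is a homomorphism $\theta:\Gamma\to\mathrm{Aut}(G)$; write $\gamma v=\theta(\gamma)v$ and $\gamma(vw)=(\gamma v)(\gamma w)$. An edge $vw$ is fixed by $\gamma$ if $\gamma(vw)=vw$ as an unordered pair. A subgraph $H$ of $G$ is $\Gamma$-symmetric with respect to $\theta$ if $\gamma(H)=H$ for all $\gamma\in\Gamma$, where $\gamma(H)$ is the image of $H$ under $\theta(\gamma)$. Norm and facets. The unit ball $\mathcal P$ of $\|\cdot\|_{\mathcal P}$ is a quadrilateral (necessarily a parallelogram centred at $0$) with facets (sides) $\pm F_1,\pm F_2$. For a facet $F$ write $[F]=\{F,-F\}$. Frameworks. A bar-joint framework $(G,p)$ in $\mathbb{R}^2$ is a finite simple graph $G$ and a point $p=(p(v))_{v\in V(G)}$ whose components $p(v)\in\mathbb{R}^2$ are distinct. It is well-positioned in $(\mathbb{R}^2,\|\cdot\|_{\mathcal P})$ if for every edge $vw$ the vector $\frac{p(v)-p(w)}{\|p(v)-p(w)\|_{\mathcal P}}$ lies in exactly one facet of $\mathcal P$; equivalently the rigidity map $f_G:(\mathbb{R}^2)^{|V(G)|}\to\mathbb{R}^{|E(G)|}$, $x\mapsto(\|x(v)-x(w)\|_{\mathcal P})_{vw\in E(G)}$, is differentiable at $p$. For well-positioned $(G,p)$, an infinitesimal flex is an element of $\ker df_G(p)$. A continuous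 rigid motion is a family of continuous paths $\alpha_x:(-\delta,\delta)\to\mathbb{R}^2$, $x\in\mathbb{R}^2$, with $\alpha_x(0)=x$ and $\|\alpha_x(t)-\alpha_y(t)\|_{\mathcal P}=\|x-y\|_{\mathcal P}$ for all $x,y,t$. A flex $u$ is trivial if there is a continuous rigid motion with $u(v)=\alpha_{p(v)}'(0)$ for all $v\in V(G)$. $(G,p)$ is infinitesimally rigid if every infinitesimal flex is trivial, and isostatic if it is infinitesimally rigid and no proper spanning subframework $(H,p)$ ($H\subsetneq G$ with $V(H)=V(G)$) is infinitesimally rigid. Symmetry. $(G,p)$ is $\Gamma$-symmetric with respect to $\theta:\Gamma\to\mathrm{Aut}(G)$ and a representation $\tau:\Gamma\to\mathrm{GL}(\mathbb{R}^2)$ if for each $\gamma\in\Gamma$, $\tau(\gamma)$ is an isometry of $(\mathbb{R}^2,\|\cdot\|_{\mathcal P})$ and $\tau(\gamma)p(v)=p(\gamma v)$ for all $v\in V(G)$. The element $\gamma$ preserves the facets of $\mathcal P$ if $\tau(\gamma)F\in[F]$ for each facet $F$; it swaps the facets if $\tau(\gamma)F_1\in[F_2]$ and $\tau(\gamma)F_2\in[F_1]$. The element $\gamma$ is a reflection if $\tau(\gamma)=I-2P$ for some rank one projection $P$ on $\mathbb{R}^2$ (not necessarily orthogonal); a half-turn rotation if $\tau(\gamma)$ is the rotation by $\pi$ about the origin, i.e. $\tau(\gamma)=-I$; a quarter-turn rotation if $\tau(\gamma)^2=-I$. (In the paper's notation the symmetry groups in (A) and (B) are called $\mathcal C_s$,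 in (C) $\mathcal C_2$, and in (D) $\mathcal C_4$.) *)

theory Defs
  imports "HOL-Analysis.Analysis" "HOL-Algebra.Elementary_Groups" "HOL-Algebra.Bij"
begin

section \<open>Graphs\<close>

text \<open>
  The vertex set of a graph is a finite type \<open>'v\<close>, so a graph is given by its
  set of edges, an edge being an unordered pair \<open>{v, w}\<close> of distinct vertices.  A subset of the
  edge set is then the same thing as a spanning subgraph.
\<close>

definition simple_graph :: "'v::finite set set \<Rightarrow> bool" where
  "simple_graph E \<longleftrightarrow> (\<forall>e\<in>E. card e = 2)"

definition connected_graph :: "'v::finite set set \<Rightarrow> bool" where
  "connected_graph E \<longleftrightarrow> (\<forall>u v. (u, v) \<in> {(x, y). {x, y} \<in> E}\<^sup>*)"

definition is_cycle :: "'v::finite set set \<Rightarrow> 'v list \<Rightarrow> bool" where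
  "is_cycle E vs \<longleftrightarrow> length vs \<ge> 3 \<and> distinct vs \<and>
     (\<forall>i < length vs. {vs ! i, vs ! (Suc i mod length vs)} \<in> E)"

definition spanning_tree :: "'v::finite set set \<Rightarrow> 'v set set \<Rightarrow> bool" where
  "spanning_tree E T \<longleftrightarrow> T \<subseteq> E \<and> connected_graph T \<and> (\<nexists>vs. is_cycle T vs)"

definition edge_disjoint_spanning_trees ::
    "'v::finite set set \<Rightarrow> 'v set set \<Rightarrow> 'v set set \<Rightarrow> bool" where
  "edge_disjoint_spanning_trees E T1 T2 \<longleftrightarrow>
     spanning_tree E T1 \<and> spanning_tree E T2 \<and> T1 \<inter> T2 = {} \<and> E = T1 \<union> T2"

definition graph_aut :: "'v::finite set set \<Rightarrow> ('v \<Rightarrow> 'v) monoid" where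
  "graph_aut E = (BijGroup UNIV)
     \<lparr>carrier := {f \<in> Bij UNIV. \<forall>v w. {f v, f w} \<in> E \<longleftrightarrow> {v, w} \<in> E}\<rparr>"

definition graph_action :: "nat \<Rightarrow> 'v::finite set set \<Rightarrow> (int \<Rightarrow> 'v \<Rightarrow> 'v) \<Rightarrow> bool" where
  "graph_action n E \<theta> \<longleftrightarrow> \<theta> \<in> hom (integer_mod_group n) (graph_aut E)"

text \<open>The image of a spanning subgraph, given by its edges, under a permutation of the vertices.\<close>

definition graph_image :: "('v::finite \<Rightarrow> 'v) \<Rightarrow> 'v set set \<Rightarrow> 'v set set" where
  "graph_image f H = (\<lambda>e. f ` e) ` H"

definition symmetric_subgraph :: "nat \<Rightarrow> (int \<Rightarrow> 'v::finite \<Rightarrow> 'v) \<Rightarrow> 'v set set \<Rightarrow> bool" where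
  "symmetric_subgraph n \<theta> H \<longleftrightarrow> (\<forall>g\<in>carrier (integer_mod_group n). graph_image (\<theta> g) H = H)"

definition fixed_edges :: "'v::finite set set \<Rightarrow> ('v \<Rightarrow> 'v) \<Rightarrow> 'v set set" where
  "fixed_edges E f = {e \<in> E. f ` e = e}"


section \<open>Norms on the plane whose unit ball is a quadrilateral\<close>

definition is_norm :: "(real^2 \<Rightarrow> real) \<Rightarrow> bool" where
  "is_norm N \<longleftrightarrow>
     (\<forall>x. N x \<ge> 0) \<and> (\<forall>x. N x = 0 \<longleftrightarrow> x = 0) \<and>
     (\<forall>c x. N (c *\<^sub>R x) = \<bar>c\<bar> * N x) \<and> (\<forall>x y. N (x + y) \<le> N x + N y)"

definition unit_ball :: "(real^2 \<Rightarrow> real) \<Rightarrow> (real^2) set" where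
  "unit_ball N = {x. N x \<le> 1}"

definition facets :: "(real^2 \<Rightarrow> real) \<Rightarrow> (real^2) set set" where
  "facets N = {F. F facet_of unit_ball N}"

text \<open>A quadrilateral is a convex polygon with exactly four sides.\<close>

definition quadrilateral_ball :: "(real^2 \<Rightarrow> real) \<Rightarrow> bool" where
  "quadrilateral_ball N \<longleftrightarrow> polytope (unit_ball N) \<and> card (facets N) = 4"

text \<open>The class \<open>[F] = {F, -F}\<close>; the unary minus on sets denotes the complement in HOL, hence
  the image under \<^const>\<open>uminus\<close>.\<close>

definition facet_class :: "(real^2) set \<Rightarrow> (real^2) set set" where
  "facet_class F = {F, uminus ` F}"


section \<open>Bar-joint frameworks\<close>

text \<open>A placement of the vertices is a vector \<open>p\<close> in \<open>(\<real>\<^sup>2)\<^sup>V\<close>.\<close>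

definition placement :: "(real^2)^'v::finite \<Rightarrow> bool" where
  "placement p \<longleftrightarrow> inj (\<lambda>v. p $ v)"

definition well_positioned ::
    "(real^2 \<Rightarrow> real) \<Rightarrow> 'v::finite set set \<Rightarrow> (real^2)^'v \<Rightarrow> bool" where
  "well_positioned N E p \<longleftrightarrow>
     (\<forall>v w. {v, w} \<in> E \<longrightarrow>
        (\<exists>!F. F \<in> facets N \<and> (p $ v - p $ w) /\<^sub>R N (p $ v - p $ w) \<in> F))"

text \<open>The length of \<open>{v, w}\<close> does not depend on the order of the end points as \<open>N\<close> is even.\<close>

definition edge_length ::
    "(real^2 \<Rightarrow> real) \<Rightarrow> (real^2)^'v::finite \<Rightarrow> 'v set \<Rightarrow> real" where
  "edge_length N x e = (THE r. \<exists>v w. e = {v, w} \<and> r = N (x $ v - x $ w))"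

lemma edge_length_doubleton:
  assumes "is_norm N"
  shows "edge_length N x {v, w} = N (x $ v - x $ w)"
proof -
  have "N (x $ w - x $ v) = N (x $ v - x $ w)"
    using assms unfolding is_norm_def
    by (metis abs_1 abs_minus_cancel minus_diff_eq mult_1 scaleR_minus1_left)
  then show ?thesis
    unfolding edge_length_def by (intro the_equality) (auto simp: doubleton_eq_iff)
qed

text \<open>The coordinates of the codomain are indexed by all sets of vertices; those that are not edges
  are padded with zeros, so that the essential codomain is \<open>\<real>\<^sup>E\<close>.\<close>

definition rigidity_map ::
    "(real^2 \<Rightarrow> real) \<Rightarrow> 'v::finite set set \<Rightarrow> (real^2)^'v \<Rightarrow> real^('v set)" where
  "rigidity_map N E x = (\<chi> e. if e \<in> E then edge_length N x e else 0)"

definition infinitesimal_flex ::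
    "(real^2 \<Rightarrow> real) \<Rightarrow> 'v::finite set set \<Rightarrow> (real^2)^'v \<Rightarrow> (real^2)^'v \<Rightarrow> bool" where
  "infinitesimal_flex N E p u \<longleftrightarrow> frechet_derivative (rigidity_map N E) (at p) u = 0"

definition rigid_motion ::
    "(real^2 \<Rightarrow> real) \<Rightarrow> real \<Rightarrow> (real^2 \<Rightarrow> real \<Rightarrow> real^2) \<Rightarrow> bool" where
  "rigid_motion N \<delta> \<alpha> \<longleftrightarrow> \<delta> > 0 \<and>
     (\<forall>x. continuous_on {-\<delta><..<\<delta>} (\<alpha> x)) \<and> (\<forall>x. \<alpha> x 0 = x) \<and>
     (\<forall>x y. \<forall>t\<in>{-\<delta><..<\<delta>}. N (\<alpha> x t - \<alpha> y t) = N (x - y))"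

definition trivial_flex ::
    "(real^2 \<Rightarrow> real) \<Rightarrow> (real^2)^'v::finite \<Rightarrow> (real^2)^'v \<Rightarrow> bool" where
  "trivial_flex N p u \<longleftrightarrow>
     (\<exists>\<delta> \<alpha>. rigid_motion N \<delta> \<alpha> \<and> (\<forall>v. (\<alpha> (p $ v) has_vector_derivative u $ v) (at 0)))"

definition infinitesimally_rigid ::
    "(real^2 \<Rightarrow> real) \<Rightarrow> 'v::finite set set \<Rightarrow> (real^2)^'v \<Rightarrow> bool" where
  "infinitesimally_rigid N E p \<longleftrightarrow> (\<forall>u. infinitesimal_flex N E p u \<longrightarrow> trivial_flex N p u)"

definition isostatic ::
    "(real^2 \<Rightarrow> real) \<Rightarrow> 'v::finite set set \<Rightarrow> (real^2)^'v \<Rightarrow> bool" where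
  "isostatic N E p \<longleftrightarrow>
     infinitesimally_rigid N E p \<and> (\<forall>H. H \<subset> E \<longrightarrow> \<not> infinitesimally_rigid N H p)"


section \<open>Symmetric frameworks\<close>

definition GL2 :: "(real^2^2) monoid" where
  "GL2 = \<lparr>carrier = {A. invertible A}, mult = (**), one = mat 1\<rparr>"

definition representation :: "nat \<Rightarrow> (int \<Rightarrow> real^2^2) \<Rightarrow> bool" where
  "representation n \<tau> \<longleftrightarrow> \<tau> \<in> hom (integer_mod_group n) GL2"

definition isometry :: "(real^2 \<Rightarrow> real) \<Rightarrow> real^2^2 \<Rightarrow> bool" where
  "isometry N A \<longleftrightarrow> (\<forall>x y. N (A *v x - A *v y) = N (x - y))"

definition symmetric_framework ::
    "(real^2 \<Rightarrow> real) \<Rightarrow> nat \<Rightarrow> (int \<Rightarrow> 'v::finite \<Rightarrow> 'v) \<Rightarrow> (int \<Rightarrow> real^2^2) \<Rightarrow>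
     (real^2)^'v \<Rightarrow> bool" where
  "symmetric_framework N n \<theta> \<tau> p \<longleftrightarrow>
     (\<forall>g\<in>carrier (integer_mod_group n).
        isometry N (\<tau> g) \<and> (\<forall>v. \<tau> g *v (p $ v) = p $ (\<theta> g v)))"

definition preserves_facets :: "(real^2 \<Rightarrow> real) \<Rightarrow> real^2^2 \<Rightarrow> bool" where
  "preserves_facets N A \<longleftrightarrow> (\<forall>F\<in>facets N. (*v) A ` F \<in> facet_class F)"

definition swaps_facets :: "(real^2 \<Rightarrow> real) \<Rightarrow> real^2^2 \<Rightarrow> bool" where
  "swaps_facets N A \<longleftrightarrow>
     (\<exists>F1 F2. facets N = facet_class F1 \<union> facet_class F2 \<and>
        (*v) A ` F1 \<in> facet_class F2 \<and> (*v) A ` F2 \<in> facet_class F1)"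

definition is_reflection :: "real^2^2 \<Rightarrow> bool" where
  "is_reflection A \<longleftrightarrow> (\<exists>P. P ** P = P \<and> rank P = 1 \<and> A = mat 1 - 2 *\<^sub>R P)"

definition half_turn :: "real^2^2 \<Rightarrow> bool" where
  "half_turn A \<longleftrightarrow> A = - mat 1"

definition quarter_turn :: "real^2^2 \<Rightarrow> bool" where
  "quarter_turn A \<longleftrightarrow> A ** A = - mat 1"

definition symmetric_isostatic_framework ::
    "(real^2 \<Rightarrow> real) \<Rightarrow> 'v::finite set set \<Rightarrow> nat \<Rightarrow> (int \<Rightarrow> 'v \<Rightarrow> 'v) \<Rightarrow>
     (int \<Rightarrow> real^2^2) \<Rightarrow> (real^2)^'v \<Rightarrow> bool" where
  "symmetric_isostatic_framework N E n \<theta> \<tau> p \<longleftrightarrow>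
     representation n \<tau> \<and> placement p \<and> well_positioned N E p \<and> isostatic N E p \<and>
     symmetric_framework N n \<theta> \<tau> p"

end

theory Submission
  imports Defs
begin

text \<open>
  Write the norm as the maximum of $|a \cdot x|$ and $|b \cdot x|$ for two linear functionals
  that are constant on the facets (\<open>quad_norm_exists\<close>). A framework is
  well-positioned if on each edge one of the two functionals is strictly larger in absolute
  value, and this colours the edges with two colours. An edge of the first colour constrains
  only the \<open>a\<close>-coordinates of the velocities, an edge of the second only the
  \<open>b\<close>-coordinates, and the trivial flexes are the translations. Hence a framework
  is isostatic exactly if both colour classes are spanning trees
  (\<open>isostatic_iff_trees\<close>).

  From frameworks to trees. An isometry that preserves the two pairs of facets preserves the
  colours, and one that swaps them, such as a quarter turn, exchanges the colours. So the two
  trees are symmetric or are exchanged. The number of fixed edges follows from a count. If a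
  tree has an involutive symmetry with fixed vertices, the fixed edges form a tree on these
  vertices; if no vertex is fixed, exactly one edge is fixed, and it is reversed
  (\<open>tree_involution_fixed_vertex\<close>, \<open>tree_involution_free\<close>). Under a
  half turn only a vertex at the origin is fixed, which leaves no fixed edge or one in each
  tree. A reflection that preserves the facets negates one of the functionals, so that one
  colour has no edge with two fixed ends and the other no reversed edge; by the count it fixes
  no edge at all. If the colours are exchanged by the generator, it cannot fix an edge either.

  From trees to frameworks. This is the main difficulty: two edge-disjoint spanning trees with a
  symmetry have to be drawn in the plane with that symmetry, such that the edges of the first
  tree are dominated by \<open>a\<close> and those of the second by \<open>b\<close>. In the
  coordinates $s = x + y$, $t = x - y$ the first condition says that the two ends are in
  increasing position, and the second that they are in decreasing position. The theorem
  \<open>sym_pair_realizable\<close> provides such drawings for pairs of disjoint forests, by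
  induction on the number of vertices. By counting there is a vertex with at most three edges.
  Its orbit is removed, the rest is drawn, and the orbit is put back, which is immediate unless
  the vertex has two neighbours $w_1$, $w_2$ of one colour and a third of the other. In this
  case an edge of the first of these colours between $w_1$ and $w_2$ makes room for the vertex.
  It may happen that the same edge is already present in the other colour, or, if the colours
  are exchanged, that a symmetry forces both colours on it. Then the edge belongs to a cluster,
  a set of vertices on which both forests induce trees. A maximal cluster and its images are
  shrunk to points, the quotient is drawn, and the clusters, drawn separately, are inserted in
  small size. The quotient fails to be a pair of disjoint forests only if a cluster is linked to
  something in both colours. By maximality the graph then consists of little more than the
  images of the cluster, and can be drawn directly.

  An edge fixed by a half turn is drawn through the origin. It is split by a new vertex at the
  origin before the theorem is applied (\<open>realizable_two_fixed_edges\<close>).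
\<close>

section \<open>Relative position of points\<close>

text \<open>
  Points are written in the coordinates $s = x + y$, $t = x - y$, where $x$ and $y$ are the
  values of the two linear functionals whose larger absolute value is the norm. Since $st = x^2
  - y^2$, the first functional dominates on a difference of two points exactly when
  \<open>s\<close> and \<open>t\<close> of the difference have the same sign. The two colours of
  an edge thus become the two order types of a pair of points: increasing (\<open>True\<close>)
  and decreasing (\<open>False\<close>).
\<close>

type_synonym point = "real \<times> real"

definition rel :: "bool \<Rightarrow> point \<Rightarrow> point \<Rightarrow> bool" where
  "rel c P Q \<longleftrightarrow> (if c then 0 < (fst P - fst Q) * (snd P - snd Q)
                  else (fst P - fst Q) * (snd P - snd Q) < 0)"

text \<open>
  \<open>Mirror\<close> is the reflection $(x, y) \mapsto (-x, y)$, which keeps the order type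
  of every pair, and \<open>Swap\<close> is the reflection $(x, y) \mapsto (y, x)$, which
  exchanges the two order types, as does \<open>Quarter\<close>. The identity is included
  because the induction passes to pieces of the graph on which no symmetry is left.
\<close>

datatype plane_sym = Id | Mirror | Half | Quarter | Swap

fun act :: "plane_sym \<Rightarrow> point \<Rightarrow> point" where
  "act Id P = P"
| "act Mirror P = (- snd P, - fst P)"
| "act Half P = (- fst P, - snd P)"
| "act Quarter P = (snd P, - fst P)"
| "act Swap P = (fst P, - snd P)"

fun period :: "plane_sym \<Rightarrow> nat" where
  "period Id = 1"
| "period Mirror = 2"
| "period Half = 2"
| "period Quarter = 4"
| "period Swap = 2"

definition swaps_colours :: "plane_sym \<Rightarrow> bool" where
  "swaps_colours ty \<longleftrightarrow> ty = Quarter \<or> ty = Swap"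

text \<open>
  The symmetries for which a vertex fixed by the symmetry group, once it exists, is unique: for
  the two rotations it is placed at the origin. The set of fixed points of \<open>Mirror\<close>
  is a line, but in the situation that matters only one vertex is fixed, since two fixed
  vertices in a symmetric tree force a fixed edge.
\<close>

definition central :: "plane_sym \<Rightarrow> bool" where
  "central ty \<longleftrightarrow> ty = Mirror \<or> ty = Half \<or> ty = Quarter"

text \<open>
  The colour of the image of an edge of colour \<open>c\<close> under the \<open>i\<close>-th
  power of the symmetry.
\<close>

definition col :: "plane_sym \<Rightarrow> bool \<Rightarrow> nat \<Rightarrow> bool" where
  "col ty c i \<longleftrightarrow> (c \<noteq> (swaps_colours ty \<and> odd i))"

text \<open>
  The points with trivial stabilizer under every symmetry that is considered.
\<close>

definition generic :: "point \<Rightarrow> bool" where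
  "generic P \<longleftrightarrow> fst P \<noteq> 0 \<and> snd P \<noteq> 0 \<and> fst P \<noteq> snd P \<and> fst P \<noteq> - snd P"

text \<open>
  The box spanned by \<open>P\<close> and \<open>Q\<close>. It is the obstruction in
  \<open>place_box\<close>: a point in increasing position to both \<open>P\<close> and
  \<open>Q\<close>, and in decreasing position to a point \<open>R\<close>, can fail to exist
  only if \<open>R\<close> lies in the box.
\<close>

definition in_box :: "point \<Rightarrow> point \<Rightarrow> point \<Rightarrow> bool" where
  "in_box P Q R \<longleftrightarrow> min (fst P) (fst Q) \<le> fst R \<and> fst R \<le> max (fst P) (fst Q)
     \<and> min (snd P) (snd Q) \<le> snd R \<and> snd R \<le> max (snd P) (snd Q)"

lemma period_pos [simp]: "0 < period ty"
  by (cases ty) auto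

lemma rel_sym: "rel c P Q \<longleftrightarrow> rel c Q P"
  unfolding rel_def by (simp add: mult_less_0_iff zero_less_mult_iff) argo

lemma rel_shift [simp]: "rel c (P + R) (Q + R) \<longleftrightarrow> rel c P Q"
  unfolding rel_def by simp

lemma rel_scale: "e > 0 \<Longrightarrow> rel c (e *\<^sub>R P) (e *\<^sub>R Q) \<longleftrightarrow> rel c P Q"
proof -
  assume "e > 0"
  moreover have "(fst (e *\<^sub>R P) - fst (e *\<^sub>R Q)) * (snd (e *\<^sub>R P) - snd (e *\<^sub>R Q))
      = (e * e) * ((fst P - fst Q) * (snd P - snd Q))"
    by (simp add: algebra_simps)
  ultimately show ?thesis
    unfolding rel_def by (simp add: zero_less_mult_iff mult_less_0_iff)
qed

lemma open_rel: "open {P. rel c P Q}"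
proof (cases c)
  case True
  have "{P. rel c P Q} = {P. 0 < (fst P - fst Q) * (snd P - snd Q)}"
    using True by (simp add: rel_def)
  also have "open \<dots>"
    by (intro open_Collect_less continuous_intros)
  finally show ?thesis .
next
  case False
  have "{P. rel c P Q} = {P. (fst P - fst Q) * (snd P - snd Q) < 0}"
    using False by (simp add: rel_def)
  also have "open \<dots>"
    by (intro open_Collect_less continuous_intros)
  finally show ?thesis .
qed

lemma col_0 [simp]: "col ty c 0 = c"
  by (simp add: col_def)

lemma col_col [simp]: "col ty (col ty c i) i = c"
  by (auto simp: col_def)

lemma col_Suc: "col ty c (Suc i) = (col ty c i \<noteq> swaps_colours ty)"
  by (auto simp: col_def)

lemma col_period [simp]: "col ty c (period ty) = c"
  by (cases ty) (auto simp: col_def swaps_colours_def)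

lemma rel_act: "rel (c \<noteq> swaps_colours ty) (act ty P) (act ty Q) \<longleftrightarrow> rel c P Q"
  by (cases ty; cases c) (auto simp: rel_def swaps_colours_def algebra_simps)

lemma rel_act_pow: "rel (col ty c i) ((act ty ^^ i) P) ((act ty ^^ i) Q) \<longleftrightarrow> rel c P Q"
proof (induction i)
  case (Suc i)
  have "rel (col ty c (Suc i)) ((act ty ^^ Suc i) P) ((act ty ^^ Suc i) Q)
      \<longleftrightarrow> rel (col ty c i \<noteq> swaps_colours ty) (act ty ((act ty ^^ i) P)) (act ty ((act ty ^^ i) Q))"
    by (simp only: col_Suc funpow.simps comp_def)
  also have "\<dots> \<longleftrightarrow> rel c P Q"
    by (simp only: rel_act Suc.IH)
  finally show ?case .
qed simp

lemma act_add: "act ty (P + Q) = act ty P + act ty Q"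
  by (cases ty) (auto simp: prod_eq_iff)

lemma act_scale: "act ty (e *\<^sub>R P) = e *\<^sub>R act ty P"
  by (cases ty) (auto simp: prod_eq_iff)

lemma act_0 [simp]: "act ty 0 = 0"
  by (cases ty) (auto simp: prod_eq_iff)

lemma act_pow_0 [simp]: "(act ty ^^ i) 0 = 0"
  by (induction i) auto

lemma act_period: "(act ty ^^ period ty) P = P"
  by (cases ty) (auto simp: eval_nat_numeral)

lemma less4: "j < (4::nat) \<longleftrightarrow> j = 0 \<or> j = 1 \<or> j = 2 \<or> j = 3" by auto
lemma less2: "j < (2::nat) \<longleftrightarrow> j = 0 \<or> j = 1" by auto

lemma act_simps3:
  "(act ty ^^ 2) P = act ty (act ty P)" "(act ty ^^ 3) P = act ty (act ty (act ty P))"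
  by (auto simp: eval_nat_numeral)

lemma generic_free:
  assumes "generic P" "0 < j" "j < period ty"
  shows "(act ty ^^ j) P \<noteq> P"
  using assms by (cases ty) (auto simp: generic_def less4 less2 act_simps3 prod_eq_iff)

text \<open>
  A nonempty open set of the plane is not covered by finitely many points and four lines; so a
  position that satisfies open conditions can always be made generic.
\<close>

lemma pick_generic:
  assumes "open (S::point set)" "P \<in> S" "finite B"
  shows "\<exists>Q\<in>S. generic Q \<and> Q \<notin> B"
proof -
  obtain U V where UV: "open U" "open V" "P \<in> U \<times> V" "U \<times> V \<subseteq> S"
    using assms(1,2) open_prod_elim by blast
  have inf: "infinite U" "infinite V"
    using UV by (auto dest: finite_imp_not_open)
  obtain s where s: "s \<in> U" "s \<notin> insert 0 (fst ` B)"
    using inf(1) assms(3) by (meson finite_imageI finite_insert finite_subset subsetI)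
  obtain t where t: "t \<in> V" "t \<notin> {0, s, - s}"
    using inf(2) by (meson finite.emptyI finite_insert finite_subset subsetI)
  have "(s, t) \<in> S" "generic (s, t)" "(s, t) \<notin> B"
    using s t UV by (auto simp: generic_def image_iff)
  then show ?thesis by blast
qed

text \<open>
  Reflecting the second coordinate exchanges the order types, which reduces each placement lemma
  to one colour.
\<close>

definition flip :: "point \<Rightarrow> point" where "flip P = (fst P, - snd P)"

lemma rel_flip: "rel c (flip P) Q \<longleftrightarrow> rel (\<not> c) P (flip Q)"
  by (cases c) (auto simp: rel_def flip_def algebra_simps)

lemma flip_flip [simp]: "flip (flip P) = P" by (simp add: flip_def)

lemma flip_inj: "flip P = flip Q \<longleftrightarrow> P = Q" by (metis flip_flip)

lemma rel_cases:
  "rel True P Q \<longleftrightarrow> (fst P < fst Q \<and> snd P < snd Q) \<or> (fst Q < fst P \<and> snd Q < snd P)"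
  "rel False P Q \<longleftrightarrow> (fst P < fst Q \<and> snd Q < snd P) \<or> (fst Q < fst P \<and> snd P < snd Q)"
  by (auto simp: rel_def zero_less_mult_iff mult_less_0_iff)

lemma finite_less_ub_real:
  fixes B :: "real set"
  assumes "finite B"
  shows "\<exists>a. \<forall>x\<in>B. x < a"
proof -
  have "bdd_above B" using assms by (rule bdd_above_finite)
  then obtain a where "\<forall>x\<in>B. x \<le> a" by (auto simp: bdd_above_def)
  then show ?thesis by (intro exI[of _ "a + 1"]) force
qed

text \<open>
  If all neighbours of a new vertex have the same colour, a point far out in one quadrant will
  do.
\<close>

lemma far_point:
  assumes "finite B"
  shows "\<exists>P. \<forall>Q\<in>B. rel c P Q"
proof -
  have 1: "\<exists>P. \<forall>Q\<in>B. rel True P Q" if fin: "finite B" for B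
  proof -
    obtain a where a: "\<forall>x\<in>fst ` B. x < a"
      using finite_imageI[OF fin, of fst] by (meson finite_less_ub_real)
    obtain b where b: "\<forall>x\<in>snd ` B. x < b"
      using finite_imageI[OF fin, of snd] by (meson finite_less_ub_real)
    show ?thesis by (rule exI[of _ "(a, b)"]) (use a b in \<open>auto simp: rel_cases\<close>)
  qed
  show ?thesis
  proof (cases c)
    case True then show ?thesis using 1[OF assms] by simp
  next
    case False
    obtain P where P: "\<forall>Q\<in>flip ` B. rel True P Q" using 1[of "flip ` B"] assms by blast
    then have "\<forall>Q\<in>B. rel c (flip P) Q" using False by (auto simp: rel_flip)
    then show ?thesis by blast
  qed
qed

lemma place_11_True:
  assumes "P1 \<noteq> P2"
  shows "\<exists>P. rel True P P1 \<and> rel False P P2 \<and> (M < \<bar>fst P\<bar> \<or> M < \<bar>snd P\<bar>)"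
proof -
  define K where "K = \<bar>fst P1\<bar> + \<bar>fst P2\<bar> + \<bar>snd P1\<bar> + \<bar>snd P2\<bar> + \<bar>M\<bar> + 1"
  have K: "fst P1 < K" "- K < fst P1" "fst P2 < K" "- K < fst P2" "snd P1 < K" "- K < snd P1"
    "snd P2 < K" "- K < snd P2" "M < K" "0 < K"
    unfolding K_def by linarith+
  consider "snd P1 < snd P2" | "snd P2 < snd P1" | "snd P1 = snd P2" "fst P1 < fst P2"
    | "snd P1 = snd P2" "fst P2 < fst P1"
    using assms by (metis linorder_less_linear prod_eqI)
  then show ?thesis
  proof cases
    case 1
    show ?thesis
      by (rule exI[of _ "(K, (snd P1 + snd P2) / 2)"]) (use 1 K in \<open>auto simp: rel_cases\<close>)
  next
    case 2
    show ?thesis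
      by (rule exI[of _ "(-K, (snd P1 + snd P2) / 2)"]) (use 2 K in \<open>auto simp: rel_cases\<close>)
  next
    case 3
    show ?thesis
      by (rule exI[of _ "((fst P1 + fst P2) / 2, K)"]) (use 3 K in \<open>auto simp: rel_cases\<close>)
  next
    case 4
    show ?thesis
      by (rule exI[of _ "((fst P1 + fst P2) / 2, -K)"]) (use 4 K in \<open>auto simp: rel_cases\<close>)
  qed
qed

text \<open>
  For one neighbour of each colour any two distinct points leave room: the sets of admissible
  points are two opposite quadrants at \<open>P1\<close> and the two others at
  \<open>P2\<close>, and such sets meet in unbounded strips.
\<close>

lemma place_11:
  assumes "P1 \<noteq> P2"
  shows "\<exists>P. rel c P P1 \<and> rel (\<not> c) P P2 \<and> (M < \<bar>fst P\<bar> \<or> M < \<bar>snd P\<bar>)"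
proof (cases c)
  case True then show ?thesis using place_11_True[OF assms] by simp
next
  case False
  then show ?thesis using place_11_True[of P2 P1 M] assms by auto
qed

lemma place_11_tall_True:
  assumes "fst P1 \<noteq> fst P2"
  shows "\<exists>P. rel True P P1 \<and> rel False P P2 \<and> M < \<bar>snd P\<bar>
           \<and> \<bar>fst P\<bar> \<le> max \<bar>fst P1\<bar> \<bar>fst P2\<bar>"
proof -
  define K where "K = \<bar>snd P1\<bar> + \<bar>snd P2\<bar> + \<bar>M\<bar> + 1"
  have K: "snd P1 < K" "- K < snd P1" "snd P2 < K" "- K < snd P2" "M < K" "0 < K"
    unfolding K_def by linarith+
  consider "fst P1 < fst P2" | "fst P2 < fst P1" using assms by linarith
  then show ?thesis
  proof cases
    case 1
    show ?thesis
      by (rule exI[of _ "((fst P1 + fst P2) / 2, K)"]) (use 1 K in \<open>auto simp: rel_cases\<close>)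
  next
    case 2
    show ?thesis
      by (rule exI[of _ "((fst P1 + fst P2) / 2, -K)"]) (use 2 K in \<open>auto simp: rel_cases\<close>)
  qed
qed

text \<open>
  If the first coordinates differ, the unbounded strip can be taken vertical.
\<close>

lemma place_11_tall:
  assumes "fst P1 \<noteq> fst P2"
  shows "\<exists>P. rel c P P1 \<and> rel (\<not> c) P P2 \<and> M < \<bar>snd P\<bar>
           \<and> \<bar>fst P\<bar> \<le> max \<bar>fst P1\<bar> \<bar>fst P2\<bar>"
proof (cases c)
  case True then show ?thesis using place_11_tall_True[OF assms] by simp
next
  case False
  then show ?thesis using place_11_tall_True[of P2 P1 M] assms by (auto simp: max.commute)
qed

text \<open>
  As \<open>P3\<close> is outside the box, one of its coordinates is beyond those of
  \<open>P1\<close> and \<open>P2\<close>; a point far out in a suitable direction is then on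
  the right side of all three.
\<close>

lemma place_box_True:
  assumes "\<not> in_box P1 P2 P3"
  shows "\<exists>P. rel True P P1 \<and> rel True P P2 \<and> rel False P P3"
proof -
  define K where "K = \<bar>fst P1\<bar> + \<bar>fst P2\<bar> + \<bar>fst P3\<bar> + \<bar>snd P1\<bar> + \<bar>snd P2\<bar> + \<bar>snd P3\<bar> + 1"
  have K: "fst P1 < K" "- K < fst P1" "fst P2 < K" "- K < fst P2" "fst P3 < K" "- K < fst P3"
    "snd P1 < K" "- K < snd P1" "snd P2 < K" "- K < snd P2" "snd P3 < K" "- K < snd P3"
    unfolding K_def by linarith+
  consider "max (snd P1) (snd P2) < snd P3" | "snd P3 < min (snd P1) (snd P2)"
    | "max (fst P1) (fst P2) < fst P3" | "fst P3 < min (fst P1) (fst P2)"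
    using assms unfolding in_box_def by linarith
  then show ?thesis
  proof cases
    case 1
    show ?thesis
      by (rule exI[of _ "(K, (max (snd P1) (snd P2) + snd P3) / 2)"])
        (use 1 K in \<open>auto simp: rel_cases\<close>)
  next
    case 2
    show ?thesis
      by (rule exI[of _ "(-K, (min (snd P1) (snd P2) + snd P3) / 2)"])
        (use 2 K in \<open>auto simp: rel_cases\<close>)
  next
    case 3
    show ?thesis
      by (rule exI[of _ "((max (fst P1) (fst P2) + fst P3) / 2, K)"])
        (use 3 K in \<open>auto simp: rel_cases\<close>)
  next
    case 4
    show ?thesis
      by (rule exI[of _ "((min (fst P1) (fst P2) + fst P3) / 2, -K)"])
        (use 4 K in \<open>auto simp: rel_cases\<close>)
  qed
qed

lemma in_box_flip: "in_box (flip P) (flip Q) (flip R) \<longleftrightarrow> in_box P Q R"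
  unfolding in_box_def flip_def by auto

lemma place_box:
  assumes "\<not> in_box P1 P2 P3"
  shows "\<exists>P. rel c P P1 \<and> rel c P P2 \<and> rel (\<not> c) P P3"
proof (cases c)
  case True then show ?thesis using place_box_True[OF assms] by simp
next
  case False
  obtain P where "rel True P (flip P1)" "rel True P (flip P2)" "rel False P (flip P3)"
    using place_box_True[of "flip P1" "flip P2" "flip P3"] assms by (auto simp: in_box_flip)
  then have "rel c (flip P) P1" "rel c (flip P) P2" "rel (\<not> c) (flip P) P3"
    using False by (auto simp: rel_flip)
  then show ?thesis by blast
qed

lemma place_21_True:
  assumes "rel True P1 P2" "P3 \<noteq> P1" "P3 \<noteq> P2"
  shows "\<exists>P. rel True P P1 \<and> rel True P P2 \<and> rel False P P3"
proof -
  have *: "\<exists>P. rel True P P1 \<and> rel True P P2 \<and> rel False P P3"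
    if "fst P1 < fst P2" "snd P1 < snd P2" "P3 \<noteq> P1" "P3 \<noteq> P2" "in_box P1 P2 P3" for P1 P2
  proof (cases "fst P3 < fst P2 \<and> snd P1 < snd P3")
    case True
    show ?thesis
      by (rule exI[of _ "((fst P3 + fst P2) / 2, (snd P1 + snd P3) / 2)"])
        (use True that in \<open>auto simp: rel_cases in_box_def\<close>)
  next
    case False
    then have "fst P1 < fst P3 \<and> snd P3 < snd P2"
      using that by (auto simp: in_box_def prod_eq_iff)
    then show ?thesis
      by (intro exI[of _ "((fst P3 + fst P1) / 2, (snd P2 + snd P3) / 2)"])
        (use that in \<open>auto simp: rel_cases in_box_def\<close>)
  qed
  show ?thesis
  proof (cases "in_box P1 P2 P3")
    case False then show ?thesis by (rule place_box_True)
  next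
    case True
    then have "in_box P2 P1 P3" by (auto simp: in_box_def)
    then show ?thesis using assms True *[of P1 P2] *[of P2 P1] by (auto simp: rel_cases(1)[of P1 P2])
  qed
qed

text \<open>
  If \<open>P1\<close> and \<open>P2\<close> are themselves in the position of colour
  \<open>c\<close>, then points near \<open>P3\<close> exist even if \<open>P3\<close> lies in
  the box. This is why the reduction below replaces a vertex with two neighbours of colour
  \<open>c\<close> by an edge of colour \<open>c\<close> between them.
\<close>

lemma place_21:
  assumes "rel c P1 P2" "P3 \<noteq> P1" "P3 \<noteq> P2"
  shows "\<exists>P. rel c P P1 \<and> rel c P P2 \<and> rel (\<not> c) P P3"
proof (cases c)
  case True then show ?thesis using place_21_True[of P1 P2 P3] assms by simp
next
  case False
  obtain P where "rel True P (flip P1)" "rel True P (flip P2)" "rel False P (flip P3)"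
    using place_21_True[of "flip P1" "flip P2" "flip P3"] assms False
    by (auto simp: flip_inj rel_flip)
  then have "rel c (flip P) P1" "rel c (flip P) P2" "rel (\<not> c) (flip P) P3"
    using False by (auto simp: rel_flip)
  then show ?thesis by blast
qed

text \<open>
  For a vertex with one fixed neighbour whose other two neighbours are images of each other: a
  symmetry that fixes one corner of a box moves the opposite corner out of it.
\<close>

lemma orbit_outside_box:
  assumes "act ty P0 = P0" "act ty Q \<noteq> Q" "rel c P0 Q" "0 < j" "j < period ty"
  shows "\<not> in_box P0 Q ((act ty ^^ j) Q)"
proof -
  have r: "(fst P0 < fst Q \<or> fst Q < fst P0) \<and> (snd P0 < snd Q \<or> snd Q < snd P0)"
    using assms(3) by (cases c) (auto simp: rel_cases)
  show ?thesis
  proof (cases ty)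
    case Mirror
    then show ?thesis using assms r
      unfolding in_box_def by (auto simp: less2 prod_eq_iff)
  next
    case Quarter
    then have "P0 = 0" using assms(1) by (auto simp: prod_eq_iff)
    with Quarter show ?thesis using assms(4,5) r
      unfolding in_box_def by (auto simp: less4 act_simps3)
  qed (use assms r in \<open>auto simp: less2 prod_eq_iff in_box_def\<close>)
qed

text \<open>
  A region that is disjoint from its images under the nontrivial powers of the symmetry and that
  contains every box with corners in it. A piece of the graph that is shifted into it can be
  copied around without collisions.
\<close>

definition slab :: "real \<Rightarrow> real \<Rightarrow> point set" where
  "slab \<sigma> L = {P. \<bar>fst P\<bar> < L \<and> L < \<sigma> * snd P}"

lemma slab_free:
  assumes "P \<in> slab \<sigma> L" "0 < j" "j < period ty" "\<bar>\<sigma>\<bar> = 1"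
  shows "(act ty ^^ j) P \<notin> slab \<sigma> L"
proof -
  have "\<sigma> = 1 \<or> \<sigma> = -1" using assms(4) by linarith
  then show ?thesis
    using assms(1-3) by (cases ty) (auto simp: slab_def less4 less2 act_simps3)
qed

lemma slab_box:
  assumes "P \<in> slab \<sigma> L" "Q \<in> slab \<sigma> L" "in_box P Q R" "\<bar>\<sigma>\<bar> = 1"
  shows "R \<in> slab \<sigma> L"
proof -
  have "\<sigma> = 1 \<or> \<sigma> = -1" using assms(4) by linarith
  then show ?thesis
    using assms(1-3) by (auto simp: slab_def in_box_def min_def max_def abs_if split: if_splits)
qed

section \<open>Sparse edge sets\<close>

definition edges_in :: "'a set set \<Rightarrow> 'a set \<Rightarrow> 'a set set" where
  "edges_in F U = {e \<in> F. e \<subseteq> U}"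

text \<open>
  The edge sets of forests, described by counting. Only this inequality is used in the
  induction; it is inherited by subsets and by the operations below without any reference to
  paths.
\<close>

definition sparse :: "'a set \<Rightarrow> 'a set set \<Rightarrow> bool" where
  "sparse X F \<longleftrightarrow> (\<forall>U\<subseteq>X. U \<noteq> {} \<longrightarrow> card (edges_in F U) < card U)"

text \<open>
  A tight set spans as many edges as sparsity permits; for a forest these are the vertex sets of
  its subtrees.
\<close>

definition tight :: "'a set set \<Rightarrow> 'a set \<Rightarrow> bool" where
  "tight F U \<longleftrightarrow> Suc (card (edges_in F U)) = card U"

definition deg :: "'a set set \<Rightarrow> 'a \<Rightarrow> nat" where
  "deg F v = card {e \<in> F. v \<in> e}"

lemma sparseD: "sparse X F \<Longrightarrow> U \<subseteq> X \<Longrightarrow> U \<noteq> {} \<Longrightarrow> card (edges_in F U) < card U"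
  unfolding sparse_def by blast

lemma finite_edges_in [intro]: "finite U \<Longrightarrow> finite (edges_in F U)"
  unfolding edges_in_def by (rule finite_subset[of _ "Pow U"]) auto

lemma tight_finite: "tight F U \<Longrightarrow> finite U" "tight F U \<Longrightarrow> U \<noteq> {}"
  unfolding tight_def by (metis card.infinite nat.distinct(1)) auto

lemma sparse_subset:
  assumes sp: "sparse X F" and "finite X" "Y \<subseteq> X" "F' \<subseteq> F"
  shows "sparse Y F'"
  unfolding sparse_def
proof (intro allI impI)
  fix U assume U: "U \<subseteq> Y" "U \<noteq> {}"
  have "finite (edges_in F U)"
    using U assms by (meson finite_edges_in finite_subset order_trans)
  moreover have "edges_in F' U \<subseteq> edges_in F U"
    using assms(4) by (auto simp: edges_in_def)
  ultimately have "card (edges_in F' U) \<le> card (edges_in F U)" by (rule card_mono)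
  also have "\<dots> < card U" using U assms by (intro sparseD[OF sp]) auto
  finally show "card (edges_in F' U) < card U" .
qed

text \<open>
  Submodularity: the union and the intersection of two intersecting tight sets together span at
  least as many edges as the two sets. Equality leaves no edge between the two differences.
\<close>

lemma tight_Un:
  assumes sp: "sparse X F" and X: "finite X" "A \<subseteq> X" "B \<subseteq> X" and t: "tight F A" "tight F B"
    and ne: "A \<inter> B \<noteq> {}"
  shows "tight F (A \<union> B)" "edges_in F (A \<union> B) = edges_in F A \<union> edges_in F B"
proof -
  have fin: "finite A" "finite B" "finite (edges_in F A)" "finite (edges_in F B)" "finite (edges_in F (A \<union> B))"
    using X by (auto intro: finite_subset)
  have I: "edges_in F A \<inter> edges_in F B = edges_in F (A \<inter> B)" by (auto simp: edges_in_def)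
  have lt: "card (edges_in F (A \<inter> B)) < card (A \<inter> B)" "card (edges_in F (A \<union> B)) < card (A \<union> B)"
    using X ne by (auto intro!: sparseD[OF sp])
  have "card (edges_in F A \<union> edges_in F B) + card (edges_in F (A \<inter> B)) = card (edges_in F A) + card (edges_in F B)"
    using card_Un_Int[OF fin(3,4)] I by simp
  moreover have "card (A \<union> B) + card (A \<inter> B) = card A + card B"
    using card_Un_Int[OF fin(1,2)] by simp
  moreover have sub: "edges_in F A \<union> edges_in F B \<subseteq> edges_in F (A \<union> B)" by (auto simp: edges_in_def)
  moreover have "card (edges_in F A \<union> edges_in F B) \<le> card (edges_in F (A \<union> B))"
    using sub fin by (intro card_mono) auto
  ultimately have eq: "card (edges_in F A \<union> edges_in F B) = card (edges_in F (A \<union> B))"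
    and tt: "Suc (card (edges_in F (A \<union> B))) = card (A \<union> B)"
    using t lt unfolding tight_def by linarith+
  show "tight F (A \<union> B)" using tt by (simp add: tight_def)
  show "edges_in F (A \<union> B) = edges_in F A \<union> edges_in F B"
    using card_subset_eq[OF fin(5) sub eq] by simp
qed

text \<open>
  Two disjoint subtrees can be joined by at most one edge, since the second would violate
  sparsity.
\<close>

lemma tight_link:
  assumes sp: "sparse X F" and X: "finite X" "A \<subseteq> X" "B \<subseteq> X" and t: "tight F A" "tight F B"
    and dj: "A \<inter> B = {}" and e: "e \<in> F" "e \<subseteq> A \<union> B" "\<not> e \<subseteq> A" "\<not> e \<subseteq> B" and ne: "{} \<notin> F"
  shows "tight F (A \<union> B)" "edges_in F (A \<union> B) = insert e (edges_in F A \<union> edges_in F B)"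
proof -
  have fin: "finite A" "finite B" "finite (edges_in F A)" "finite (edges_in F B)" "finite (edges_in F (A \<union> B))"
    using X by (auto intro: finite_subset)
  have I: "edges_in F A \<inter> edges_in F B = {}"
  proof -
    have "f = {}" if "f \<subseteq> A" "f \<subseteq> B" for f using that dj by blast
    then show ?thesis using ne by (auto simp: edges_in_def)
  qed
  have "A \<noteq> {}" using t tight_finite by blast
  then have lt: "card (edges_in F (A \<union> B)) < card (A \<union> B)"
    using X by (auto intro!: sparseD[OF sp])
  have "card (insert e (edges_in F A \<union> edges_in F B)) = Suc (card (edges_in F A) + card (edges_in F B))"
    using fin I e by (simp add: card_Un_disjoint edges_in_def)
  moreover have "card (A \<union> B) = card A + card B"
    using card_Un_disjoint fin dj by blast
  moreover have sub: "insert e (edges_in F A \<union> edges_in F B) \<subseteq> edges_in F (A \<union> B)" using e by (auto simp: edges_in_def)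
  moreover have "card (insert e (edges_in F A \<union> edges_in F B)) \<le> card (edges_in F (A \<union> B))"
    using sub fin by (intro card_mono) auto
  ultimately have eq: "card (insert e (edges_in F A \<union> edges_in F B)) = card (edges_in F (A \<union> B))"
    and tt: "Suc (card (edges_in F (A \<union> B))) = card (A \<union> B)"
    using t lt unfolding tight_def by linarith+
  show "tight F (A \<union> B)" using tt by (simp add: tight_def)
  show "edges_in F (A \<union> B) = insert e (edges_in F A \<union> edges_in F B)"
    using card_subset_eq[OF fin(5) sub eq] by simp
qed

text \<open>
  Repeated linking of subtrees to a central one; here the subtrees are the images of one piece
  under the symmetry.
\<close>

lemma tight_star:
  fixes k :: nat
  assumes sp: "sparse X F" and X: "finite X" "S \<subseteq> X" and t: "tight F S" and ne: "{} \<notin> F"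
    and B: "\<And>j. j < k \<Longrightarrow> B j \<subseteq> X \<and> tight F (B j) \<and> S \<inter> B j = {}"
    and dj: "\<And>i j. i < k \<Longrightarrow> j < k \<Longrightarrow> i \<noteq> j \<Longrightarrow> B i \<inter> B j = {}"
    and e: "\<And>j. j < k \<Longrightarrow> e j \<in> F \<and> e j \<subseteq> S \<union> B j \<and> \<not> e j \<subseteq> S \<and> \<not> e j \<subseteq> B j"
  shows "tight F (S \<union> (\<Union>j<k. B j))
    \<and> edges_in F (S \<union> (\<Union>j<k. B j)) = edges_in F S \<union> (\<Union>j<k. insert (e j) (edges_in F (B j)))"
proof -
  have "k' \<le> k \<Longrightarrow> tight F (S \<union> (\<Union>j<k'. B j))
    \<and> edges_in F (S \<union> (\<Union>j<k'. B j)) = edges_in F S \<union> (\<Union>j<k'. insert (e j) (edges_in F (B j)))" for k'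
  proof (induction k')
  case 0 then show ?case using t by simp
next
  case (Suc k')
  have k': "k' < k" using Suc.prems by simp
  let ?A = "S \<union> (\<Union>j<k'. B j)"
  have IH: "tight F ?A" "edges_in F ?A = edges_in F S \<union> (\<Union>j<k'. insert (e j) (edges_in F (B j)))"
    using Suc.IH k' by auto
  have "B j \<subseteq> X" if "j < k'" for j using B[of j] that k' by simp
  then have BX: "\<Union> (B ` {..<k'}) \<subseteq> X" by blast
  have "B j \<inter> B k' = {}" if "j < k'" for j using dj[of j k'] that k' by simp
  then have dj1: "?A \<inter> B k' = {}" using B[OF k'] by blast
  have ek: "e k' \<in> F" "e k' \<subseteq> S \<union> B k'" "\<not> e k' \<subseteq> S" "\<not> e k' \<subseteq> B k'" using e[OF k'] by auto
  have ek': "e k' \<subseteq> ?A \<union> B k'" "\<not> e k' \<subseteq> ?A" using ek dj1 by blast+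
  have "tight F (?A \<union> B k')" "edges_in F (?A \<union> B k') = insert (e k') (edges_in F ?A \<union> edges_in F (B k'))"
    using tight_link[OF sp X(1) _ _ IH(1) _ dj1 ek(1) ek' ek(4) ne] X BX B[OF k'] by auto
  moreover have "?A \<union> B k' = S \<union> (\<Union>j<Suc k'. B j)" by (auto simp: lessThan_Suc)
  ultimately show ?case using IH(2) by (auto simp: lessThan_Suc)
  qed
  then show ?thesis by blast
qed

lemma tight_singleton: "{} \<notin> F \<Longrightarrow> {x} \<notin> F \<Longrightarrow> tight F {x}"
proof -
  assume "{} \<notin> F" "{x} \<notin> F"
  then have "edges_in F {x} = {}" by (auto simp: edges_in_def subset_singleton_iff)
  then show ?thesis by (simp add: tight_def)
qed

lemma card2D: "card e = 2 \<Longrightarrow> a \<in> e \<Longrightarrow> \<exists>b. b \<noteq> a \<and> e = {a, b}"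
  by (auto simp: card_2_iff doubleton_eq_iff)

lemma tight_pair:
  assumes "{a, b} \<in> F" "a \<noteq> b" "\<forall>e\<in>F. card e = 2"
  shows "tight F {a, b}"
proof -
  have "edges_in F {a, b} = {{a, b}}"
  proof -
    have "e = {a, b}" if "e \<in> F" "e \<subseteq> {a, b}" for e
      using that assms by (intro card_subset_eq) auto
    then show ?thesis using assms by (auto simp: edges_in_def)
  qed
  then show ?thesis using assms by (simp add: tight_def)
qed

text \<open>
  Contracting disjoint subtrees of a forest gives a forest: each contraction loses as many edges
  as it loses vertices.
\<close>

lemma sparse_contract:
  fixes q :: "'a \<Rightarrow> 'b"
  assumes sp: "sparse X F" and X: "finite X" and e: "\<forall>e\<in>F. e \<subseteq> X \<and> card e = 2"
    and fib: "\<And>y. y \<in> q ` X \<Longrightarrow> tight F {x \<in> X. q x = y}"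
  shows "sparse (q ` X) {q ` e |e. e \<in> F \<and> card (q ` e) = 2}"
  unfolding sparse_def
proof (intro allI impI)
  fix U assume U: "U \<subseteq> q ` X" "U \<noteq> {}"
  define V where "V = {x \<in> X. q x \<in> U}"
  define S where "S = {e \<in> F. q ` e \<subseteq> U \<and> card (q ` e) = 2}"
  define fb where "fb y = {x \<in> X. q x = y}" for y
  have finU: "finite U" using U X by (auto intro: finite_subset)
  have finV: "finite V" using X by (simp add: V_def)
  have V0: "V \<subseteq> X" "V \<noteq> {}" using U by (auto simp: V_def)
  have Vfb: "V = (\<Union>y\<in>U. fb y)" by (auto simp: V_def fb_def)
  have finfb: "finite (fb y)" for y using X by (simp add: fb_def)
  have cV: "card V = (\<Sum>y\<in>U. card (fb y))"
    unfolding Vfb using finU finfb by (intro card_UN_disjoint) (auto simp: fb_def)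
  have cW: "card (\<Union>y\<in>U. edges_in F (fb y)) = (\<Sum>y\<in>U. card (edges_in F (fb y)))"
  proof (intro card_UN_disjoint ballI impI)
    fix y z :: 'b assume "y \<noteq> z"
    then show "edges_in F (fb y) \<inter> edges_in F (fb z) = {}"
    proof -
      have "f = {}" if "f \<subseteq> fb y" "f \<subseteq> fb z" for f :: "'a set"
        using that \<open>y \<noteq> z\<close> by (auto simp: fb_def)
      moreover have "{} \<notin> F" using e by auto
      ultimately show ?thesis unfolding edges_in_def by blast
    qed
  qed (use finU finfb in auto)
  have SV: "S \<subseteq> edges_in F V" using e by (auto simp: S_def edges_in_def V_def)
  have WV: "(\<Union>y\<in>U. edges_in F (fb y)) \<subseteq> edges_in F V" by (auto simp: edges_in_def fb_def V_def)
  have SW: "S \<inter> (\<Union>y\<in>U. edges_in F (fb y)) = {}"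
  proof -
    have "card (q ` e) \<noteq> 2" if "e \<subseteq> fb y" for e y
    proof -
      have "q ` e \<subseteq> {y}" using that by (auto simp: fb_def)
      then have "card (q ` e) \<le> 1" using card_mono[of "{y}" "q ` e"] by simp
      then show ?thesis by simp
    qed
    then show ?thesis by (auto simp: S_def edges_in_def)
  qed
  have fin3: "finite S" "finite (\<Union>y\<in>U. edges_in F (fb y))"
    using finite_subset[OF SV] finite_subset[OF WV] finV by blast+
  have "card S + (\<Sum>y\<in>U. card (edges_in F (fb y))) = card (S \<union> (\<Union>y\<in>U. edges_in F (fb y)))"
    using SW fin3 cW by (subst card_Un_disjoint) auto
  also have "\<dots> \<le> card (edges_in F V)"
    using SV WV finV by (intro card_mono) auto
  also have "\<dots> < card V" using sparseD[OF sp] V0 by blast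
  also have "card V = (\<Sum>y\<in>U. card (edges_in F (fb y))) + card U"
  proof -
    have "card (fb y) = card (edges_in F (fb y)) + 1" if "y \<in> U" for y
      using fib[of y] that U by (auto simp: tight_def fb_def)
    then have "card V = (\<Sum>y\<in>U. card (edges_in F (fb y)) + 1)" using cV by simp
    then show ?thesis by (simp only: sum.distrib) simp
  qed
  finally have "card S < card U" by simp
  moreover have "edges_in {q ` e |e. e \<in> F \<and> card (q ` e) = 2} U = (`) q ` S"
    by (auto simp: edges_in_def S_def)
  moreover have "card ((`) q ` S) \<le> card S"
    using SV finV by (intro card_image_le) (auto intro: finite_subset)
  ultimately show "card (edges_in {q ` e |e. e \<in> F \<and> card (q ` e) = 2} U) < card U" by simp
qed

lemma even_card_involution:
  assumes "finite S" "\<And>x. x \<in> S \<Longrightarrow> f x \<in> S \<and> f (f x) = x \<and> f x \<noteq> x"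
  shows "even (card S)"
  using assms
proof (induction S rule: finite_psubset_induct)
  case (psubset S)
  show ?case
  proof (cases "S = {}")
    case False
    then obtain x where x: "x \<in> S" by blast
    have fx: "f x \<in> S" "f (f x) = x" "f x \<noteq> x" using psubset.prems x by auto
    have "even (card (S - {x, f x}))"
    proof (rule psubset.IH)
      show "S - {x, f x} \<subset> S" using x by blast
      fix y assume "y \<in> S - {x, f x}"
      then show "f y \<in> S - {x, f x} \<and> f (f y) = y \<and> f y \<noteq> y"
        using psubset.prems[of y] fx by auto
    qed
    moreover have "card S = card (S - {x, f x}) + 2"
      using card_Diff_subset[of "{x, f x}" S] fx x psubset.hyps card_mono[of S "{x, f x}"] by simp
    ultimately show ?thesis by simp
  qed simp
qed

text \<open>
  A parity argument. An involution without fixed points on the vertex set of a subtree makes the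
  number of vertices even, hence the number of edges odd, and so fixes an edge, which must join
  a vertex to its image.
\<close>

lemma tight_invariant_fixed_point:
  assumes C: "\<And>x. x \<in> C \<Longrightarrow> h x \<in> C \<and> h (h x) = x" and t: "tight F C"
    and e2: "\<forall>e\<in>F. card e = 2" and inv: "\<And>e. e \<in> edges_in F C \<Longrightarrow> h ` e \<in> F"
    and nf: "\<And>x. x \<in> C \<Longrightarrow> {x, h x} \<notin> F"
  shows "\<exists>x\<in>C. h x = x"
proof (rule ccontr)
  assume nofix: "\<not> (\<exists>x\<in>C. h x = x)"
  have fin: "finite C" using t tight_finite by blast
  have "even (card C)"
    using even_card_involution[OF fin, of h] C nofix by blast
  moreover have "even (card (edges_in F C))"
  proof (rule even_card_involution[of _ "\<lambda>e. h ` e"])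
    show "finite (edges_in F C)" using fin by auto
    fix e assume e: "e \<in> edges_in F C"
    have "e \<subseteq> C" using e by (simp add: edges_in_def)
    have "h ` h ` e = (\<lambda>x. x) ` e"
      unfolding image_image using \<open>e \<subseteq> C\<close> C by (intro image_cong) auto
    then have "h ` h ` e = e" by simp
    moreover have "h ` e \<in> edges_in F C" using inv[OF e] \<open>e \<subseteq> C\<close> C by (auto simp: edges_in_def)
    moreover have "h ` e \<noteq> e"
    proof
      assume he: "h ` e = e"
      obtain a b where ab: "e = {a, b}" "a \<noteq> b" using e e2 by (auto simp: edges_in_def card_2_iff)
      have "h a = a \<or> h a = b" using he ab by auto
      then show False using nofix nf[of a] ab e \<open>e \<subseteq> C\<close> by (auto simp: edges_in_def)
    qed
    ultimately show "h ` e \<in> edges_in F C \<and> h ` h ` e = e \<and> h ` e \<noteq> e" by simp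
  qed
  ultimately show False using t by (simp add: tight_def) (metis even_Suc)
qed

lemma sum_deg:
  assumes "finite F" "finite Z"
  shows "(\<Sum>v\<in>Z. deg F v) = (\<Sum>e\<in>F. card (e \<inter> Z))"
proof -
  have "(\<Sum>v\<in>Z. deg F v) = (\<Sum>v\<in>Z. \<Sum>e\<in>F. if v \<in> e then 1 else 0)"
    using assms by (simp add: deg_def sum.If_cases Int_def)
  also have "\<dots> = (\<Sum>e\<in>F. \<Sum>v\<in>Z. if v \<in> e then 1 else 0)" by (rule sum.swap)
  also have "\<dots> = (\<Sum>e\<in>F. card (e \<inter> Z))"
    using assms by (simp add: sum.If_cases Int_def conj_commute)
  finally show ?thesis .
qed

text \<open>
  A forest has average degree less than two. One vertex may be left out of the sum, because it
  is the end of at least one edge or there is one edge less.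
\<close>

lemma sum_deg_central:
  assumes sp: "sparse X F" and X: "finite X" and e: "\<forall>e\<in>F. e \<subseteq> X \<and> card e = 2"
    and Z: "Z \<subseteq> X" "Z \<noteq> {}" "card X \<le> card Z + 1"
  shows "(\<Sum>v\<in>Z. deg F v) + 1 \<le> 2 * card Z"
proof -
  have FX: "edges_in F X = F" using e by (auto simp: edges_in_def)
  have fin: "finite F" "finite Z" using FX X Z finite_edges_in[of X F] by (auto intro: finite_subset)
  have "(\<Sum>v\<in>Z. deg F v) = (\<Sum>e\<in>F. card (e \<inter> Z))" using sum_deg fin by blast
  also have "\<dots> \<le> (\<Sum>e\<in>F. 1 + (if e \<subseteq> Z then 1 else 0))"
  proof (rule sum_mono)
    fix f assume f: "f \<in> F"
    then have "finite f" "card f = 2" using e X by (auto intro: finite_subset)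
    then have "card (f \<inter> Z) \<le> 2" using card_mono[of f "f \<inter> Z"] by auto
    moreover have "card (f \<inter> Z) \<noteq> 2" if "\<not> f \<subseteq> Z"
    proof
      assume "card (f \<inter> Z) = 2"
      then have "f \<inter> Z = f" using \<open>finite f\<close> \<open>card f = 2\<close> by (intro card_subset_eq) auto
      then show False using that by blast
    qed
    ultimately show "card (f \<inter> Z) \<le> 1 + (if f \<subseteq> Z then 1 else 0)"
      by (cases "f \<subseteq> Z") (simp_all, linarith?)
  qed
  also have "\<dots> = card F + card (edges_in F Z)"
    using fin by (simp only: sum.distrib) (simp add: sum.If_cases edges_in_def Int_def)
  also have "\<dots> + 2 \<le> card X + card Z"
  proof -
    have "X \<noteq> {}" using Z by blast
    then show ?thesis using sparseD[OF sp, of X] sparseD[OF sp, of Z] Z FX by auto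
  qed
  finally show ?thesis using Z by simp
qed

text \<open>
  Vertices of degree at least two may be removed from the bound, which is why fixed vertices of
  small degree have to be treated first for the symmetry \<open>Swap\<close>.
\<close>

lemma sum_deg_remaining:
  assumes sp: "sparse X F" and X: "finite X" "X \<noteq> {}" and e: "\<forall>e\<in>F. e \<subseteq> X \<and> card e = 2"
    and Z: "Z \<subseteq> X" and two: "\<And>f. f \<in> X - Z \<Longrightarrow> 2 \<le> deg F f"
  shows "(\<Sum>v\<in>Z. deg F v) + 1 \<le> 2 * card Z"
proof -
  have FX: "edges_in F X = F" using e by (auto simp: edges_in_def)
  have fin: "finite F" "finite Z" using FX X Z finite_edges_in[of X F] by (auto intro: finite_subset)
  have "(\<Sum>v\<in>Z. deg F v) + 2 * card (X - Z) \<le> (\<Sum>v\<in>Z. deg F v) + (\<Sum>v\<in>X - Z. deg F v)"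
    using sum_mono[of "X - Z" "\<lambda>_. 2" "deg F"] two by simp
  also have "\<dots> = (\<Sum>v\<in>X. deg F v)" using X Z by (metis sum.subset_diff add.commute)
  also have "\<dots> = (\<Sum>f\<in>F. card (f \<inter> X))" using sum_deg fin X by blast
  also have "\<dots> = (\<Sum>f\<in>F. 2)" using e by (intro sum.cong) (auto simp: Int_absorb2)
  finally have "(\<Sum>v\<in>Z. deg F v) + 2 * card (X - Z) \<le> 2 * card F" by simp
  moreover have "card F < card X" using sparseD[OF sp, of X] X FX by auto
  moreover have "card (X - Z) = card X - card Z" "card Z \<le> card X"
    using Z X fin by (auto simp: card_Diff_subset card_mono)
  ultimately show ?thesis by linarith
qed

text \<open>
  Two forests on the same vertices have fewer than four edge ends per vertex on average.
\<close>

lemma low_degree: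
  assumes "finite Z" "(\<Sum>v\<in>Z. deg (F True) v) + 1 \<le> 2 * card Z" "(\<Sum>v\<in>Z. deg (F False) v) + 1 \<le> 2 * card Z"
  shows "\<exists>v\<in>Z. deg (F True) v + deg (F False) v \<le> 3"
proof (rule ccontr)
  assume "\<not> ?thesis"
  then have "(\<Sum>v\<in>Z. 4) \<le> (\<Sum>v\<in>Z. deg (F True) v + deg (F False) v)"
    by (intro sum_mono) force
  then have "4 * card Z \<le> (\<Sum>v\<in>Z. deg (F True) v) + (\<Sum>v\<in>Z. deg (F False) v)"
    by (simp add: sum.distrib)
  then show False using assms by linarith
qed

section \<open>Pairs of sparse edge sets with a plane symmetry\<close>

definition restr :: "(bool \<Rightarrow> 'a set set) \<Rightarrow> 'a set \<Rightarrow> bool \<Rightarrow> 'a set set" where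
  "restr F Y c = edges_in (F c) Y"

definition realizes ::
    "plane_sym \<Rightarrow> 'a set \<Rightarrow> ('a \<Rightarrow> 'a) \<Rightarrow> (bool \<Rightarrow> 'a set set) \<Rightarrow> ('a \<Rightarrow> point) \<Rightarrow> bool" where
  "realizes ty X g F p \<longleftrightarrow> inj_on p X \<and> (\<forall>x\<in>X. p (g x) = act ty (p x)) \<and>
     (\<forall>c x y. {x, y} \<in> F c \<longrightarrow> rel c (p x) (p y))"

text \<open>
  The combinatorial data that are to be drawn in the plane: two sparse edge sets (the two
  colours) on \<open>X\<close> and a permutation \<open>g\<close> that acts on them like the
  symmetry \<open>ty\<close> acts on the order types. A point of the plane with nontrivial
  stabilizer is fixed by the whole group, and for a rotation only the origin is fixed; this
  explains the conditions on fixed vertices. Diameters, the edges between a vertex and its image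
  under the involution $g^{n/2}$, are excluded, because then every invariant subtree contains a
  fixed vertex; trees with diameters are treated separately later. Sparsity instead of
  connectedness makes the class closed under the removal of an orbit and under passing to
  subsets.
\<close>

locale sym_pair =
  fixes ty :: plane_sym and X :: "'a set" and g :: "'a \<Rightarrow> 'a" and F :: "bool \<Rightarrow> 'a set set"
  assumes finite_X: "finite X"
    and g_in: "x \<in> X \<Longrightarrow> g x \<in> X"
    and g_period: "x \<in> X \<Longrightarrow> (g ^^ period ty) x = x"
    and edge: "e \<in> F c \<Longrightarrow> e \<subseteq> X \<and> card e = 2"
    and sparse_F: "sparse X (F c)"
    and edge_g: "e \<in> F c \<Longrightarrow> g ` e \<in> F (c \<noteq> swaps_colours ty)"
    and free: "x \<in> X \<Longrightarrow> 0 < j \<Longrightarrow> j < period ty \<Longrightarrow> (g ^^ j) x = x \<Longrightarrow> g x = x"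
    and one_fixed: "central ty \<Longrightarrow> x \<in> X \<Longrightarrow> y \<in> X \<Longrightarrow> g x = x \<Longrightarrow> g y = y \<Longrightarrow> x = y"
    and no_diameter: "central ty \<Longrightarrow> x \<in> X \<Longrightarrow> {x, (g ^^ (period ty div 2)) x} \<notin> F c"
begin

abbreviation "n \<equiv> period ty"
abbreviation "ac \<equiv> act ty"
abbreviation "colour \<equiv> col ty"

definition mobile :: "'a \<Rightarrow> bool" where
  "mobile x \<longleftrightarrow> (\<forall>j. 0 < j \<longrightarrow> j < n \<longrightarrow> (g ^^ j) x \<noteq> x)"

definition orbit :: "'a \<Rightarrow> 'a set" where
  "orbit x = (\<lambda>i. (g ^^ i) x) ` {..<n}"

lemma pow_in: "x \<in> X \<Longrightarrow> (g ^^ i) x \<in> X"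
  by (induction i) (auto intro: g_in)

lemma pow_mult: "x \<in> X \<Longrightarrow> (g ^^ (k * n)) x = x"
proof (induction k)
  case (Suc k)
  have "(g ^^ (Suc k * n)) x = (g ^^ n) ((g ^^ (k * n)) x)"
    by (simp only: mult_Suc funpow_add comp_def)
  then show ?case using Suc by (simp add: g_period)
qed simp

lemma pow_mod: "x \<in> X \<Longrightarrow> (g ^^ i) x = (g ^^ (i mod n)) x"
proof -
  assume "x \<in> X"
  have "(g ^^ i) x = (g ^^ (i mod n + (i div n) * n)) x" by simp
  also have "\<dots> = (g ^^ (i mod n)) ((g ^^ ((i div n) * n)) x)" by (simp only: funpow_add comp_def)
  also have "\<dots> = (g ^^ (i mod n)) x" using pow_mult \<open>x \<in> X\<close> by simp
  finally show ?thesis .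
qed

lemma pow_back: "x \<in> X \<Longrightarrow> i \<le> n \<Longrightarrow> (g ^^ (n - i)) ((g ^^ i) x) = x"
proof -
  assume "x \<in> X" "i \<le> n"
  have "(g ^^ (n - i)) ((g ^^ i) x) = (g ^^ (n - i + i)) x" by (simp only: funpow_add comp_def)
  then show ?thesis using \<open>x \<in> X\<close> \<open>i \<le> n\<close> g_period by simp
qed

lemma pow_forth: "x \<in> X \<Longrightarrow> i \<le> n \<Longrightarrow> (g ^^ i) ((g ^^ (n - i)) x) = x"
  using pow_back[of x "n - i"] by simp

lemma pow_inj: "inj_on (g ^^ i) X"
proof (rule inj_onI)
  fix x y assume xy: "x \<in> X" "y \<in> X" "(g ^^ i) x = (g ^^ i) y"
  then have "(g ^^ (i mod n)) x = (g ^^ (i mod n)) y" by (metis pow_mod)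
  then have "(g ^^ (n - i mod n)) ((g ^^ (i mod n)) x) = (g ^^ (n - i mod n)) ((g ^^ (i mod n)) y)"
    by simp
  then show "x = y" using pow_back xy by simp
qed

lemma colour_back: "i \<le> n \<Longrightarrow> colour c (n - i) = colour c i"
  by (cases ty) (auto simp: col_def swaps_colours_def)

lemma edge_pow: "e \<in> F c \<Longrightarrow> (g ^^ i) ` e \<in> F (colour c i)"
proof (induction i)
  case (Suc i)
  have "g ` (g ^^ i) ` e \<in> F (colour c i \<noteq> swaps_colours ty)" using edge_g Suc by blast
  then show ?case by (simp only: col_Suc funpow.simps image_comp)
qed simp

lemma edge_back: "(g ^^ i) ` e \<in> F c \<Longrightarrow> e \<subseteq> X \<Longrightarrow> i \<le> n \<Longrightarrow> e \<in> F (colour c i)"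
proof -
  assume *: "(g ^^ i) ` e \<in> F c" "e \<subseteq> X" "i \<le> n"
  have "(g ^^ (n - i)) ` (g ^^ i) ` e \<in> F (colour c (n - i))" by (rule edge_pow[OF *(1)])
  moreover have "(g ^^ (n - i)) ` (g ^^ i) ` e = (\<lambda>x. x) ` e"
    unfolding image_image using pow_back * by (intro image_cong) auto
  ultimately show ?thesis using colour_back * by simp
qed

lemma not_mobile: "x \<in> X \<Longrightarrow> \<not> mobile x \<Longrightarrow> g x = x \<and> 1 < n"
  unfolding mobile_def using free by fastforce

lemma not_mobile_pow: "x \<in> X \<Longrightarrow> \<not> mobile x \<Longrightarrow> (g ^^ i) x = x"
  using not_mobile by (induction i) auto

lemma edgeD: "{x, y} \<in> F c \<Longrightarrow> x \<in> X \<and> y \<in> X \<and> x \<noteq> y"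
  using edge[of "{x, y}" c] by auto

lemma edge_shift:
  assumes "{(g ^^ i) v, y} \<in> F c" "i < n" "v \<in> X"
  shows "{v, (g ^^ (n - i)) y} \<in> F (colour c i)" "y = (g ^^ i) ((g ^^ (n - i)) y)"
proof -
  have y: "y \<in> X" using edgeD assms by blast
  show yy: "y = (g ^^ i) ((g ^^ (n - i)) y)" using pow_forth[OF y, of i] assms by simp
  have "(g ^^ i) ` {v, (g ^^ (n - i)) y} \<in> F c" using assms yy by simp
  then show "{v, (g ^^ (n - i)) y} \<in> F (colour c i)"
    using edge_back[of i "{v, (g ^^ (n - i)) y}" c] assms pow_in y by auto
qed

lemma mobile_inj: "v \<in> X \<Longrightarrow> mobile v \<Longrightarrow> i < n \<Longrightarrow> j < n \<Longrightarrow> (g ^^ i) v = (g ^^ j) v \<Longrightarrow> i = j"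
proof -
  have *: "False" if "v \<in> X" "mobile v" "i < j" "j < n" "(g ^^ i) v = (g ^^ j) v" for i j
  proof -
    have "(g ^^ i) ((g ^^ (j - i)) v) = (g ^^ (i + (j - i))) v" by (simp only: funpow_add comp_def)
    then have "(g ^^ i) ((g ^^ (j - i)) v) = (g ^^ i) v" using that by simp
    then have "(g ^^ (j - i)) v = v" using pow_inj[of i] pow_in that(1) by (meson inj_onD)
    then show False using that by (auto simp: mobile_def)
  qed
  show "v \<in> X \<Longrightarrow> mobile v \<Longrightarrow> i < n \<Longrightarrow> j < n \<Longrightarrow> (g ^^ i) v = (g ^^ j) v \<Longrightarrow> i = j"
    using *[of i j] *[of j i] by (metis linorder_neqE_nat)
qed

lemma orbit_self: "v \<in> orbit v"
  unfolding orbit_def by (intro image_eqI[of _ _ 0]) auto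

lemma orbit_sub: "v \<in> X \<Longrightarrow> orbit v \<subseteq> X"
  unfolding orbit_def using pow_in by auto

lemma pow_orbit: "v \<in> X \<Longrightarrow> (g ^^ i) v \<in> orbit v"
  using pow_mod[of v i] unfolding orbit_def by (metis imageI lessThan_iff mod_less_divisor period_pos)

lemma orbit_pow_iff: "v \<in> X \<Longrightarrow> x \<in> X \<Longrightarrow> (g ^^ i) x \<in> orbit v \<longleftrightarrow> x \<in> orbit v"
proof -
  have fwd: "(g ^^ i) x \<in> orbit v" if "v \<in> X" "x \<in> orbit v" for x i
  proof -
    obtain j where "x = (g ^^ j) v" using \<open>x \<in> orbit v\<close> by (auto simp: orbit_def)
    then have "(g ^^ i) x = (g ^^ (i + j)) v" by (simp add: funpow_add)
    then show ?thesis using pow_orbit that by simp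
  qed
  assume v: "v \<in> X" "x \<in> X"
  show ?thesis
  proof
    assume "(g ^^ i) x \<in> orbit v"
    then have "(g ^^ (i mod n)) x \<in> orbit v" using pow_mod v by metis
    then have "(g ^^ (n - i mod n)) ((g ^^ (i mod n)) x) \<in> orbit v" using fwd v by blast
    then show "x \<in> orbit v" using pow_back[of x "i mod n"] v by simp
  qed (use fwd v in blast)
qed

lemma orbit_g_iff: "v \<in> X \<Longrightarrow> x \<in> X \<Longrightarrow> g x \<in> orbit v \<longleftrightarrow> x \<in> orbit v"
  using orbit_pow_iff[of v x 1] by simp

lemma orbit_fixed: "v \<in> X \<Longrightarrow> \<not> mobile v \<Longrightarrow> orbit v = {v}"
  using not_mobile_pow orbit_self[of v] by (auto simp: orbit_def)

lemma sub_pair: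
  assumes "Y \<subseteq> X" "\<And>y. y \<in> Y \<Longrightarrow> g y \<in> Y"
  shows "sym_pair ty Y g (restr F Y)"
proof
  show "finite Y" using assms finite_X finite_subset by blast
  show "sparse Y (restr F Y c)" for c
  proof -
    have "restr F Y c \<subseteq> F c" by (auto simp: restr_def edges_in_def)
    then show ?thesis using sparse_subset[OF sparse_F finite_X assms(1)] by blast
  qed
  show "g ` e \<in> restr F Y (c \<noteq> swaps_colours ty)" if "e \<in> restr F Y c" for e c
    using that edge_g[of e c] assms(2) by (auto simp: restr_def edges_in_def)
  show "x = y" if "central ty" "x \<in> Y" "y \<in> Y" "g x = x" "g y = y" for x y
    using one_fixed that assms(1) by blast
qed (use assms g_period edge free no_diameter in \<open>auto simp: restr_def edges_in_def\<close>)

text \<open>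
  On an arbitrary subset the symmetry is lost, but the edge sets can still be drawn.
\<close>

lemma sub_pair_Id:
  assumes "Y \<subseteq> X"
  shows "sym_pair Id Y id (restr F Y)"
proof
  show "finite Y" using assms finite_X finite_subset by blast
  show "sparse Y (restr F Y c)" for c
  proof -
    have "restr F Y c \<subseteq> F c" by (auto simp: restr_def edges_in_def)
    then show ?thesis using sparse_subset[OF sparse_F finite_X assms(1)] by blast
  qed
qed (use assms edge in \<open>auto simp: restr_def edges_in_def swaps_colours_def central_def\<close>)

lemma pow_act:
  assumes "\<And>x. x \<in> X \<Longrightarrow> p (g x) = ac (p x)" "x \<in> X"
  shows "p ((g ^^ i) x) = (ac ^^ i) (p x)"
  using assms(2) by (induction i) (auto simp: assms(1) pow_in)

end

lemma act_pow_back: "i \<le> period ty \<Longrightarrow> (act ty ^^ (period ty - i)) ((act ty ^^ i) P) = P"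
  by (metis act_period comp_apply funpow_add le_add_diff_inverse2)

lemma act_pow_inj: "i \<le> period ty \<Longrightarrow> (act ty ^^ i) P = (act ty ^^ i) Q \<Longrightarrow> P = Q"
  by (metis act_pow_back)

lemma continuous_act [continuous_intros]: "continuous_on UNIV (act ty)"
proof (cases ty)
  case Id then show ?thesis using continuous_on_id by (simp add: id_def)
next
  case Mirror
  then have "act ty = (\<lambda>P. (- snd P, - fst P))" by (auto simp: fun_eq_iff)
  then show ?thesis by (auto intro!: continuous_intros)
next
  case Half
  then have "act ty = (\<lambda>P. (- fst P, - snd P))" by (auto simp: fun_eq_iff)
  then show ?thesis by (auto intro!: continuous_intros)
next
  case Quarter
  then have "act ty = (\<lambda>P. (snd P, - fst P))" by (auto simp: fun_eq_iff)
  then show ?thesis by (auto intro!: continuous_intros)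
next
  case Swap
  then have "act ty = (\<lambda>P. (fst P, - snd P))" by (auto simp: fun_eq_iff)
  then show ?thesis by (auto intro!: continuous_intros)
qed

lemma continuous_act_pow: "continuous_on UNIV (act ty ^^ i)"
proof (induction i)
  case 0 then show ?case using continuous_on_id by (simp add: id_def)
next
  case (Suc i)
  have "continuous_on UNIV (act ty \<circ> (act ty ^^ i))"
    using Suc continuous_act by (intro continuous_on_compose) (auto intro: continuous_on_subset)
  then show ?case by simp
qed

lemma open_rel_fun:
  assumes f: "continuous_on UNIV f"
  shows "open {P. rel c P (f P)}"
proof (cases c)
  case True
  have "{P. rel c P (f P)} = {P. 0 < (fst P - fst (f P)) * (snd P - snd (f P))}"
    using True by (simp add: rel_def)
  also have "open \<dots>"
    by (intro open_Collect_less continuous_intros f)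
  finally show ?thesis .
next
  case False
  have "{P. rel c P (f P)} = {P. (fst P - fst (f P)) * (snd P - snd (f P)) < 0}"
    using False by (simp add: rel_def)
  also have "open \<dots>"
    by (intro open_Collect_less continuous_intros f)
  finally show ?thesis .
qed

lemma eventually_rel:
  assumes "rel c P Q"
  shows "eventually (\<lambda>\<epsilon>. rel c (P + \<epsilon> *\<^sub>R P') (Q + \<epsilon> *\<^sub>R Q')) (at_right 0)"
proof -
  let ?f = "\<lambda>\<epsilon>. (fst (P + \<epsilon> *\<^sub>R P') - fst (Q + \<epsilon> *\<^sub>R Q')) * (snd (P + \<epsilon> *\<^sub>R P') - snd (Q + \<epsilon> *\<^sub>R Q'))"
  have "(?f \<longlongrightarrow> (fst (P + 0 *\<^sub>R P') - fst (Q + 0 *\<^sub>R Q')) * (snd (P + 0 *\<^sub>R P') - snd (Q + 0 *\<^sub>R Q'))) (at_right 0)"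
    by (intro tendsto_intros)
  then have "(?f \<longlongrightarrow> (fst P - fst Q) * (snd P - snd Q)) (at_right 0)" by simp
  from order_tendstoD[OF this] show ?thesis
    using assms unfolding rel_def by (cases c) auto
qed

lemma eventually_neq:
  assumes "P \<noteq> (Q::point)"
  shows "eventually (\<lambda>\<epsilon>. P + \<epsilon> *\<^sub>R P' \<noteq> Q + \<epsilon> *\<^sub>R Q') (at_right 0)"
proof -
  have "((\<lambda>\<epsilon>. P + \<epsilon> *\<^sub>R P' - (Q + \<epsilon> *\<^sub>R Q')) \<longlongrightarrow> P + 0 *\<^sub>R P' - (Q + 0 *\<^sub>R Q')) (at_right 0)"
    by (intro tendsto_intros)
  then have "((\<lambda>\<epsilon>. P + \<epsilon> *\<^sub>R P' - (Q + \<epsilon> *\<^sub>R Q')) \<longlongrightarrow> P - Q) (at_right 0)" by simp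
  then have "eventually (\<lambda>\<epsilon>. P + \<epsilon> *\<^sub>R P' - (Q + \<epsilon> *\<^sub>R Q') \<noteq> 0) (at_right 0)"
    using assms by (intro tendsto_imp_eventually_ne[of _ "P - Q"]) auto
  then show ?thesis by (simp add: algebra_simps)
qed

context sym_pair
begin

text \<open>
  A drawing in which several vertices share a point is resolved by adding a small multiple of
  another equivariant drawing: strict positions survive, and pairs in the same point get the
  position they have in the second drawing. The extra condition \<open>Q\<close> is any
  condition on \<open>\<epsilon>\<close> that holds for all sufficiently small values.
\<close>

lemma blow_up:
  assumes p: "\<And>x. x \<in> X \<Longrightarrow> p (g x) = ac (p x)" and r: "\<And>x. x \<in> X \<Longrightarrow> r (g x) = ac (r x)"
    and edges: "\<And>c x y. {x, y} \<in> F c \<Longrightarrow> rel c (p x) (p y) \<or> p x = p y \<and> rel c (r x) (r y)"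
    and inj: "\<And>x y. x \<in> X \<Longrightarrow> y \<in> X \<Longrightarrow> x \<noteq> y \<Longrightarrow> p x = p y \<Longrightarrow> r x \<noteq> r y"
    and ev: "eventually Q (at_right (0::real))"
  shows "\<exists>\<epsilon>>0. Q \<epsilon> \<and> realizes ty X g F (\<lambda>x. p x + \<epsilon> *\<^sub>R r x)"
proof -
  have 1: "eventually (\<lambda>\<epsilon>. {x, y} \<in> F c \<longrightarrow> rel c (p x + \<epsilon> *\<^sub>R r x) (p y + \<epsilon> *\<^sub>R r y)) (at_right 0)" for c x y
  proof (cases "{x, y} \<in> F c")
    case True
    show ?thesis
    proof (cases "rel c (p x) (p y)")
      case True then show ?thesis using eventually_rel[OF True] by (auto elim: eventually_mono)
    next
      case False
      then have "p x = p y" "rel c (r x) (r y)" using edges True by auto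
      have "eventually (\<lambda>\<epsilon>::real. 0 < \<epsilon>) (at_right 0)" by (simp add: eventually_at_right_less)
      then show ?thesis
      proof (rule eventually_mono)
        fix \<epsilon> :: real assume "0 < \<epsilon>"
        then have "rel c (\<epsilon> *\<^sub>R r x + p x) (\<epsilon> *\<^sub>R r y + p x)"
          using rel_scale \<open>rel c (r x) (r y)\<close> by (simp only: rel_shift)
        then show "{x, y} \<in> F c \<longrightarrow> rel c (p x + \<epsilon> *\<^sub>R r x) (p y + \<epsilon> *\<^sub>R r y)"
          using \<open>p x = p y\<close> by (simp add: add.commute)
      qed
    qed
  qed simp
  have 2: "eventually (\<lambda>\<epsilon>. x \<noteq> y \<longrightarrow> p x + \<epsilon> *\<^sub>R r x \<noteq> p y + \<epsilon> *\<^sub>R r y) (at_right 0)"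
    if "x \<in> X" "y \<in> X" for x y
  proof (cases "p x = p y")
    case True
    have "eventually (\<lambda>\<epsilon>::real. 0 < \<epsilon>) (at_right 0)" by (simp add: eventually_at_right_less)
    then show ?thesis
      using inj[OF that _ True] True by (auto elim!: eventually_mono)
  next
    case False
    then show ?thesis using eventually_neq[OF False] by (auto elim: eventually_mono)
  qed
  have "eventually (\<lambda>\<epsilon>. Q \<epsilon> \<and> 0 < \<epsilon> \<and>
     (\<forall>c\<in>UNIV. \<forall>x\<in>X. \<forall>y\<in>X. ({x, y} \<in> F c \<longrightarrow> rel c (p x + \<epsilon> *\<^sub>R r x) (p y + \<epsilon> *\<^sub>R r y)) \<and>
        (x \<noteq> y \<longrightarrow> p x + \<epsilon> *\<^sub>R r x \<noteq> p y + \<epsilon> *\<^sub>R r y))) (at_right 0)"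
    using finite_X 1 2 ev
    by (intro eventually_conj eventually_ball_finite ballI) (auto simp: eventually_at_right_less)
  then obtain \<epsilon> where e: "Q \<epsilon>" "0 < \<epsilon>"
    "\<And>c x y. x \<in> X \<Longrightarrow> y \<in> X \<Longrightarrow> {x, y} \<in> F c \<Longrightarrow> rel c (p x + \<epsilon> *\<^sub>R r x) (p y + \<epsilon> *\<^sub>R r y)"
    "\<And>x y. x \<in> X \<Longrightarrow> y \<in> X \<Longrightarrow> x \<noteq> y \<Longrightarrow> p x + \<epsilon> *\<^sub>R r x \<noteq> p y + \<epsilon> *\<^sub>R r y"
    by (smt (verit) UNIV_I eventually_happens trivial_limit_at_right_real)
  have "realizes ty X g F (\<lambda>x. p x + \<epsilon> *\<^sub>R r x)"
    unfolding realizes_def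
  proof (intro conjI allI ballI impI)
    show "inj_on (\<lambda>x. p x + \<epsilon> *\<^sub>R r x) X" using e(4) by (meson inj_onI)
    show "p (g x) + \<epsilon> *\<^sub>R r (g x) = ac (p x + \<epsilon> *\<^sub>R r x)" if "x \<in> X" for x
      using that by (simp add: p r act_add act_scale)
    show "rel c (p x + \<epsilon> *\<^sub>R r x) (p y + \<epsilon> *\<^sub>R r y)" if "{x, y} \<in> F c" for c x y
      using e(3) edgeD that by blast
  qed
  then show ?thesis using e by blast
qed

text \<open>
  Putting back the orbit of a mobile vertex. It is enough to find a point for one vertex of the
  orbit; the others follow by symmetry, and a small perturbation makes the point generic, so
  that the images are distinct.
\<close>

lemma extend:
  assumes v: "v \<in> X" "mobile v" and p0: "realizes ty (X - orbit v) g (restr F (X - orbit v)) p0"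
    and S: "open S" "P \<in> S"
    and h1: "\<And>c w. {v, w} \<in> F c \<Longrightarrow> w \<in> X - orbit v \<Longrightarrow> rel c P (p0 w)"
    and h2: "\<And>c j. 0 < j \<Longrightarrow> j < n \<Longrightarrow> {v, (g ^^ j) v} \<in> F c \<Longrightarrow> rel c P ((ac ^^ j) P)"
  shows "\<exists>p. realizes ty X g F p \<and> p v \<in> S \<and> (\<forall>x\<in>X - orbit v. p x = p0 x)"
proof -
  let ?X0 = "X - orbit v"
  define S1 where "S1 = (\<Inter>c\<in>UNIV. \<Inter>w\<in>{w\<in>?X0. {v, w} \<in> F c}. {Q. rel c Q (p0 w)})"
  define S2 where "S2 = (\<Inter>c\<in>UNIV. \<Inter>j\<in>{j. 0 < j \<and> j < n \<and> {v, (g ^^ j) v} \<in> F c}. {Q. rel c Q ((ac ^^ j) Q)})"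
  have "open S1" unfolding S1_def using finite_X
    by (intro open_INT open_rel ballI) auto
  moreover have "open S2" unfolding S2_def
    by (intro open_INT open_rel_fun ballI continuous_act_pow) auto
  ultimately have "open (S \<inter> S1 \<inter> S2)" using S by blast
  moreover have "P \<in> S \<inter> S1 \<inter> S2" using S h1 h2 by (auto simp: S1_def S2_def)
  moreover have "finite (p0 ` ?X0)" using finite_X by simp
  ultimately obtain Q where Q: "Q \<in> S" "Q \<in> S1" "Q \<in> S2" "generic Q" "Q \<notin> p0 ` ?X0"
    using pick_generic[of "S \<inter> S1 \<inter> S2" P "p0 ` ?X0"] by blast
  define idx where "idx x = (SOME i. i < n \<and> x = (g ^^ i) v)" for x
  define p where "p x = (if x \<in> orbit v then (ac ^^ idx x) Q else p0 x)" for x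
  have idx: "idx ((g ^^ i) v) = i" if "i < n" for i
  proof -
    have "idx ((g ^^ i) v) < n \<and> (g ^^ i) v = (g ^^ idx ((g ^^ i) v)) v"
      unfolding idx_def by (rule someI[of _ i]) (use that in simp)
    then show ?thesis using mobile_inj[OF v] that by metis
  qed
  have pv: "p ((g ^^ i) v) = (ac ^^ i) Q" if "i < n" for i
    using idx[OF that] pow_orbit[OF v(1)] by (simp add: p_def)
  have p0eq: "p x = p0 x" if "x \<in> ?X0" for x using that by (simp add: p_def)
  have eqv: "p (g x) = ac (p x)" if "x \<in> X" for x
  proof (cases "x \<in> orbit v")
    case True
    then obtain i where i: "i < n" "x = (g ^^ i) v" by (auto simp: orbit_def)
    have gx: "g x = (g ^^ Suc i) v" using i by simp
    show ?thesis
    proof (cases "Suc i < n")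
      case True
      then show ?thesis using pv[OF True] pv[OF i(1)] i gx by simp
    next
      case False
      then have "Suc i = n" using i by simp
      then have "g x = (g ^^ 0) v" using gx g_period v by simp
      moreover have "ac ((ac ^^ i) Q) = Q" using act_period[of ty Q] \<open>Suc i = n\<close> by (metis funpow.simps(2) comp_apply)
      ultimately show ?thesis using pv[of 0] pv[OF i(1)] i by simp
    qed
  next
    case False
    then have "g x \<notin> orbit v" using orbit_g_iff v that by simp
    then show ?thesis using False that g_in p0 by (auto simp: p_def realizes_def)
  qed
  have inj: "inj_on p X"
  proof -
    have OO: "x = y" if "x \<in> orbit v" "y \<in> orbit v" "p x = p y" for x y
    proof -
      obtain i j where ij: "i < n" "x = (g ^^ i) v" "j < n" "y = (g ^^ j) v"
        using \<open>x \<in> orbit v\<close> \<open>y \<in> orbit v\<close> by (auto simp: orbit_def)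
      have eq: "(ac ^^ i) Q = (ac ^^ j) Q" using that(3) pv ij by simp
      have False if "i < j" "j < n" "(ac ^^ i) Q = (ac ^^ j) Q" for i j
      proof -
        have "(ac ^^ j) Q = (ac ^^ i) ((ac ^^ (j - i)) Q)"
          using that(1) by (metis comp_apply funpow_add le_add_diff_inverse less_imp_le)
        then have "(ac ^^ (j - i)) Q = Q" using act_pow_inj[of i ty] that by simp
        then show False using generic_free[OF Q(4), of "j - i" ty] that by simp
      qed
      then show ?thesis using ij eq by (metis linorder_neqE_nat)
    qed
    have OX: "p x \<noteq> p y" if "x \<in> orbit v" "y \<in> ?X0" for x y
    proof
      assume eq: "p x = p y"
      obtain i where i: "i < n" "x = (g ^^ i) v" using \<open>x \<in> orbit v\<close> by (auto simp: orbit_def)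
      have "p ((g ^^ (n - i)) y) = (ac ^^ (n - i)) (p y)" using pow_act[of p y "n - i", OF eqv] \<open>y \<in> ?X0\<close> by simp
      also have "\<dots> = (ac ^^ (n - i)) ((ac ^^ i) Q)" using eq pv i by simp
      also have "\<dots> = Q" using act_pow_back i by simp
      finally have "p ((g ^^ (n - i)) y) = Q" .
      moreover have "(g ^^ (n - i)) y \<in> ?X0" using \<open>y \<in> ?X0\<close> orbit_pow_iff v pow_in by auto
      ultimately show False using Q(5) p0eq by (metis imageI)
    qed
    show ?thesis
    proof (rule inj_onI)
      fix x y assume xy: "x \<in> X" "y \<in> X" "p x = p y"
      show "x = y"
      proof (cases "x \<in> orbit v"; cases "y \<in> orbit v")
        assume "x \<notin> orbit v" "y \<notin> orbit v"
        then show ?thesis using xy p0 p0eq by (auto simp: realizes_def inj_on_def)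
      qed (use OO OX[of x y] OX[of y x] xy in auto)
    qed
  qed
  have edges: "rel c (p x) (p y)" if e: "{x, y} \<in> F c" for c x y
  proof -
    have *: "rel c (p x) (p y)" if e: "{x, y} \<in> F c" and x: "x \<in> orbit v" for x y
    proof -
      obtain i where i: "i < n" "x = (g ^^ i) v" using x by (auto simp: orbit_def)
      define y' where "y' = (g ^^ (n - i)) y"
      have y: "y \<in> X" using edgeD e by blast
      then have y': "y' \<in> X" using pow_in by (simp add: y'_def)
      have e': "{v, y'} \<in> F (colour c i)" and yy: "y = (g ^^ i) y'"
        using edge_shift[OF _ i(1) v(1), of y c] e i by (auto simp: y'_def)
      have "rel (colour c i) Q (p y')"
      proof (cases "y' \<in> orbit v")
        case True
        then obtain j where j: "j < n" "y' = (g ^^ j) v" by (auto simp: orbit_def)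
        have "j \<noteq> 0" using j edgeD[OF e'] by (cases j) auto
        then show ?thesis using j e' Q(3) pv[OF j(1)] by (force simp: S2_def)
      next
        case False
        then show ?thesis using e' Q(2) y' p0eq[of y'] by (force simp: S1_def)
      qed
      then have "rel (colour (colour c i) i) ((ac ^^ i) Q) ((ac ^^ i) (p y'))"
        by (simp only: rel_act_pow)
      then show ?thesis using pv i yy pow_act[of p y' i, OF eqv y'] by simp
    qed
    show ?thesis
    proof (cases "x \<in> orbit v")
      case True then show ?thesis using * e by blast
    next
      case x: False
      show ?thesis
      proof (cases "y \<in> orbit v")
        case True
        then show ?thesis using *[of y x] e rel_sym by (metis insert_commute)
      next
        case False
        then have "{x, y} \<in> restr F ?X0 c" using x e edgeD[OF e] by (simp add: restr_def edges_in_def)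
        then show ?thesis using p0 x False edgeD[OF e] p0eq by (simp add: realizes_def)
      qed
    qed
  qed
  have "p v = Q" using pv[of 0] by simp
  then show ?thesis using inj eqv edges Q p0eq unfolding realizes_def by blast
qed

text \<open>
  For \<open>Swap\<close> a fixed vertex has to be drawn on the axis. If it has at most one
  neighbour of the first colour, hence at most one of the second, its image, a point far out on
  the axis has the right position to both.
\<close>

lemma extend_fixed:
  assumes f: "f \<in> X" "\<not> mobile f" and sw: "ty = Swap" and dis: "F True \<inter> F False = {}"
    and d: "deg (F True) f \<le> 1"
    and p0: "realizes ty (X - {f}) g (restr F (X - {f})) p0"
  shows "\<exists>p. realizes ty X g F p \<and> M < \<bar>fst (p f)\<bar> \<and> (\<forall>x\<in>X - {f}. p x = p0 x)"
proof -
  have gf: "g f = f" using not_mobile f by blast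
  have finF: "finite (F True)"
    using finite_subset[of "F True" "Pow X"] edge finite_X by blast
  have gg: "g (g x) = x" if "x \<in> X" for x using g_period[OF that] sw by (simp add: eval_nat_numeral)
  define K where "K = Max (insert \<bar>M\<bar> ((\<lambda>x. \<bar>fst (p0 x)\<bar>) ` X)) + 1"
  have K: "M < K" "0 < K" "\<bar>fst (p0 x)\<bar> < K" if "x \<in> X" for x
  proof -
    have "\<bar>M\<bar> \<le> K - 1" "\<bar>fst (p0 x)\<bar> \<le> K - 1" if "x \<in> X" for x
      using finite_X that unfolding K_def by auto
    then show "M < K" "0 < K" "\<bar>fst (p0 x)\<bar> < K" using that by force+
  qed
  have K0: "M < K" "0 < K" using K[OF f(1)] by auto
  have FF: "{f, g y} \<in> F True" if "{f, y} \<in> F False" for y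
    using edge_g[OF that] gf sw by (simp add: swaps_colours_def)
  \<comment> \<open>The sign of the coordinate on the axis is chosen according to the side on which the neighbour lies.\<close>
  have "\<exists>s. \<bar>s\<bar> = K \<and> (\<forall>w. {f, w} \<in> F True \<longrightarrow> rel True (s, 0) (p0 w))"
  proof (cases "\<exists>w. {f, w} \<in> F True")
    case True
    then obtain w where w: "{f, w} \<in> F True" by blast
    have wX: "w \<in> X" "w \<noteq> f" using edgeD[OF w] by auto
    have uniq: "w' = w" if "{f, w'} \<in> F True" for w'
    proof -
      have "card {{f, w}, {f, w'}} \<le> deg (F True) f"
        unfolding deg_def using w that finF by (intro card_mono) auto
      then have "{f, w} = {f, w'}" using d by (auto simp: card_insert_if split: if_splits)
      then show ?thesis by (auto simp: doubleton_eq_iff)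
    qed
    have "g w \<noteq> w"
    proof
      assume "g w = w"
      then have "{f, w} \<in> F False" using edge_g[OF w] gf sw by (simp add: swaps_colours_def)
      then show False using w dis by blast
    qed
    have "g w \<noteq> f" using gf gg[OF wX(1)] wX(2) by metis
    have "p0 (g w) \<noteq> p0 w" using p0 \<open>g w \<noteq> w\<close> \<open>g w \<noteq> f\<close> wX g_in by (auto simp: realizes_def inj_on_def)
    moreover have "p0 (g w) = act Swap (p0 w)" using p0 wX sw by (simp add: realizes_def)
    ultimately have "snd (p0 w) \<noteq> 0" by (auto simp: prod_eq_iff)
    then have "rel True (if 0 < snd (p0 w) then - K else K, 0) (p0 w)"
      using K(3)[OF wX(1)] by (auto simp: rel_cases)
    then show ?thesis using uniq K0 by (intro exI[of _ "if 0 < snd (p0 w) then - K else K"]) auto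
  next
    case False then show ?thesis using K0 by (intro exI[of _ K]) auto
  qed
  then obtain s where s: "\<bar>s\<bar> = K" "\<And>w. {f, w} \<in> F True \<Longrightarrow> rel True (s, 0) (p0 w)" by blast
  define p where "p = p0(f := (s, 0))"
  have g_ne: "g x \<noteq> f" if "x \<in> X" "x \<noteq> f" for x using gf gg that by metis
  have "realizes ty X g F p"
    unfolding realizes_def
  proof (intro conjI allI ballI impI)
    have "(s, 0) \<noteq> p0 x" if "x \<in> X" for x using K(3)[OF that] s(1) by (metis fst_conv less_irrefl)
    then have no: "p0 x \<noteq> (s, 0)" if "x \<in> X" for x using that by metis
    have "inj_on p0 (X - {f})" using p0 by (simp add: realizes_def)
    then show "inj_on p X" using no unfolding inj_on_def p_def by (metis DiffI fun_upd_apply singletonD)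
    show "p (g x) = ac (p x)" if "x \<in> X" for x
      using that p0 gf sw g_ne[OF that] by (auto simp: p_def realizes_def)
    show "rel c (p x) (p y)" if e: "{x, y} \<in> F c" for c x y
    proof -
      have *: "rel c (s, 0) (p0 w)" if e: "{f, w} \<in> F c" for w
      proof (cases c)
        case True then show ?thesis using s e by simp
      next
        case False
        have w: "w \<in> X" "w \<noteq> f" using edgeD[OF e] by auto
        have "rel True (s, 0) (p0 (g w))" using s FF e False by simp
        then have "rel True (s, 0) (act Swap (p0 w))" using p0 w sw by (simp add: realizes_def)
        then show ?thesis using False by (auto simp: rel_cases)
      qed
      show ?thesis
      proof (cases "x = f \<or> y = f")
        case True
        then show ?thesis
          using *[of y] *[of x] edgeD[OF e] e rel_sym[of c "p0 x"] by (auto simp: p_def insert_commute)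
      next
        case False
        then have "{x, y} \<in> restr F (X - {f}) c" using e edgeD[OF e] by (simp add: restr_def edges_in_def)
        then show ?thesis using p0 False by (simp add: realizes_def p_def)
      qed
    qed
  qed
  then show ?thesis using s K0 by (intro exI[of _ p]) (auto simp: p_def)
qed

end

section \<open>Removing a vertex of degree three\<close>

text \<open>
  The critical case of the induction: a mobile vertex of minimal degree has two neighbours
  \<open>w1\<close>, \<open>w2\<close> of colour \<open>c\<close> and one neighbour
  \<open>w3\<close> of the other colour, none of them in its own orbit. The induction hypothesis
  \<open>IH\<close> is needed for all symmetry types, since the clusters below may lose their
  symmetry.
\<close>

locale reduction = sym_pair +
  fixes v :: 'a and c :: bool and w1 w2 w3 :: 'a
  assumes disjoint: "F True \<inter> F False = {}"
    and v: "v \<in> X" "mobile v"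
    and nbrs: "{v, w} \<in> F c \<longleftrightarrow> w = w1 \<or> w = w2" "{v, w} \<in> F (\<not> c) \<longleftrightarrow> w = w3"
    and w12: "w1 \<noteq> w2"
    and away: "w1 \<in> X - orbit v" "w2 \<in> X - orbit v" "w3 \<in> X - orbit v"
    and IH: "\<And>ty' (Y::'a set) g' F'. card Y < card X \<Longrightarrow> sym_pair ty' Y g' F' \<Longrightarrow> F' True \<inter> F' False = {} \<Longrightarrow>
               \<exists>p. realizes ty' Y g' F' p"
    and min_deg: "x \<in> X \<Longrightarrow> mobile x \<Longrightarrow> 3 \<le> deg (F True) x + deg (F False) x"
    and fixed_deg: "ty = Swap \<Longrightarrow> x \<in> X \<Longrightarrow> \<not> mobile x \<Longrightarrow> 2 \<le> deg (F True) x"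
begin

definition "X0 = X - orbit v"
definition "A = restr F X0"
definition "e0 = {w1, w2}"
text \<open>
  The orbit of \<open>v\<close> is deleted and the edge $\{w_1, w_2\}$ is added in colour
  \<open>c\<close>, together with its images.
\<close>

definition "F' d = A d \<union> {(g ^^ i) ` e0 | i. colour c i = d}"

lemma X0_sub: "X0 \<subseteq> X" by (auto simp: X0_def)
lemma finite_X0: "finite X0" using X0_sub finite_X finite_subset by blast
lemma w_in: "w1 \<in> X0" "w2 \<in> X0" "w3 \<in> X0" using away by (auto simp: X0_def)
lemma w_inX: "w1 \<in> X" "w2 \<in> X" "w3 \<in> X" using away by auto

lemma g_X0: "x \<in> X0 \<Longrightarrow> g x \<in> X0"
  using orbit_g_iff v g_in by (auto simp: X0_def)

lemma pow_X0: "x \<in> X0 \<Longrightarrow> (g ^^ i) x \<in> X0"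
  by (induction i) (auto intro: g_X0)

lemma card_X0: "card X0 < card X"
  using finite_X v orbit_self[of v] by (intro psubset_card_mono) (auto simp: X0_def)

lemma FF: "e \<in> F d \<Longrightarrow> e \<notin> F (\<not> d)"
  using disjoint by (cases d) auto

lemma w3_ne: "w3 \<noteq> w1" "w3 \<noteq> w2"
  using nbrs FF by blast+

lemma A_pair: "sym_pair ty X0 g A"
  unfolding A_def using X0_sub g_X0 by (intro sub_pair) auto

lemma A_sub: "A d \<subseteq> F d" by (auto simp: A_def restr_def edges_in_def)

lemma A_dis: "A True \<inter> A False = {}" using A_sub disjoint by blast

lemma finish:
  assumes p0: "realizes ty X0 g A p0"
    and P: "rel c P (p0 w1)" "rel c P (p0 w2)" "rel (\<not> c) P (p0 w3)"
  shows "\<exists>p. realizes ty X g F p"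
proof -
  have "\<exists>p. realizes ty X g F p \<and> p v \<in> UNIV \<and> (\<forall>x\<in>X - orbit v. p x = p0 x)"
  proof (rule extend[OF v, of p0 UNIV P])
    show "realizes ty (X - orbit v) g (restr F (X - orbit v)) p0"
      using p0 by (simp add: A_def X0_def)
    show "rel d P (p0 w)" if "{v, w} \<in> F d" for d w
      using nbrs[of w] that P by (cases "d = c") auto
    show "rel d P ((ac ^^ j) P)" if "{v, (g ^^ j) v} \<in> F d" for d j
    proof -
      have "(g ^^ j) v \<in> {w1, w2, w3}" using nbrs[of "(g ^^ j) v"] that by (cases "d = c") auto
      then show ?thesis using pow_orbit[OF v(1), of j] away by auto
    qed
  qed auto
  then show ?thesis by blast
qed

lemma finish_box:
  assumes p0: "realizes ty X0 g A p0" and "\<not> in_box (p0 w1) (p0 w2) (p0 w3)"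
  shows "\<exists>p. realizes ty X g F p"
  using finish[OF p0] place_box[OF assms(2), of c] by blast

lemma e0_sub: "e0 \<subseteq> X0" using w_in by (auto simp: e0_def)
lemma e0_subX: "e0 \<subseteq> X" using e0_sub X0_sub by blast
lemma card_e0: "card e0 = 2" using w12 by (simp add: e0_def)

lemma colour_mod: "colour d (i mod n) = colour d i"
  by (cases ty) (auto simp: col_def swaps_colours_def odd_iff_mod_2_eq_one mod_mod_cancel dvd_mod_iff)

lemma e0_mod: "(g ^^ i) ` e0 = (g ^^ (i mod n)) ` e0"
  using pow_mod e0_subX by (intro image_cong) auto

text \<open>
  Sparsity is preserved because each added edge stands for a vertex with two edges: replacing it
  by that vertex turns a violation in the reduced pair into one in the given pair.
\<close>

lemma F'_pair: "sym_pair ty X0 g F'"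
proof
  interpret A: sym_pair ty X0 g A by (rule A_pair)
  show "finite X0" by (rule finite_X0)
  show "g x \<in> X0" if "x \<in> X0" for x using g_X0 that .
  show "(g ^^ n) x = x" if "x \<in> X0" for x using g_period that X0_sub by blast
  show "g x = x" if "x \<in> X0" "0 < j" "j < n" "(g ^^ j) x = x" for x j using free that X0_sub by blast
  show "x = y" if "central ty" "x \<in> X0" "y \<in> X0" "g x = x" "g y = y" for x y
    using one_fixed that X0_sub by blast
  show edge': "e \<subseteq> X0 \<and> card e = 2" if e: "e \<in> F' d" for e d
  proof (cases "e \<in> A d")
    case True then show ?thesis using A.edge by blast
  next
    case False
    then obtain i where "e = (g ^^ i) ` e0" using e by (auto simp: F'_def)
    moreover have "(g ^^ i) ` e0 \<subseteq> X0" using pow_X0 e0_sub by auto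
    moreover have "card ((g ^^ i) ` e0) = 2"
      using card_image[OF inj_on_subset[OF pow_inj e0_subX]] card_e0 by simp
    ultimately show ?thesis by simp
  qed
  show "g ` e \<in> F' (d \<noteq> swaps_colours ty)" if e: "e \<in> F' d" for e d
  proof (cases "e \<in> A d")
    case True then show ?thesis using A.edge_g unfolding F'_def by blast
  next
    case False
    then obtain i where i: "e = (g ^^ i) ` e0" "colour c i = d" using e by (auto simp: F'_def)
    have "g ` e = (g ^^ Suc i) ` e0" using i by (simp add: image_comp)
    moreover have "colour c (Suc i) = (d \<noteq> swaps_colours ty)" using i by (simp only: col_Suc)
    ultimately show ?thesis unfolding F'_def by blast
  qed
  show "sparse X0 (F' d)" for d
    unfolding sparse_def
  proof (intro allI impI)
    fix U assume U: "U \<subseteq> X0" "U \<noteq> {}"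
    \<comment> \<open>The added edges inside \<open>U\<close>; each of them is traded for the corresponding image of \<open>v\<close>.\<close>
    define J where "J = {i. i < n \<and> colour c i = d \<and> (g ^^ i) ` e0 \<subseteq> U}"
    define V where "V = U \<union> (\<lambda>i. (g ^^ i) v) ` J"
    define S where "S w = (\<lambda>i. {(g ^^ i) v, (g ^^ i) w}) ` J" for w
    have finU: "finite U" using U finite_X0 finite_subset by blast
    have finJ: "finite J" by (simp add: J_def)
    have injv: "inj_on (\<lambda>i. (g ^^ i) v) J"
      using mobile_inj[OF v] by (auto simp: J_def intro!: inj_onI)
    have vO: "(g ^^ i) v \<notin> X0" for i using pow_orbit[OF v(1)] by (simp add: X0_def)
    have wO: "(g ^^ i) w1 \<in> X0" "(g ^^ i) w2 \<in> X0" for i using pow_X0 w_in by auto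
    have cV: "card V = card U + card J"
      unfolding V_def using finU finJ injv U vO
      by (subst card_Un_disjoint) (auto simp: card_image)
    have key: "i = j \<and> (g ^^ i) x = (g ^^ i) y"
      if "{(g ^^ i) v, (g ^^ i) x} = {(g ^^ j) v, (g ^^ j) y}" "i \<in> J" "j \<in> J" "x \<in> {w1, w2}" "y \<in> {w1, w2}"
      for i j x y
    proof -
      have "(g ^^ i) x \<in> X0" "(g ^^ j) y \<in> X0" using that wO by auto
      then have "(g ^^ i) v = (g ^^ j) v" "(g ^^ i) x = (g ^^ j) y"
        using that(1) vO by (metis doubleton_eq_iff)+
      then show ?thesis using injv that by (auto simp: inj_on_def)
    qed
    have "card (S w) = card J" if w: "w \<in> {w1, w2}" for w
      unfolding S_def
    proof (rule card_image, rule inj_onI)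
      fix i j assume "i \<in> J" "j \<in> J" "{(g ^^ i) v, (g ^^ i) w} = {(g ^^ j) v, (g ^^ j) w}"
      then show "i = j" using key[of i w j w] w by blast
    qed
    then have cS: "card (S w1) = card J" "card (S w2) = card J" by auto
    have S12: "S w1 \<inter> S w2 = {}"
    proof -
      have False if "i \<in> J" "j \<in> J" "{(g ^^ i) v, (g ^^ i) w1} = {(g ^^ j) v, (g ^^ j) w2}" for i j
      proof -
        have "(g ^^ i) w1 = (g ^^ i) w2" using key[OF that(3,1,2)] by blast
        then show False using w12 pow_inj[of i] w_inX by (meson inj_onD)
      qed
      then show ?thesis by (auto simp: S_def)
    qed
    have SA: "(S w1 \<union> S w2) \<inter> edges_in (A d) U = {}"
      using vO U by (auto simp: S_def edges_in_def)
    have sub: "(S w1 \<union> S w2) \<union> edges_in (A d) U \<subseteq> edges_in (F d) V"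
    proof -
      have "{(g ^^ i) v, (g ^^ i) w} \<in> F d" if "i \<in> J" "w \<in> {w1, w2}" for i w
      proof -
        have "(g ^^ i) ` {v, w} \<in> F (colour c i)" using edge_pow nbrs that by blast
        then show ?thesis using that by (simp add: J_def)
      qed
      moreover have "(g ^^ i) w \<in> U" if "i \<in> J" "w \<in> {w1, w2}" for i w
        using that by (auto simp: J_def e0_def)
      ultimately have "f \<in> edges_in (F d) V" if "f \<in> S w" "w \<in> {w1, w2}" for f w
        using that by (auto simp: S_def edges_in_def V_def)
      moreover have "f \<in> edges_in (F d) V" if "f \<in> edges_in (A d) U" for f
        using that A_sub[of d] by (auto simp: edges_in_def V_def)
      ultimately show ?thesis by blast
    qed
    have fin3: "finite (S w1)" "finite (S w2)" "finite (edges_in (A d) U)" "finite (edges_in (F d) V)"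
      using finJ finU by (auto simp: S_def V_def)
    have "card J + card J + card (edges_in (A d) U) = card ((S w1 \<union> S w2) \<union> edges_in (A d) U)"
      using cS S12 SA fin3 by (simp add: card_Un_disjoint)
    also have "\<dots> \<le> card (edges_in (F d) V)" using sub fin3 by (intro card_mono) auto
    also have "\<dots> < card V"
      using U X0_sub v pow_in by (intro sparseD[OF sparse_F]) (auto simp: V_def)
    finally have 1: "card J + card (edges_in (A d) U) < card U" using cV by simp
    have "edges_in (F' d) U \<subseteq> edges_in (A d) U \<union> (\<lambda>i. (g ^^ i) ` e0) ` J"
    proof
      fix e assume e: "e \<in> edges_in (F' d) U"
      show "e \<in> edges_in (A d) U \<union> (\<lambda>i. (g ^^ i) ` e0) ` J"
      proof (cases "e \<in> A d")
        case False
        then obtain i where i: "e = (g ^^ i) ` e0" "colour c i = d" using e by (auto simp: F'_def edges_in_def)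
        have "i mod n \<in> J" using i e colour_mod e0_mod[of i] by (auto simp: J_def edges_in_def)
        then show ?thesis using i e0_mod by blast
      qed (use e in \<open>auto simp: edges_in_def\<close>)
    qed
    then have "card (edges_in (F' d) U) \<le> card (edges_in (A d) U \<union> (\<lambda>i. (g ^^ i) ` e0) ` J)"
      using fin3 finJ by (intro card_mono) auto
    also have "\<dots> \<le> card (edges_in (A d) U) + card ((\<lambda>i. (g ^^ i) ` e0) ` J)" by (rule card_Un_le)
    also have "\<dots> \<le> card (edges_in (A d) U) + card J" using card_image_le[OF finJ] by simp
    finally show "card (edges_in (F' d) U) < card U" using 1 by simp
  qed
  show "{x, (g ^^ (n div 2)) x} \<notin> F' d" if ce: "central ty" and x: "x \<in> X0" for x d
  proof
    let ?h = "g ^^ (n div 2)"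
    have n2: "n div 2 + n div 2 = n" "colour d (n div 2) = d" "n div 2 < n" "0 < n div 2" for d
      using ce by (cases ty; simp add: central_def col_def swaps_colours_def)+
    have hh: "?h (?h y) = y" if "y \<in> X" for y
      using g_period[OF that] n2(1) by (metis comp_apply funpow_add)
    \<comment> \<open>If the added edge were a diameter, \<open>v\<close>, its image and the two ends would span a cycle of length four in colour \<open>c\<close>.\<close>
    assume "{x, ?h x} \<in> F' d"
    moreover have "{x, ?h x} \<notin> A d" using no_diameter ce x X0_sub A_sub by blast
    ultimately obtain i where i: "{x, ?h x} = (g ^^ i) ` e0" by (auto simp: F'_def)
    then have i': "{x, ?h x} = (g ^^ (i mod n)) ` e0" using e0_mod by simp
    define j where "j = i mod n"
    have j: "j < n" "{x, ?h x} = (g ^^ j) ` e0" using i' by (auto simp: j_def)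
    define y where "y = (g ^^ (n - j)) x"
    have xX: "x \<in> X" using x X0_sub by blast
    have "(g ^^ (n - j)) ` (g ^^ j) ` e0 = (\<lambda>z. z) ` e0"
      unfolding image_image using pow_back e0_subX j by (intro image_cong) auto
    then have "e0 = (g ^^ (n - j)) ` {x, ?h x}" using j by simp
    also have "\<dots> = {y, ?h y}"
      unfolding y_def by (simp add: funpow_add[symmetric] comp_def[symmetric] add.commute del: comp_apply)
        (metis add.commute comp_apply funpow_add)
    finally have "e0 = {y, ?h y}" .
    moreover have yX: "y \<in> X" using pow_in xX by (simp add: y_def)
    ultimately have hw: "?h w1 = w2" "?h w2 = w1"
      using hh[of y] w12 by (auto simp: e0_def doubleton_eq_iff)
    let ?v = "?h v"
    have vv: "?v \<noteq> v" using v n2 by (auto simp: mobile_def)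
    have vO: "v \<notin> X0" "?v \<notin> X0" using pow_orbit[OF v(1)] orbit_self by (auto simp: X0_def)
    have E: "{v, w1} \<in> F c" "{v, w2} \<in> F c" using nbrs by auto
    have "?h ` {v, w1} \<in> F c" "?h ` {v, w2} \<in> F c"
      using edge_pow[OF E(1), of "n div 2"] edge_pow[OF E(2), of "n div 2"] n2(2)[of c] by simp_all
    then have E': "{?v, w2} \<in> F c" "{?v, w1} \<in> F c" using hw by auto
    let ?U = "{v, ?v, w1, w2}"
    let ?S = "{{v, w1}, {v, w2}, {?v, w2}, {?v, w1}}"
    have ne: "v \<noteq> w1" "v \<noteq> w2" "?v \<noteq> w1" "?v \<noteq> w2" using vO w_in by auto
    have "?S \<subseteq> edges_in (F c) ?U" using E E' by (auto simp: edges_in_def)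
    then have "card ?S \<le> card (edges_in (F c) ?U)" by (intro card_mono finite_edges_in) auto
    moreover have "card ?S = 4" using ne vv w12 by (auto simp: card_insert_if doubleton_eq_iff)
    moreover have "card (edges_in (F c) ?U) < card ?U"
      using v pow_in w_inX by (intro sparseD[OF sparse_F]) auto
    moreover have "card ?U \<le> 4" by (simp add: card_insert_if)
    ultimately show False by simp
  qed
qed

sublocale R: sym_pair ty X0 g F' by (rule F'_pair)

text \<open>
  The added edge has both colours if its ends are joined by an edge of the other colour, or if
  \<open>Swap\<close> maps it to itself.
\<close>

definition conflict :: bool where
  "conflict \<longleftrightarrow> e0 \<in> F (\<not> c) \<or> (ty = Swap \<and> g ` e0 = e0)"

lemma e0_F': "(g ^^ i) ` e0 \<in> F' (colour c i)"
  unfolding F'_def by blast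

lemma no_conflict_disjoint:
  assumes "\<not> conflict"
  shows "F' True \<inter> F' False = {}"
proof -
  have new_old: False if "(g ^^ i) ` e0 \<in> A d" "colour c i \<noteq> d" for i d
  proof -
    have "(g ^^ (i mod n)) ` e0 \<in> F d" using that A_sub e0_mod by auto
    then have "e0 \<in> F (colour d (i mod n))"
      using edge_back[of "i mod n"] e0_subX by (simp add: less_imp_le)
    moreover have "colour d (i mod n) = (\<not> c)" using that(2) colour_mod by (auto simp: col_def)
    ultimately show False using assms by (simp add: conflict_def)
  qed
  have new_new: False if eq: "(g ^^ i) ` e0 = (g ^^ j) ` e0" and ij: "colour c i \<noteq> colour c j" for i j
  proof -
    define k where "k = (i + (n - j mod n)) mod n"
    have sw: "swaps_colours ty" "odd i \<noteq> odd j" using ij by (auto simp: col_def)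
    have evn: "even n" using sw(1) by (cases ty) (auto simp: swaps_colours_def)
    have jn: "j mod n < n" by simp
    have "(g ^^ (n - j mod n)) ` (g ^^ i) ` e0 = (g ^^ (n - j mod n)) ` (g ^^ (j mod n)) ` e0"
      using eq e0_mod[of j] by simp
    also have "\<dots> = (\<lambda>x. x) ` e0"
      unfolding image_image using pow_back e0_subX jn by (intro image_cong) (auto simp: less_imp_le)
    finally have "(g ^^ (n - j mod n)) ` (g ^^ i) ` e0 = e0" by simp
    then have "(g ^^ (n - j mod n + i)) ` e0 = e0" by (simp only: funpow_add image_comp)
    then have ke: "(g ^^ k) ` e0 = e0" using e0_mod[of "n - j mod n + i"] by (simp add: k_def add.commute)
    have "odd (a - b) = odd b" if "even a" "b \<le> a" for a b :: nat using that by presburger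
    from this[OF evn less_imp_le[OF jn]] have "odd (n - j mod n) = odd (j mod n)" .
    moreover have "odd (j mod n) = odd j" using evn by (simp add: dvd_mod_iff)
    ultimately have "odd (i + (n - j mod n))"
      using sw(2) by (simp only: even_add) blast
    then have kodd: "odd k" "k < n" using evn by (auto simp: k_def dvd_mod_iff)
    show False
    proof (cases "ty = Swap")
      case True
      then have "k = 1" using kodd by (auto simp: less2)
      then have "g ` e0 = e0" using ke by simp
      then show False using assms True unfolding conflict_def by blast
    next
      case False
      then have ty: "ty = Quarter" using sw(1) by (simp add: swaps_colours_def)
      then have k4: "k = 1 \<or> k = 3" using kodd by (auto simp: less4)
      have "(g ^^ k) w1 = w1 \<and> (g ^^ k) w2 = w2 \<or> (g ^^ k) w1 = w2 \<and> (g ^^ k) w2 = w1"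
        using ke w12 by (auto simp: e0_def doubleton_eq_iff)
      then have "(g ^^ k) ((g ^^ k) w1) = w1" "(g ^^ k) ((g ^^ k) w2) = w2" by auto
      then have kk: "(g ^^ (k + k)) w1 = w1" "(g ^^ (k + k)) w2 = w2" by (simp_all add: funpow_add)
      have "(k + k) mod n = 2" using k4 ty by auto
      then have "(g ^^ 2) w1 = w1" "(g ^^ 2) w2 = w2" using kk pow_mod[of _ "k + k"] w_inX by metis+
      then have "g w1 = w1" "g w2 = w2" using free[of _ 2] w_inX ty by auto
      then show False using one_fixed[of w1 w2] w_inX w12 ty by (simp add: central_def)
    qed
  qed
  show ?thesis
  proof (rule ccontr)
    assume "\<not> ?thesis"
    then obtain e where e: "e \<in> F' True" "e \<in> F' False" by blast
    then show False
      using A_dis new_old[of _ True] new_old[of _ False] new_new unfolding F'_def by blast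
  qed
qed

lemma A_sub_F': "A d \<subseteq> F' d" by (auto simp: F'_def)

text \<open>
  The reduced pair is drawn by induction. The added edge puts \<open>w1\<close> and
  \<open>w2\<close> into the position that makes room for \<open>v\<close>.
\<close>

lemma case_no_conflict:
  assumes "\<not> conflict"
  shows "\<exists>p. realizes ty X g F p"
proof -
  obtain p0 where p0: "realizes ty X0 g F' p0"
    using IH[OF card_X0 F'_pair no_conflict_disjoint[OF assms]] by blast
  have "e0 \<in> F' c" using e0_F'[of 0] by simp
  then have "rel c (p0 w1) (p0 w2)" using p0 by (simp add: realizes_def e0_def)
  moreover have "p0 w3 \<noteq> p0 w1" "p0 w3 \<noteq> p0 w2"
    using p0 w3_ne w_in by (auto simp: realizes_def inj_on_def)
  ultimately obtain P where "rel c P (p0 w1)" "rel c P (p0 w2)" "rel (\<not> c) P (p0 w3)"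
    using place_21 by blast
  moreover have "realizes ty X0 g A p0" using p0 A_sub_F' unfolding realizes_def by blast
  ultimately show ?thesis using finish by blast
qed

text \<open>
  Here \<open>w1\<close> and \<open>w2\<close> are mirror images, so their box is a segment
  orthogonal to the axis, and it is enough to move the orbit of \<open>w3\<close> slightly
  parallel to the axis.
\<close>

lemma case_swapped_pair:
  assumes sw: "ty = Swap" and w: "g w1 = w2"
  shows "\<exists>p. realizes ty X g F p"
proof -
  interpret A: sym_pair ty X0 g A by (rule A_pair)
  obtain p0 where p0: "realizes ty X0 g A p0"
    using IH[OF card_X0 A_pair A_dis] by blast
  have gg: "g (g x) = x" if "x \<in> X" for x using g_period[OF that] sw by (simp add: eval_nat_numeral)
  have "{..<n} = {0, 1}" using sw by (auto simp: less2)
  then have orb: "orbit w3 = {w3, g w3}" by (simp add: orbit_def)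
  have no: "w1 \<notin> orbit w3" using orb w3_ne w gg[OF w_inX(3)] by auto
  define r where "r x = (if x \<in> orbit w3 then (1, 0) else (0, 0) :: point)" for x
  have "\<exists>\<epsilon>>0. fst (p0 w3) + \<epsilon> \<noteq> fst (p0 w1) \<and> realizes ty X0 g A (\<lambda>x. p0 x + \<epsilon> *\<^sub>R r x)"
  proof (rule A.blow_up)
    show "p0 (g x) = ac (p0 x)" if "x \<in> X0" for x using p0 that by (simp add: realizes_def)
    show "r (g x) = ac (r x)" if "x \<in> X0" for x
      using that X0_sub orbit_g_iff[OF w_inX(3), of x] sw by (auto simp: r_def)
    show "rel d (p0 x) (p0 y) \<or> p0 x = p0 y \<and> rel d (r x) (r y)" if "{x, y} \<in> A d" for d x y
      using p0 that by (simp add: realizes_def)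
    show "r x \<noteq> r y" if "x \<in> X0" "y \<in> X0" "x \<noteq> y" "p0 x = p0 y" for x y
      using p0 that by (auto simp: realizes_def inj_on_def)
    show "\<forall>\<^sub>F \<epsilon> in at_right 0. fst (p0 w3) + \<epsilon> \<noteq> fst (p0 w1)"
    proof (cases "fst (p0 w1) - fst (p0 w3) > 0")
      case True
      show ?thesis
        using eventually_at_right_real[OF True] by (rule eventually_mono) auto
    next
      case False
      have "\<forall>\<^sub>F \<epsilon> in at_right (0::real). 0 < \<epsilon>" by (simp add: eventually_at_right_less)
      then show ?thesis by (rule eventually_mono) (use False in auto)
    qed
  qed
  then obtain \<epsilon> where e: "\<epsilon> > 0" "fst (p0 w3) + \<epsilon> \<noteq> fst (p0 w1)"
    "realizes ty X0 g A (\<lambda>x. p0 x + \<epsilon> *\<^sub>R r x)" by blast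
  let ?p = "\<lambda>x. p0 x + \<epsilon> *\<^sub>R r x"
  have "fst (?p w3) \<noteq> fst (?p w1)" using e no orbit_self[of w3] by (simp add: r_def)
  moreover have "?p (g w1) = ac (?p w1)" using e(3) w_in(1) unfolding realizes_def by blast
  then have "fst (?p w2) = fst (?p w1)" unfolding w using sw by (cases "?p w1") simp
  ultimately have "\<not> in_box (?p w1) (?p w2) (?p w3)" by (auto simp: in_box_def)
  then show ?thesis using finish_box e(3) by blast
qed

end

section \<open>Clusters and their images\<close>

context sym_pair
begin

definition apart :: "'a set \<Rightarrow> bool" where
  "apart K \<longleftrightarrow> (\<forall>j. 0 < j \<longrightarrow> j < n \<longrightarrow> (g ^^ j) ` K \<inter> K = {})"

text \<open>
  Copies a drawing of \<open>K\<close> to the images of \<open>K\<close> by the symmetry; all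
  other vertices are sent to the origin.
\<close>

definition spread :: "'a set \<Rightarrow> ('a \<Rightarrow> point) \<Rightarrow> 'a \<Rightarrow> point" where
  "spread K r x = (if \<exists>i<n. x \<in> (g ^^ i) ` K
     then let i = (LEAST i. x \<in> (g ^^ i) ` K) in (ac ^^ i) (r ((g ^^ (n - i)) x)) else 0)"

lemma apart_eq:
  assumes "K \<subseteq> X" "apart K" "x \<in> (g ^^ i) ` K" "x \<in> (g ^^ j) ` K" "i < n" "j < n"
  shows "i = j"
proof -
  have *: False if ij: "x \<in> (g ^^ i) ` K" "x \<in> (g ^^ j) ` K" "i < j" "j < n" for i j
  proof -
    obtain u u' where u: "u \<in> K" "u' \<in> K" "x = (g ^^ i) u" "x = (g ^^ j) u'" using ij by blast
    have "(g ^^ j) u' = (g ^^ i) ((g ^^ (j - i)) u')"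
      using \<open>i < j\<close> by (metis comp_apply funpow_add le_add_diff_inverse less_imp_le)
    then have "(g ^^ (j - i)) u' = u" using u pow_inj[of i] pow_in assms(1) by (metis inj_onD subsetD)
    then have "u \<in> (g ^^ (j - i)) ` K \<inter> K" using u by blast
    moreover have "(g ^^ (j - i)) ` K \<inter> K = {}" using assms(2) ij by (simp add: apart_def)
    ultimately show False by blast
  qed
  show ?thesis using *[of i j] *[of j i] assms by (metis linorder_neqE_nat)
qed

lemma spread_on:
  assumes "K \<subseteq> X" "apart K" "u \<in> K" "i < n"
  shows "spread K r ((g ^^ i) u) = (ac ^^ i) (r u)"
proof -
  have mem: "(g ^^ i) u \<in> (g ^^ i) ` K" using assms by blast
  have "(LEAST i'. (g ^^ i) u \<in> (g ^^ i') ` K) = i"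
  proof (rule Least_equality, rule mem)
    fix j assume "(g ^^ i) u \<in> (g ^^ j) ` K"
    then show "i \<le> j" using apart_eq[OF assms(1,2) mem _ assms(4), of j] assms(4)
      by (metis dual_order.strict_trans linorder_not_le order_less_irrefl)
  qed
  then show ?thesis using mem assms pow_back[of u i] by (auto simp: spread_def Let_def)
qed

lemma image_pow_Suc: "(g ^^ Suc i) ` K = g ` (g ^^ i) ` K"
  by (simp add: image_comp)

lemma image_pow_mod: "K \<subseteq> X \<Longrightarrow> (g ^^ i) ` K = (g ^^ (i mod n)) ` K"
  using pow_mod by (intro image_cong) auto

lemma image_pow_sub: "K \<subseteq> X \<Longrightarrow> (g ^^ i) ` K \<subseteq> X"
  using pow_in by auto

lemma in_image_pow_iff: "K \<subseteq> X \<Longrightarrow> x \<in> X \<Longrightarrow> g x \<in> (g ^^ Suc i) ` K \<longleftrightarrow> x \<in> (g ^^ i) ` K"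
  unfolding image_pow_Suc using inj_on_image_mem_iff[of g X x "(g ^^ i) ` K"] pow_inj[of 1] image_pow_sub[of K i]
  by simp

lemma covered_iff:
  assumes K: "K \<subseteq> X"
  shows "(\<exists>i<n. x \<in> (g ^^ i) ` K) \<longleftrightarrow> (\<exists>i. x \<in> (g ^^ i) ` K)"
proof
  assume "\<exists>i. x \<in> (g ^^ i) ` K"
  then obtain i where "x \<in> (g ^^ (i mod n)) ` K" using image_pow_mod[OF K] by blast
  then show "\<exists>i<n. x \<in> (g ^^ i) ` K" using mod_less_divisor[OF period_pos] by blast
qed blast

lemma covered_g_iff:
  assumes "K \<subseteq> X" "x \<in> X"
  shows "(\<exists>i<n. g x \<in> (g ^^ i) ` K) \<longleftrightarrow> (\<exists>i<n. x \<in> (g ^^ i) ` K)"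
proof -
  have "(\<exists>i. g x \<in> (g ^^ i) ` K) \<longleftrightarrow> (\<exists>i. x \<in> (g ^^ i) ` K)"
  proof
    assume "\<exists>i. g x \<in> (g ^^ i) ` K"
    then obtain i where "i < n" "g x \<in> (g ^^ i) ` K" using covered_iff[OF assms(1)] by blast
    then have "g x \<in> (g ^^ Suc (i + n - 1)) ` K" using image_pow_mod[OF assms(1), of "i + n"] by simp
    then show "\<exists>i. x \<in> (g ^^ i) ` K" using in_image_pow_iff[OF assms] by blast
  qed (use in_image_pow_iff[OF assms] in blast)
  then show ?thesis using covered_iff[OF assms(1)] by simp
qed

lemma spread_g:
  assumes K: "K \<subseteq> X" "apart K" and x: "x \<in> X"
  shows "spread K r (g x) = ac (spread K r x)"
proof (cases "\<exists>i<n. x \<in> (g ^^ i) ` K")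
  case True
  then obtain i u where i: "i < n" "u \<in> K" "x = (g ^^ i) u" by blast
  have gx: "g x = (g ^^ Suc i) u" using i by simp
  show ?thesis
  proof (cases "Suc i < n")
    case True
    then show ?thesis using spread_on[OF K i(2) True] spread_on[OF K i(2,1)] i gx by simp
  next
    case False
    then have n: "Suc i = n" using i by simp
    then have "g x = (g ^^ 0) u" using gx g_period i K by auto
    moreover have "ac ((ac ^^ i) (r u)) = r u" using act_period[of ty "r u"] n by (metis funpow.simps(2) comp_apply)
    ultimately show ?thesis using spread_on[OF K i(2), of 0] spread_on[OF K i(2,1)] i by simp
  qed
next
  case False
  then have "\<not> (\<exists>i<n. g x \<in> (g ^^ i) ` K)" using covered_g_iff[OF K(1) x] by blast
  then show ?thesis unfolding spread_def using False by (simp only: if_False act_0)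
qed

lemma spread_edge:
  assumes K: "K \<subseteq> X" "apart K" and r: "realizes Id K id (restr F K) r"
    and e: "{x, y} \<in> F d" "x \<in> (g ^^ i) ` K" "y \<in> (g ^^ i) ` K" "i < n"
  shows "rel d (spread K r x) (spread K r y)"
proof -
  obtain u u' where u: "u \<in> K" "x = (g ^^ i) u" "u' \<in> K" "y = (g ^^ i) u'" using e by blast
  have "(g ^^ i) ` {u, u'} \<in> F d" using e u by simp
  then have "{u, u'} \<in> F (colour d i)" using edge_back[of i "{u, u'}" d] u K e by auto
  then have "rel (colour d i) (r u) (r u')"
    using r u by (auto simp: realizes_def restr_def edges_in_def)
  then have "rel (colour (colour d i) i) ((ac ^^ i) (r u)) ((ac ^^ i) (r u'))"
    by (simp only: rel_act_pow)
  then show ?thesis using spread_on[OF K] u e by simp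
qed

lemma spread_inj:
  assumes K: "K \<subseteq> X" "apart K" and r: "inj_on r K"
    and e: "x \<in> (g ^^ i) ` K" "y \<in> (g ^^ i) ` K" "i < n" "x \<noteq> y"
  shows "spread K r x \<noteq> spread K r y"
proof -
  obtain u u' where u: "u \<in> K" "x = (g ^^ i) u" "u' \<in> K" "y = (g ^^ i) u'" using e by blast
  then have "r u \<noteq> r u'" using r e by (auto simp: inj_on_def)
  then show ?thesis using spread_on[OF K] u e act_pow_inj[of i ty "r u" "r u'"] by auto
qed

lemma inv_pow: "g ` K = K \<Longrightarrow> (g ^^ i) ` K = K"
proof (induction i)
  case (Suc i) then show ?case by (simp only: image_pow_Suc)
qed simp

text \<open>
  A cluster \<open>K\<close> and its images are first drawn as single points and then resolved.
  The cluster is either invariant, and is then drawn symmetrically, or is disjoint from its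
  images, and is then drawn without symmetry and copied.
\<close>

lemma cluster_blow_up:
  assumes K: "K \<subseteq> X"
    and cl: "g ` K = K \<and> realizes ty K g (restr F K) rK \<or> apart K \<and> realizes Id K id (restr F K) rK"
    and p: "\<And>x. x \<in> X \<Longrightarrow> p (g x) = ac (p x)"
    and edges: "\<And>d x y. {x, y} \<in> F d \<Longrightarrow>
         rel d (p x) (p y) \<or> p x = p y \<and> (\<exists>i<n. x \<in> (g ^^ i) ` K \<and> y \<in> (g ^^ i) ` K)"
    and pts: "\<And>x y. x \<in> X \<Longrightarrow> y \<in> X \<Longrightarrow> x \<noteq> y \<Longrightarrow> p x = p y \<Longrightarrow>
         \<exists>i<n. x \<in> (g ^^ i) ` K \<and> y \<in> (g ^^ i) ` K"
    and ev: "\<And>r. eventually (\<lambda>\<epsilon>. Q (\<lambda>x. p x + \<epsilon> *\<^sub>R r x)) (at_right 0)"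
  shows "\<exists>p. realizes ty X g F p \<and> Q p"
  using cl
proof
  assume a: "g ` K = K \<and> realizes ty K g (restr F K) rK"
  then have gK: "g ` K = K" and rK: "realizes ty K g (restr F K) rK" by auto
  define r where "r x = (if x \<in> K then rK x else 0)" for x
  have gK': "g x \<in> K \<longleftrightarrow> x \<in> K" if "x \<in> X" for x
    using in_image_pow_iff[OF K that, of 0] gK by simp
  have "\<exists>\<epsilon>>0. Q (\<lambda>x. p x + \<epsilon> *\<^sub>R r x) \<and> realizes ty X g F (\<lambda>x. p x + \<epsilon> *\<^sub>R r x)"
  proof (rule blow_up[of p r "\<lambda>\<epsilon>. Q (\<lambda>x. p x + \<epsilon> *\<^sub>R r x)"])
    show "r (g x) = ac (r x)" if "x \<in> X" for x
      using rK gK'[OF that] by (auto simp: r_def realizes_def)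
    show "rel d (p x) (p y) \<or> p x = p y \<and> rel d (r x) (r y)" if e: "{x, y} \<in> F d" for d x y
    proof -
      have "rel d (rK x) (rK y)" if "x \<in> K" "y \<in> K"
        using rK e that by (auto simp: realizes_def restr_def edges_in_def)
      then show ?thesis using edges[OF e] inv_pow[OF gK] by (auto simp: r_def)
    qed
    show "r x \<noteq> r y" if "x \<in> X" "y \<in> X" "x \<noteq> y" "p x = p y" for x y
      using pts[OF that] inv_pow[OF gK] rK that(3) by (auto simp: r_def realizes_def inj_on_def)
  qed (use ev p in auto)
  then show ?thesis by blast
next
  assume a: "apart K \<and> realizes Id K id (restr F K) rK"
  then have ap: "apart K" and rK: "realizes Id K id (restr F K) rK" by auto
  let ?r = "spread K rK"
  have "\<exists>\<epsilon>>0. Q (\<lambda>x. p x + \<epsilon> *\<^sub>R ?r x) \<and> realizes ty X g F (\<lambda>x. p x + \<epsilon> *\<^sub>R ?r x)"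
  proof (rule blow_up[of p ?r "\<lambda>\<epsilon>. Q (\<lambda>x. p x + \<epsilon> *\<^sub>R ?r x)"])
    show "?r (g x) = ac (?r x)" if "x \<in> X" for x using spread_g[OF K ap that] .
    show "rel d (p x) (p y) \<or> p x = p y \<and> rel d (?r x) (?r y)" if e: "{x, y} \<in> F d" for d x y
      using edges[OF e] spread_edge[OF K ap rK e] by blast
    show "?r x \<noteq> ?r y" if "x \<in> X" "y \<in> X" "x \<noteq> y" "p x = p y" for x y
      using pts[OF that] spread_inj[OF K ap, of rK x _ y] rK that(3) by (auto simp: realizes_def)
  qed (use ev p in auto)
  then show ?thesis by blast
qed

lemma edges_in_pow:
  assumes "C \<subseteq> X" "i \<le> n"
  shows "edges_in (F d) ((g ^^ i) ` C) = (\<lambda>e. (g ^^ i) ` e) ` edges_in (F (colour d i)) C"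
proof (intro equalityI subsetI)
  fix f assume f: "f \<in> edges_in (F d) ((g ^^ i) ` C)"
  then obtain e where e: "e \<subseteq> C" "f = (g ^^ i) ` e" by (auto simp: edges_in_def elim!: subset_imageE)
  then have "e \<in> F (colour d i)" using edge_back[of i e d] f assms by (auto simp: edges_in_def)
  then show "f \<in> (\<lambda>e. (g ^^ i) ` e) ` edges_in (F (colour d i)) C" using e by (auto simp: edges_in_def)
next
  fix f assume "f \<in> (\<lambda>e. (g ^^ i) ` e) ` edges_in (F (colour d i)) C"
  then obtain e where "e \<in> F (colour d i)" "e \<subseteq> C" "f = (g ^^ i) ` e" by (auto simp: edges_in_def)
  then show "f \<in> edges_in (F d) ((g ^^ i) ` C)"
    using edge_pow[of e "colour d i" i] by (auto simp: edges_in_def)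
qed

lemma tight_pow:
  assumes "C \<subseteq> X" "i \<le> n" "tight (F (colour d i)) C"
  shows "tight (F d) ((g ^^ i) ` C)"
proof -
  have "card (edges_in (F d) ((g ^^ i) ` C)) = card (edges_in (F (colour d i)) C)"
    unfolding edges_in_pow[OF assms(1,2)]
  proof (rule card_image, rule inj_onI)
    fix e f assume "e \<in> edges_in (F (colour d i)) C" "f \<in> edges_in (F (colour d i)) C" "(g ^^ i) ` e = (g ^^ i) ` f"
    then show "e = f" using inj_on_image_eq_iff[OF pow_inj[of i], of e f] assms(1) by (auto simp: edges_in_def)
  qed
  moreover have "card ((g ^^ i) ` C) = card C"
    using card_image[OF inj_on_subset[OF pow_inj assms(1)]] .
  ultimately show ?thesis using assms(3) by (simp add: tight_def)
qed

lemma no_empty_edge: "{} \<notin> F d" "{x} \<notin> F d"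
  using edge[of "{}" d] edge[of "{x}" d] by auto

end

section \<open>Conflicts and tight clusters\<close>

text \<open>
  If the added edge has both colours, no position of its ends suits both, and they are treated
  as part of a cluster that shrinks to a point.
\<close>

locale conflict_reduction = reduction +
  assumes conflict: conflict and not_swapped: "ty = Swap \<Longrightarrow> g w1 \<noteq> w2"
begin

lemma e0_all: "(g ^^ i) ` e0 \<in> F' d"
proof -
  have "e0 \<in> F' d" for d
  proof (cases "d = c")
    case True then show ?thesis using e0_F'[of 0] by simp
  next
    case False
    then have dc: "d = (\<not> c)" by auto
    show ?thesis
    proof (cases "e0 \<in> F (\<not> c)")
      case True
      then have "e0 \<in> A d" using e0_sub dc by (simp add: A_def restr_def edges_in_def)
      then show ?thesis using A_sub_F' by blast
    next
      case False
      then have sw: "ty = Swap" "g ` e0 = e0" using conflict by (auto simp: conflict_def)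
      have "g ` e0 \<in> F' (c \<noteq> swaps_colours ty)" using R.edge_g[of e0 c] e0_F'[of 0] by simp
      then show ?thesis using sw dc by (simp add: swaps_colours_def)
    qed
  qed
  then have "e0 \<in> F' (colour d i)" by blast
  then show ?thesis using R.edge_pow[of e0 "colour d i" i] by simp
qed

lemma shared: "e \<in> F' True \<Longrightarrow> e \<in> F' False \<Longrightarrow> \<exists>i. e = (g ^^ i) ` e0"
  using A_dis unfolding F'_def by blast

text \<open>
  The clusters that may be shrunk to a point: they contain the added edge and are tight in both
  colours, so that contracting them keeps both edge sets sparse, and they are invariant or
  disjoint from their images. An invariant cluster must be proper, since otherwise drawing it
  would be as hard as the whole task.
\<close>

definition admissible :: "'a set \<Rightarrow> bool" where
  "admissible C \<longleftrightarrow> C \<subseteq> X0 \<and> e0 \<subseteq> C \<and> (\<forall>d. tight (F' d) C) \<and>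
     (g ` C = C \<and> C \<noteq> X0 \<or> 1 < n \<and> R.apart C)"

lemma tight_e0: "tight (F' d) e0"
  using e0_all[of 0 d] w12 R.edge unfolding e0_def by (intro tight_pair) auto

lemma mobile_w12_apart:
  assumes j: "0 < j" "j < n" and mb: "mobile w1"
  shows "(g ^^ j) w1 \<noteq> w2"
proof
  assume eq: "(g ^^ j) w1 = w2"
  have e0j: "{w1, (g ^^ j) w1} \<in> F' c" using e0_all[of 0 c] eq by (simp add: e0_def)
  show False
  proof (cases ty)
    case Mirror
    then show False using R.no_diameter[of w1 c] j e0j w_in by (auto simp: central_def less2)
  next
    case Half
    then show False using R.no_diameter[of w1 c] j e0j w_in by (auto simp: central_def less2)
  next
    case Swap
    then show False using not_swapped j eq by (auto simp: less2)
  next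
    case Id then show False using j by simp
  next
    case Quarter
    have j': "j = 1 \<or> j = 3"
      using R.no_diameter[of w1 c] j e0j w_in Quarter by (auto simp: central_def less4)
    let ?a = "(g ^^ 0) w1" and ?b = "(g ^^ 1) w1" and ?c = "(g ^^ 2) w1" and ?d = "(g ^^ 3) w1"
    have dist: "?a \<noteq> ?b" "?a \<noteq> ?c" "?a \<noteq> ?d" "?b \<noteq> ?c" "?b \<noteq> ?d" "?c \<noteq> ?d"
      using mobile_inj[OF w_inX(1) mb, of 0 1] mobile_inj[OF w_inX(1) mb, of 0 2] mobile_inj[OF w_inX(1) mb, of 0 3]
        mobile_inj[OF w_inX(1) mb, of 1 2] mobile_inj[OF w_inX(1) mb, of 1 3] mobile_inj[OF w_inX(1) mb, of 2 3]
        Quarter by auto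
    let ?S = "{{?a, ?b}, {?b, ?c}, {?c, ?d}, {?d, ?a}}"
    have E: "{(g ^^ i) w1, (g ^^ (i + j)) w1} \<in> F' c" for i
      using e0_all[of i c] eq by (auto simp: e0_def funpow_add)
    have E': "{(g ^^ i) w1, (g ^^ k) w1} \<in> F' c" if "k = (i + j) mod 4" for i k
      using E[of i] pow_mod[OF w_inX(1), of "i + j"] Quarter that by simp
    have "?S \<subseteq> F' c"
      using j'
    proof
      assume "j = 1"
      then show ?thesis using E'[of 1 0] E'[of 2 1] E'[of 3 2] E'[of 0 3] by simp
    next
      assume "j = 3"
      then show ?thesis using E'[of 0 1] E'[of 1 2] E'[of 2 3] E'[of 3 0] by (simp add: insert_commute)
    qed
    then have "?S \<subseteq> edges_in (F' c) {?a, ?b, ?c, ?d}" by (auto simp: edges_in_def)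
    then have "card ?S \<le> card (edges_in (F' c) {?a, ?b, ?c, ?d})" by (intro card_mono finite_edges_in) auto
    moreover have "card ?S = 4" using dist by (simp add: card_insert_if doubleton_eq_iff)
    moreover have "card (edges_in (F' c) {?a, ?b, ?c, ?d}) < card {?a, ?b, ?c, ?d}"
      using pow_X0[of w1] w_in g_X0 by (intro sparseD[OF R.sparse_F]) auto
    moreover have "card {?a, ?b, ?c, ?d} \<le> 4" by (simp add: card_insert_if)
    ultimately show False by simp
  qed
qed

text \<open>
  If one end \<open>f\<close> of the added edge is fixed, the star that consists of
  \<open>f\<close> and the orbit of the other end is invariant and tight. It is an admissible
  cluster unless it is everything, and then \<open>w3\<close> is an image of that end and lies
  outside the box.
\<close>

lemma one_fixed_end:
  assumes e0: "e0 = {f, w}" and f: "\<not> mobile f" and w: "mobile w"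
  shows "(\<exists>C. admissible C) \<or> (\<exists>p. realizes ty X g F p)"
proof -
  have fw: "f \<in> X0" "w \<in> X0" "f \<noteq> w" using e0_sub e0 f w by auto
  have fwX: "f \<in> X" "w \<in> X" using fw X0_sub by auto
  have gf: "g f = f" "1 < n" using not_mobile[OF fwX(1) f] by auto
  have fi: "(g ^^ i) f = f" for i using not_mobile_pow[OF fwX(1) f] .
  have fO: "f \<notin> orbit w"
  proof
    assume "f \<in> orbit w"
    then obtain i where "i < n" "f = (g ^^ i) w" by (auto simp: orbit_def)
    then have "(g ^^ (n - i)) f = w" using pow_back[of w i] fwX by simp
    then show False using fi fw by simp
  qed
  let ?C = "{f} \<union> (\<Union>j<n. {(g ^^ j) w})"
  have C: "?C = insert f (orbit w)" by (auto simp: orbit_def)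
  have ne: "(g ^^ j) w \<noteq> f" for j using fO pow_orbit[OF fwX(2), of j] by metis
  have t: "tight (F' d) ?C" for d
  proof -
    have "tight (F' d) ?C \<and> edges_in (F' d) ?C
        = edges_in (F' d) {f} \<union> (\<Union>j<n. insert ((g ^^ j) ` e0) (edges_in (F' d) {(g ^^ j) w}))"
    proof (rule tight_star[OF R.sparse_F finite_X0])
      show "{(g ^^ i) w} \<inter> {(g ^^ j) w} = {}" if "i < n" "j < n" "i \<noteq> j" for i j
        using mobile_inj[OF fwX(2) w that(1,2)] that by auto
      show "(g ^^ j) ` e0 \<in> F' d \<and> (g ^^ j) ` e0 \<subseteq> {f} \<union> {(g ^^ j) w} \<and>
        \<not> (g ^^ j) ` e0 \<subseteq> {f} \<and> \<not> (g ^^ j) ` e0 \<subseteq> {(g ^^ j) w}" for j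
        using e0_all[of j d] e0 fi[of j] ne[of j] by auto
      show "{(g ^^ j) w} \<subseteq> X0 \<and> tight (F' d) {(g ^^ j) w} \<and> {f} \<inter> {(g ^^ j) w} = {}" for j
        using pow_X0[OF fw(2), of j] ne[of j] tight_singleton[OF R.no_empty_edge] by auto
    qed (use fw R.no_empty_edge in \<open>auto intro: tight_singleton\<close>)
    then show ?thesis by blast
  qed
  have "(\<lambda>i. (g ^^ i) w) ` {..<n} = orbit w" by (simp add: orbit_def)
  have gC: "g ` ?C = ?C"
  proof -
    have "g ` orbit w \<subseteq> orbit w" using orbit_g_iff[OF fwX(2)] orbit_sub[OF fwX(2)] by blast
    moreover have "card (g ` orbit w) = card (orbit w)"
      using orbit_sub[OF fwX(2)] pow_inj[of 1] by (intro card_image) (auto intro: inj_on_subset)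
    moreover have "finite (orbit w)" by (simp add: orbit_def)
    ultimately have "g ` orbit w = orbit w" using card_subset_eq by blast
    then show ?thesis using C gf by simp
  qed
  show ?thesis
  proof (cases "?C = X0")
    case False
    have "?C \<subseteq> X0" using fw(1) pow_X0[OF fw(2)] by blast
    moreover have "e0 \<subseteq> ?C" using C e0 orbit_self[of w] by simp
    ultimately have "admissible ?C" unfolding admissible_def using False gC t by blast
    then show ?thesis by blast
  next
    case True
    interpret A: sym_pair ty X0 g A by (rule A_pair)
    obtain p0 where p0: "realizes ty X0 g A p0"
      using IH[OF card_X0 A_pair A_dis] by blast
    have gw: "g w \<noteq> w" using w gf(2) by (auto simp: mobile_def dest: spec[of _ 1])
    have "\<not> (ty = Swap \<and> g ` e0 = e0)" using gw gf e0 fw by (auto simp: doubleton_eq_iff)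
    then have "e0 \<in> F (\<not> c)" using conflict by (auto simp: conflict_def)
    then have "{f, w} \<in> A (\<not> c)" using e0_sub e0 by (simp add: A_def restr_def edges_in_def)
    then have r: "rel (\<not> c) (p0 f) (p0 w)" using p0 by (simp add: realizes_def)
    have w3: "w3 \<noteq> f" "w3 \<noteq> w" using w3_ne e0 by (auto simp: e0_def doubleton_eq_iff)
    have "w3 \<in> orbit w" using w_in(3) True C w3 by blast
    then obtain j where j: "j < n" "w3 = (g ^^ j) w" by (auto simp: orbit_def)
    have "0 < j" using j w3 by (cases j) auto
    have eqv: "p0 (g x) = ac (p0 x)" if "x \<in> X0" for x using p0 that by (simp add: realizes_def)
    have "p0 w3 = (ac ^^ j) (p0 w)" using A.pow_act[of p0 w j] eqv fw j by simp
    moreover have "\<not> in_box (p0 f) (p0 w) ((ac ^^ j) (p0 w))"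
    proof (rule orbit_outside_box[OF _ _ r \<open>0 < j\<close> j(1)])
      show "ac (p0 f) = p0 f" using eqv[OF fw(1)] gf by simp
      have "p0 (g w) \<noteq> p0 w" using p0 gw fw g_X0 by (auto simp: realizes_def inj_on_def)
      then show "ac (p0 w) \<noteq> p0 w" using eqv fw by simp
    qed
    ultimately have "\<not> in_box (p0 f) (p0 w) (p0 w3)" by simp
    moreover have "w1 = f \<and> w2 = w \<or> w1 = w \<and> w2 = f" using e0 by (auto simp: e0_def doubleton_eq_iff)
    ultimately have "\<not> in_box (p0 w1) (p0 w2) (p0 w3)" by (auto simp: in_box_def min.commute max.commute)
    then show ?thesis using finish_box[OF p0] by blast
  qed
qed

text \<open>
  In all other cases the two ends themselves form an admissible cluster.
\<close>

lemma admissible_or_done: "(\<exists>C. admissible C) \<or> (\<exists>p. realizes ty X g F p)"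
proof -
  have neX0: "e0 \<noteq> X0" using w_in(3) w3_ne by (auto simp: e0_def)
  consider "n = 1" | "1 < n" "mobile w1" "mobile w2" | "\<not> mobile w1" "mobile w2" | "mobile w1" "\<not> mobile w2"
    | "\<not> mobile w1" "\<not> mobile w2" "1 < n"
    by (metis One_nat_def Suc_lessI period_pos)
  then show ?thesis
  proof cases
    case 1
    then have gx: "g x = x" if "x \<in> X" for x using g_period[OF that] by simp
    have "g ` e0 = (\<lambda>x. x) ` e0" by (rule image_cong) (use gx e0_subX in blast)+
    then have "g ` e0 = e0" by simp
    then show ?thesis using neX0 e0_sub tight_e0 unfolding admissible_def by blast
  next
    case 2
    have "(g ^^ j) ` e0 \<inter> e0 = {}" if j: "0 < j" "j < n" for j
    proof -
      have "(g ^^ j) w2 \<noteq> w1"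
      proof
        assume "(g ^^ j) w2 = w1"
        then have "(g ^^ (n - j)) w1 = w2" using pow_back[of w2 j] w_inX j by auto
        then show False using mobile_w12_apart[of "n - j"] j 2 by simp
      qed
      moreover have "(g ^^ j) w1 \<noteq> w1" "(g ^^ j) w2 \<noteq> w2" using 2 j by (auto simp: mobile_def)
      ultimately show ?thesis using mobile_w12_apart[OF j 2(2)] by (auto simp: e0_def)
    qed
    then have "R.apart e0" by (simp add: R.apart_def)
    then show ?thesis using 2 e0_sub tight_e0 unfolding admissible_def by blast
  next
    case 3 then show ?thesis using one_fixed_end[of w1 w2] by (simp add: e0_def)
  next
    case 4 then show ?thesis using one_fixed_end[of w2 w1] by (simp add: e0_def insert_commute)
  next
    case 5
    then have "g ` e0 = e0" using not_mobile w_inX by (auto simp: e0_def)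
    then show ?thesis using neX0 e0_sub tight_e0 unfolding admissible_def by blast
  qed
qed

end

context sym_pair
begin

lemma orbit_image:
  assumes "v \<in> X"
  shows "g ` orbit v = orbit v"
proof -
  have "g ` orbit v \<subseteq> orbit v" using orbit_g_iff[OF assms] orbit_sub[OF assms] by blast
  moreover have "card (g ` orbit v) = card (orbit v)"
    using orbit_sub[OF assms] pow_inj[of 1] by (intro card_image) (auto intro: inj_on_subset)
  moreover have "finite (orbit v)" by (simp add: orbit_def)
  ultimately show ?thesis using card_subset_eq by blast
qed

lemma half_period:
  assumes "central ty"
  shows "n div 2 + n div 2 = n" "colour d (n div 2) = d" "n div 2 < n" "0 < n div 2"
  using assms by (cases ty; simp add: central_def col_def swaps_colours_def)+

lemma half_half: "central ty \<Longrightarrow> x \<in> X \<Longrightarrow> (g ^^ (n div 2)) ((g ^^ (n div 2)) x) = x"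
  using g_period half_period(1) by (metis comp_apply funpow_add)

end

section \<open>Double links of a maximal cluster\<close>

text \<open>
  Contracting a cluster fails only if some edge gets both colours, that is, if a cluster and a
  vertex, or two clusters, are linked in both colours. For a cluster of maximal size such a
  double link is rigid: the cluster and what it is linked to would form a larger cluster unless
  they exhaust all vertices.
\<close>

locale max_cluster = conflict_reduction +
  fixes C
  assumes admissible_C: "admissible C" and max_C: "admissible C' \<Longrightarrow> card C' \<le> card C"
begin

definition "B i = (g ^^ i) ` C"

lemma C_sub: "C \<subseteq> X0" and e0_C: "e0 \<subseteq> C" and C_tight: "tight (F' d) C"
  and C_cases: "g ` C = C \<and> C \<noteq> X0 \<or> 1 < n \<and> apart C"
  using admissible_C unfolding admissible_def R.apart_def apart_def by auto

lemma C_subX: "C \<subseteq> X" using C_sub X0_sub by blast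
lemma w_C: "w1 \<in> C" "w2 \<in> C" using e0_C by (auto simp: e0_def)
lemma finite_C: "finite C" using C_sub finite_X0 finite_subset by blast

lemma B_0 [simp]: "B 0 = C" by (simp add: B_def)
lemma B_sub: "B i \<subseteq> X0" using pow_X0 C_sub by (auto simp: B_def)
lemma B_mod: "B i = B (i mod n)" unfolding B_def using image_pow_mod[OF C_subX] .
lemma B_add: "(g ^^ i) ` B j = B (i + j)" by (simp add: B_def image_comp funpow_add)
lemma B_Suc: "g ` B j = B (Suc j)" using B_add[of 1 j] by simp
lemma B_inv: "g ` C = C \<Longrightarrow> B i = C" unfolding B_def by (rule inv_pow)

lemma B_tight: "tight (F' d) (B i)"
proof -
  have "tight (F' d) (B (i mod n))"
    unfolding B_def by (rule R.tight_pow[OF C_sub]) (simp_all add: less_imp_le C_tight)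
  then show ?thesis using B_mod by metis
qed

text \<open>
  The images of the cluster are equal or disjoint, both for invariant clusters and for those
  that are disjoint from their images.
\<close>

lemma B_meet: "B i \<inter> B j \<noteq> {} \<Longrightarrow> B i = B j"
proof -
  assume ne: "B i \<inter> B j \<noteq> {}"
  show ?thesis
    using C_cases
  proof
    assume "g ` C = C \<and> C \<noteq> X0" then show ?thesis using B_inv by blast
  next
    assume a: "1 < n \<and> apart C"
    obtain x where "x \<in> B (i mod n)" "x \<in> B (j mod n)" using ne B_mod by blast
    then have "i mod n = j mod n"
      unfolding B_def using apart_eq[OF C_subX, of x "i mod n" "j mod n"] a by auto
    then show ?thesis using B_mod by metis
  qed
qed

lemma B_apart: "apart C \<Longrightarrow> i < n \<Longrightarrow> j < n \<Longrightarrow> i \<noteq> j \<Longrightarrow> B i \<inter> B j = {}"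
  unfolding B_def using apart_eq[OF C_subX, of _ i j] by blast

lemma B_pow_iff: "x \<in> X0 \<Longrightarrow> (g ^^ i) x \<in> B (i + j) \<longleftrightarrow> x \<in> B j"
  unfolding B_add[symmetric] using inj_on_image_mem_iff[OF R.pow_inj, of x "B j" i] B_sub by blast

definition "link S T d \<longleftrightarrow> (\<exists>e\<in>F' d. e \<subseteq> S \<union> T \<and> \<not> e \<subseteq> S \<and> \<not> e \<subseteq> T)"
definition "dlink S T \<longleftrightarrow> (\<forall>d. link S T d)"

lemma dlink_sym: "dlink S T \<longleftrightarrow> dlink T S"
  unfolding dlink_def link_def by (simp add: Un_commute conj_commute)

lemma dlink_shift:
  assumes "dlink S T" "S \<subseteq> X0" "T \<subseteq> X0"
  shows "dlink ((g ^^ i) ` S) ((g ^^ i) ` T)"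
  unfolding dlink_def link_def
proof
  fix d
  obtain e where e: "e \<in> F' (colour d i)" "e \<subseteq> S \<union> T" "\<not> e \<subseteq> S" "\<not> e \<subseteq> T"
    using assms(1) unfolding dlink_def link_def by blast
  have eX: "e \<subseteq> X0" using e assms by blast
  have "(g ^^ i) ` e \<in> F' d" using R.edge_pow[OF e(1), of i] by simp
  moreover have "(g ^^ i) ` e \<subseteq> (g ^^ i) ` S \<union> (g ^^ i) ` T" using e by blast
  moreover have "\<not> (g ^^ i) ` e \<subseteq> (g ^^ i) ` S" "\<not> (g ^^ i) ` e \<subseteq> (g ^^ i) ` T"
    using inj_on_image_subset_iff[OF R.pow_inj eX] assms e by blast+
  ultimately show "\<exists>e\<in>F' d. e \<subseteq> (g ^^ i) ` S \<union> (g ^^ i) ` T \<and> \<not> e \<subseteq> (g ^^ i) ` S \<and> \<not> e \<subseteq> (g ^^ i) ` T"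
    by blast
qed

lemma no_self_dlink: "\<not> dlink S S" unfolding dlink_def link_def by blast

lemma link_single:
  assumes "link S {z} d" "z \<notin> S"
  shows "\<exists>c\<in>S. {z, c} \<in> F' d"
proof -
  obtain e where e: "e \<in> F' d" "e \<subseteq> S \<union> {z}" "\<not> e \<subseteq> S" using assms by (auto simp: link_def)
  then have "z \<in> e" by blast
  then obtain c where "c \<noteq> z" "e = {z, c}" using card2D[of e z] R.edge[OF e(1)] by blast
  then show ?thesis using e by blast
qed

text \<open>
  The parity argument, applied to the involution $g^{n/2}$.
\<close>

lemma central_fixed_point:
  assumes ce: "central ty" and T: "T \<subseteq> X0" "tight (F' d) T" and inv: "(g ^^ (n div 2)) ` T \<subseteq> T"
  shows "\<exists>x\<in>T. g x = x"
proof -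
  let ?h = "g ^^ (n div 2)"
  have "\<exists>x\<in>T. ?h x = x"
  proof (rule tight_invariant_fixed_point[OF _ T(2)])
    show "?h x \<in> T \<and> ?h (?h x) = x" if "x \<in> T" for x
      using that inv T R.half_half[OF ce] by blast
    show "?h ` e \<in> F' d" if "e \<in> edges_in (F' d) T" for e
      using R.edge_pow[of e d "n div 2"] that R.half_period(2)[OF ce] by (simp add: edges_in_def)
    show "{x, ?h x} \<notin> F' d" if "x \<in> T" for x using R.no_diameter[OF ce] that T by blast
  qed (use R.edge in blast)
  then obtain x where x: "x \<in> T" "?h x = x" by blast
  then have "g x = x" using R.free[of x "n div 2"] R.half_period[OF ce] T by blast
  then show ?thesis using x by blast
qed

lemma not_central_apart:
  assumes ap: "apart C" "1 < n" and T: "T \<subseteq> (\<Union>i. B i)" "tight (F' d) T" "(g ^^ (n div 2)) ` T \<subseteq> T"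
  shows "\<not> central ty"
proof
  assume ce: "central ty"
  have "T \<subseteq> X0" using T B_sub by blast
  then obtain x where x: "x \<in> T" "g x = x" using central_fixed_point[OF ce _ T(2,3)] by blast
  then obtain i where i: "x \<in> B i" using T by blast
  then have "x \<in> B (Suc i)" using x B_Suc[of i] by (metis imageI)
  then have "B (Suc i mod n) = B (i mod n)" using i B_meet[of "Suc i" i] B_mod by blast
  moreover have "B (i mod n) \<noteq> {}" using w_C by (auto simp: B_def)
  moreover have "Suc i mod n \<noteq> i mod n" using ap(2) by (simp add: mod_Suc)
  ultimately show False using B_apart[OF ap(1), of "Suc i mod n" "i mod n"] by auto
qed

lemma two_links_distinct:
  assumes "{z, a} \<in> F' True" "{z, b} \<in> F' False" "\<forall>i. z \<notin> B i"
  shows "a \<noteq> b"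
proof
  assume "a = b"
  then obtain i where "{z, a} = (g ^^ i) ` e0" using shared assms by blast
  moreover have "(g ^^ i) ` e0 \<subseteq> B i" using e0_C unfolding B_def by blast
  ultimately have "z \<in> B i" by blast
  then show False using assms by blast
qed

text \<open>
  Adding the orbit of \<open>z\<close> to the cluster gives an invariant tight set, so by
  maximality it is everything. As the orbit is attached to the cluster by single edges,
  \<open>z\<close> is a leaf in each colour.
\<close>

lemma invariant_dlink:
  assumes gC: "g ` C = C" and z: "z \<in> X0" "z \<notin> C" and dl: "dlink C {z}"
  shows "X0 = C \<union> orbit z" "\<exists>a\<in>C. {z, a} \<in> F' d \<and> (\<forall>y. {z, y} \<in> F' d \<longrightarrow> y = a)"
proof -
  have zX: "z \<in> X" using z X0_sub by blast
  obtain a where a: "\<And>d. a d \<in> C" "\<And>d. {z, a d} \<in> F' d"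
    using link_single[OF _ z(2)] dl unfolding dlink_def by metis
  define k where "k = (if mobile z then n else 1)"
  have Bi: "B i = C" for i using B_inv[OF gC] .
  have pz: "(g ^^ j) z \<notin> C" for j using B_pow_iff[OF z(1), of j 0] Bi z(2) by simp
  have pa: "(g ^^ j) x \<in> C" if "x \<in> C" for j x using Bi[of j] that by (auto simp: B_def)
  have zj: "j = 0" if "j < k" "(g ^^ j) z = z" for j
  proof (cases "mobile z")
    case True
    then show ?thesis using that mobile_inj[OF zX True, of j 0] by (simp add: k_def)
  next
    case False
    then show ?thesis using that(1) by (simp add: k_def)
  qed
  have k: "0 < k" by (simp add: k_def)
  let ?T = "C \<union> (\<Union>j<k. {(g ^^ j) z})"
  let ?e = "\<lambda>d j. (g ^^ j) ` {z, a (colour d j)}"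
  have st: "tight (F' d) ?T \<and> edges_in (F' d) ?T
      = edges_in (F' d) C \<union> (\<Union>j<k. insert (?e d j) (edges_in (F' d) {(g ^^ j) z}))" for d
  proof (rule tight_star[OF R.sparse_F finite_X0 C_sub C_tight])
    show "{(g ^^ j) z} \<subseteq> X0 \<and> tight (F' d) {(g ^^ j) z} \<and> C \<inter> {(g ^^ j) z} = {}" for j
      using pow_X0[OF z(1)] pz tight_singleton[OF R.no_empty_edge] by auto
    show "{(g ^^ i) z} \<inter> {(g ^^ j) z} = {}" if "i < k" "j < k" "i \<noteq> j" for i j
      using that mobile_inj[OF zX, of i j] by (cases "mobile z") (auto simp: k_def)
    show "?e d j \<in> F' d \<and> ?e d j \<subseteq> C \<union> {(g ^^ j) z} \<and> \<not> ?e d j \<subseteq> C \<and> \<not> ?e d j \<subseteq> {(g ^^ j) z}" for j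
      using R.edge_pow[OF a(2)[of "colour d j"], of j] pa[OF a(1)[of "colour d j"], of j] pz[of j] by auto
  qed (rule R.no_empty_edge)
  have T: "?T = C \<union> orbit z"
    using orbit_fixed[OF zX] by (cases "mobile z") (auto simp: k_def orbit_def)
  show X0: "X0 = C \<union> orbit z"
  proof (rule ccontr)
    assume ne: "X0 \<noteq> C \<union> orbit z"
    have "g ` (C \<union> orbit z) = C \<union> orbit z" using gC orbit_image[OF zX] by (simp add: image_Un)
    moreover have "orbit z \<subseteq> X0" using pow_X0[OF z(1)] by (auto simp: orbit_def)
    ultimately have "admissible (C \<union> orbit z)"
      unfolding admissible_def using st T ne C_sub e0_C by auto
    then have "card (C \<union> orbit z) \<le> card C" using max_C by blast
    moreover have "card C < card (C \<union> orbit z)"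
      using z(2) orbit_self[of z] finite_C by (intro psubset_card_mono) (auto simp: orbit_def)
    ultimately show False by simp
  qed
  show "\<exists>a\<in>C. {z, a} \<in> F' d \<and> (\<forall>y. {z, y} \<in> F' d \<longrightarrow> y = a)"
  proof (intro bexI conjI allI impI)
    fix y assume y: "{z, y} \<in> F' d"
    then have "{z, y} \<in> edges_in (F' d) ?T" using R.edge[OF y] T X0 by (auto simp: edges_in_def)
    moreover have "edges_in (F' d) {x} = {}" for x
      using R.no_empty_edge[where d = d] by (auto simp: edges_in_def subset_singleton_iff)
    moreover have "{z, y} \<notin> edges_in (F' d) C" using z by (auto simp: edges_in_def)
    ultimately obtain j where j: "j < k" "{z, y} = ?e d j" using st[of d] by auto
    then have "z = (g ^^ j) z" using pa[OF a(1)[of "colour d j"], of j] z(2) by auto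
    then have "j = 0" using zj j by simp
    then show "y = a d" using j by (auto simp: doubleton_eq_iff)
  qed (use a in auto)
qed

text \<open>
  If \<open>z\<close> were mobile, \<open>C\<close> with \<open>z\<close> would still be
  disjoint from its images, against maximality. So \<open>z\<close> is fixed, and
  \<open>z\<close> with all images of \<open>C\<close> is an invariant tight set, hence
  everything.
\<close>

lemma apart_dlink_point:
  assumes ap: "apart C" "1 < n" and z: "z \<in> X0" "\<forall>i. z \<notin> B i" and dl: "dlink C {z}"
  shows "g z = z" "X0 = insert z (\<Union>i<n. B i)"
    "\<exists>a. (\<forall>d. a d \<in> C \<and> {z, a d} \<in> F' d) \<and>
       (\<forall>d e. e \<in> F' d \<longrightarrow> (\<exists>i<n. e \<subseteq> B i) \<or> (\<exists>i<n. e = (g ^^ i) ` {z, a (colour d i)}))"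
proof -
  have zX: "z \<in> X" using z X0_sub by blast
  have zC: "z \<notin> C" using z(2) B_0 by metis
  obtain a where a: "\<And>d. a d \<in> C" "\<And>d. {z, a d} \<in> F' d"
    using link_single[OF _ zC] dl unfolding dlink_def by metis
  have nm: "\<not> mobile z"
  proof
    assume mb: "mobile z"
    have t: "tight (F' d) (C \<union> {z})" for d
    proof (rule tight_link[OF R.sparse_F finite_X0 C_sub _ C_tight _ _ a(2)])
      show "tight (F' d) {z}" using tight_singleton[OF R.no_empty_edge] .
      show "{} \<notin> F' d" by (rule R.no_empty_edge)
    qed (use z zC a(1)[of d] in auto)
    have "(g ^^ j) ` (C \<union> {z}) \<inter> (C \<union> {z}) = {}" if j: "0 < j" "j < n" for j
    proof -
      have "(g ^^ j) z \<notin> C"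
      proof
        assume "(g ^^ j) z \<in> C"
        then have "(g ^^ j) z \<in> B (j + (n - j))" using B_mod[of n] j by simp
        then show False using B_pow_iff[OF z(1)] z(2) by blast
      qed
      moreover have "(g ^^ j) z \<noteq> z" using mb j by (simp add: mobile_def)
      moreover have "z \<notin> (g ^^ j) ` C" using z(2) by (simp add: B_def)
      moreover have "(g ^^ j) ` C \<inter> C = {}" using ap j by (simp add: apart_def)
      ultimately show ?thesis by auto
    qed
    then have "admissible (C \<union> {z})" unfolding admissible_def R.apart_def using C_sub z e0_C t ap by auto
    then have "card (C \<union> {z}) \<le> card C" by (rule max_C)
    then show False using zC finite_C by simp
  qed
  show gz: "g z = z" using not_mobile[OF zX nm] by blast
  have pz: "(g ^^ i) z = z" for i using not_mobile_pow[OF zX nm] .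
  let ?T = "{z} \<union> (\<Union>j<n. B j)"
  let ?e = "\<lambda>d j. (g ^^ j) ` {z, a (colour d j)}"
  have st: "tight (F' d) ?T \<and> edges_in (F' d) ?T
      = edges_in (F' d) {z} \<union> (\<Union>j<n. insert (?e d j) (edges_in (F' d) (B j)))" for d
  proof (rule tight_star[OF R.sparse_F finite_X0 _ _ R.no_empty_edge(1)])
    show "tight (F' d) {z}" using tight_singleton[OF R.no_empty_edge] .
    show "B j \<subseteq> X0 \<and> tight (F' d) (B j) \<and> {z} \<inter> B j = {}" for j using B_sub B_tight z by blast
    show "B i \<inter> B j = {}" if "i < n" "j < n" "i \<noteq> j" for i j using B_apart[OF ap(1) that] .
    fix j
    have "(g ^^ j) (a (colour d j)) \<in> B j" using a by (simp add: B_def)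
    then show "?e d j \<in> F' d \<and> ?e d j \<subseteq> {z} \<union> B j \<and> \<not> ?e d j \<subseteq> {z} \<and> \<not> ?e d j \<subseteq> B j"
      using R.edge_pow[OF a(2)[of "colour d j"], of j] pz[of j] z(2) by auto
  qed (use z in auto)
  have gT: "g ` ?T = ?T"
  proof -
    have "g ` (\<Union>j<n. B j) = (\<Union>j<n. B (Suc j))" by (simp add: image_UN B_Suc)
    also have "\<dots> = (\<Union>j. B j)"
    proof
      show "(\<Union>j. B j) \<subseteq> (\<Union>j<n. B (Suc j))"
      proof
        fix x assume "x \<in> (\<Union>j. B j)"
        then obtain j where "x \<in> B j" by blast
        moreover have "Suc ((j + (n - 1)) mod n) mod n = j mod n"
        proof -
          have "Suc (j + (n - 1)) = j + n" using period_pos[of ty] by linarith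
          then show ?thesis by (metis mod_Suc_eq mod_add_self2)
        qed
        ultimately have "x \<in> B (Suc ((j + (n - 1)) mod n))"
          using B_mod[of "Suc ((j + (n - 1)) mod n)"] B_mod[of j] by simp
        then show "x \<in> (\<Union>j<n. B (Suc j))" by fastforce
      qed
    qed blast
    also have "\<dots> = (\<Union>j<n. B j)" using B_mod by (auto intro: mod_less_divisor[OF period_pos])
    finally show ?thesis using gz by simp
  qed
  have X0: "X0 = ?T"
  proof (rule ccontr)
    assume ne: "X0 \<noteq> ?T"
    have CT: "C \<subseteq> (\<Union>j<n. B j)" using B_0 period_pos by blast
    have "?T \<subseteq> X0" using B_sub z by blast
    moreover have "e0 \<subseteq> ?T" using subset_trans[OF e0_C CT] by (rule le_supI2)
    moreover have "\<forall>d. tight (F' d) ?T" using st by simp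
    ultimately have "admissible ?T"
      unfolding admissible_def using gT ne[symmetric] by (intro conjI disjI1) assumption+
    then have "card ?T \<le> card C" by (rule max_C)
    moreover have "card C < card ?T"
      using zC CT \<open>?T \<subseteq> X0\<close> finite_X0 by (intro psubset_card_mono) (auto intro: finite_subset)
    ultimately show False by simp
  qed
  then show "X0 = insert z (\<Union>i<n. B i)" by simp
  have "(\<exists>i<n. e \<subseteq> B i) \<or> (\<exists>i<n. e = ?e d i)" if e: "e \<in> F' d" for d e
  proof -
    have "e \<in> edges_in (F' d) ?T" using R.edge[OF e] e X0 by (simp add: edges_in_def)
    moreover have "edges_in (F' d) {z} = {}"
      using R.no_empty_edge[where d = d] by (auto simp: edges_in_def subset_singleton_iff)
    ultimately have "\<exists>j<n. e = ?e d j \<or> e \<in> edges_in (F' d) (B j)" using st[of d] by auto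
    then show ?thesis by (auto simp: edges_in_def)
  qed
  then show "\<exists>a. (\<forall>d. a d \<in> C \<and> {z, a d} \<in> F' d) \<and>
       (\<forall>d e. e \<in> F' d \<longrightarrow> (\<exists>i<n. e \<subseteq> B i) \<or> (\<exists>i<n. e = (g ^^ i) ` {z, a (colour d i)}))"
    using a by blast
qed

text \<open>
  The union of \<open>C\<close> and the linked image is tight. For a central symmetry a tight
  set assembled from images of \<open>C\<close> that is invariant under $g^{n/2}$ would contain
  the fixed vertex, which is impossible; so the symmetry is \<open>Swap\<close> and the two
  images make up everything.
\<close>

lemma apart_dlink_block:
  assumes ap: "apart C" "1 < n" and k: "0 < k" "k < n" and dl: "dlink C (B k)"
  shows "ty = Swap" "X0 = C \<union> g ` C"
    "\<exists>a\<in>C. \<exists>b\<in>C. a \<noteq> b \<and> (\<forall>e. e \<in> F' True \<longrightarrow> (\<exists>i<n. e \<subseteq> B i) \<or> e = {a, g b}) \<and>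
       (\<forall>e. e \<in> F' False \<longrightarrow> (\<exists>i<n. e \<subseteq> B i) \<or> e = {g a, b})"
proof -
  have CB: "C \<inter> B j = {}" if "0 < j" "j < n" for j using B_apart[OF ap(1), of 0 j] that by simp
  have tl: "tight (F' d) (C \<union> B j) \<and> (\<forall>e\<in>F' d. e \<subseteq> C \<union> B j \<longrightarrow> \<not> e \<subseteq> C \<longrightarrow> \<not> e \<subseteq> B j \<longrightarrow>
      edges_in (F' d) (C \<union> B j) = insert e (edges_in (F' d) C \<union> edges_in (F' d) (B j)))"
    if j: "0 < j" "j < n" and dl: "dlink C (B j)" for j d
  proof -
    have "tight (F' d) (C \<union> B j) \<and>
      edges_in (F' d) (C \<union> B j) = insert e (edges_in (F' d) C \<union> edges_in (F' d) (B j))"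
      if "e \<in> F' d" "e \<subseteq> C \<union> B j" "\<not> e \<subseteq> C" "\<not> e \<subseteq> B j" for e
      using tight_link[OF R.sparse_F finite_X0 C_sub B_sub C_tight B_tight CB[OF j] that R.no_empty_edge(1)] by blast
    then show ?thesis using dl unfolding dlink_def link_def by blast
  qed
  have not_central: "\<not> central ty"
  proof
    assume ce: "central ty"
    show False
    proof (cases "k = n div 2")
      case True
      have "(g ^^ (n div 2)) ` (C \<union> B k) = B k \<union> B (k + k)"
        unfolding image_Un B_add True by (simp add: B_def)
      also have "B (k + k) = C" using True R.half_period(1)[OF ce] B_mod[of n] by simp
      finally have "(g ^^ (n div 2)) ` (C \<union> B k) \<subseteq> C \<union> B k" by blast
      moreover have "C \<union> B k \<subseteq> (\<Union>i. B i)" using B_0 by blast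
      ultimately show False using not_central_apart[OF ap, of "C \<union> B k" True] tl[OF k dl] ce by blast
    next
      case False
      have ty: "ty = Quarter" "k = 1 \<or> k = 3"
        using ce k False by (auto simp: central_def less2 less4)
      have n4: "n = 4" using ty by simp
      have dl1: "dlink C (B 1)"
      proof (cases "k = 1")
        case False
        then have k3: "k = 3" using ty by simp
        have "dlink ((g ^^ 1) ` C) ((g ^^ 1) ` B k)" by (rule dlink_shift[OF dl C_sub B_sub])
        moreover have "(g ^^ 1) ` B k = C" using B_add[of 1 k] k3 n4 B_mod[of 4] by simp
        moreover have "(g ^^ 1) ` C = B 1" by (simp add: B_def)
        ultimately show ?thesis using dlink_sym by metis
      qed (use dl in simp)
      let ?T = "C \<union> B 1"
      have T0: "tight (F' d) ?T" for d using tl[OF _ _ dl1] n4 by simp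
      have TX: "?T \<subseteq> X0" using C_sub B_sub by blast
      have gi: "(g ^^ i) ` ?T = B i \<union> B (Suc i)" for i
        unfolding image_Un B_add using B_add[of i 0] by (simp add: B_def)
      have Ti: "tight (F' d) (B i \<union> B (Suc i))" if "i \<le> n" for i d
        using R.tight_pow[OF TX that T0, of d] gi[of i] by simp
      have ne: "B i \<noteq> {}" for i using w_C by (auto simp: B_def)
      have U1: "tight (F' d) ((B 0 \<union> B 1) \<union> (B 1 \<union> B 2))" for d
        using tight_Un(1)[OF R.sparse_F finite_X0, where A = "B 0 \<union> B 1" and B = "B 1 \<union> B 2"]
          ne[of 1] Ti[of 0 d] Ti[of 1 d] n4 B_sub[of 0] B_sub[of 1] B_sub[of 2]
        by (simp add: numeral_2_eq_2) blast
      have U2: "tight (F' d) (((B 0 \<union> B 1) \<union> (B 1 \<union> B 2)) \<union> (B 2 \<union> B 3))" for d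
        using tight_Un(1)[OF R.sparse_F finite_X0, where A = "(B 0 \<union> B 1) \<union> (B 1 \<union> B 2)" and B = "B 2 \<union> B 3"]
          ne[of 2] U1[of d] Ti[of 2 d] n4 B_sub[of 0] B_sub[of 1] B_sub[of 2] B_sub[of 3]
        by (simp add: eval_nat_numeral) blast
      let ?U = "((B 0 \<union> B 1) \<union> (B 1 \<union> B 2)) \<union> (B 2 \<union> B 3)"
      have h1: "(g ^^ (n div 2)) ` ?U \<subseteq> ?U"
      proof -
        have "n div 2 + 0 = 2" "n div 2 + 1 = 3" "n div 2 + 2 = 4" "n div 2 + 3 = 5" using n4 by simp_all
        moreover have "B 4 = B 0" "B 5 = B 1" using B_mod[of 4] B_mod[of 5] n4 by simp_all
        ultimately show ?thesis unfolding image_Un B_add by (simp only:) blast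
      qed
      have h2: "?U \<subseteq> (\<Union>i. B i)" by (intro Un_least UN_upper) simp_all
      show False using not_central_apart[OF ap h2 U2[of True] h1] ce by simp
    qed
  qed
  then show sw: "ty = Swap" using ap(2) by (cases ty) (auto simp: central_def)
  then have k1: "k = 1" and n2: "n = 2" using k by auto
  have Bk: "B k = g ` C" using k1 by (simp add: B_def)
  have gg: "g (g x) = x" if "x \<in> X0" for x using R.g_period[OF that] n2 by (simp add: eval_nat_numeral)
  have "g ` g ` C = (\<lambda>x. x) ` C"
    unfolding image_image by (rule image_cong) (use gg C_sub in blast)+
  then have ggC: "g ` g ` C = C" by simp
  show X0: "X0 = C \<union> g ` C"
  proof (rule ccontr)
    assume ne: "X0 \<noteq> C \<union> g ` C"
    have "g ` (C \<union> g ` C) = C \<union> g ` C" using ggC by (simp add: image_Un Un_commute)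
    moreover have "tight (F' d) (C \<union> g ` C)" for d using tl[OF k dl] Bk by simp
    moreover have "C \<union> g ` C \<subseteq> X0" using C_sub g_X0 by blast
    ultimately have "admissible (C \<union> g ` C)"
      unfolding admissible_def using ne e0_C by blast
    then have "card (C \<union> g ` C) \<le> card C" by (rule max_C)
    moreover have "card C < card (C \<union> g ` C)"
      using CB[OF k] Bk w_C finite_C by (intro psubset_card_mono) auto
    ultimately show False by simp
  qed
  obtain e where e: "e \<in> F' True" "e \<subseteq> C \<union> B k" "\<not> e \<subseteq> C" "\<not> e \<subseteq> B k"
    using dl unfolding dlink_def link_def by blast
  obtain y where y: "y \<in> e" "y \<notin> C" using e by blast
  then obtain b where b: "b \<in> C" "y = g b" using e Bk by blast
  obtain a where a: "e = {y, a}" using card2D[OF _ y(1)] R.edge[OF e(1)] by blast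
  then have "a \<in> C" using e y b Bk by blast
  then have ab: "a \<in> C" "b \<in> C" "e = {a, g b}" using a b by auto
  have ge: "g ` e \<in> F' False" using R.edge_g[OF e(1)] sw by (simp add: swaps_colours_def)
  have ge': "g ` e = {g a, b}" using ab gg C_sub by auto
  have "g b \<notin> C" "g a \<notin> C" using CB[OF k] Bk ab by blast+
  have "a \<noteq> b"
  proof
    assume "a = b"
    then have "g ` e = e" using ge' ab by auto
    then obtain i where i: "e = (g ^^ i) ` e0" using shared e ge by metis
    moreover have "(g ^^ i) ` e0 \<subseteq> B i" using e0_C unfolding B_def by blast
    ultimately have "e \<subseteq> B (i mod n)" using B_mod[of i] by simp
    moreover have "i mod n = 0 \<or> i mod n = k" using n2 k1 by auto
    ultimately have "e \<subseteq> B 0 \<or> e \<subseteq> B k" by metis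
    then show False using e(3,4) B_0 by simp
  qed
  have cov: "\<exists>i<n. f \<subseteq> B i" if "f \<subseteq> C \<or> f \<subseteq> B k" for f
    using that
  proof
    assume "f \<subseteq> C" then show ?thesis by (intro exI[of _ 0]) simp
  next
    assume "f \<subseteq> B k" then show ?thesis using k(2) by (intro exI[of _ k]) simp
  qed
  have T: "(\<exists>i<n. f \<subseteq> B i) \<or> f = {a, g b}" if f: "f \<in> F' True" for f
  proof -
    have "f \<in> edges_in (F' True) (C \<union> B k)" using R.edge[OF f] f X0 Bk by (simp add: edges_in_def)
    moreover have "edges_in (F' True) (C \<union> B k) = insert e (edges_in (F' True) C \<union> edges_in (F' True) (B k))"
      using conjunct2[OF tl[OF k dl, of True]] e by blast
    ultimately have "f \<in> insert e (edges_in (F' True) C \<union> edges_in (F' True) (B k))" by (rule subst[rotated])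
    then have "f = e \<or> f \<subseteq> C \<or> f \<subseteq> B k" unfolding edges_in_def by blast
    then show ?thesis using cov[of f] ab(3) by blast
  qed
  have "(\<exists>i<n. f \<subseteq> B i) \<or> f = {g a, b}" if f: "f \<in> F' False" for f
  proof -
    have "g ` e \<subseteq> C \<union> B k" "\<not> g ` e \<subseteq> C" "\<not> g ` e \<subseteq> B k"
      using ge' ab Bk \<open>g a \<notin> C\<close> CB[OF k] by auto
    moreover have "f \<in> edges_in (F' False) (C \<union> B k)" using R.edge[OF f] f X0 Bk by (simp add: edges_in_def)
    moreover have "edges_in (F' False) (C \<union> B k) = insert (g ` e) (edges_in (F' False) C \<union> edges_in (F' False) (B k))"
      using conjunct2[OF tl[OF k dl, of False]] ge ge'(1) calculation by blast
    ultimately have "f \<in> insert (g ` e) (edges_in (F' False) C \<union> edges_in (F' False) (B k))" by simp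
    then have "f = g ` e \<or> f \<subseteq> C \<or> f \<subseteq> B k" unfolding edges_in_def by blast
    then show ?thesis using cov[of f] ge' by blast
  qed
  then show "\<exists>a\<in>C. \<exists>b\<in>C. a \<noteq> b \<and> (\<forall>e. e \<in> F' True \<longrightarrow> (\<exists>i<n. e \<subseteq> B i) \<or> e = {a, g b}) \<and>
       (\<forall>e. e \<in> F' False \<longrightarrow> (\<exists>i<n. e \<subseteq> B i) \<or> e = {g a, b})"
    using T ab \<open>a \<noteq> b\<close> by blast
qed

end

section \<open>Drawing a doubly linked cluster\<close>

lemma in_box_bound:
  assumes "in_box P Q R"
  shows "\<bar>fst R\<bar> \<le> \<bar>fst P\<bar> + \<bar>fst Q\<bar> + \<bar>snd P\<bar> + \<bar>snd Q\<bar>"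
    "\<bar>snd R\<bar> \<le> \<bar>fst P\<bar> + \<bar>fst Q\<bar> + \<bar>snd P\<bar> + \<bar>snd Q\<bar>"
  using assms unfolding in_box_def by linarith+

lemma realizes_shift_Id:
  assumes "realizes Id K id G r"
  shows "realizes Id K id G (\<lambda>u. r u + Q)"
  using assms by (auto simp: realizes_def inj_on_def)

context sym_pair
begin

text \<open>
  Without symmetry any coordinate of a vertex may be changed slightly.
\<close>

lemma perturb_Id:
  assumes K: "K \<subseteq> X" and r0: "realizes Id K id (restr F K) r0" and xy: "x \<in> K" "y \<in> K" "x \<noteq> y"
  shows "\<exists>r. realizes Id K id (restr F K) r \<and> fst (r x) \<noteq> fst (r y)"
proof -
  interpret K: sym_pair Id K id "restr F K" by (rule sub_pair_Id[OF K])
  define s where "s u = (if u = x then (1, 0) else (0, 0) :: point)" for u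
  have "\<exists>\<epsilon>>0. fst (r0 x) + \<epsilon> \<noteq> fst (r0 y) \<and> realizes Id K id (restr F K) (\<lambda>u. r0 u + \<epsilon> *\<^sub>R s u)"
  proof (rule K.blow_up)
    show "\<forall>\<^sub>F \<epsilon> in at_right 0. fst (r0 x) + \<epsilon> \<noteq> fst (r0 y)"
    proof (cases "fst (r0 y) - fst (r0 x) > 0")
      case True
      show ?thesis
        using eventually_at_right_real[OF True] by (rule eventually_mono) auto
    next
      case False
      have "\<forall>\<^sub>F \<epsilon> in at_right (0::real). 0 < \<epsilon>" by (simp add: eventually_at_right_less)
      then show ?thesis by (rule eventually_mono) (use False in auto)
    qed
  qed (use r0 in \<open>auto simp: realizes_def inj_on_def\<close>)
  then obtain \<epsilon> where "fst (r0 x) + \<epsilon> \<noteq> fst (r0 y)" "realizes Id K id (restr F K) (\<lambda>u. r0 u + \<epsilon> *\<^sub>R s u)"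
    by blast
  then show ?thesis using xy by (intro exI[of _ "\<lambda>u. r0 u + \<epsilon> *\<^sub>R s u"]) (simp add: s_def)
qed

lemma spread_slab:
  assumes K: "K \<subseteq> X" "apart K" and r: "inj_on r K" "r ` K \<subseteq> slab \<sigma> L" and s: "\<bar>\<sigma>\<bar> = 1" "0 \<le> L"
    and x: "x \<in> (g ^^ i) ` K" "i < n"
  shows "spread K r x \<noteq> 0"
    and "0 < i \<Longrightarrow> spread K r x \<notin> slab \<sigma> L"
    and "\<And>y j. y \<in> (g ^^ j) ` K \<Longrightarrow> j < n \<Longrightarrow> spread K r x = spread K r y \<Longrightarrow> x = y"
proof -
  have free: "(ac ^^ j) (r u) \<notin> slab \<sigma> L" if "u \<in> K" "0 < j" "j < n" for u j
    using slab_free[of "r u" \<sigma> L j ty] r that s by blast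
  obtain u where u: "u \<in> K" "x = (g ^^ i) u" using x by blast
  have sx: "spread K r x = (ac ^^ i) (r u)" using spread_on[OF K u(1) x(2)] u by simp
  have "r u \<noteq> 0"
    using r(2) u s by (auto simp: slab_def)
  then show "spread K r x \<noteq> 0" using sx act_pow_inj[of i ty "r u" 0] x(2) by auto
  show "0 < i \<Longrightarrow> spread K r x \<notin> slab \<sigma> L" using sx free u x by simp
  fix y j assume y: "y \<in> (g ^^ j) ` K" "j < n" "spread K r x = spread K r y"
  obtain u' where u': "u' \<in> K" "y = (g ^^ j) u'" using y by blast
  have eq: "(ac ^^ i) (r u) = (ac ^^ j) (r u')" using sx spread_on[OF K u'(1) y(2)] u' y(3) by simp
  have no: False if "i < j" "j < n" "u \<in> K" "u' \<in> K" "(ac ^^ i) (r u) = (ac ^^ j) (r u')" for i j u u'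
  proof -
    have "(ac ^^ j) (r u') = (ac ^^ i) ((ac ^^ (j - i)) (r u'))"
      using that(1) by (metis comp_apply funpow_add le_add_diff_inverse less_imp_le)
    then have "r u = (ac ^^ (j - i)) (r u')" using act_pow_inj[of i ty] that by simp
    then show False using free[of u' "j - i"] that r(2) by auto
  qed
  have "i = j" using no[of i j u u'] no[of j i u' u] eq u u' x y by (metis linorder_neqE_nat)
  then have "r u = r u'" using eq act_pow_inj[of i ty] x by simp
  then show "x = y" using u u' r \<open>i = j\<close> by (auto simp: inj_on_def)
qed

end

context max_cluster
begin

abbreviation "realizable \<equiv> \<exists>p. realizes ty X g F p"

lemma A_sub_pair: "Y \<subseteq> X0 \<Longrightarrow> (\<And>y. y \<in> Y \<Longrightarrow> g y \<in> Y) \<Longrightarrow> sym_pair ty Y g (restr A Y)"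
  by (rule sym_pair.sub_pair[OF A_pair])

lemma restr_dis: "restr F Y True \<inter> restr F Y False = {}" "restr A Y True \<inter> restr A Y False = {}"
  using disjoint A_dis by (auto simp: restr_def edges_in_def)

lemma card_C: "card C < card X"
proof -
  have "card C \<le> card X0" using C_sub finite_X0 by (intro card_mono)
  then show ?thesis using card_X0 by simp
qed

lemma orbit_v_edge:
  assumes "{(g ^^ i) v, y} \<in> F d" "i < n"
  shows "\<exists>w\<in>{w1, w2, w3}. y = (g ^^ i) w"
proof -
  have "{v, (g ^^ (n - i)) y} \<in> F (colour d i)" "y = (g ^^ i) ((g ^^ (n - i)) y)"
    using edge_shift[OF assms v(1)] by auto
  moreover have "x \<in> {w1, w2, w3}" if "{v, x} \<in> F d'" for x d'
    using that nbrs[of x] by (cases "d' = c") auto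
  ultimately show ?thesis by blast
qed

lemma v_notin: "(g ^^ i) v \<notin> X0" using pow_orbit[OF v(1)] by (simp add: X0_def)

text \<open>
  By the structure of double links \<open>z\<close> is a leaf in both colours, so that
  minimality of the degree forces \<open>w3\<close> to lie in its orbit. Hence \<open>w3\<close>
  can be drawn after the cluster, with one neighbour of each colour, and so far out that it is
  not in the box of \<open>w1\<close> and \<open>w2\<close>.
\<close>

lemma case_invariant:
  assumes gC: "g ` C = C" and z: "z \<in> X0" "z \<notin> C" and dl: "dlink C {z}"
  shows realizable
proof -
  interpret A: sym_pair ty X0 g A by (rule A_pair)
  have Bi: "B i = C" for i using B_inv[OF gC] .
  have not_cent: "\<not> mobile x \<Longrightarrow> ty = Swap" if x: "x \<in> X0" "x \<notin> C" for x
  proof -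
    assume nm: "\<not> mobile x"
    then have gx: "g x = x" "1 < n" using not_mobile x X0_sub by blast+
    have "\<not> central ty"
    proof
      assume ce: "central ty"
      have "(g ^^ (n div 2)) ` C \<subseteq> C" using Bi by (simp add: B_def)
      then obtain y where "y \<in> C" "g y = y" using central_fixed_point[OF ce C_sub C_tight] by blast
      then show False using one_fixed[OF ce _ _ gx(1)] x C_sub X0_sub by blast
    qed
    then show "ty = Swap" using gx(2) by (cases ty) (auto simp: central_def)
  qed
  have out: "(g ^^ j) x \<notin> C" if "x \<in> X0" "x \<notin> C" for j x
    using B_pow_iff[of x j 0] Bi that by simp
  have w3z: "w3 \<in> orbit z"
  proof (rule ccontr)
    assume no: "w3 \<notin> orbit z"
    have zX: "z \<in> X" using z X0_sub by blast
    have d1: "deg (F d) z \<le> 1" for d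
    proof -
      obtain a where a: "\<And>y. {z, y} \<in> F' d \<Longrightarrow> y = a" using invariant_dlink(2)[OF gC z dl] by blast
      have "e = {z, a}" if e: "e \<in> F d" "z \<in> e" for e
      proof -
        obtain y where y: "e = {z, y}" using card2D[OF _ e(2)] edge[OF e(1)] by blast
        have yX: "y \<in> X" using edgeD[of z y d] e y by simp
        show ?thesis
        proof (cases "y \<in> X0")
          case True
          then have "e \<in> A d" using e y z by (simp add: A_def restr_def edges_in_def)
          then show ?thesis using a A_sub_F' y by blast
        next
          case False
          then obtain i where i: "i < n" "y = (g ^^ i) v" using yX by (auto simp: X0_def orbit_def)
          then have "{(g ^^ i) v, z} \<in> F d" using e y by (simp add: insert_commute)
          then obtain w where w: "w \<in> {w1, w2, w3}" "z = (g ^^ i) w" using orbit_v_edge i by blast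
          have "w \<noteq> w1 \<and> w \<noteq> w2"
          proof -
            have "(g ^^ i) w1 \<in> C" "(g ^^ i) w2 \<in> C" using w_C Bi[of i] by (auto simp: B_def)
            then show ?thesis using w z by auto
          qed
          then have "w3 = w" using w by blast
          then have "(g ^^ i) w3 \<in> orbit z" using w orbit_self by simp
          then show ?thesis using no orbit_pow_iff[OF zX w_inX(3)] by simp
        qed
      qed
      then have "{e \<in> F d. z \<in> e} \<subseteq> {{z, a}}" by blast
      then have "card {e \<in> F d. z \<in> e} \<le> card {{z, a}}" by (intro card_mono) auto
      then show ?thesis by (simp add: deg_def)
    qed
    show False
    proof (cases "mobile z")
      case True
      then show False using min_deg[OF zX True] d1[of True] d1[of False] by simp
    next
      case False
      then show False using fixed_deg[OF not_cent[OF z False] zX False] d1[of True] by simp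
    qed
  qed
  obtain i where i: "w3 = (g ^^ i) z" using w3z by (auto simp: orbit_def)
  have w3C: "w3 \<notin> C" using out[OF z] i by simp
  have "dlink ((g ^^ i) ` C) ((g ^^ i) ` {z})" using dlink_shift[OF dl C_sub] z by simp
  then have dl3: "dlink C {w3}" using Bi[of i] i by (simp add: B_def)
  note str = invariant_dlink[OF gC w_in(3) w3C dl3]
  obtain a where a: "\<And>d. a d \<in> C" "\<And>d. {w3, a d} \<in> F' d" "\<And>d y. {w3, y} \<in> F' d \<Longrightarrow> y = a d"
    using str(2) by metis
  have at: "a True \<noteq> a False" using two_links_distinct[OF a(2)[of True] a(2)[of False]] Bi w3C by simp
  have X0C: "X0 - orbit w3 = C"
    using str(1) out[OF w_in(3) w3C] by (auto simp: orbit_def)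
  have gC': "g y \<in> C" if "y \<in> C" for y using gC that by blast
  obtain r where r: "realizes ty C g (restr A C) r"
    using IH[OF card_C A_sub_pair[OF C_sub gC'] restr_dis(2)] by blast
  \<comment> \<open>Any point of the box is bounded by \<open>M\<close> in both coordinates.\<close>
  define M where "M = \<bar>fst (r w1)\<bar> + \<bar>fst (r w2)\<bar> + \<bar>snd (r w1)\<bar> + \<bar>snd (r w2)\<bar>"
  have "\<exists>p. realizes ty X0 g A p \<and> (M < \<bar>fst (p w3)\<bar> \<or> M < \<bar>snd (p w3)\<bar>) \<and> (\<forall>x\<in>C. p x = r x)"
  proof (cases "mobile w3")
    case True
    let ?S = "{P::point. M < \<bar>fst P\<bar>} \<union> {P. M < \<bar>snd P\<bar>}"
    have "r (a True) \<noteq> r (a False)" using r a at by (auto simp: realizes_def inj_on_def)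
    then obtain P where P: "rel True P (r (a True))" "rel False P (r (a False))" "P \<in> ?S"
      using place_11[of "r (a True)" "r (a False)" True M] by auto
    have oS: "open ?S" by (intro open_Un open_Collect_less continuous_intros)
    have "\<exists>p. realizes ty X0 g A p \<and> p w3 \<in> ?S \<and> (\<forall>x\<in>X0 - orbit w3. p x = r x)"
    proof (rule A.extend[OF w_in(3) True _ oS P(3)])
      show "realizes ty (X0 - orbit w3) g (restr A (X0 - orbit w3)) r" using r X0C by simp
      show "rel d P (r w)" if "{w3, w} \<in> A d" for d w
      proof -
        have "w = a d" using that A_sub_F' a(3) by blast
        then show ?thesis using P by (cases d) auto
      qed
      show "rel d P ((ac ^^ j) P)" if "{w3, (g ^^ j) w3} \<in> A d" for d j
      proof -
        have "(g ^^ j) w3 = a d" using that A_sub_F' a(3) by blast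
        then show ?thesis using a(1)[of d] out[OF w_in(3) w3C, of j] by simp
      qed
    qed
    then show ?thesis using X0C by auto
  next
    case False
    have sw: "ty = Swap" using not_cent[OF w_in(3) w3C False] .
    have "orbit w3 = {w3}" using orbit_fixed w_inX False by blast
    then have X0': "X0 - {w3} = C" using X0C by simp
    have "{e \<in> A True. w3 \<in> e} \<subseteq> {{w3, a True}}"
    proof
      fix e assume e: "e \<in> {e \<in> A True. w3 \<in> e}"
      then obtain y where "e = {w3, y}" using card2D[of e w3] A.edge[of e True] by blast
      then show "e \<in> {{w3, a True}}" using e A_sub_F' a(3) by blast
    qed
    then have "card {e \<in> A True. w3 \<in> e} \<le> card {{w3, a True}}" by (intro card_mono) auto
    then have "deg (A True) w3 \<le> 1" by (simp add: deg_def)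
    then have "\<exists>p. realizes ty X0 g A p \<and> M < \<bar>fst (p w3)\<bar> \<and> (\<forall>x\<in>X0 - {w3}. p x = r x)"
      using A.extend_fixed[OF w_in(3) False sw A_dis _ ] r X0' by simp
    then show ?thesis using X0' by auto
  qed
  then obtain p where p: "realizes ty X0 g A p" "M < \<bar>fst (p w3)\<bar> \<or> M < \<bar>snd (p w3)\<bar>" "\<And>x. x \<in> C \<Longrightarrow> p x = r x"
    by blast
  have "\<not> in_box (p w1) (p w2) (p w3)"
  proof
    assume "in_box (p w1) (p w2) (p w3)"
    then show False
      using in_box_bound[of "p w1" "p w2" "p w3"] p(2) unfolding M_def p(3)[OF w_C(1)] p(3)[OF w_C(2)] by linarith
  qed
  then show ?thesis using finish_box p by blast
qed

text \<open>
  If \<open>w3\<close> belongs to the cluster, then all neighbours of \<open>v\<close> do, and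
  \<open>v\<close> is drawn together with the cluster; otherwise \<open>v\<close> is added
  afterwards.
\<close>

definition "K = (if w3 \<in> C then insert v C else C)"

lemma K_sub: "K \<subseteq> X" using C_subX v by (auto simp: K_def)
lemma C_K: "C \<subseteq> K" by (auto simp: K_def)
lemma B_K: "B i \<subseteq> (g ^^ i) ` K" using C_K unfolding B_def by blast

lemma K_apart:
  assumes "apart C"
  shows "apart K"
proof (cases "w3 \<in> C")
  case True
  have "(g ^^ j) ` insert v C \<inter> insert v C = {}" if j: "0 < j" "j < n" for j
  proof -
    have "(g ^^ j) v \<notin> C" using v_notin C_sub by blast
    moreover have "(g ^^ j) v \<noteq> v" using v(2) j by (simp add: mobile_def)
    moreover have "v \<notin> (g ^^ j) ` C" using v_notin[of 0] B_sub[of j] by (auto simp: B_def)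
    moreover have "(g ^^ j) ` C \<inter> C = {}" using assms j by (simp add: apart_def)
    ultimately show ?thesis by auto
  qed
  then show ?thesis using True by (simp add: apart_def K_def)
qed (use assms in \<open>simp add: K_def\<close>)

text \<open>
  A drawing of the cluster inside a slab is copied to its images. The remaining vertex, if there
  is one, goes to the origin. If \<open>v\<close> is not yet drawn, then \<open>w3\<close> lies
  outside the slab, hence outside the box of \<open>w1\<close> and \<open>w2\<close>, and there
  is room for \<open>v\<close>.
\<close>

lemma spread_finish:
  assumes ap: "apart C" and r: "realizes Id K id (restr F K) r" "r ` K \<subseteq> slab \<sigma> L" "\<bar>\<sigma>\<bar> = 1" "0 \<le> L"
    and cov: "\<And>x y. x \<in> X0 \<Longrightarrow> y \<in> X0 \<Longrightarrow> \<forall>i<n. x \<notin> B i \<Longrightarrow> \<forall>i<n. y \<notin> B i \<Longrightarrow> x = y"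
    and edges: "\<And>d x y. {x, y} \<in> A d \<Longrightarrow>
        (\<exists>i<n. x \<in> B i \<and> y \<in> B i) \<or> rel d (spread K r x) (spread K r y)"
  shows realizable
proof -
  note Kap = K_apart[OF ap]
  let ?p = "spread K r"
  have inj_r: "inj_on r K" using r by (simp add: realizes_def)
  have zero: "?p x = 0" if "x \<in> X0" "\<forall>i<n. x \<notin> B i" for x
  proof -
    have "x \<notin> (g ^^ i) ` K" if "i < n" for i
    proof -
      have "x \<noteq> (g ^^ i) v" using v_notin \<open>x \<in> X0\<close> by metis
      then show ?thesis using \<open>\<forall>i<n. x \<notin> B i\<close> that by (auto simp: K_def B_def)
    qed
    then have "\<not> (\<exists>i<n. x \<in> (g ^^ i) ` K)" by blast
    then show ?thesis unfolding spread_def by (simp only: if_False)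
  qed
  have inj: "x = y" if "x \<in> Y" "y \<in> Y" "?p x = ?p y" and Y: "Y \<subseteq> X0 \<union> (\<Union>i<n. (g ^^ i) ` K)" for x y Y
  proof -
    have *: "(x \<in> X0 \<and> (\<forall>i<n. x \<notin> B i)) \<or> (\<exists>i<n. x \<in> (g ^^ i) ` K)" if "x \<in> Y" for x
      using that Y B_K by blast
    have "x = y" if "\<exists>i<n. x \<in> (g ^^ i) ` K" "\<exists>i<n. y \<in> (g ^^ i) ` K"
      using that spread_slab(3)[OF K_sub Kap inj_r r(2-4)] \<open>?p x = ?p y\<close> by blast
    moreover have False if "\<exists>i<n. x \<in> (g ^^ i) ` K" "?p x = 0" for x
      using that spread_slab(1)[OF K_sub Kap inj_r r(2-4)] by blast
    ultimately show ?thesis using *[OF \<open>x \<in> Y\<close>] *[OF \<open>y \<in> Y\<close>] zero cov \<open>?p x = ?p y\<close> by metis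
  qed
  have edgeA: "rel d (?p x) (?p y)" if e: "{x, y} \<in> A d" for d x y
    using edges[OF e]
  proof
    assume "\<exists>i<n. x \<in> B i \<and> y \<in> B i"
    then show ?thesis using spread_edge[OF K_sub Kap r(1), of x y d] A_sub B_K e by blast
  qed
  show ?thesis
  proof (cases "w3 \<in> C")
    case True
    have K: "K = insert v C" using True by (simp add: K_def)
    have "realizes ty X g F ?p"
      unfolding realizes_def
    proof (intro conjI allI ballI impI)
      have "orbit v \<subseteq> (\<Union>i<n. (g ^^ i) ` K)" by (auto simp: orbit_def K)
      then have "X \<subseteq> X0 \<union> (\<Union>i<n. (g ^^ i) ` K)" by (auto simp: X0_def)
      then show "inj_on ?p X" using inj[of _ X] by (intro inj_onI)
      show "?p (g x) = ac (?p x)" if "x \<in> X" for x using spread_g[OF K_sub Kap that] .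
      have O: "rel d (?p x) (?p y)" if e: "{x, y} \<in> F d" and x: "x \<in> orbit v" for d x y
      proof -
        obtain i where i: "i < n" "x = (g ^^ i) v" using x by (auto simp: orbit_def)
        then obtain w where "w \<in> {w1, w2, w3}" "y = (g ^^ i) w" using orbit_v_edge[of i y d] e by blast
        then have "x \<in> (g ^^ i) ` K" "y \<in> (g ^^ i) ` K" using i w_C True K by auto
        then show ?thesis using spread_edge[OF K_sub Kap r(1) e _ _ i(1)] by blast
      qed
      show "rel d (?p x) (?p y)" if e: "{x, y} \<in> F d" for d x y
      proof (cases "x \<in> orbit v \<or> y \<in> orbit v")
        case True
        then show ?thesis using O[OF e] O[of y x d] e rel_sym by (metis insert_commute)
      next
        case False
        then have "{x, y} \<in> A d" using edgeD[OF e] e by (simp add: A_def X0_def restr_def edges_in_def)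
        then show ?thesis by (rule edgeA)
      qed
    qed
    then show ?thesis by blast
  next
    case False
    have K: "K = C" using False by (simp add: K_def)
    have p: "realizes ty X0 g A ?p"
      unfolding realizes_def
    proof (intro conjI allI ballI impI)
      show "inj_on ?p X0" using inj[of _ X0] by (intro inj_onI) blast
      show "?p (g x) = ac (?p x)" if "x \<in> X0" for x using spread_g[OF K_sub Kap] that X0_sub by blast
    qed (rule edgeA)
    have sl: "?p w \<in> slab \<sigma> L" if "w \<in> C" for w
      using spread_on[OF K_sub Kap, of w 0 r] that K r(2) by auto
    have "?p w3 \<notin> slab \<sigma> L"
    proof (cases "\<exists>i<n. w3 \<in> B i")
      case True
      then obtain i where i: "i < n" "w3 \<in> B i" by blast
      then have "0 < i" using False by (cases i) auto
      then show ?thesis using spread_slab(2)[OF K_sub Kap inj_r r(2-4), of w3 i] i B_K by blast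
    next
      case False
      then have "?p w3 = 0" using zero w_in by blast
      then show ?thesis using r(4) by (simp add: slab_def)
    qed
    then have "\<not> in_box (?p w1) (?p w2) (?p w3)"
      using slab_box[OF sl[OF w_C(1)] sl[OF w_C(2)] _ r(3)] by blast
    then show ?thesis using finish_box[OF p] by blast
  qed
qed

lemma obtain_K:
  assumes ap: "apart C" "1 < n" and ab: "a \<in> C" "b \<in> C" "a \<noteq> b"
  obtains r R where "realizes Id K id (restr F K) r" "fst (r a) \<noteq> fst (r b)" "0 < R"
    "\<And>u. u \<in> K \<Longrightarrow> \<bar>fst (r u)\<bar> < R \<and> \<bar>snd (r u)\<bar> < R"
proof -
  have "g v \<notin> K"
  proof -
    have "g v \<noteq> v" using v(2) ap(2) by (auto simp: mobile_def dest: spec[of _ 1])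
    moreover have "g v \<notin> C" using v_notin[of 1] C_sub by auto
    ultimately show ?thesis by (simp add: K_def)
  qed
  then have "card K < card X"
    using K_sub g_in[OF v(1)] finite_X by (intro psubset_card_mono) auto
  then obtain r0 where "realizes Id K id (restr F K) r0"
    using IH[OF _ sub_pair_Id[OF K_sub] restr_dis(1)] by blast
  then obtain r where r: "realizes Id K id (restr F K) r" "fst (r a) \<noteq> fst (r b)"
    using perturb_Id[OF K_sub _ _ _ ab(3)] ab C_K by blast
  define R where "R = Max (insert 0 ((\<lambda>u. \<bar>fst (r u)\<bar> + \<bar>snd (r u)\<bar>) ` K)) + 1"
  have fK: "finite K" using K_sub finite_X finite_subset by blast
  have R0: "0 < R"
  proof -
    have "0 \<le> R - 1" unfolding R_def using fK by simp
    then show ?thesis by simp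
  qed
  have "\<bar>fst (r u)\<bar> < R \<and> \<bar>snd (r u)\<bar> < R" if "u \<in> K" for u
  proof -
    have "\<bar>fst (r u)\<bar> + \<bar>snd (r u)\<bar> \<le> R - 1" unfolding R_def using fK that by simp
    then show ?thesis by linarith
  qed
  then show ?thesis using that r R0 by blast
qed

text \<open>
  The cluster is drawn without symmetry, the fixed vertex is placed at a point \<open>Q\<close>
  far above or below it in the right position to its two neighbours, and the origin is moved to
  \<open>Q\<close> before the drawing is copied.
\<close>

lemma case_apart_point:
  assumes ap: "apart C" "1 < n" and z: "z \<in> X0" "\<forall>i. z \<notin> B i" and dl: "dlink C {z}"
  shows realizable
proof -
  note str = apart_dlink_point[OF ap z dl]
  from str(3) obtain a where a0: "\<forall>d. a d \<in> C \<and> {z, a d} \<in> F' d"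
    and a1: "\<forall>d e. e \<in> F' d \<longrightarrow> (\<exists>i<n. e \<subseteq> B i) \<or> (\<exists>i<n. e = (g ^^ i) ` {z, a (colour d i)})"
    by (elim exE conjE)
  have a: "a d \<in> C" "{z, a d} \<in> F' d" for d using a0 by auto
  have at: "a True \<noteq> a False" using two_links_distinct[OF a(2)[of True] a(2)[of False] z(2)] .
  obtain r R where r: "realizes Id K id (restr F K) r" "fst (r (a True)) \<noteq> fst (r (a False))" "0 < R"
    "\<And>u. u \<in> K \<Longrightarrow> \<bar>fst (r u)\<bar> < R \<and> \<bar>snd (r u)\<bar> < R"
    using obtain_K[OF ap a(1)[of True] a(1)[of False] at] by blast
  obtain Q where Q: "rel True Q (r (a True))" "rel False Q (r (a False))" "3 * R < \<bar>snd Q\<bar>"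
    "\<bar>fst Q\<bar> \<le> max \<bar>fst (r (a True))\<bar> \<bar>fst (r (a False))\<bar>"
    using place_11_tall[OF r(2), of True "3 * R"] by auto
  have Qf: "\<bar>fst Q\<bar> < R" using Q(4) r(4)[of "a True"] r(4)[of "a False"] a(1) C_K by fastforce
  \<comment> \<open>After the translation by \<open>- Q\<close> the cluster lies on the side of the axis opposite to \<open>Q\<close>.\<close>
  define \<sigma> :: real where "\<sigma> = (if 0 < snd Q then -1 else 1)"
  define r' where "r' = (\<lambda>u. r u + (- Q))"
  have r': "realizes Id K id (restr F K) r'" unfolding r'_def by (rule realizes_shift_Id[OF r(1)])
  have sl: "r' ` K \<subseteq> slab \<sigma> (2 * R)"
  proof
    fix P assume "P \<in> r' ` K"
    then obtain u where u: "u \<in> K" "P = r u + (- Q)" by (auto simp: r'_def)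
    then show "P \<in> slab \<sigma> (2 * R)" using r(4)[OF u(1)] Qf Q(3) unfolding slab_def \<sigma>_def by auto
  qed
  have pz: "(g ^^ i) z = z" for i using str(1) by (induction i) auto
  have z0: "spread K r' z = 0"
  proof -
    have "z \<notin> (g ^^ i) ` K" for i
    proof -
      have "z \<noteq> (g ^^ i) v" using v_notin z by metis
      then show ?thesis using z by (auto simp: K_def B_def)
    qed
    then have "\<not> (\<exists>i<n. z \<in> (g ^^ i) ` K)" by blast
    then show ?thesis unfolding spread_def by (simp only: if_False)
  qed
  show ?thesis
  proof (rule spread_finish[OF ap(1) r' sl])
    show "\<bar>\<sigma>\<bar> = 1" by (simp add: \<sigma>_def)
    show "0 \<le> 2 * R" using r(3) by simp
    show "x = y" if "x \<in> X0" "y \<in> X0" "\<forall>i<n. x \<notin> B i" "\<forall>i<n. y \<notin> B i" for x y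
    proof -
      have "w = z" if w: "w \<in> X0" "\<forall>i<n. w \<notin> B i" for w
      proof -
        have "w \<in> insert z (\<Union>i<n. B i)" using w(1) unfolding str(2)[symmetric] .
        then show ?thesis using w(2) by auto
      qed
      then show ?thesis using that by metis
    qed
    show "(\<exists>i<n. x \<in> B i \<and> y \<in> B i) \<or> rel d (spread K r' x) (spread K r' y)" if e: "{x, y} \<in> A d" for d x y
    proof -
      have "{x, y} \<in> F' d" using e A_sub_F' by blast
      then consider "\<exists>i<n. {x, y} \<subseteq> B i" | i where "i < n" "{x, y} = (g ^^ i) ` {z, a (colour d i)}"
        using a1 by blast
      then show ?thesis
      proof cases
        case 2
        let ?d = "colour d i"
        have "rel ?d Q (r (a ?d))" using Q by (cases ?d) auto
        then have "rel ?d (Q + (- Q)) (r (a ?d) + (- Q))" by (simp only: rel_shift)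
        then have "rel ?d 0 (r' (a ?d))" by (simp add: r'_def)
        then have "rel (colour ?d i) ((ac ^^ i) 0) ((ac ^^ i) (r' (a ?d)))" by (simp only: rel_act_pow)
        then have "rel d 0 ((ac ^^ i) (r' (a ?d)))" by simp
        moreover have "spread K r' ((g ^^ i) (a ?d)) = (ac ^^ i) (r' (a ?d))"
          using spread_on[OF K_sub K_apart[OF ap(1)], of "a ?d" i r'] a(1) C_K 2(1) by blast
        ultimately have R: "rel d (spread K r' z) (spread K r' ((g ^^ i) (a ?d)))" using z0 by simp
        have "x = z \<and> y = (g ^^ i) (a ?d) \<or> y = z \<and> x = (g ^^ i) (a ?d)"
          using 2(2) pz[of i] by (auto simp: doubleton_eq_iff)
        then show ?thesis using R rel_sym by metis
      qed blast
    qed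
  qed
qed

text \<open>
  The single edge between \<open>C\<close> and its mirror image joins \<open>a\<close> to the
  image of \<open>b\<close>. If the cluster is far from the axis, the order type of this pair
  depends only on the order of the first coordinates of \<open>a\<close> and \<open>b\<close>
  and on the side of the axis, which is chosen accordingly.
\<close>

lemma case_apart_block:
  assumes ap: "apart C" "1 < n" and k: "0 < k" "k < n" and dl: "dlink C (B k)"
  shows realizable
proof -
  note str = apart_dlink_block[OF ap k dl]
  from str(3) obtain a b where ab: "a \<in> C" "b \<in> C" "a \<noteq> b"
    and ab_True: "\<forall>e. e \<in> F' True \<longrightarrow> (\<exists>i<n. e \<subseteq> B i) \<or> e = {a, g b}"
    and ab_False: "\<forall>e. e \<in> F' False \<longrightarrow> (\<exists>i<n. e \<subseteq> B i) \<or> e = {g a, b}"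
    by (elim bexE conjE)
  obtain r R where r: "realizes Id K id (restr F K) r" "fst (r a) \<noteq> fst (r b)" "0 < R"
    "\<And>u. u \<in> K \<Longrightarrow> \<bar>fst (r u)\<bar> < R \<and> \<bar>snd (r u)\<bar> < R"
    using obtain_K[OF ap ab] by blast
  define \<sigma> :: real where "\<sigma> = (if fst (r b) < fst (r a) then 1 else -1)"
  define r' where "r' = (\<lambda>u. r u + (0, 3 * R * \<sigma>))"
  have r': "realizes Id K id (restr F K) r'" unfolding r'_def by (rule realizes_shift_Id[OF r(1)])
  have sl: "r' ` K \<subseteq> slab \<sigma> R"
  proof
    fix P assume "P \<in> r' ` K"
    then obtain u where u: "u \<in> K" "P = r u + (0, 3 * R * \<sigma>)" by (auto simp: r'_def)
    then show "P \<in> slab \<sigma> R" using r(4)[OF u(1)] r(3) unfolding slab_def \<sigma>_def by auto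
  qed
  have n2: "n = 2" using str(1) by simp
  let ?p = "spread K r'"
  have on: "?p u = r' u" "?p (g u) = act Swap (r' u)" if "u \<in> C" for u
    using spread_on[OF K_sub K_apart[OF ap(1)], of u 0 r'] spread_on[OF K_sub K_apart[OF ap(1)], of u 1 r']
      that C_K n2 str(1) by auto
  have bd: "\<bar>snd (r a)\<bar> < R" "\<bar>snd (r b)\<bar> < R" using r(4) ab C_K by blast+
  have E: "rel True (?p a) (?p (g b))" "rel False (?p (g a)) (?p b)"
    using on[OF ab(1)] on[OF ab(2)] bd r(2,3) by (auto simp: rel_cases r'_def \<sigma>_def)
  show ?thesis
  proof (rule spread_finish[OF ap(1) r' sl])
    show "\<bar>\<sigma>\<bar> = 1" by (simp add: \<sigma>_def)
    show "0 \<le> R" using r(3) by simp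
    show "x = y" if "x \<in> X0" "y \<in> X0" "\<forall>i<n. x \<notin> B i" "\<forall>i<n. y \<notin> B i" for x y
    proof -
      have "x \<in> B 0 \<or> x \<in> B 1" using that(1) str(2) by (auto simp: B_def)
      then show ?thesis using that(3)[rule_format, of 0] that(3)[rule_format, of 1] n2 by auto
    qed
    show "(\<exists>i<n. x \<in> B i \<and> y \<in> B i) \<or> rel d (?p x) (?p y)" if e: "{x, y} \<in> A d" for d x y
    proof -
      have e': "{x, y} \<in> F' d" using e A_sub_F' by blast
      show ?thesis
      proof (cases d)
        case True
        then have "(\<exists>i<n. {x, y} \<subseteq> B i) \<or> {x, y} = {a, g b}" using ab_True[rule_format, of "{x, y}"] e' by simp
        then show ?thesis
        proof
          assume "{x, y} = {a, g b}"
          then have "x = a \<and> y = g b \<or> x = g b \<and> y = a" by (simp add: doubleton_eq_iff)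
          then show ?thesis using E(1) rel_sym[of True "?p (g b)" "?p a"] True by metis
        qed blast
      next
        case False
        then have "(\<exists>i<n. {x, y} \<subseteq> B i) \<or> {x, y} = {g a, b}" using ab_False[rule_format, of "{x, y}"] e' by simp
        then show ?thesis
        proof
          assume "{x, y} = {g a, b}"
          then have "x = g a \<and> y = b \<or> x = b \<and> y = g a" by (simp add: doubleton_eq_iff)
          then show ?thesis using E(2) rel_sym[of False "?p b" "?p (g a)"] False by metis
        qed blast
      qed
    qed
  qed
qed


section \<open>Contracting the clusters\<close>

text \<open>
  The cluster and its images become points: \<open>q\<close> chooses a representative in each
  class, \<open>G\<close> is the induced permutation, and \<open>F2\<close> the induced pair of
  edge sets.
\<close>

definition "sim x y \<longleftrightarrow> x = y \<or> (\<exists>i. x \<in> B i \<and> y \<in> B i)"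
definition "q x = (SOME y. y \<in> X0 \<and> sim x y)"
definition "G x = q (g x)"
definition "F2 d = {q ` e | e. e \<in> F' d \<and> card (q ` e) = 2}"

lemma sim_refl [simp]: "sim x x" by (simp add: sim_def)
lemma sim_sym: "sim x y \<longleftrightarrow> sim y x" by (auto simp: sim_def)

lemma sim_B:
  assumes "sim x y" "x \<in> B i"
  shows "y \<in> B i"
proof (cases "x = y")
  case False
  then obtain j where j: "x \<in> B j" "y \<in> B j" using assms(1) by (auto simp: sim_def)
  then have "B j = B i" using B_meet[of j i] assms(2) by blast
  then show ?thesis using j by simp
qed (use assms in simp)

lemma sim_trans:
  assumes "sim x y" "sim y z"
  shows "sim x z"
proof (cases "y = z")
  case False
  then obtain i where i: "y \<in> B i" "z \<in> B i" using assms(2) by (auto simp: sim_def)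
  have "sim y x" using assms(1) by (simp add: sim_sym)
  then have "x \<in> B i" using sim_B i by blast
  then show ?thesis using i unfolding sim_def by blast
qed (use assms in simp)

lemma q_spec:
  assumes "x \<in> X0"
  shows "q x \<in> X0 \<and> sim x (q x)"
  unfolding q_def by (rule someI[of _ x]) (simp add: assms)

lemma q_in: "x \<in> X0 \<Longrightarrow> q x \<in> X0" and sim_q: "x \<in> X0 \<Longrightarrow> sim x (q x)"
  using q_spec by blast+

lemma q_eq:
  assumes "x \<in> X0" "y \<in> X0"
  shows "q x = q y \<longleftrightarrow> sim x y"
proof
  assume "q x = q y"
  then show "sim x y" using sim_q[OF assms(1)] sim_q[OF assms(2)] sim_trans sim_sym by metis
next
  assume s: "sim x y"
  have "sim x z \<longleftrightarrow> sim y z" for z using s sim_trans sim_sym by metis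
  then show "q x = q y" by (simp add: q_def)
qed

lemma sim_g:
  assumes "x \<in> X0" "y \<in> X0"
  shows "sim (g x) (g y) \<longleftrightarrow> sim x y"
proof
  assume s: "sim (g x) (g y)"
  show "sim x y"
  proof (cases "g x = g y")
    case True
    then have "x = y" using R.pow_inj[of 1] assms by (auto simp: inj_on_def)
    then show ?thesis by simp
  next
    case False
    then obtain i where i: "g x \<in> B i" "g y \<in> B i" using s by (auto simp: sim_def)
    have "B i = B (1 + (i + (n - 1)))"
    proof -
      have eq: "1 + (i + (n - 1)) = i + n" using period_pos[of ty] by linarith
      show ?thesis unfolding eq using B_mod[of "i + n"] B_mod[of i] by simp
    qed
    then have "x \<in> B (i + (n - 1))" "y \<in> B (i + (n - 1))"
      using i B_pow_iff[OF assms(1), of 1] B_pow_iff[OF assms(2), of 1] by auto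
    then show ?thesis by (auto simp: sim_def)
  qed
next
  assume s: "sim x y"
  show "sim (g x) (g y)"
  proof (cases "x = y")
    case False
    then obtain i where "x \<in> B i" "y \<in> B i" using s by (auto simp: sim_def)
    then have "g x \<in> B (Suc i)" "g y \<in> B (Suc i)" using B_Suc[of i] by blast+
    then show ?thesis unfolding sim_def by blast
  qed simp
qed

lemma G_q: "x \<in> X0 \<Longrightarrow> G (q x) = q (g x)"
  unfolding G_def using q_eq[of "g (q x)" "g x"] sim_g[of "q x" x] sim_q sim_sym q_in g_X0 by blast

lemma G_pow_q: "x \<in> X0 \<Longrightarrow> (G ^^ i) (q x) = q ((g ^^ i) x)"
  using pow_X0 by (induction i) (simp_all add: G_q)

lemma fibre_B: "x \<in> B i \<Longrightarrow> {y \<in> X0. q y = q x} = B i"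
proof -
  assume x: "x \<in> B i"
  have xX: "x \<in> X0" using x B_sub by blast
  have "y \<in> B i" if "y \<in> X0" "q y = q x" for y
    using q_eq[OF xX that(1)] that x sim_B by metis
  moreover have "q y = q x" "y \<in> X0" if "y \<in> B i" for y
  proof -
    show "y \<in> X0" using that B_sub by blast
    then show "q y = q x" using q_eq[OF _ xX] x that by (auto simp: sim_def)
  qed
  ultimately show ?thesis by blast
qed

lemma fibre_point: "x \<in> X0 \<Longrightarrow> \<forall>i. x \<notin> B i \<Longrightarrow> {y \<in> X0. q y = q x} = {x}"
  using q_eq[of _ x] unfolding sim_def by auto

lemma fibre_tight: "x \<in> X0 \<Longrightarrow> tight (F' d) {y \<in> X0. q y = q x}"
proof (cases "\<exists>i. x \<in> B i")
  case True
  then show ?thesis using fibre_B B_tight by auto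
next
  case False
  assume "x \<in> X0"
  then show ?thesis using fibre_point False tight_singleton[OF R.no_empty_edge] by simp
qed

lemma sim_move:
  assumes x: "x \<in> X0" and j: "0 < j" "j < n" and s: "sim ((g ^^ j) x) x"
  shows "(g ^^ j) x = x \<or> (g ` C = C \<and> x \<in> C)"
proof (rule ccontr)
  assume no: "\<not> ?thesis"
  then obtain i where i: "(g ^^ j) x \<in> B i" "x \<in> B i" using s by (auto simp: sim_def)
  have "(g ^^ j) x \<in> B (j + i)" using B_pow_iff[OF x] i by blast
  then have "B (j + i) = B i" using i B_meet by blast
  then have eq: "B ((j + i) mod n) = B (i mod n)" using B_mod by metis
  have "B (i mod n) \<noteq> {}" using w_C by (auto simp: B_def)
  moreover have "(j + i) mod n \<noteq> i mod n"
  proof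
    assume "(j + i) mod n = i mod n"
    then have "n dvd (j + i - i)" by (metis le_add2 mod_eq_dvd_iff_nat)
    then show False using j by (auto dest: dvd_imp_le)
  qed
  ultimately have "\<not> apart C"
    using eq B_apart[of "(j + i) mod n" "i mod n"] by auto
  then have "g ` C = C" using C_cases by blast
  then show False using no i B_inv by auto
qed

lemma quotient_edge:
  assumes "e \<in> F' d" "card (q ` e) = 2"
  obtains a b where "e = {a, b}" "a \<in> X0" "b \<in> X0" "q a \<noteq> q b"
proof -
  obtain a b where ab: "e = {a, b}" "a \<noteq> b" using R.edge[OF assms(1)] by (auto simp: card_2_iff)
  have "q a \<noteq> q b" using assms(2) ab by auto
  then show ?thesis using ab R.edge[OF assms(1)] that by blast
qed

text \<open>
  All fibres are tight, so sparsity is inherited. The conditions on fixed vertices and diameters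
  could only fail at the contracted clusters; there the parity argument provides a fixed vertex
  inside an invariant cluster.
\<close>

lemma contraction_pair: "sym_pair ty (q ` X0) G F2"
proof
  show "finite (q ` X0)" using finite_X0 by blast
  show "G y \<in> q ` X0" if "y \<in> q ` X0" for y using that G_q g_X0 by auto
  show "(G ^^ n) y = y" if "y \<in> q ` X0" for y using that G_pow_q R.g_period by auto
  show "e \<subseteq> q ` X0 \<and> card e = 2" if "e \<in> F2 d" for e d
    using that R.edge unfolding F2_def by blast
  show "sparse (q ` X0) (F2 d)" for d
    unfolding F2_def using R.edge fibre_tight by (intro sparse_contract[OF R.sparse_F finite_X0]) auto
  show "G ` f \<in> F2 (d \<noteq> swaps_colours ty)" if f: "f \<in> F2 d" for f d
  proof -
    obtain e where e: "f = q ` e" "e \<in> F' d" "card (q ` e) = 2" using f by (auto simp: F2_def)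
    obtain a b where ab: "e = {a, b}" "a \<in> X0" "b \<in> X0" "q a \<noteq> q b" using quotient_edge[OF e(2,3)] .
    have "G ` f = q ` g ` e" using e ab G_q by auto
    moreover have "q (g a) \<noteq> q (g b)" using ab q_eq g_X0 sim_g by simp
    then have "card (q ` g ` e) = 2" using ab by auto
    ultimately show ?thesis using R.edge_g[OF e(2)] unfolding F2_def by blast
  qed
  show "G y = y" if y: "y \<in> q ` X0" "0 < j" "j < n" "(G ^^ j) y = y" for y j
  proof -
    obtain x where x: "x \<in> X0" "y = q x" using y by blast
    have "q ((g ^^ j) x) = q x" using y x G_pow_q by simp
    then have s: "sim ((g ^^ j) x) x" using q_eq pow_X0 x by blast
    have "sim (g x) x"
      using sim_move[OF x(1) y(2,3) s]
    proof
      assume "(g ^^ j) x = x"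
      then show ?thesis using R.free[OF x(1) y(2,3)] by simp
    next
      assume "g ` C = C \<and> x \<in> C"
      then have "g x \<in> B 0" "x \<in> B 0" by auto
      then show ?thesis unfolding sim_def by blast
    qed
    then show ?thesis using x G_q q_eq g_X0 by simp
  qed
  show "y = z" if ce: "central ty" and y: "y \<in> q ` X0" "z \<in> q ` X0" "G y = y" "G z = z" for y z
  proof -
    obtain x u where x: "x \<in> X0" "y = q x" "u \<in> X0" "z = q u" using y by blast
    have n1: "1 < n" using ce by (cases ty) (auto simp: central_def)
    have "sim ((g ^^ 1) x) x" "sim ((g ^^ 1) u) u" using y x G_q q_eq g_X0 by auto
    then have *: "g x = x \<or> (g ` C = C \<and> x \<in> C)" "g u = u \<or> (g ` C = C \<and> u \<in> C)"
      using sim_move[OF x(1) _ n1] sim_move[OF x(3) _ n1] by auto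
    have fixC: "w \<in> C" if "g ` C = C" "g w = w" "w \<in> X0" for w
    proof -
      have "(g ^^ (n div 2)) ` C \<subseteq> C" using B_inv[OF that(1)] by (simp add: B_def)
      then obtain v0 where "v0 \<in> C" "g v0 = v0" using central_fixed_point[OF ce C_sub C_tight] by blast
      then show ?thesis using R.one_fixed[OF ce] that C_sub by blast
    qed
    have "x = u \<or> (x \<in> C \<and> u \<in> C)" using * fixC R.one_fixed[OF ce x(1,3)] x by blast
    then have "sim x u" using B_0 unfolding sim_def by metis
    then show ?thesis using x q_eq by simp
  qed
  show "{y, (G ^^ (n div 2)) y} \<notin> F2 d" if ce: "central ty" and y: "y \<in> q ` X0" for y d
  proof
    let ?h = "g ^^ (n div 2)"
    obtain x where x: "x \<in> X0" "y = q x" using y by blast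
    assume "{y, (G ^^ (n div 2)) y} \<in> F2 d"
    then have "{q x, q (?h x)} \<in> F2 d" using x G_pow_q by simp
    then obtain e where e: "{q x, q (?h x)} = q ` e" "e \<in> F' d" "card (q ` e) = 2" by (auto simp: F2_def)
    obtain a b where ab: "e = {a, b}" "a \<in> X0" "b \<in> X0" "q a = q x" "q b = q (?h x)"
    proof -
      obtain a b where *: "e = {a, b}" "a \<in> X0" "b \<in> X0" "q a \<noteq> q b" using quotient_edge[OF e(2,3)] .
      then have "q a = q x \<and> q b = q (?h x) \<or> q b = q x \<and> q a = q (?h x)"
        using e(1) by (auto simp: doubleton_eq_iff)
      then show ?thesis using that[of a b] that[of b a] * by (auto simp: insert_commute)
    qed
    have hx: "?h x \<in> X0" using pow_X0 x by blast
    have ne: "\<not> sim x (?h x)"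
    proof
      assume "sim x (?h x)"
      then have "q x = q (?h x)" using q_eq[OF x(1) hx] by simp
      then have "card (q ` e) = card {q x}" using e(1) by simp
      then show False using e(3) by simp
    qed
    have xa: "sim x a" "sim (?h x) b" using ab q_eq x hx by metis+
    show False
    proof (cases "\<exists>i. x \<in> B i")
      case False
      then have "a = x" using xa by (auto simp: sim_def)
      have "\<not> (\<exists>i. ?h x \<in> B i)"
      proof
        assume "\<exists>i. ?h x \<in> B i"
        then obtain i where i: "?h x \<in> B i" by blast
        have "?h (?h x) \<in> B (n div 2 + i)" using B_pow_iff[OF hx] i by blast
        then show False using False R.half_half[OF ce x(1)] by simp
      qed
      then have "b = ?h x" using xa by (auto simp: sim_def)
      then show False using \<open>a = x\<close> R.no_diameter[OF ce x(1)] e ab by blast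
    next
      case True
      then obtain i where i: "x \<in> B i" by blast
      let ?S = "B i" and ?T = "B (n div 2 + i)"
      have hT: "?h x \<in> ?T" using B_pow_iff[OF x(1)] i by blast
      have aS: "a \<in> ?S" "b \<in> ?T" using sim_B xa i hT by blast+
      have dj: "?S \<inter> ?T = {}"
      proof (rule ccontr)
        assume "?S \<inter> ?T \<noteq> {}"
        then have "?S = ?T" using B_meet by blast
        then show False using ne i hT by (auto simp: sim_def)
      qed
      have eST: "e \<subseteq> ?S \<union> ?T" "\<not> e \<subseteq> ?S" "\<not> e \<subseteq> ?T" using ab aS dj by blast+
      note tl = tight_link(2)[OF R.sparse_F finite_X0 B_sub B_sub B_tight B_tight dj e(2) eST R.no_empty_edge(1)]
      have he: "?h ` e \<in> F' d" using R.edge_pow[OF e(2), of "n div 2"] R.half_period(2)[OF ce] by simp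
      have haT: "?h a \<in> ?T" using B_pow_iff[OF ab(2)] aS by blast
      have "?h b \<in> B (n div 2 + (n div 2 + i))" using B_pow_iff[OF ab(3)] aS by blast
      also have "n div 2 + (n div 2 + i) = i + n" using R.half_period(1)[OF ce] by simp
      also have "B (i + n) = B i" using B_mod[of "i + n"] B_mod[of i] by simp
      finally have hbS: "?h b \<in> ?S" .
      have "?h ` e \<in> edges_in (F' d) (?S \<union> ?T)" using he ab haT hbS by (simp add: edges_in_def)
      moreover have "?h ` e \<notin> edges_in (F' d) ?S" "?h ` e \<notin> edges_in (F' d) ?T"
        using ab haT hbS dj by (auto simp: edges_in_def)
      ultimately have hee: "?h ` e = e" using tl by blast
      have "?h a \<in> ?h ` e" using ab by simp
      then have "?h a = a \<or> ?h a = b" unfolding hee using ab by simp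
      moreover have "?h a \<noteq> a"
      proof
        assume "?h a = a"
        then have "a \<in> ?T" using haT by simp
        then show False using aS(1) dj by blast
      qed
      ultimately have "?h a = b" by blast
      then show False using R.no_diameter[OF ce ab(2)] e ab by blast
    qed
  qed
qed

text \<open>
  An edge of the contraction with both colours is a double link of a cluster, unless it comes
  from one edge between unclustered vertices; but the only edges with both colours are the added
  ones, and these lie in clusters.
\<close>

lemma no_dlink_disjoint:
  assumes nz: "\<And>z. z \<in> X0 \<Longrightarrow> \<forall>i. z \<notin> B i \<Longrightarrow> \<not> dlink C {z}"
    and nb: "\<And>k. apart C \<Longrightarrow> 1 < n \<Longrightarrow> 0 < k \<Longrightarrow> k < n \<Longrightarrow> \<not> dlink C (B k)"
  shows "F2 True \<inter> F2 False = {}"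
proof (rule ccontr)
  assume "F2 True \<inter> F2 False \<noteq> {}"
  then obtain f where f: "f \<in> F2 True" "f \<in> F2 False" by blast
  obtain e1 where e1: "f = q ` e1" "e1 \<in> F' True" "card (q ` e1) = 2" using f by (auto simp: F2_def)
  obtain e2 where e2: "f = q ` e2" "e2 \<in> F' False" "card (q ` e2) = 2" using f by (auto simp: F2_def)
  obtain a b where ab: "e1 = {a, b}" "a \<in> X0" "b \<in> X0" "q a \<noteq> q b" using quotient_edge[OF e1(2,3)] .
  define cl where "cl x = {y \<in> X0. q y = q x}" for x
  have e2X: "e2 \<subseteq> X0" using R.edge[OF e2(2)] by blast
  have qe: "q ` e2 = {q a, q b}" "q ` e1 = {q a, q b}" using e1 e2 ab by auto
  have dl: "dlink (cl a) (cl b)"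
  proof -
    have "link (cl a) (cl b) d" for d
    proof -
      define e where "e = (if d then e1 else e2)"
      have e: "e \<in> F' d" "e \<subseteq> X0" "q ` e = {q a, q b}"
        using e1 e2 e2X ab qe by (auto simp: e_def)
      have "e \<subseteq> cl a \<union> cl b" using e by (auto simp: cl_def)
      moreover have "\<not> e \<subseteq> cl a" "\<not> e \<subseteq> cl b"
      proof -
        have "q a \<in> q ` e" "q b \<in> q ` e" unfolding e(3) by simp_all
        then obtain s t where st: "s \<in> e" "q a = q s" "t \<in> e" "q b = q t" by (elim imageE)
        have "s \<notin> cl b" "t \<notin> cl a" using ab(4) st(2,4) unfolding cl_def by simp_all
        then show "\<not> e \<subseteq> cl a" "\<not> e \<subseteq> cl b" using st by blast+
      qed
      ultimately show ?thesis unfolding link_def using e(1) by blast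
    qed
    then show ?thesis by (simp add: dlink_def)
  qed
  have main: False if x: "x \<in> X0" "y \<in> X0" "x \<in> B i" and dl: "dlink (cl x) (cl y)" for x y i
  proof -
    define i' where "i' = i mod n"
    have i': "i' < n" "x \<in> B i'" using x B_mod[of i] by (auto simp: i'_def)
    have clx: "cl x = B i'" unfolding cl_def by (rule fibre_B[OF i'(2)])
    have clX: "cl y \<subseteq> X0" by (auto simp: cl_def)
    have "dlink ((g ^^ (n - i')) ` B i') ((g ^^ (n - i')) ` cl y)"
      using dlink_shift[OF dl] clx clX B_sub by metis
    moreover have "(g ^^ (n - i')) ` B i' = C" using B_add[of "n - i'" i'] i' B_mod[of n] by simp
    ultimately have dl': "dlink C ((g ^^ (n - i')) ` cl y)" by simp
    show False
    proof (cases "\<exists>j. y \<in> B j")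
      case True
      then obtain j where "y \<in> B j" by blast
      then have "cl y = B j" unfolding cl_def by (rule fibre_B)
      then have "(g ^^ (n - i')) ` cl y = B ((n - i' + j) mod n)"
        using B_add[of "n - i'" j] B_mod[of "n - i' + j"] by simp
      then have dk: "dlink C (B ((n - i' + j) mod n))" using dl' by simp
      then have "B ((n - i' + j) mod n) \<noteq> C" using no_self_dlink[of C] by auto
      then have "(n - i' + j) mod n \<noteq> 0" "g ` C \<noteq> C" using B_inv by (auto intro: ccontr)
      then show False using nb[of "(n - i' + j) mod n"] dk C_cases by auto
    next
      case False
      let ?z = "(g ^^ (n - i')) y"
      have "cl y = {y}" unfolding cl_def using fibre_point[OF x(2)] False by blast
      then have dz: "dlink C {?z}" using dl' by simp
      have "?z \<notin> B j" for j
      proof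
        assume "?z \<in> B j"
        then have "(g ^^ i') ?z \<in> B (i' + j)" using B_pow_iff[of ?z i' j] pow_X0[OF x(2)] by blast
        then show False using False R.pow_forth[OF x(2), of i'] i' by auto
      qed
      then show False using nz[of ?z] dz pow_X0[OF x(2)] by blast
    qed
  qed
  show False
  proof (cases "(\<exists>i. a \<in> B i) \<or> (\<exists>i. b \<in> B i)")
    case True
    then show False using main[OF ab(2,3) _ dl] main[OF ab(3,2)] dl dlink_sym by blast
  next
    case False
    then have "cl a = {a}" "cl b = {b}" unfolding cl_def using fibre_point ab by blast+
    then have ca: "{y \<in> X0. q y = q a} = {a}" and cb: "{y \<in> X0. q y = q b} = {b}" by (auto simp: cl_def)
    have "x \<in> {a, b}" if x: "x \<in> e2" for x
    proof -
      have "q x \<in> q ` e2" using x by blast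
      then have "q x = q a \<or> q x = q b" unfolding qe(1) by blast
      then have "x \<in> {y \<in> X0. q y = q a} \<or> x \<in> {y \<in> X0. q y = q b}" using x e2X by blast
      then show ?thesis unfolding ca cb by blast
    qed
    then have "e2 \<subseteq> e1" using ab by blast
    then have "e2 = e1" using R.edge[OF e1(2)] R.edge[OF e2(2)] card_subset_eq[of e1 e2] ab by simp
    then obtain i where i: "e1 = (g ^^ i) ` e0" using shared e1 e2 by metis
    then have "a \<in> B i" using e0_C ab unfolding B_def by blast
    then show False using False by blast
  qed
qed

text \<open>
  The contraction is drawn by induction and the clusters are blown up. If \<open>w3\<close> lies
  outside the cluster, \<open>v\<close> can be placed while the cluster is still a point, at
  which \<open>w1\<close> and \<open>w2\<close> coincide; small perturbations do no harm.
  Otherwise \<open>v\<close> joins the cluster.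
\<close>

lemma case_contraction:
  assumes nz: "\<And>z. z \<in> X0 \<Longrightarrow> \<forall>i. z \<notin> B i \<Longrightarrow> \<not> dlink C {z}"
    and nb: "\<And>k. apart C \<Longrightarrow> 1 < n \<Longrightarrow> 0 < k \<Longrightarrow> k < n \<Longrightarrow> \<not> dlink C (B k)"
  shows realizable
proof -
  interpret A: sym_pair ty X0 g A by (rule A_pair)
  have "card (q ` X0) < card X" using card_image_le[OF finite_X0, of q] card_X0 by simp
  then obtain p2 where p2: "realizes ty (q ` X0) G F2 p2"
    using IH[OF _ contraction_pair no_dlink_disjoint[OF nz nb]] by blast
  have p2g: "p2 (q (g x)) = ac (p2 (q x))" if "x \<in> X0" for x
    using p2 that G_q[OF that] by (auto simp: realizes_def)
  have p2g': "p2 (q ((g ^^ i) x)) = (ac ^^ i) (p2 (q x))" if "x \<in> X0" for x i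
    using A.pow_act[of "\<lambda>x. p2 (q x)" x i] p2g that by blast
  have p2i: "p2 (q x) = p2 (q y) \<longleftrightarrow> sim x y" if "x \<in> X0" "y \<in> X0" for x y
    using p2 that q_eq[OF that] by (auto simp: realizes_def inj_on_def)
  have p2e: "rel d (p2 (q x)) (p2 (q y)) \<or> sim x y" if e: "{x, y} \<in> F' d" for d x y
  proof -
    have xy: "x \<in> X0" "y \<in> X0" using R.edgeD e by auto
    show ?thesis
    proof (cases "sim x y")
      case False
      then have "q x \<noteq> q y" using q_eq xy by simp
      then have "q ` {x, y} \<in> F2 d" unfolding F2_def using e by (intro CollectI exI[of _ "{x, y}"]) simp
      then show ?thesis using p2 by (simp add: realizes_def)
    qed simp
  qed
  have simB: "\<exists>i<n. x \<in> B i \<and> y \<in> B i" if s: "sim x y" and ne: "x \<noteq> y" for x y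
  proof -
    obtain i where "x \<in> B i" "y \<in> B i" using s ne by (auto simp: sim_def)
    then have "x \<in> B (i mod n)" "y \<in> B (i mod n)" using B_mod[of i] by auto
    then show ?thesis by (intro exI[of _ "i mod n"]) simp
  qed
  have s12: "sim w1 w2" using w_C B_0 unfolding sim_def by metis
  show ?thesis
  proof (cases "w3 \<in> C")
    case False
    have "\<not> sim w1 w3" using False sim_B[of w1 w3 0] w_C by auto
    then have "p2 (q w1) \<noteq> p2 (q w3)" using p2i w_in by blast
    then obtain P where P: "rel c P (p2 (q w1))" "rel (\<not> c) P (p2 (q w3))" using place_11 by blast
    have P2: "rel c P (p2 (q w2))" using P(1) p2i[OF w_in(1,2)] s12 by simp
    let ?Q = "\<lambda>p. rel c P (p w1) \<and> rel c P (p w2) \<and> rel (\<not> c) P (p w3)"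
    have "\<exists>rK. g ` C = C \<and> realizes ty C g (restr A C) rK \<or> apart C \<and> realizes Id C id (restr A C) rK"
      using C_cases
    proof
      assume "g ` C = C \<and> C \<noteq> X0"
      then have gC: "g ` C = C" and gC': "\<And>y. y \<in> C \<Longrightarrow> g y \<in> C" by auto
      show ?thesis using IH[OF card_C A_sub_pair[OF C_sub gC'] restr_dis(2)] gC by blast
    next
      assume "1 < n \<and> apart C"
      then show ?thesis using IH[OF card_C A.sub_pair_Id[OF C_sub] restr_dis(2)] by blast
    qed
    then obtain rK where rK: "g ` C = C \<and> realizes ty C g (restr A C) rK \<or> apart C \<and> realizes Id C id (restr A C) rK"
      by blast
    have "\<exists>p. realizes ty X0 g A p \<and> ?Q p"
    proof (rule A.cluster_blow_up[of C rK "\<lambda>x. p2 (q x)" ?Q])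
      show "C \<subseteq> X0" by (rule C_sub)
      show "g ` C = C \<and> realizes ty C g (restr A C) rK \<or> A.apart C \<and> realizes Id C id (restr A C) rK"
        using rK by (simp add: A.apart_def apart_def)
      show "p2 (q (g x)) = ac (p2 (q x))" if "x \<in> X0" for x by (rule p2g[OF that])
      show "rel d (p2 (q x)) (p2 (q y)) \<or>
          p2 (q x) = p2 (q y) \<and> (\<exists>i<n. x \<in> (g ^^ i) ` C \<and> y \<in> (g ^^ i) ` C)" if e: "{x, y} \<in> A d" for d x y
      proof -
        have "{x, y} \<in> F' d" using e A_sub_F' by blast
        then show ?thesis using p2e[of x y d] simB[of x y] p2i[of x y] R.edgeD[of x y d] unfolding B_def by blast
      qed
      show "\<exists>i<n. x \<in> (g ^^ i) ` C \<and> y \<in> (g ^^ i) ` C"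
        if "x \<in> X0" "y \<in> X0" "x \<noteq> y" "p2 (q x) = p2 (q y)" for x y
        using that p2i simB unfolding B_def by blast
      show "\<forall>\<^sub>F \<epsilon> in at_right 0. rel c P (p2 (q w1) + \<epsilon> *\<^sub>R r w1) \<and> rel c P (p2 (q w2) + \<epsilon> *\<^sub>R r w2) \<and>
          rel (\<not> c) P (p2 (q w3) + \<epsilon> *\<^sub>R r w3)" for r
        using eventually_rel[OF P(1), of 0 "r w1"] eventually_rel[OF P2, of 0 "r w2"] eventually_rel[OF P(2), of 0 "r w3"]
        by (simp add: eventually_conj)
    qed
    then show ?thesis using finish by blast
  next
    case True
    define idx where "idx x = (SOME i. i < n \<and> x = (g ^^ i) v)" for x
    \<comment> \<open>Every vertex in the orbit of \<open>v\<close> is drawn at the point of the cluster that contains its neighbours.\<close>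
    define ext where "ext x = (if x \<in> X0 then x else (g ^^ idx x) w1)" for x
    have idx: "idx ((g ^^ i) v) = i" if "i < n" for i
    proof -
      have "idx ((g ^^ i) v) < n \<and> (g ^^ i) v = (g ^^ idx ((g ^^ i) v)) v"
        unfolding idx_def by (rule someI[of _ i]) (use that in simp)
      then show ?thesis using mobile_inj[OF v] that by metis
    qed
    have ext_v: "ext ((g ^^ i) v) = (g ^^ i) w1" if "i < n" for i
      using v_notin idx[OF that] by (simp add: ext_def)
    have ext_X0: "ext x = x" if "x \<in> X0" for x using that by (simp add: ext_def)
    have X_cases: "x \<in> X0 \<or> (\<exists>i<n. x = (g ^^ i) v)" if "x \<in> X" for x
      using that by (auto simp: X0_def orbit_def)
    have ext_in: "ext x \<in> X0" if "x \<in> X" for x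
      using X_cases[OF that] ext_X0 ext_v pow_X0[OF w_in(1)] by auto
    have ext_g: "ext (g x) = g (ext x)" if "x \<in> X" for x
      using X_cases[OF that]
    proof
      assume "x \<in> X0" then show ?thesis using ext_X0 g_X0 by simp
    next
      assume "\<exists>i<n. x = (g ^^ i) v"
      then obtain i where i: "i < n" "x = (g ^^ i) v" by blast
      show ?thesis
      proof (cases "Suc i < n")
        case True
        have "g x = (g ^^ Suc i) v" using i by simp
        then show ?thesis using ext_v[OF True] ext_v[OF i(1)] i by simp
      next
        case False
        then have n: "Suc i = n" using i by simp
        have "g x = (g ^^ Suc i) v" "g (ext x) = (g ^^ Suc i) w1" using i ext_v[OF i(1)] by simp_all
        then have "g x = (g ^^ 0) v" "g (ext x) = w1" unfolding n using g_period v w_inX by simp_all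
        then show ?thesis using ext_v[of 0] by simp
      qed
    qed
    define Kc where "Kc = (if g ` C = C then C \<union> orbit v else insert v C)"
    have CK: "C \<subseteq> Kc" "v \<in> Kc" using orbit_self[of v] by (auto simp: Kc_def)
    have Kc_sub: "Kc \<subseteq> X" using C_subX orbit_sub[OF v(1)] v by (auto simp: Kc_def)
    have BK': "B i \<subseteq> (g ^^ i) ` Kc" for i using CK by (auto simp: B_def)
    have vK: "(g ^^ i) v \<in> (g ^^ i) ` Kc" for i using CK by blast
    have "\<exists>rK. g ` Kc = Kc \<and> realizes ty Kc g (restr F Kc) rK \<or> apart Kc \<and> realizes Id Kc id (restr F Kc) rK"
    proof (cases "g ` C = C")
      case gC: True
      then have Kc: "Kc = C \<union> orbit v" by (simp add: Kc_def)
      have gK: "g ` Kc = Kc" using gC orbit_image[OF v(1)] by (simp add: Kc image_Un)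
      then have gK': "\<And>y. y \<in> Kc \<Longrightarrow> g y \<in> Kc" by blast
      have "C \<noteq> X0"
      proof
        assume "C = X0"
        then have "\<not> (g ` C = C \<and> C \<noteq> X0)" by blast
        then have "1 < n" "apart C" using C_cases by blast+
        then have "C \<inter> C = {}" using gC by (auto simp: apart_def dest: spec[of _ 1])
        then show False using w_C by blast
      qed
      then have "Kc \<noteq> X" using C_sub Kc orbit_sub[OF v(1)] unfolding X0_def by blast
      then have "card Kc < card X" using Kc_sub finite_X by (intro psubset_card_mono) auto
      then show ?thesis using IH[OF _ sub_pair[OF Kc_sub gK'] restr_dis(1)] gK by blast
    next
      case False
      then have ap: "apart C" "1 < n" using C_cases by auto
      have Kc: "Kc = K" using False True by (simp add: Kc_def K_def)
      have "g v \<notin> Kc"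
      proof -
        have "g v \<noteq> v" using v(2) ap(2) by (auto simp: mobile_def dest: spec[of _ 1])
        moreover have "g v \<notin> C" using v_notin[of 1] C_sub by auto
        ultimately show ?thesis using False by (simp add: Kc_def)
      qed
      then have "card Kc < card X"
        using Kc_sub g_in[OF v(1)] finite_X by (intro psubset_card_mono) auto
      then show ?thesis
        using IH[OF _ sub_pair_Id[OF Kc_sub] restr_dis(1)] K_apart[OF ap(1)] Kc by metis
    qed
    then obtain rK where rK: "g ` Kc = Kc \<and> realizes ty Kc g (restr F Kc) rK \<or> apart Kc \<and> realizes Id Kc id (restr F Kc) rK"
      by blast
    have "\<exists>p. realizes ty X g F p \<and> True"
    proof (rule cluster_blow_up[of Kc rK "\<lambda>x. p2 (q (ext x))" "\<lambda>_. True", OF Kc_sub rK])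
      show "p2 (q (ext (g x))) = ac (p2 (q (ext x)))" if "x \<in> X" for x
        using p2g[OF ext_in[OF that]] ext_g[OF that] by simp
      have O: "p2 (q (ext x)) = p2 (q (ext y)) \<and> (\<exists>i<n. x \<in> (g ^^ i) ` Kc \<and> y \<in> (g ^^ i) ` Kc)"
        if e: "{x, y} \<in> F d" and x: "x \<in> orbit v" for d x y
      proof -
        obtain i where i: "i < n" "x = (g ^^ i) v" using x by (auto simp: orbit_def)
        then obtain w where w: "w \<in> {w1, w2, w3}" "y = (g ^^ i) w" using orbit_v_edge[of i y d] e by blast
        then have wC: "w \<in> C" "w \<in> X0" using w_C True C_sub by auto
        have yX: "y \<in> X0" using w pow_X0[OF wC(2)] by simp
        have "sim w1 w" using w_C wC B_0 unfolding sim_def by metis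
        then have "p2 (q w1) = p2 (q w)" using p2i w_in wC by simp
        then have "p2 (q ((g ^^ i) w1)) = p2 (q ((g ^^ i) w))" using p2g'[of w1 i] p2g'[of w i] w_in wC by simp
        then have "p2 (q (ext x)) = p2 (q (ext y))" using ext_X0[OF yX] ext_v[OF i(1)] i w by simp
        moreover have "y \<in> (g ^^ i) ` Kc" using w wC CK by blast
        ultimately show ?thesis using i vK by blast
      qed
      show "rel d (p2 (q (ext x))) (p2 (q (ext y))) \<or>
          p2 (q (ext x)) = p2 (q (ext y)) \<and> (\<exists>i<n. x \<in> (g ^^ i) ` Kc \<and> y \<in> (g ^^ i) ` Kc)"
        if e: "{x, y} \<in> F d" for d x y
      proof (cases "x \<in> orbit v \<or> y \<in> orbit v")
        case True
        have e': "{y, x} \<in> F d" using e by (simp add: insert_commute)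
        from True show ?thesis
        proof
          assume "x \<in> orbit v" then show ?thesis using O[OF e] by blast
        next
          assume "y \<in> orbit v"
          from O[OF e' this] show ?thesis by metis
        qed
      next
        case False
        then have xy: "x \<in> X0" "y \<in> X0" using edgeD[OF e] by (auto simp: X0_def)
        then have "{x, y} \<in> F' d" using e A_sub_F'[of d] by (auto simp: A_def restr_def edges_in_def)
        then have "rel d (p2 (q x)) (p2 (q y)) \<or> sim x y" by (rule p2e)
        then show ?thesis using simB[of x y] p2i[OF xy] edgeD[OF e] ext_X0 xy BK' by (metis subsetD)
      qed
      show "\<exists>i<n. x \<in> (g ^^ i) ` Kc \<and> y \<in> (g ^^ i) ` Kc"
        if xy: "x \<in> X" "y \<in> X" "x \<noteq> y" "p2 (q (ext x)) = p2 (q (ext y))" for x y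
      proof -
        have s: "sim (ext x) (ext y)" using p2i xy ext_in by blast
        have gKi: "(g ^^ l) v \<in> (g ^^ j) ` Kc" if "l < n" "j < n" "(g ^^ l) w1 \<in> B j" for l j
        proof (cases "g ` C = C")
          case gC: True
          have "g ` Kc = Kc" using gC orbit_image[OF v(1)] by (simp add: Kc_def image_Un)
          then have "(g ^^ j) ` Kc = Kc" "(g ^^ l) ` Kc = Kc" using inv_pow by blast+
          then show ?thesis using vK[of l] by simp
        next
          case False
          then have ap: "apart C" using C_cases by blast
          have "(g ^^ l) w1 \<in> B l" using w_C by (auto simp: B_def)
          then have "l = j" using B_apart[OF ap that(1,2)] that(3) by blast
          then show ?thesis using vK by simp
        qed
        have O: "\<exists>i<n. x \<in> (g ^^ i) ` Kc \<and> y \<in> (g ^^ i) ` Kc"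
          if xv: "\<exists>i<n. x = (g ^^ i) v" and s: "sim (ext x) (ext y)" and yX: "y \<in> X" for x y
        proof -
          obtain i where i: "i < n" "x = (g ^^ i) v" using xv by blast
          have "ext x \<in> B i" using ext_v[OF i(1)] i w_C by (auto simp: B_def)
          then have yB: "ext y \<in> B i" using s sim_B by blast
          from X_cases[OF yX] have "y \<in> (g ^^ i) ` Kc"
          proof
            assume "y \<in> X0" then show ?thesis using yB ext_X0 BK' by auto
          next
            assume "\<exists>i<n. y = (g ^^ i) v"
            then obtain l where "l < n" "y = (g ^^ l) v" by blast
            then show ?thesis using gKi[of l i] yB ext_v i by simp
          qed
          then show ?thesis using i vK by blast
        qed
        show ?thesis
        proof (cases "x \<in> X0 \<and> y \<in> X0")
          case True
          then have "sim x y" using s ext_X0 by simp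
          then show ?thesis using simB[of x y] xy(3) BK' by blast
        next
          case False
          then show ?thesis
            using X_cases[OF xy(1)] X_cases[OF xy(2)] O[OF _ s xy(2)] O[of y x] s sim_sym xy(1) by blast
        qed
      qed
    qed simp
    then show ?thesis by blast
  qed
qed

lemma cluster_case: realizable
proof (cases "\<exists>z\<in>X0. (\<forall>i. z \<notin> B i) \<and> dlink C {z}")
  case True
  then obtain z where z: "z \<in> X0" "\<forall>i. z \<notin> B i" "dlink C {z}" by blast
  then have "z \<notin> C" using B_0 by metis
  then show ?thesis using C_cases case_invariant[OF _ z(1) _ z(3)] case_apart_point[OF _ _ z] by blast
next
  case no_point: False
  show ?thesis
  proof (cases "\<exists>k. apart C \<and> 1 < n \<and> 0 < k \<and> k < n \<and> dlink C (B k)")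
    case True
    then show ?thesis using case_apart_block by blast
  next
    case False
    then show ?thesis using no_point by (intro case_contraction) blast+
  qed
qed

end

section \<open>Realizing symmetric pairs of forests\<close>

text \<open>
  The order type of a point and its image under the quarter turn depends only on which
  coordinate is larger in absolute value, and both regions contain points in each position to a
  given point.
\<close>

lemma place_quarter:
  "\<exists>P. rel d0 P (act Quarter P) \<and> rel d P Q"
proof -
  have key: "rel True P (act Quarter P) \<longleftrightarrow> \<bar>snd P\<bar> < \<bar>fst P\<bar>"
    "rel False P (act Quarter P) \<longleftrightarrow> \<bar>fst P\<bar> < \<bar>snd P\<bar>" for P
    by (auto simp: rel_cases)
  define M where "M = \<bar>fst Q\<bar> + \<bar>snd Q\<bar> + 2"
  have M: "\<bar>fst Q\<bar> + 1 < M" "\<bar>snd Q\<bar> + 1 < M" by (auto simp: M_def)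
  show ?thesis
  proof (cases d0; cases d)
    assume "d0" "d" then show ?thesis using M
      by (intro exI[of _ "(M, snd Q + 1)"]) (auto simp: key rel_cases)
  next
    assume "d0" "\<not> d" then show ?thesis using M
      by (intro exI[of _ "(M, snd Q - 1)"]) (auto simp: key rel_cases)
  next
    assume "\<not> d0" "d" then show ?thesis using M
      by (intro exI[of _ "(fst Q + 1, M)"]) (auto simp: key rel_cases)
  next
    assume "\<not> d0" "\<not> d" then show ?thesis using M
      by (intro exI[of _ "(fst Q - 1, M)"]) (auto simp: key rel_cases)
  qed
qed

context sym_pair
begin

definition "nb d v = {w. {v, w} \<in> F d}"

lemma nb_sub: "nb d v \<subseteq> X" using edgeD by (auto simp: nb_def)
lemma finite_nb: "finite (nb d v)" using nb_sub finite_X finite_subset by blast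

lemma card_nb: "card (nb d v) = deg (F d) v"
proof -
  have "{e \<in> F d. v \<in> e} = (\<lambda>w. {v, w}) ` nb d v"
  proof (intro equalityI subsetI)
    fix e assume "e \<in> {e \<in> F d. v \<in> e}"
    then obtain w where "e = {v, w}" "e \<in> F d" using card2D[of e v] edge[of e d] by blast
    then show "e \<in> (\<lambda>w. {v, w}) ` nb d v" by (auto simp: nb_def)
  qed (auto simp: nb_def)
  moreover have "inj_on (\<lambda>w. {v, w}) (nb d v)" by (auto simp: inj_on_def doubleton_eq_iff)
  ultimately show ?thesis by (simp add: deg_def card_image)
qed

lemma deg_g: "f \<in> X \<Longrightarrow> g f = f \<Longrightarrow> deg (F d) f \<le> deg (F (d \<noteq> swaps_colours ty)) f"
proof -
  assume f: "f \<in> X" "g f = f"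
  have "g ` nb d f \<subseteq> nb (d \<noteq> swaps_colours ty) f"
  proof
    fix y assume "y \<in> g ` nb d f"
    then obtain w where "y = g w" "{f, w} \<in> F d" by (auto simp: nb_def)
    then show "y \<in> nb (d \<noteq> swaps_colours ty) f" using edge_g[of "{f, w}" d] f by (simp add: nb_def)
  qed
  moreover have "card (g ` nb d f) = card (nb d f)"
    using pow_inj[of 1] nb_sub by (intro card_image) (auto intro: inj_on_subset)
  ultimately have "card (nb d f) \<le> card (nb (d \<noteq> swaps_colours ty) f)" using card_mono[OF finite_nb] by metis
  then show ?thesis by (simp add: card_nb)
qed

lemma remaining_pair: "v \<in> X \<Longrightarrow> sym_pair ty (X - orbit v) g (restr F (X - orbit v))"
  using orbit_g_iff g_in by (intro sub_pair) auto

lemma card_remaining: "v \<in> X \<Longrightarrow> card (X - orbit v) < card X"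
  using orbit_self[of v] finite_X by (intro psubset_card_mono) auto

end

text \<open>
  Induction on the number of vertices. Counting degrees gives a mobile vertex with at most three
  edges, or, for \<open>Swap\<close>, a fixed vertex with at most one edge of each colour.
  Delete its orbit, draw the rest, and put it back. Only a vertex with two edges of one colour
  and one of the other needs the reduction of the preceding sections.
\<close>

theorem sym_pair_realizable:
  assumes "sym_pair ty (X :: 'a set) g F" "F True \<inter> F False = {}"
  shows "\<exists>p. realizes ty X g F p"
  using assms
proof (induction "card X" arbitrary: ty X g F rule: less_induct)
  case less
  interpret sym_pair ty X g F by (rule less.prems(1))
  have IH: "\<exists>p. realizes ty' Y g' F' p"
    if "card Y < card X" "sym_pair ty' Y g' F'" "F' True \<inter> F' False = {}" for ty' and Y :: "'a set" and g' F'
    using less.hyps that by blast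
  have dis: "F True \<inter> F False = {}" by (rule less.prems(2))
  have FF: "e \<in> F d \<Longrightarrow> e \<notin> F (\<not> d)" for e d using dis by (cases d) auto
  have rdis: "restr F Y True \<inter> restr F Y False = {}" for Y using dis by (auto simp: restr_def edges_in_def)
  define Z where "Z = {x \<in> X. mobile x}"
  have finZ: "finite Z" "Z \<subseteq> X" using finite_X by (auto simp: Z_def)
  have e2: "\<forall>e\<in>F d. e \<subseteq> X \<and> card e = 2" for d using edge by blast
  show ?case
  proof (cases "ty = Swap \<and> (\<exists>f\<in>X. \<not> mobile f \<and> deg (F True) f \<le> 1)")
    case True
    then obtain f where f: "f \<in> X" "\<not> mobile f" "deg (F True) f \<le> 1" and sw: "ty = Swap" by blast
    have orb: "orbit f = {f}" by (rule orbit_fixed[OF f(1,2)])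
    obtain p0 where "realizes ty (X - {f}) g (restr F (X - {f})) p0"
      using IH[OF card_remaining[OF f(1)] remaining_pair[OF f(1)] rdis] orb by auto
    then show ?thesis using extend_fixed[OF f(1,2) sw dis f(3)] by blast
  next
    case noSwap: False
    have fixed_deg: "2 \<le> deg (F True) x" if "ty = Swap" "x \<in> X" "\<not> mobile x" for x
      using noSwap that by force
    show ?thesis
    proof (cases "Z = {}")
      case True
      show ?thesis
      proof (cases "central ty")
        case ce: True
        have "x = y" if "x \<in> X" "y \<in> X" for x y
          using one_fixed[OF ce that] True that not_mobile by (auto simp: Z_def)
        then have "realizes ty X g F (\<lambda>_. 0)"
          using edgeD by (fastforce simp: realizes_def inj_on_def)
        then show ?thesis by blast
      next
        case False
        show ?thesis
        proof (cases "X = {}")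
          case True
          then have "realizes ty X g F (\<lambda>_. 0)" using edgeD by (fastforce simp: realizes_def)
          then show ?thesis by blast
        next
          case ne: False
          then obtain x where x: "x \<in> X" "\<not> mobile x" using True by (auto simp: Z_def)
          then have "ty = Swap" using not_mobile[OF x] False by (cases ty) (auto simp: central_def)
          then have "2 \<le> deg (F True) f" if "f \<in> X - {}" for f
            using fixed_deg that True by (auto simp: Z_def)
          then have "(\<Sum>v\<in>{}. deg (F True) v) + 1 \<le> 2 * card ({} :: 'a set)"
            using ne by (intro sum_deg_remaining[OF sparse_F finite_X _ e2]) auto
          then show ?thesis by simp
        qed
      qed
    next
      case neZ: False
      have sums: "(\<Sum>v\<in>Z. deg (F d) v) + 1 \<le> 2 * card Z" for d
      proof (cases "ty = Swap")
        case sw: True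
        have "2 \<le> deg (F d) f" if f: "f \<in> X - Z" for f
        proof -
          have f': "f \<in> X" "\<not> mobile f" using f by (auto simp: Z_def)
          have "deg (F True) f \<le> deg (F False) f"
            using deg_g[of f True] not_mobile f' sw by (simp add: swaps_colours_def)
          then show ?thesis using fixed_deg[OF sw f'] by (cases d) auto
        qed
        then show ?thesis
          using neZ finZ by (intro sum_deg_remaining[OF sparse_F finite_X _ e2]) auto
      next
        case False
        have "x = y" if "x \<in> X - Z" "y \<in> X - Z" for x y
        proof -
          have *: "g x = x" "g y = y" "1 < n" using that not_mobile by (auto simp: Z_def)
          then have "central ty" using False by (cases ty) (auto simp: central_def)
          then show ?thesis using one_fixed[of x y] * that by auto
        qed
        then have "card (X - Z) \<le> 1"
          using finite_X by (metis card_le_Suc0_iff_eq finite_Diff One_nat_def)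
        then have "card X \<le> card Z + 1"
          using card_Diff_subset[OF finZ] by linarith
        then show ?thesis
          using neZ finZ by (intro sum_deg_central[OF sparse_F finite_X e2]) auto
      qed
      let ?D = "\<lambda>v. deg (F True) v + deg (F False) v"
      define v where "v = arg_min_on ?D Z"
      have v: "v \<in> Z" "\<And>x. x \<in> Z \<Longrightarrow> ?D v \<le> ?D x"
        unfolding v_def by (rule arg_min_if_finite(1)[OF finZ(1) neZ], rule arg_min_least[OF finZ(1) neZ])
      obtain u where u: "u \<in> Z" "?D u \<le> 3" using low_degree[of Z F, OF finZ(1) sums sums] by blast
      have Dv: "?D v \<le> 3" using v(2)[OF u(1)] u(2) by linarith
      have vX: "v \<in> X" "mobile v" using v(1) by (auto simp: Z_def)
      let ?X0 = "X - orbit v"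
      let ?A = "restr F ?X0"
      have Dnb: "card (nb True v) + card (nb False v) \<le> 3" using Dv by (simp add: card_nb)
      have nbdis: "nb True v \<inter> nb False v = {}" using dis by (auto simp: nb_def)
      obtain p0 where p0: "realizes ty ?X0 g ?A p0"
        using IH[OF card_remaining[OF vX(1)] remaining_pair[OF vX(1)] rdis] by blast
      show ?thesis
      proof (cases "\<exists>d j. 0 < j \<and> j < n \<and> {v, (g ^^ j) v} \<in> F d")
        case True
        then obtain d j where dj: "0 < j" "j < n" "{v, (g ^^ j) v} \<in> F d" by blast
        \<comment> \<open>An edge inside the orbit of \<open>v\<close>: for a symmetry of order two it would be a diameter, or have both colours.\<close>
        have Q: "ty = Quarter"
        proof (cases ty)
          case Mirror then show ?thesis using no_diameter[of v d] dj vX by (auto simp: central_def less2)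
        next
          case Half then show ?thesis using no_diameter[of v d] dj vX by (auto simp: central_def less2)
        next
          case Swap
          then have "j = 1" using dj by (auto simp: less2)
          moreover have "g (g v) = v" using g_period[OF vX(1)] Swap by (simp add: eval_nat_numeral)
          ultimately have "{v, g v} \<in> F (\<not> d)"
            using edge_g[OF dj(3)] Swap by (simp add: swaps_colours_def insert_commute)
          then show ?thesis using FF dj \<open>j = 1\<close> by auto
        qed (use dj in auto)
        have n4: "n = 4" using Q by simp
        have g4: "(g ^^ 4) v = v" using g_period[OF vX(1)] n4 by simp
        have no2: "{v, (g ^^ 2) v} \<notin> F d'" for d'
          using no_diameter[of v d'] Q vX by (simp add: central_def)
        have sc: "colour d' 1 = (\<not> d')" "colour d' 3 = (\<not> d')" for d' using Q by (auto simp: col_def swaps_colours_def)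
        have to3: "{v, (g ^^ 3) v} \<in> F (\<not> d')" if "{v, (g ^^ 1) v} \<in> F d'" for d'
        proof -
          have "(g ^^ 3) ` {v, (g ^^ 1) v} \<in> F (colour d' 3)" by (rule edge_pow[OF that])
          moreover have "(g ^^ 3) ((g ^^ 1) v) = v" using g4 by (simp add: eval_nat_numeral)
          ultimately show ?thesis using sc by (simp add: insert_commute)
        qed
        have to1: "{v, (g ^^ 1) v} \<in> F (\<not> d')" if "{v, (g ^^ 3) v} \<in> F d'" for d'
        proof -
          have "(g ^^ 1) ` {v, (g ^^ 3) v} \<in> F (colour d' 1)" by (rule edge_pow[OF that])
          moreover have "(g ^^ 1) ((g ^^ 3) v) = v" using g4 by (simp add: eval_nat_numeral)
          ultimately show ?thesis using sc by (simp add: insert_commute)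
        qed
        have "j = 1 \<or> j = 3" using dj n4 no2 by (auto simp: less4)
        then obtain d0 where d0: "{v, (g ^^ 1) v} \<in> F d0" using dj to1 by blast
        have d0': "{v, (g ^^ 3) v} \<in> F (\<not> d0)" by (rule to3[OF d0])
        let ?b = "(g ^^ 1) v" and ?c = "(g ^^ 3) v"
        have bc: "?b \<noteq> ?c" using mobile_inj[OF vX, of 1 3] n4 by auto
        \<comment> \<open>The two edges inside the orbit leave at most one further neighbour.\<close>
        have one: "w = w'" if w: "w \<in> (nb True v \<union> nb False v) - orbit v" "w' \<in> (nb True v \<union> nb False v) - orbit v" for w w'
        proof (rule ccontr)
          assume "w \<noteq> w'"
          have "?b \<in> orbit v" "?c \<in> orbit v" using pow_orbit[OF vX(1)] by blast+
          then have "card {?b, ?c, w, w'} = 4" using \<open>w \<noteq> w'\<close> w bc by (auto simp: card_insert_if)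
          moreover have "{?b, ?c, w, w'} \<subseteq> nb True v \<union> nb False v"
            using w d0 d0' by (cases d0) (auto simp: nb_def)
          then have "card {?b, ?c, w, w'} \<le> card (nb True v \<union> nb False v)"
            using finite_nb by (intro card_mono) auto
          ultimately show False using Dnb card_Un_le[of "nb True v" "nb False v"] by linarith
        qed
        have "\<exists>P. rel d0 P (act Quarter P) \<and> (\<forall>d w. {v, w} \<in> F d \<longrightarrow> w \<notin> orbit v \<longrightarrow> rel d P (p0 w))"
        proof (cases "\<exists>d w. {v, w} \<in> F d \<and> w \<notin> orbit v")
          case True
          then obtain d1 w where w: "{v, w} \<in> F d1" "w \<notin> orbit v" by blast
          have uniq: "d' = d1 \<and> w' = w" if "{v, w'} \<in> F d'" "w' \<notin> orbit v" for d' w'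
          proof -
            have "x \<in> nb True v \<union> nb False v" if "{v, x} \<in> F d''" for x d''
              using that by (cases d'') (auto simp: nb_def)
            then have "w' = w" using one w that by blast
            then show ?thesis using FF w that by (cases "d' = d1") auto
          qed
          obtain P where P: "rel d0 P (act Quarter P)" "rel d1 P (p0 w)"
            using place_quarter[of d0 d1 "p0 w"] by blast
          show ?thesis
          proof (intro exI[of _ P] conjI allI impI)
            fix d' w' assume "{v, w'} \<in> F d'" "w' \<notin> orbit v"
            then show "rel d' P (p0 w')" using uniq[of w' d'] P by simp
          qed (rule P(1))
        next
          case False
          then show ?thesis using place_quarter[of d0 True 0] by blast
        qed
        then obtain P where P: "rel d0 P (act Quarter P)"
          "\<And>d w. {v, w} \<in> F d \<Longrightarrow> w \<notin> orbit v \<Longrightarrow> rel d P (p0 w)" by blast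
        have "\<exists>p. realizes ty X g F p \<and> p v \<in> UNIV \<and> (\<forall>x\<in>?X0. p x = p0 x)"
        proof (rule extend[OF vX p0])
          show "rel d P (p0 w)" if "{v, w} \<in> F d" "w \<in> ?X0" for d w using P(2) that by blast
          show "rel d P ((ac ^^ j) P)" if j: "0 < j" "j < n" and e: "{v, (g ^^ j) v} \<in> F d" for d j
          proof -
            consider "j = 1" | "j = 3" using j n4 no2 e by (auto simp: less4)
            then show ?thesis
            proof cases
              case 1
              then have "d = d0" using FF[OF d0] e by (cases "d = d0") auto
              then show ?thesis using P(1) 1 Q by simp
            next
              case 2
              then have "d = (\<not> d0)" using FF[OF d0'] e by (cases "d = (\<not> d0)") auto
              moreover have "rel (\<not> d0) P (act Quarter (act Quarter (act Quarter P)))"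
                using P(1) by (cases d0) (auto simp: rel_cases)
              ultimately show ?thesis using 2 Q by (simp add: act_simps3)
            qed
          qed
        qed auto
        then show ?thesis by blast
      next
        case noin: False
        have nbX0: "w \<in> ?X0" if "w \<in> nb d v" for d w
        proof -
          have "w \<notin> orbit v"
          proof
            assume "w \<in> orbit v"
            then obtain j where j: "j < n" "w = (g ^^ j) v" by (auto simp: orbit_def)
            moreover have "w \<noteq> v" using that edgeD[of v w d] by (auto simp: nb_def)
            ultimately have "0 < j" by (cases j) auto
            then show False using noin j that by (auto simp: nb_def)
          qed
          then show ?thesis using that nb_sub by blast
        qed
        have extend': ?thesis if P: "\<forall>d. \<forall>w\<in>nb d v. rel d P (p0 w)" for P
        proof -
          have "\<exists>p. realizes ty X g F p \<and> p v \<in> UNIV \<and> (\<forall>x\<in>?X0. p x = p0 x)"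
          proof (rule extend[OF vX p0, of UNIV P])
            show "rel d P (p0 w)" if "{v, w} \<in> F d" for d w using P that by (auto simp: nb_def)
          qed (use noin in auto)
          then show ?thesis by blast
        qed
        obtain c where c: "card (nb (\<not> c) v) \<le> card (nb c v)"
        proof (cases "card (nb False v) \<le> card (nb True v)")
          case True then show ?thesis using that[of True] by simp
        next
          case False then show ?thesis using that[of False] by simp
        qed
        have tot: "card (nb c v) + card (nb (\<not> c) v) \<le> 3" using Dnb by (cases c) auto
        consider "card (nb (\<not> c) v) = 0" | "card (nb (\<not> c) v) = 1" "card (nb c v) = 1"
          | "card (nb (\<not> c) v) = 1" "card (nb c v) = 2" using c tot by linarith
        then show ?thesis
        proof cases
          case 1
          then have "nb (\<not> c) v = {}" using finite_nb by simp
          moreover obtain P where "\<forall>Q\<in>p0 ` nb c v. rel c P Q"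
            using far_point[OF finite_imageI[OF finite_nb]] by blast
          ultimately have "\<forall>w\<in>nb d v. rel d P (p0 w)" for d by (cases "d = c") auto
          then have "\<forall>d. \<forall>w\<in>nb d v. rel d P (p0 w)" by blast
          then show ?thesis by (rule extend')
        next
          case 2
          obtain w1 w2 where w: "nb c v = {w1}" "nb (\<not> c) v = {w2}"
            using 2 by (metis One_nat_def card_1_singletonE)
          have "w1 \<noteq> w2" using w nbdis by (cases c) auto
          then have "p0 w1 \<noteq> p0 w2" using p0 nbX0[of w1 c] nbX0[of w2 "\<not> c"] w by (auto simp: realizes_def inj_on_def)
          then obtain P where "rel c P (p0 w1)" "rel (\<not> c) P (p0 w2)" using place_11 by blast
          then have "\<forall>w\<in>nb d v. rel d P (p0 w)" for d using w by (cases "d = c") auto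
          then have "\<forall>d. \<forall>w\<in>nb d v. rel d P (p0 w)" by blast
          then show ?thesis by (rule extend')
        next
          case 3
          obtain w1 w2 where w12: "nb c v = {w1, w2}" "w1 \<noteq> w2" using 3(2) by (auto simp: card_2_iff)
          obtain w3 where w3: "nb (\<not> c) v = {w3}" using 3(1) by (metis One_nat_def card_1_singletonE)
          have D3: "?D v = 3" using 3 by (cases c) (auto simp: card_nb[symmetric])
          interpret red: reduction ty X g F v c w1 w2 w3
          proof
            show "{v, w} \<in> F c \<longleftrightarrow> w = w1 \<or> w = w2" for w using w12 by (auto simp: nb_def)
            show "{v, w} \<in> F (\<not> c) \<longleftrightarrow> w = w3" for w using w3 by (auto simp: nb_def)
            show "w1 \<in> X - orbit v" "w2 \<in> X - orbit v" using nbX0[of _ c] w12 by auto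
            show "w3 \<in> X - orbit v" using nbX0[of _ "\<not> c"] w3 by auto
            show "3 \<le> deg (F True) x + deg (F False) x" if "x \<in> X" "mobile x" for x
              using v(2)[of x] that D3 by (simp add: Z_def)
          qed (use dis vX w12 IH fixed_deg in auto)
          show ?thesis
          proof (cases "red.conflict")
            case False then show ?thesis by (rule red.case_no_conflict)
          next
            case cf: True
            show ?thesis
            proof (cases "ty = Swap \<and> g w1 = w2")
              case True then show ?thesis using red.case_swapped_pair by blast
            next
              case False
              interpret cr: conflict_reduction ty X g F v c w1 w2 w3
                by unfold_locales (use cf False in auto)
              show ?thesis
                using cr.admissible_or_done
              proof
                assume "\<exists>C. cr.admissible C"
                then obtain C0 where "cr.admissible C0" by blast
                moreover have "card C' < Suc (card X)" if "cr.admissible C'" for C'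
                proof -
                  have "C' \<subseteq> X" using that red.X0_sub by (auto simp: cr.admissible_def)
                  then show ?thesis using card_mono[OF finite_X] by (simp add: less_Suc_eq_le)
                qed
                ultimately obtain C where C: "cr.admissible C" "\<forall>C'. cr.admissible C' \<longrightarrow> card C' \<le> card C"
                  using ex_has_greatest_nat[of cr.admissible C0 card "Suc (card X)"] by blast
                interpret mc: max_cluster ty X g F v c w1 w2 w3 C
                  by unfold_locales (use C in auto)
                show ?thesis by (rule mc.cluster_case)
              qed
            qed
          qed
        qed
      qed
    qed
  qed
qed

section \<open>Spanning trees and involutions\<close>

abbreviation adj :: "'v set set \<Rightarrow> ('v \<times> 'v) set" where
  "adj T \<equiv> {(x, y). {x, y} \<in> T}"

definition tree :: "'v::finite set set \<Rightarrow> bool" where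
  "tree T \<longleftrightarrow> (\<forall>e\<in>T. card e = 2) \<and> connected_graph T \<and> (\<nexists>vs. is_cycle T vs)"

text \<open>
  The distance from the set \<open>S\<close>. Every vertex outside \<open>S\<close> has an edge
  to a vertex of the level below, its parent; counting these edges takes the place of an
  induction on leaves.
\<close>

definition level :: "'v set set \<Rightarrow> 'v set \<Rightarrow> 'v \<Rightarrow> nat" where
  "level T S v = (LEAST k. \<exists>s\<in>S. (s, v) \<in> adj T ^^ k)"

lemma level_reach:
  assumes "connected_graph T" "S \<noteq> {}"
  shows "\<exists>s\<in>S. (s, v) \<in> adj T ^^ level T S v"
proof -
  obtain s where s: "s \<in> S" using assms(2) by blast
  have "(s, v) \<in> (adj T)\<^sup>*" using assms(1) unfolding connected_graph_def by blast
  then have "\<exists>k. \<exists>s\<in>S. (s, v) \<in> adj T ^^ k" using s rtrancl_imp_relpow by fast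
  then show ?thesis unfolding level_def by (rule LeastI_ex)
qed

lemma level_eq_0:
  assumes "connected_graph T" "S \<noteq> {}"
  shows "level T S v = 0 \<longleftrightarrow> v \<in> S"
  using level_reach[OF assms, of v] unfolding level_def
  by (metis (lifting) Least_eq_0 relpow_0_E relpow_0_I)

lemma level_parent:
  assumes "connected_graph T" "S \<noteq> {}" "v \<notin> S"
  shows "\<exists>w. {v, w} \<in> T \<and> Suc (level T S w) = level T S v"
proof -
  have reach: "\<exists>s\<in>S. (s, u) \<in> adj T ^^ level T S u" for u using level_reach[OF assms(1,2)] .
  have pos: "level T S v \<noteq> 0" using level_eq_0 assms by metis
  then obtain k where k: "level T S v = Suc k" using not0_implies_Suc by blast
  obtain s w where s: "s \<in> S" "(s, w) \<in> adj T ^^ k" "{w, v} \<in> T"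
    using reach[of v] k by auto
  have "level T S w \<le> k" unfolding level_def using s by (intro Least_le) auto
  moreover have "level T S v \<le> Suc (level T S w)"
  proof -
    obtain s' where "s' \<in> S" "(s', w) \<in> adj T ^^ level T S w" using reach by blast
    then have "(s', v) \<in> adj T ^^ Suc (level T S w)" using s by auto
    then show ?thesis using \<open>s' \<in> S\<close> unfolding level_def[of T S v] by (intro Least_le) blast
  qed
  ultimately have "Suc (level T S w) = level T S v" using k by auto
  then show ?thesis using s by (metis insert_commute)
qed

definition parent :: "'v set set \<Rightarrow> 'v set \<Rightarrow> 'v \<Rightarrow> 'v" where
  "parent T S v = (SOME w. {v, w} \<in> T \<and> Suc (level T S w) = level T S v)"

lemma parent:
  assumes "connected_graph T" "S \<noteq> {}" "v \<notin> S"
  shows "{v, parent T S v} \<in> T" "Suc (level T S (parent T S v)) = level T S v"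
  using someI_ex[OF level_parent[OF assms]] unfolding parent_def by blast+

lemma inj_parent_edge:
  assumes "connected_graph T" "S \<noteq> {}"
  shows "inj_on (\<lambda>v. {v, parent T S v}) (- S)"
proof
  fix v w assume "v \<in> - S" "w \<in> - S" and eq: "{v, parent T S v} = {w, parent T S w}"
  then have "Suc (level T S (parent T S v)) = level T S v" "Suc (level T S (parent T S w)) = level T S w"
    using parent(2)[OF assms] by auto
  then show "v = w" using eq by (auto simp: doubleton_eq_iff)
qed

lemma distinct_path:
  assumes "(x, y) \<in> (adj T)\<^sup>*"
  shows "\<exists>vs. vs \<noteq> [] \<and> hd vs = x \<and> last vs = y \<and> distinct vs \<and>
    (\<forall>i. Suc i < length vs \<longrightarrow> {vs ! i, vs ! Suc i} \<in> T)"
  using assms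
proof (induction rule: rtrancl_induct)
  case base
  show ?case by (intro exI[of _ "[x]"]) auto
next
  case (step y z)
  then obtain vs where vs: "vs \<noteq> []" "hd vs = x" "last vs = y" "distinct vs"
    "\<forall>i. Suc i < length vs \<longrightarrow> {vs ! i, vs ! Suc i} \<in> T" by blast
  show ?case
  proof (cases "z \<in> set vs")
    case True
    then obtain k where k: "k < length vs" "vs ! k = z" by (metis in_set_conv_nth)
    have "last (take (Suc k) vs) = z" using k by (simp add: take_Suc_conv_app_nth)
    then show ?thesis
      using vs k by (intro exI[of _ "take (Suc k) vs"]) (auto simp: hd_take)
  next
    case False
    have "{(vs @ [z]) ! i, (vs @ [z]) ! Suc i} \<in> T" if "Suc i < length (vs @ [z])" for i
    proof (cases "Suc i < length vs")
      case True
      then show ?thesis using vs(5) by (auto simp: nth_append)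
    next
      case last: False
      then have "i = length vs - 1" using that vs(1) by (cases vs) auto
      then have "vs ! i = y" using vs(1,3) by (simp add: last_conv_nth)
      then show ?thesis using step(2) last that by (auto simp: nth_append)
    qed
    then show ?thesis
      using vs(1-4) False by (intro exI[of _ "vs @ [z]"]) (auto)
  qed
qed

lemma bridge_of_acyclic:
  assumes "\<nexists>vs. is_cycle T vs" "{x, y} \<in> T" "x \<noteq> y"
  shows "(x, y) \<notin> (adj (T - {{x, y}}))\<^sup>*"
proof
  assume "(x, y) \<in> (adj (T - {{x, y}}))\<^sup>*"
  from distinct_path[OF this] obtain vs where vs: "vs \<noteq> []" "hd vs = x" "last vs = y" "distinct vs"
    "\<forall>i. Suc i < length vs \<longrightarrow> {vs ! i, vs ! Suc i} \<in> T - {{x, y}}"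
    by (elim exE conjE)
  have ends: "vs ! 0 = x" "vs ! (length vs - 1) = y" using vs by (simp_all add: hd_conv_nth last_conv_nth)
  have "length vs \<noteq> 1" using ends assms(3) by auto
  moreover have "length vs \<noteq> 2"
  proof
    assume 2: "length vs = 2"
    then show False using vs(5)[rule_format, of 0] ends by simp
  qed
  moreover have "length vs \<noteq> 0" using vs(1) by simp
  ultimately have len: "length vs \<ge> 3" by linarith
  have "{vs ! i, vs ! (Suc i mod length vs)} \<in> T" if "i < length vs" for i
  proof (cases "Suc i < length vs")
    case True
    then show ?thesis using vs(5) by auto
  next
    case False
    then have i: "Suc i = length vs" using that by auto
    then have "vs ! i = y" using ends(2) by (metis diff_Suc_1)
    then show ?thesis using ends(1) assms(2) i by (simp add: insert_commute)
  qed
  then have "is_cycle T vs" using len vs(4) unfolding is_cycle_def by blast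
  then show False using assms(1) by blast
qed

text \<open>
  The parent edges connect everything to \<open>r\<close>, so any other edge would close a
  cycle.
\<close>

lemma tree_parent_edges:
  assumes T: "tree T"
  shows "T = (\<lambda>v. {v, parent T {r} v}) ` (- {r})"
proof
  let ?P = "(\<lambda>v. {v, parent T {r} v}) ` (- {r})"
  have conn: "connected_graph T" and ac: "\<nexists>vs. is_cycle T vs" using T by (auto simp: tree_def)
  show sub: "?P \<subseteq> T" using parent(1)[OF conn, of "{r}"] by auto
  have reach: "(r, v) \<in> (adj ?P)\<^sup>* \<and> (v, r) \<in> (adj ?P)\<^sup>*" for v
  proof (induction "level T {r} v" arbitrary: v rule: less_induct)
    case less
    show ?case
    proof (cases "v = r")
      case False
      then have "{v, parent T {r} v} \<in> ?P" by blast
      then have e: "(v, parent T {r} v) \<in> adj ?P" "(parent T {r} v, v) \<in> adj ?P"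
        by (simp, simp add: insert_commute[of "parent T {r} v"])
      have "level T {r} (parent T {r} v) < level T {r} v"
        using parent(2)[OF conn, of "{r}" v] False by simp
      from less[OF this] show ?thesis
        using e by (meson converse_rtrancl_into_rtrancl rtrancl.rtrancl_into_rtrancl)
    qed simp
  qed
  show "T \<subseteq> ?P"
  proof
    fix e assume e: "e \<in> T"
    then have "card e = 2" using T unfolding tree_def by blast
    then obtain x y where xy: "e = {x, y}" "x \<noteq> y" by (auto simp: card_2_iff)
    show "e \<in> ?P"
    proof (rule ccontr)
      assume "e \<notin> ?P"
      then have "adj ?P \<subseteq> adj (T - {{x, y}})" using sub xy by auto
      then have "(adj ?P)\<^sup>* \<subseteq> (adj (T - {{x, y}}))\<^sup>*" by (rule rtrancl_mono)
      moreover have "(x, y) \<in> (adj ?P)\<^sup>*" using reach by (meson rtrancl_trans)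
      ultimately have "(x, y) \<in> (adj (T - {{x, y}}))\<^sup>*" by (rule subsetD)
      moreover have "(x, y) \<notin> (adj (T - {{x, y}}))\<^sup>*"
        using bridge_of_acyclic[OF ac, of x y] e xy by simp
      ultimately show False by blast
    qed
  qed
qed

lemma card_tree:
  fixes T :: "'v::finite set set"
  assumes "tree T" shows "card T = CARD('v) - 1"
proof -
  fix r :: 'v
  have "connected_graph T" using assms by (simp add: tree_def)
  from card_image[OF inj_parent_edge[OF this, of "{r}"]] show ?thesis
    using tree_parent_edges[OF assms, of r] by (simp add: card_Diff_subset Compl_eq_Diff_UNIV)
qed

text \<open>
  In a nonempty set \<open>U\<close> a vertex of lowest level has its parent outside
  \<open>U\<close> or is the root, so the edges inside \<open>U\<close> are parent edges of the
  other vertices.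
\<close>

lemma tree_sparse:
  fixes T :: "'v::finite set set"
  assumes T: "tree T" shows "sparse UNIV T"
  unfolding sparse_def
proof (intro allI impI)
  fix U :: "'v set" assume U: "U \<noteq> {}"
  fix r :: 'v
  have conn: "connected_graph T" using T by (simp add: tree_def)
  define u where "u = arg_min_on (level T {r}) U"
  have u: "u \<in> U" "\<And>v. v \<in> U \<Longrightarrow> level T {r} u \<le> level T {r} v"
    unfolding u_def using U arg_min_if_finite(1)[of U] arg_min_least[of U] by auto
  have "edges_in T U \<subseteq> (\<lambda>v. {v, parent T {r} v}) ` (U - {u})"
  proof
    fix e assume e: "e \<in> edges_in T U"
    then have "e \<in> T" "e \<subseteq> U" by (auto simp: edges_in_def)
    then obtain v where v: "v \<noteq> r" "e = {v, parent T {r} v}"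
      by (subst (asm) tree_parent_edges[OF T, of r]) auto
    have "v \<in> U" "parent T {r} v \<in> U" using v \<open>e \<subseteq> U\<close> by auto
    moreover have "v \<noteq> u" using u(2)[OF \<open>parent T {r} v \<in> U\<close>] parent(2)[OF conn, of "{r}" v] v by auto
    ultimately show "e \<in> (\<lambda>v. {v, parent T {r} v}) ` (U - {u})" using v by blast
  qed
  then have "card (edges_in T U) \<le> card (U - {u})"
    by (meson card_image_le card_mono finite finite_imageI le_trans)
  then show "card (edges_in T U) < card U"
    using u(1) by (metis card_Diff1_less finite le_less_trans)
qed

text \<open>
  If \<open>S\<close> spans a subtree, there are exactly as many edges outside \<open>S\<close>
  as parent edges. So every edge outside \<open>S\<close> goes up one level, and parents are
  unique.
\<close>

lemma level_in_tree:
  fixes T :: "'v::finite set set"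
  assumes T: "tree T" and S: "S \<noteq> {}" "Suc (card (edges_in T S)) = card S"
    and e: "{v, w} \<in> T" "\<not> {v, w} \<subseteq> S"
  shows "level T S v \<noteq> level T S w" "level T S w < level T S v \<Longrightarrow> v \<notin> S \<and> w = parent T S v"
proof -
  have conn: "connected_graph T" using T by (simp add: tree_def)
  let ?P = "(\<lambda>v. {v, parent T S v}) ` (- S)"
  have "?P \<subseteq> T - edges_in T S" using parent(1)[OF conn S(1)] by (auto simp: edges_in_def)
  moreover have "card ?P = card (T - edges_in T S)"
  proof -
    have "card ?P = card (- S)" by (rule card_image[OF inj_parent_edge[OF conn S(1)]])
    also have "\<dots> = CARD('v) - card S" by (simp add: card_Diff_subset Compl_eq_Diff_UNIV)
    also have "\<dots> = card T - card (edges_in T S)"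
      using card_tree[OF T] S(2) by linarith
    also have "\<dots> = card (T - edges_in T S)"
      by (rule card_Diff_subset[symmetric]) (auto simp: edges_in_def)
    finally show ?thesis .
  qed
  ultimately have "?P = T - edges_in T S" by (intro card_subset_eq) auto
  then have "{v, w} \<in> ?P" using e by (auto simp: edges_in_def)
  then obtain z where z: "z \<notin> S" "{v, w} = {z, parent T S z}" by auto
  then have "(v = z \<and> w = parent T S z) \<or> (w = z \<and> v = parent T S z)" by (auto simp: doubleton_eq_iff)
  then show "level T S v \<noteq> level T S w" "level T S w < level T S v \<Longrightarrow> v \<notin> S \<and> w = parent T S v"
    using parent(2)[OF conn S(1) z(1)] z(1) by auto
qed

lemma level_invariant:
  assumes h: "\<And>v. h (h v) = v" and T: "\<And>e. e \<in> T \<Longrightarrow> h ` e \<in> T" and S: "h ` S \<subseteq> S"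
  shows "level T S (h v) = level T S v"
proof -
  have step: "(h x, h y) \<in> adj T ^^ k" if "(x, y) \<in> adj T ^^ k" for x y k
    using that
  proof (induction k arbitrary: y)
    case (Suc k)
    then obtain z where "(x, z) \<in> adj T ^^ k" "{z, y} \<in> T" by auto
    then have "(h x, h z) \<in> adj T ^^ k" "{h z, h y} \<in> T" using Suc.IH T[of "{z, y}"] by auto
    then show ?case by auto
  qed simp
  have "(\<exists>s\<in>S. (s, h v) \<in> adj T ^^ k) \<longleftrightarrow> (\<exists>s\<in>S. (s, v) \<in> adj T ^^ k)" for k
  proof
    assume "\<exists>s\<in>S. (s, h v) \<in> adj T ^^ k"
    then obtain s where "s \<in> S" "(s, h v) \<in> adj T ^^ k" by blast
    then have "h s \<in> S" "(h s, v) \<in> adj T ^^ k" using S step[of s "h v" k] h by auto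
    then show "\<exists>s\<in>S. (s, v) \<in> adj T ^^ k" by blast
  next
    assume "\<exists>s\<in>S. (s, v) \<in> adj T ^^ k"
    then obtain s where "s \<in> S" "(s, v) \<in> adj T ^^ k" by blast
    then have "h s \<in> S" "(h s, h v) \<in> adj T ^^ k" using S step[of s v k] h by auto
    then show "\<exists>s\<in>S. (s, h v) \<in> adj T ^^ k" by blast
  qed
  then show ?thesis unfolding level_def by presburger
qed

text \<open>
  Take a fixed vertex as root. Levels are invariant, so no edge can be reversed, and parents of
  fixed vertices are fixed; the fixed edges are the parent edges of the fixed vertices other
  than the root.
\<close>

lemma tree_involution_fixed_vertex:
  fixes T :: "'v::finite set set"
  assumes T: "tree T" and h: "\<And>v. h (h v) = v" and hT: "\<And>e. e \<in> T \<Longrightarrow> h ` e \<in> T" and r: "h r = r"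
  shows "{v, h v} \<notin> T" "Suc (card {e \<in> T. h ` e = e}) = card {v. h v = v}"
proof -
  have conn: "connected_graph T" using T by (simp add: tree_def)
  have inv: "level T {r} (h v) = level T {r} v" for v
    by (rule level_invariant[OF h hT]) (use r in auto)
  have in0: "edges_in T {r} = {}"
  proof (rule ccontr)
    assume "edges_in T {r} \<noteq> {}"
    then obtain e where e: "e \<in> T" "e \<subseteq> {r}" by (auto simp: edges_in_def)
    then have "card e \<le> 1" by (metis card_mono finite is_singletonI is_singleton_altdef)
    then show False using T e(1) by (auto simp: tree_def)
  qed
  have S: "{r} \<noteq> {}" "Suc (card (edges_in T {r})) = card {r}" using in0 by simp_all
  have out: "\<not> e \<subseteq> {r}" if "e \<in> T" for e using in0 that by (auto simp: edges_in_def)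
  show norev: "{v, h v} \<notin> T" for v
  proof
    assume e: "{v, h v} \<in> T"
    show False using level_in_tree(1)[OF T S e out[OF e]] inv by simp
  qed
  have par: "h (parent T {r} v) = parent T {r} v" if v: "h v = v" "v \<noteq> r" for v
  proof -
    have "{v, parent T {r} v} \<in> T" using parent(1)[OF conn S(1), of v] v by simp
    from hT[OF this] have e: "{v, h (parent T {r} v)} \<in> T" using v by simp
    have "level T {r} (h (parent T {r} v)) < level T {r} v"
      unfolding inv using parent(2)[OF conn S(1), of v] v by simp
    from level_in_tree(2)[OF T S e out[OF e] this] show ?thesis by simp
  qed
  have "{e \<in> T. h ` e = e} = (\<lambda>v. {v, parent T {r} v}) ` ({v. h v = v} - {r})"
  proof (intro equalityI subsetI)
    fix e assume "e \<in> {e \<in> T. h ` e = e}"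
    then have e: "e \<in> T" "h ` e = e" by auto
    obtain v where v: "v \<noteq> r" "e = {v, parent T {r} v}"
      using e(1) by (subst (asm) tree_parent_edges[OF T, of r]) auto
    have "h v = v \<or> h v = parent T {r} v" using e(2) v(2) by auto
    then have "h v = v" using norev[of v] e(1) v(2) by auto
    then show "e \<in> (\<lambda>v. {v, parent T {r} v}) ` ({v. h v = v} - {r})" using v by blast
  next
    fix e assume "e \<in> (\<lambda>v. {v, parent T {r} v}) ` ({v. h v = v} - {r})"
    then obtain v where v: "h v = v" "v \<noteq> r" "e = {v, parent T {r} v}" by blast
    then show "e \<in> {e \<in> T. h ` e = e}" using par[OF v(1,2)] parent(1)[OF conn S(1), of v] by auto
  qed
  moreover have "inj_on (\<lambda>v. {v, parent T {r} v}) ({v. h v = v} - {r})"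
    by (rule inj_on_subset[OF inj_parent_edge[OF conn S(1)]]) auto
  ultimately have "card {e \<in> T. h ` e = e} = card ({v. h v = v} - {r})" by (simp add: card_image)
  then show "Suc (card {e \<in> T. h ` e = e}) = card {v. h v = v}"
    using card_Suc_Diff1[of "{v. h v = v}" r] r by (metis (mono_tags, lifting) finite mem_Collect_eq)
qed

text \<open>
  The number of edges is odd, so some edge is fixed. Measuring levels from this edge shows that
  there is no other, since a reversed edge would join two vertices of the same level.
\<close>

lemma tree_involution_free:
  fixes T :: "'v::finite set set"
  assumes T: "tree T" and h: "\<And>v. h (h v) = v" and hT: "\<And>e. e \<in> T \<Longrightarrow> h ` e \<in> T"
    and free: "\<And>v. h v \<noteq> v"
  shows "card {e \<in> T. h ` e = e} = 1"
proof -
  have hh: "h ` (h ` e) = e" for e unfolding image_image by (simp add: h)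
  have "even (CARD('v))"
    using even_card_involution[of "UNIV :: 'v set" h] h free by auto
  then have "odd (card T)" using card_tree[OF T]
    by (metis One_nat_def Suc_pred even_Suc zero_less_card_finite)
  moreover have "even (card (T - {e \<in> T. h ` e = e}))"
  proof (rule even_card_involution)
    fix e assume "e \<in> T - {e \<in> T. h ` e = e}"
    then show "h ` e \<in> T - {e \<in> T. h ` e = e} \<and> h ` (h ` e) = e \<and> h ` e \<noteq> e"
      using hT[of e] hh[of e] by auto
  qed auto
  ultimately have "{e \<in> T. h ` e = e} \<noteq> {}" by (metis Diff_empty)
  then obtain e where e: "e \<in> T" "h ` e = e" by auto
  have e': "card e = 2" using T e by (auto simp: tree_def)
  have "edges_in T e = {e}"
  proof (intro equalityI subsetI)
    fix f assume "f \<in> edges_in T e"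
    then have "f \<subseteq> e" "card f = 2" using T by (auto simp: edges_in_def tree_def)
    then show "f \<in> {e}" using e' by (metis card_subset_eq finite singletonI)
  qed (use e in \<open>auto simp: edges_in_def\<close>)
  then have S2: "Suc (card (edges_in T e)) = card e" unfolding e' by simp
  have S1: "e \<noteq> {}" using e' by (metis card.empty zero_neq_numeral)
  note S = S1 S2
  have "f = e" if f: "f \<in> T" "h ` f = f" for f
  proof (rule ccontr)
    assume "f \<noteq> e"
    have c2: "card f = 2" using T f by (auto simp: tree_def)
    then have "f \<noteq> {}" by auto
    then obtain v where "v \<in> f" by blast
    then have "h v \<in> f" using f by blast
    have "{v, h v} \<subseteq> f" "card {v, h v} = 2" using \<open>v \<in> f\<close> \<open>h v \<in> f\<close> free[of v] by auto
    then have fv: "f = {v, h v}" using c2 by (metis card_subset_eq finite)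
    have "\<not> f \<subseteq> e" using \<open>f \<noteq> e\<close> e' c2 by (metis card_subset_eq finite)
    moreover have "level T e (h v) = level T e v" by (rule level_invariant[OF h hT]) (use e in auto)
    ultimately show False using level_in_tree(1)[OF T S, of v "h v"] f fv by simp
  qed
  then have "{e \<in> T. h ` e = e} = {e}" using e by blast
  then show ?thesis by (metis is_singletonI is_singleton_altdef)
qed

text \<open>
  Together with the minimality of trees this characterizes spanning trees as the minimal
  connected spanning subgraphs, which is how they arise from isostatic frameworks.
\<close>

lemma cycle_edge_removable:
  assumes conn: "connected_graph T" and cyc: "is_cycle T vs"
  shows "\<exists>e\<in>T. connected_graph (T - {e})"
proof -
  define m where "m = length vs"
  have m: "m \<ge> 3" "distinct vs" and ed: "\<And>i. i < m \<Longrightarrow> {vs ! i, vs ! (Suc i mod m)} \<in> T"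
    using cyc unfolding is_cycle_def m_def by auto
  let ?e = "{vs ! 0, vs ! 1}"
  let ?H = "T - {?e}"
  have eT: "?e \<in> T" using ed[of 0] m by simp
  have ne: "vs ! i \<noteq> vs ! j" if "i < m" "j < m" "i \<noteq> j" for i j
    using that m(2) by (simp add: nth_eq_iff_index_eq m_def)
  have "sym (adj ?H)" by (auto simp: sym_def insert_commute)
  then have sym: "sym ((adj ?H)\<^sup>*)" by (rule sym_rtrancl)
  have up: "(vs ! 1, vs ! Suc i) \<in> (adj ?H)\<^sup>*" if "Suc i < m" for i
    using that
  proof (induction i)
    case (Suc i)
    have "{vs ! Suc i, vs ! Suc (Suc i)} \<in> T" using ed[of "Suc i"] Suc.prems by simp
    moreover have "vs ! 0 \<notin> {vs ! Suc i, vs ! Suc (Suc i)}"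
      using ne[of 0 "Suc i"] ne[of 0 "Suc (Suc i)"] Suc.prems by auto
    then have "{vs ! Suc i, vs ! Suc (Suc i)} \<noteq> ?e" by blast
    ultimately have "(vs ! Suc i, vs ! Suc (Suc i)) \<in> adj ?H" by simp
    then show ?case using Suc by (meson Suc_lessD rtrancl.rtrancl_into_rtrancl)
  qed simp
  have "{vs ! (m - 1), vs ! 0} \<in> T" using ed[of "m - 1"] m by simp
  moreover have "{vs ! (m - 1), vs ! 0} \<noteq> ?e"
    using ne[of "m - 1" 0] ne[of "m - 1" 1] m by (auto simp: doubleton_eq_iff)
  ultimately have "(vs ! (m - 1), vs ! 0) \<in> adj ?H" by simp
  moreover have "(vs ! 1, vs ! (m - 1)) \<in> (adj ?H)\<^sup>*" using up[of "m - 2"] m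
    by (simp add: numeral_2_eq_2 Suc_diff_Suc)
  ultimately have "(vs ! 1, vs ! 0) \<in> (adj ?H)\<^sup>*" by (rule rtrancl.rtrancl_into_rtrancl[rotated])
  then have ends: "(vs ! 1, vs ! 0) \<in> (adj ?H)\<^sup>*" "(vs ! 0, vs ! 1) \<in> (adj ?H)\<^sup>*"
    using sym by (auto dest: symD)
  have "adj T \<subseteq> (adj ?H)\<^sup>*"
  proof clarify
    fix x y assume xy: "{x, y} \<in> T"
    show "(x, y) \<in> (adj ?H)\<^sup>*"
    proof (cases "{x, y} = ?e")
      case True
      then show ?thesis using ends unfolding doubleton_eq_iff by auto
    next
      case False
      then show ?thesis using xy by (intro r_into_rtrancl) simp
    qed
  qed
  then have "(adj T)\<^sup>* \<subseteq> (adj ?H)\<^sup>*" by (rule rtrancl_subset_rtrancl)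
  then have "connected_graph ?H" using conn unfolding connected_graph_def by blast
  then show ?thesis using eT by blast
qed

lemma tree_minimal:
  fixes T :: "'v::finite set set"
  assumes T: "tree T" and H: "H \<subset> T" shows "\<not> connected_graph H"
proof
  assume conn: "connected_graph H"
  fix r :: 'v
  let ?P = "(\<lambda>v. {v, parent H {r} v}) ` (- {r})"
  have "CARD('v) - 1 = card ?P"
    using card_image[OF inj_parent_edge[OF conn, of "{r}"]]
    by (simp add: card_Diff_subset Compl_eq_Diff_UNIV)
  also have "\<dots> \<le> card H" using parent(1)[OF conn, of "{r}"] by (intro card_mono) auto
  also have "\<dots> < card T" using H by (intro psubset_card_mono) auto
  finally show False using card_tree[OF T] by simp
qed

section \<open>Norms whose unit ball is a parallelogram\<close>

definition face :: "(real^2 \<Rightarrow> real) \<Rightarrow> real^2 \<Rightarrow> (real^2) set" where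
  "face N c = {x. N x \<le> 1 \<and> c \<bullet> x = 1}"

lemma inner_plane: "(x :: real^2) \<bullet> y = x $ 1 * y $ 1 + x $ 2 * y $ 2"
  by (simp add: inner_vec_def sum_2)

lemma functional_unique:
  fixes c d u v :: "real^2"
  assumes "u \<noteq> v" "c \<bullet> u = 1" "c \<bullet> v = 1" "d \<bullet> u = 1" "d \<bullet> v = 1"
  shows "c = d"
proof -
  define D where "D = u $ 1 * v $ 2 - u $ 2 * v $ 1"
  have c: "c $ 1 * u $ 1 + c $ 2 * u $ 2 = 1" "c $ 1 * v $ 1 + c $ 2 * v $ 2 = 1"
    and d: "d $ 1 * u $ 1 + d $ 2 * u $ 2 = 1" "d $ 1 * v $ 1 + d $ 2 * v $ 2 = 1"
    using assms(2-5) by (simp_all add: inner_plane)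
  have "D \<noteq> 0"
  proof
    assume "D = 0"
    then have D0: "u $ 1 * v $ 2 = u $ 2 * v $ 1" by (simp add: D_def)
    have "v $ 1 = u $ 1" "v $ 2 = u $ 2" using c D0 by algebra+
    then show False using assms(1) by (simp add: vec_eq_iff forall_2)
  qed
  moreover have "D * (c $ 1 - d $ 1) = 0" "D * (c $ 2 - d $ 2) = 0"
    unfolding D_def using c d by algebra+
  ultimately show ?thesis by (simp add: vec_eq_iff forall_2)
qed

lemma facet_of_linear_image:
  fixes f :: "'a::euclidean_space \<Rightarrow> 'b::euclidean_space"
  assumes "linear f" "inj f"
  shows "f ` C facet_of f ` S \<longleftrightarrow> C facet_of S"
  unfolding facet_of_def using assms
  by (simp add: face_of_linear_image aff_dim_injective_linear_image)

text \<open>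
  The norm in terms of its two facet functionals \<open>a\<close> and \<open>b\<close>, with the
  dual basis \<open>e1\<close>, \<open>e2\<close>. The roles of the two functionals are
  symmetric, so that most statements are proved for \<open>a\<close> only.
\<close>

locale quad_norm =
  fixes N :: "real^2 \<Rightarrow> real" and a b e1 e2 :: "real^2"
  assumes N: "N x = max \<bar>a \<bullet> x\<bar> \<bar>b \<bullet> x\<bar>"
    and dual [simp]: "a \<bullet> e1 = 1" "a \<bullet> e2 = 0" "b \<bullet> e1 = 0" "b \<bullet> e2 = 1"
    and norm: "is_norm N"
    and facets: "facets N = face N ` {a, - a, b, - b}"

text \<open>
  Write the ball as an irredundant intersection of half planes $\{c \cdot x \le 1\}$; this
  normal form is possible as the origin is an interior point. The half planes correspond to the
  four facets, and the set of the functionals \<open>c\<close> is invariant under $-1$ because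
  the ball is. So there are two pairs $\pm a$, $\pm b$, and homogeneity turns the description of
  the ball into a formula for the norm.
\<close>

lemma quad_norm_exists:
  assumes norm: "is_norm N" and quad: "quadrilateral_ball N"
  shows "\<exists>a b e1 e2. quad_norm N a b e1 e2"
proof -
  let ?P = "unit_ball N"
  have N0: "N x = 0 \<longleftrightarrow> x = 0" and Nc: "N (r *\<^sub>R x) = \<bar>r\<bar> * N x" and Ntri: "N (x + y) \<le> N x + N y"
    and Npos: "N x \<ge> 0" for x y r
    using norm unfolding is_norm_def by auto
  have Nminus: "N (- x) = N x" for x using Nc[of "-1" x] by simp
  define K where "K = N (axis 1 1) + N (axis 2 1) + 1"
  have K: "K > 0" using Npos[of "axis 1 1"] Npos[of "axis 2 1"] by (simp add: K_def)
  have NK: "N x \<le> K * norm x" for x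
  proof -
    have "x = (x $ 1) *\<^sub>R axis 1 1 + (x $ 2) *\<^sub>R axis 2 1"
      by (simp add: vec_eq_iff forall_2 axis_def)
    then have "N x \<le> N ((x $ 1) *\<^sub>R axis 1 1) + N ((x $ 2) *\<^sub>R axis 2 1)" by (metis Ntri)
    also have "\<dots> = \<bar>x $ 1\<bar> * N (axis 1 1) + \<bar>x $ 2\<bar> * N (axis 2 1)" by (simp add: Nc)
    also have "\<dots> \<le> norm x * N (axis 1 1) + norm x * N (axis 2 1)"
      by (intro add_mono mult_right_mono component_le_norm_cart Npos)
    also have "\<dots> \<le> K * norm x" by (simp add: K_def algebra_simps)
    finally show ?thesis .
  qed
  have ball: "ball 0 (1 / K) \<subseteq> ?P"
  proof
    fix x :: "real^2" assume "x \<in> ball 0 (1 / K)"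
    then have "K * norm x < 1" using K by (simp add: field_simps)
    then show "x \<in> ?P" using NK[of x] by (simp add: unit_ball_def)
  qed
  then have int: "0 \<in> interior ?P" using K by (intro interiorI[of "ball 0 (1 / K)"]) auto
  then have aff: "affine hull ?P = UNIV" by (intro affine_hull_nonempty_interior) auto
  have dim: "aff_dim ?P = 2" using int aff_dim_nonempty_interior[of ?P] by auto
  have "polyhedron ?P" using quad by (simp add: quadrilateral_ball_def polytope_imp_polyhedron)
  then obtain H where H: "finite H" "?P = affine hull ?P \<inter> \<Inter>H"
      and Hab: "\<forall>h\<in>H. \<exists>a b. a \<noteq> 0 \<and> h = {x. a \<bullet> x \<le> b}"
      and Hmin: "\<And>F'. F' \<subset> H \<Longrightarrow> ?P \<subset> affine hull ?P \<inter> \<Inter>F'"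
    using polyhedron_Int_affine_minimal[of ?P] by auto
  then obtain \<alpha> \<beta> where ab: "\<And>h. h \<in> H \<Longrightarrow> \<alpha> h \<noteq> 0 \<and> h = {x. \<alpha> h \<bullet> x \<le> \<beta> h}" by metis
  have facet: "C facet_of ?P \<longleftrightarrow> (\<exists>h. h \<in> H \<and> C = ?P \<inter> {x. \<alpha> h \<bullet> x = \<beta> h})" for C
    by (rule facet_of_polyhedron_explicit[OF H ab Hmin])
  have \<beta>: "\<beta> h > 0" if h: "h \<in> H" for h
  proof -
    define x where "x = (1 / (2 * K * norm (\<alpha> h))) *\<^sub>R \<alpha> h"
    have "norm (\<alpha> h) > 0" using ab[OF h] by simp
    then have "norm x = 1 / (2 * K)" using K by (simp add: x_def)
    then have "x \<in> ?P" using ball K by (auto simp: subset_iff field_simps)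
    then have "x \<in> h" using H(2) h by blast
    then have "\<alpha> h \<bullet> x \<le> \<beta> h" using ab[OF h] by blast
    moreover have "\<alpha> h \<bullet> x > 0" unfolding x_def using ab[OF h] K by simp
    ultimately show ?thesis by simp
  qed
  define A where "A = (\<lambda>h. (1 / \<beta> h) *\<^sub>R \<alpha> h) ` H"
  have P: "x \<in> ?P \<longleftrightarrow> (\<forall>c\<in>A. c \<bullet> x \<le> 1)" for x
  proof -
    have "x \<in> ?P \<longleftrightarrow> (\<forall>h\<in>H. x \<in> h)" using H(2) aff by auto
    also have "\<dots> \<longleftrightarrow> (\<forall>h\<in>H. \<alpha> h \<bullet> x \<le> \<beta> h)" using ab by blast
    also have "\<dots> \<longleftrightarrow> (\<forall>c\<in>A. c \<bullet> x \<le> 1)" using \<beta> unfolding A_def by (simp add: field_simps)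
    finally show ?thesis .
  qed
  have fac: "facets N = face N ` A"
  proof -
    have eq: "?P \<inter> {x. \<alpha> h \<bullet> x = \<beta> h} = face N ((1 / \<beta> h) *\<^sub>R \<alpha> h)" if "h \<in> H" for h
      using \<beta>[OF that] by (auto simp: face_def unit_ball_def field_simps)
    have "facets N = (\<lambda>h. ?P \<inter> {x. \<alpha> h \<bullet> x = \<beta> h}) ` H" unfolding facets_def facet by blast
    then show ?thesis unfolding A_def image_image using eq by simp
  qed
  \<comment> \<open>A facet is one-dimensional, hence has two points, and these determine the functional.\<close>
  have two: "\<exists>u v. u \<noteq> v \<and> u \<in> face N c \<and> v \<in> face N c" if "c \<in> A" for c
  proof (rule ccontr)
    assume no: "\<not> ?thesis"
    have F: "face N c facet_of ?P" using fac that unfolding facets_def by blast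
    then have "aff_dim (face N c) = 1" "face N c \<noteq> {}" using dim by (auto simp: facet_of_def)
    moreover from this no obtain u where "face N c = {u}" by blast
    ultimately show False by simp
  qed
  have uniq: "c = d" if cd: "c \<in> A" "face N c \<subseteq> face N d" for c d
  proof -
    obtain u v where uv: "u \<noteq> v" "u \<in> face N c" "v \<in> face N c" using two[OF cd(1)] by blast
    then have "u \<in> face N d" "v \<in> face N d" using cd by auto
    then show ?thesis using functional_unique[OF uv(1), of c d] uv by (simp add: face_def)
  qed
  have neg: "- c \<in> A" if c: "c \<in> A" for c
  proof -
    have "uminus ` ?P = ?P"
    proof (intro equalityI subsetI)
      fix x assume "x \<in> ?P"
      then have "x = - (- x)" "- x \<in> ?P" by (auto simp: unit_ball_def Nminus)
      then show "x \<in> uminus ` ?P" by blast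
    qed (auto simp: unit_ball_def Nminus)
    moreover have "face N c facet_of ?P" using fac c unfolding facets_def by blast
    ultimately have "uminus ` face N c facet_of ?P"
      using facet_of_linear_image[of "uminus :: real^2 \<Rightarrow> real^2" "face N c" ?P]
      by (simp add: linear_uminus)
    then have "uminus ` face N c \<in> face N ` A" using fac unfolding facets_def by blast
    then obtain d where d: "d \<in> A" "uminus ` face N c = face N d" by blast
    have "face N c \<subseteq> face N (- d)"
    proof
      fix x assume x: "x \<in> face N c"
      then have "- x \<in> face N d" using d(2) by blast
      then show "x \<in> face N (- d)" by (simp add: face_def Nminus)
    qed
    then have "c = - d" by (rule uniq[OF c])
    then show ?thesis using d(1) by simp
  qed
  have nz: "c \<noteq> 0" if "c \<in> A" for c using two[OF that] by (auto simp: face_def)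
  have "inj_on (face N) A" by (rule inj_onI) (use uniq in blast)
  then have card: "card A = 4" using quad fac by (simp add: quadrilateral_ball_def card_image)
  then have finA: "finite A" using card.infinite by fastforce
  obtain a where a: "a \<in> A" using card by fastforce
  have "card {a, - a} \<le> 2" by (simp add: card_insert_if)
  then have "\<not> A \<subseteq> {a, - a}" using card card_mono[of "{a, - a}" A] by auto
  then obtain b where b: "b \<in> A" "b \<noteq> a" "b \<noteq> - a" by blast
  have "a \<noteq> - a" "b \<noteq> - b" using nz a b by (simp_all add: vec_eq_iff forall_2)
  moreover have "a \<noteq> b" "a \<noteq> - b" "- a \<noteq> b" "- a \<noteq> - b" using b by auto
  ultimately have "distinct [a, - a, b, - b]" by (simp only: distinct.simps list.set insert_iff empty_iff) simp
  then have "card {a, - a, b, - b} = 4" using distinct_card by fastforce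
  then have Aeq: "A = {a, - a, b, - b}"
    using a b neg card finA by (metis card_subset_eq empty_subsetI insert_subset)
  have Ple: "N x \<le> 1 \<longleftrightarrow> \<bar>a \<bullet> x\<bar> \<le> 1 \<and> \<bar>b \<bullet> x\<bar> \<le> 1" for x
    using P[of x] unfolding Aeq unit_ball_def by auto
  let ?M = "\<lambda>x. max \<bar>a \<bullet> x\<bar> \<bar>b \<bullet> x\<bar>"
  have scale: "N x \<le> r \<longleftrightarrow> ?M x \<le> r" if "r > 0" for r x
    using Ple[of "(1 / r) *\<^sub>R x"] that by (simp add: Nc field_simps abs_mult)
  have Neq: "N x = ?M x" for x
  proof (rule antisym)
    have "N x \<le> ?M x + e" if "e > 0" for e using scale[of "?M x + e" x] that by (smt (verit))
    then show "N x \<le> ?M x" by (rule field_le_epsilon)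
    have "?M x \<le> N x + e" if "e > 0" for e using scale[of "N x + e" x] that Npos[of x] by (smt (verit))
    then show "?M x \<le> N x" by (rule field_le_epsilon)
  qed
  \<comment> \<open>The functionals are independent as the norm of a common zero would vanish; the dual basis is given by the rule of Cramer.\<close>
  define D where "D = a $ 1 * b $ 2 - a $ 2 * b $ 1"
  have D: "D \<noteq> 0"
  proof
    assume D0: "D = 0"
    define x :: "real^2" where "x = vector [b $ 2, - (b $ 1)]"
    have "a \<bullet> x = 0" "b \<bullet> x = 0" using D0 by (simp_all add: x_def inner_plane D_def)
    then have "N x = 0" by (simp add: Neq)
    then have "x = 0" by (simp add: N0)
    then have "b = 0" by (simp add: x_def vec_eq_iff forall_2)
    then show False using nz b by blast
  qed
  define e1 :: "real^2" where "e1 = vector [b $ 2 / D, - (b $ 1) / D]"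
  define e2 :: "real^2" where "e2 = vector [- (a $ 2) / D, a $ 1 / D]"
  have "a \<bullet> e1 = D / D" "b \<bullet> e2 = D / D"
    unfolding e1_def e2_def diff_divide_distrib[symmetric]
    by (simp_all add: inner_plane diff_divide_distrib[symmetric]) (simp_all add: D_def mult.commute)
  moreover have "a \<bullet> e2 = 0" "b \<bullet> e1 = 0" unfolding e1_def e2_def by (simp_all add: inner_plane)
  ultimately have "a \<bullet> e1 = 1" "b \<bullet> e2 = 1" "a \<bullet> e2 = 0" "b \<bullet> e1 = 0" using D by simp_all
  then have "quad_norm N a b e1 e2"
    using Neq norm fac Aeq D by unfold_locales auto
  then show ?thesis by blast
qed

context quad_norm
begin

lemma flip_names: "quad_norm N b a e2 e1"
  using N norm facets by unfold_locales (auto simp: max.commute)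

lemma N_eq_0: "N x = 0 \<longleftrightarrow> x = 0" using norm by (simp add: is_norm_def)

lemma expand: "x = (a \<bullet> x) *\<^sub>R e1 + (b \<bullet> x) *\<^sub>R e2"
proof -
  have "N (x - ((a \<bullet> x) *\<^sub>R e1 + (b \<bullet> x) *\<^sub>R e2)) = 0"
    unfolding N by (simp add: inner_diff_right inner_add_right)
  then show ?thesis by (simp add: N_eq_0)
qed

lemma coord_eqI: "a \<bullet> x = a \<bullet> y \<Longrightarrow> b \<bullet> x = b \<bullet> y \<Longrightarrow> x = y"
  by (metis expand)

lemma uminus_face: "uminus ` face N c = face N (- c)"
proof -
  have "N (- x) = N x" for x unfolding N by simp
  then have "x \<in> face N (- c) \<longleftrightarrow> - x \<in> face N c" for x by (auto simp: face_def)
  then have "\<forall>y. y \<in> uminus ` face N c \<longleftrightarrow> y \<in> face N (- c)"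
    by (metis imageE imageI minus_minus)
  then show ?thesis unfolding set_eq_iff .
qed

lemma face_ne:
  assumes "\<bar>s\<bar> = 1" "\<bar>t\<bar> = 1"
  shows "face N (s *\<^sub>R a) \<noteq> face N (t *\<^sub>R b)"
proof -
  have "s *\<^sub>R e1 \<in> face N (s *\<^sub>R a)" "s *\<^sub>R e1 \<notin> face N (t *\<^sub>R b)"
    using assms by (auto simp: face_def N abs_if split: if_splits)
  then show ?thesis by blast
qed

text \<open>
  A unit vector lies on the facets of those functionals that attain the value one in absolute
  value; two of them do so at the vertices of the ball only.
\<close>

lemma unique_facet_iff:
  assumes "d \<noteq> 0"
  shows "(\<exists>!F. F \<in> facets N \<and> d /\<^sub>R N d \<in> F) \<longleftrightarrow> \<bar>a \<bullet> d\<bar> \<noteq> \<bar>b \<bullet> d\<bar>"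
proof -
  have pos: "N d > 0" using assms norm unfolding is_norm_def by (metis less_eq_real_def)
  define y where "y = d /\<^sub>R N d"
  have y: "a \<bullet> y = (a \<bullet> d) / N d" "b \<bullet> y = (b \<bullet> d) / N d" by (simp_all add: y_def field_simps)
  have Ny: "N y = 1" using pos y unfolding N[of y] by (simp add: N[of d] max_def) 
  have in_face: "y \<in> face N c \<longleftrightarrow> c \<bullet> y = 1" for c by (simp add: face_def Ny)
  have abs1: "max \<bar>a \<bullet> y\<bar> \<bar>b \<bullet> y\<bar> = 1" using Ny by (simp add: N)
  have "(\<exists>!F. F \<in> facets N \<and> y \<in> F) \<longleftrightarrow> \<bar>a \<bullet> y\<bar> \<noteq> \<bar>b \<bullet> y\<bar>"
  proof
    assume u: "\<exists>!F. F \<in> facets N \<and> y \<in> F"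
    show "\<bar>a \<bullet> y\<bar> \<noteq> \<bar>b \<bullet> y\<bar>"
    proof
      assume eq: "\<bar>a \<bullet> y\<bar> = \<bar>b \<bullet> y\<bar>"
      define s t where "s = a \<bullet> y" and "t = b \<bullet> y"
      have st: "\<bar>s\<bar> = 1" "\<bar>t\<bar> = 1" using eq abs1 by (auto simp: s_def t_def)
      have "s * s = 1" "t * t = 1" using st by (auto simp: abs_if split: if_splits)
      then have "y \<in> face N (s *\<^sub>R a)" "y \<in> face N (t *\<^sub>R b)" by (simp_all add: in_face s_def t_def)
      moreover have "face N (s *\<^sub>R a) \<in> facets N" "face N (t *\<^sub>R b) \<in> facets N"
        using st unfolding facets by (auto simp: abs_if split: if_splits)
      ultimately show False using u face_ne[OF st] by blast
    qed
  next
    assume "\<bar>a \<bullet> y\<bar> \<noteq> \<bar>b \<bullet> y\<bar>"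
    then have "(\<bar>a \<bullet> y\<bar> = 1 \<and> \<bar>b \<bullet> y\<bar> < 1) \<or> (\<bar>b \<bullet> y\<bar> = 1 \<and> \<bar>a \<bullet> y\<bar> < 1)" using abs1 by linarith
    then have "(a \<bullet> y = 1 \<and> \<bar>b \<bullet> y\<bar> < 1) \<or> (a \<bullet> y = -1 \<and> \<bar>b \<bullet> y\<bar> < 1) \<or>
      (b \<bullet> y = 1 \<and> \<bar>a \<bullet> y\<bar> < 1) \<or> (b \<bullet> y = -1 \<and> \<bar>a \<bullet> y\<bar> < 1)" by linarith
    then consider c where "c \<in> {a, - a, b, - b}" "c \<bullet> y = 1" "\<forall>c'\<in>{a, - a, b, - b}. c' \<bullet> y = 1 \<longrightarrow> c' = c"
      by fastforce
    then obtain c where c: "c \<in> {a, - a, b, - b}" "c \<bullet> y = 1"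
      and c': "\<And>c'. c' \<in> {a, - a, b, - b} \<Longrightarrow> c' \<bullet> y = 1 \<Longrightarrow> c' = c" by metis
    show "\<exists>!F. F \<in> facets N \<and> y \<in> F"
    proof (rule ex1I[of _ "face N c"])
      show "face N c \<in> facets N \<and> y \<in> face N c" unfolding facets in_face using c by blast
      fix F assume F: "F \<in> facets N \<and> y \<in> F"
      then obtain c1 where c1: "c1 \<in> {a, - a, b, - b}" "F = face N c1" unfolding facets by blast
      then have "c1 \<bullet> y = 1" using F in_face by metis
      then show "F = face N c" using c'[OF c1(1)] c1(2) by metis
    qed
  qed
  also have "\<dots> \<longleftrightarrow> \<bar>a \<bullet> d\<bar> \<noteq> \<bar>b \<bullet> d\<bar>" using pos by (simp add: y)
  finally show ?thesis by (simp add: y_def)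
qed

text \<open>
  A linear functional is determined by its values on a facet, because the facet of
  \<open>a\<close> contains $e_1 \pm e_2$.
\<close>

lemma facet_image_a:
  assumes "(*v) A ` face N a = face N d"
  shows "d \<bullet> (A *v x) = a \<bullet> x"
proof -
  have "e1 + e2 \<in> face N a" "e1 - e2 \<in> face N a"
    by (auto simp: face_def N inner_add_right inner_diff_right)
  then have "A *v (e1 + e2) \<in> face N d" "A *v (e1 - e2) \<in> face N d" using assms by blast+
  then have "d \<bullet> (A *v e1) = 1" "d \<bullet> (A *v e2) = 0"
    by (auto simp: face_def matrix_vector_right_distrib matrix_vector_mult_diff_distrib inner_add_right inner_diff_right)
  then have "d \<bullet> (A *v ((a \<bullet> x) *\<^sub>R e1 + (b \<bullet> x) *\<^sub>R e2)) = a \<bullet> x"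
    by (simp add: matrix_vector_right_distrib matrix_vector_mult_scaleR inner_add_right)
  then show ?thesis using expand[of x] by simp
qed


lemma facet_image_b:
  assumes "(*v) A ` face N b = face N d"
  shows "d \<bullet> (A *v x) = b \<bullet> x"
  using quad_norm.facet_image_a[OF flip_names assms] .

lemma facet_image_sign:
  "(*v) A ` face N a \<in> {face N d, face N (- d)} \<Longrightarrow> \<exists>s. \<bar>s\<bar> = 1 \<and> (\<forall>x. d \<bullet> (A *v x) = s * (a \<bullet> x))"
proof -
  assume "(*v) A ` face N a \<in> {face N d, face N (- d)}"
  then consider "(*v) A ` face N a = face N d" | "(*v) A ` face N a = face N (- d)" by auto
  then show ?thesis
  proof cases
    case 1
    from facet_image_a[OF 1] show ?thesis by (intro exI[of _ 1]) simp
  next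
    case 2
    have "d \<bullet> (A *v x) = -1 * (a \<bullet> x)" for x
      using facet_image_a[OF 2, of x] unfolding inner_minus_left by simp
    then show ?thesis by (intro exI[of _ "-1"]) simp
  qed
qed


lemma preserves_facets_coords:
  assumes "preserves_facets N A"
  shows "\<exists>s t. \<bar>s\<bar> = 1 \<and> \<bar>t\<bar> = 1 \<and> (\<forall>x. a \<bullet> (A *v x) = s * (a \<bullet> x) \<and> b \<bullet> (A *v x) = t * (b \<bullet> x))"
proof -
  have "(*v) A ` face N a \<in> {face N a, face N (- a)}" "(*v) A ` face N b \<in> {face N b, face N (- b)}"
    using bspec[OF assms[unfolded preserves_facets_def], of "face N a"]
      bspec[OF assms[unfolded preserves_facets_def], of "face N b"]
    by (simp_all add: facets facet_class_def uminus_face)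
  from facet_image_sign[OF this(1)] quad_norm.facet_image_sign[OF flip_names this(2)]
  show ?thesis by metis
qed

lemma swapping_coords:
  assumes "(*v) A ` face N a \<in> {face N b, face N (- b)}" "(*v) A ` face N b \<in> {face N a, face N (- a)}"
  shows "\<exists>s t. \<bar>s\<bar> = 1 \<and> \<bar>t\<bar> = 1 \<and> (\<forall>x. a \<bullet> (A *v x) = s * (b \<bullet> x) \<and> b \<bullet> (A *v x) = t * (a \<bullet> x))"
proof -
  from quad_norm.facet_image_sign[OF flip_names assms(2)] facet_image_sign[OF assms(1)]
  show ?thesis by metis
qed

lemma swaps_facets_coords:
  assumes "swaps_facets N A"
  shows "\<exists>s t. \<bar>s\<bar> = 1 \<and> \<bar>t\<bar> = 1 \<and> (\<forall>x. a \<bullet> (A *v x) = s * (b \<bullet> x) \<and> b \<bullet> (A *v x) = t * (a \<bullet> x))"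
proof -
  obtain F1 F2 where F: "facets N = facet_class F1 \<union> facet_class F2"
    "(*v) A ` F1 \<in> facet_class F2" "(*v) A ` F2 \<in> facet_class F1"
    using assms unfolding swaps_facets_def by blast
  have neg: "(*v) A ` (uminus ` F) = uminus ` ((*v) A ` F)" for F
    unfolding image_image by (simp add: vec.neg)
  have clneg: "facet_class (uminus ` F) = facet_class F" for F :: "(real^2) set"
    unfolding facet_class_def image_image by auto
  have clmem: "uminus ` F \<in> facet_class G" if "F \<in> facet_class G" for F G :: "(real^2) set"
    using that unfolding facet_class_def by (auto simp: image_image)
  have nn: "face N a \<noteq> face N b" "face N a \<noteq> face N (- b)" "face N (- a) \<noteq> face N b" "face N (- a) \<noteq> face N (- b)"
    using face_ne[of 1 1] face_ne[of 1 "-1"] face_ne[of "-1" 1] face_ne[of "-1" "-1"] by simp_all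
  have ca: "facet_class (face N a) = {face N a, face N (- a)}" and cb: "facet_class (face N b) = {face N b, face N (- b)}"
    unfolding facet_class_def uminus_face by auto
  have disj: "facet_class (face N a) \<inter> facet_class (face N b) = {}" unfolding ca cb using nn by auto
  have fac: "facets N = facet_class (face N a) \<union> facet_class (face N b)"
    unfolding facets facet_class_def uminus_face by auto
  have cl: "facet_class F = facet_class (face N c)" if "F \<in> facet_class (face N c)" for F c
    using that clneg unfolding facet_class_def by (auto simp: image_image)
  have self: "F \<in> facet_class F" for F :: "(real^2) set" by (simp add: facet_class_def)
  have c1: "facet_class F1 = facet_class (face N a) \<or> facet_class F1 = facet_class (face N b)"
    and c2: "facet_class F2 = facet_class (face N a) \<or> facet_class F2 = facet_class (face N b)"
    using F(1) fac cl self by blast+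
  have both: "(facet_class F1 = facet_class (face N a) \<and> facet_class F2 = facet_class (face N b)) \<or>
    (facet_class F1 = facet_class (face N b) \<and> facet_class F2 = facet_class (face N a))"
    using c1 c2 F(1) fac disj self by blast
  have img: "(*v) A ` F' \<in> facet_class G" if "(*v) A ` F \<in> facet_class G" "F' \<in> facet_class F" for F F' G
  proof -
    have "F' = F \<or> F' = uminus ` F" using that(2) by (simp add: facet_class_def)
    then show ?thesis using that(1) clmem neg by metis
  qed
  have "(*v) A ` face N a \<in> facet_class (face N b) \<and> (*v) A ` face N b \<in> facet_class (face N a)"
    using both
  proof
    assume "facet_class F1 = facet_class (face N a) \<and> facet_class F2 = facet_class (face N b)"
    then show ?thesis using img[OF F(2)] img[OF F(3)] self by metis
  next
    assume "facet_class F1 = facet_class (face N b) \<and> facet_class F2 = facet_class (face N a)"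
    then show ?thesis using img[OF F(2)] img[OF F(3)] self by metis
  qed
  then show ?thesis unfolding ca cb by (intro swapping_coords) auto
qed

lemma isometry_norm: "isometry N A \<Longrightarrow> N (A *v x) = N x"
  unfolding isometry_def by (metis diff_zero matrix_vector_mult_0_right)

lemma isometry_facet:
  assumes iso: "isometry N A" and F: "F \<in> facets N"
  shows "(*v) A ` F \<in> facets N"
proof -
  have lin: "linear ((*v) A)" by simp
  have "A *v x = 0 \<Longrightarrow> x = 0" for x using isometry_norm[OF iso, of x] N_eq_0 by metis
  then have inj: "inj ((*v) A)" using lin by (simp add: linear_injective_0)
  have surj: "surj ((*v) A)" by (rule linear_inj_imp_surj[OF lin inj])
  have "(*v) A ` unit_ball N = unit_ball N"
  proof (intro equalityI subsetI)
    fix y assume "y \<in> unit_ball N"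
    moreover obtain x where "y = A *v x" using surj by (metis surjD)
    ultimately show "y \<in> (*v) A ` unit_ball N" using isometry_norm[OF iso, of x] by (auto simp: unit_ball_def)
  qed (auto simp: unit_ball_def isometry_norm[OF iso])
  then show ?thesis using F facet_of_linear_image[OF lin inj, of F "unit_ball N"] by (simp add: facets_def)
qed

text \<open>
  An isometry permutes the facets. It cannot preserve a pair $\pm F$ of opposite facets, because
  its square would then fix the corresponding functional, but the square is $-1$.
\<close>

lemma quarter_turn_coords:
  assumes iso: "isometry N A" and q: "quarter_turn A"
  shows "\<exists>s t. \<bar>s\<bar> = 1 \<and> \<bar>t\<bar> = 1 \<and> (\<forall>x. a \<bullet> (A *v x) = s * (b \<bullet> x) \<and> b \<bullet> (A *v x) = t * (a \<bullet> x))"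
proof -
  have AA: "A *v (A *v x) = - x" for x
    using q unfolding quarter_turn_def matrix_vector_mul_assoc
    by (simp add: vec_eq_iff matrix_vector_mult_def forall_2 sum_2 mat_def)
  have fa: "(*v) A ` face N a \<in> face N ` {a, - a, b, - b}" and fb: "(*v) A ` face N b \<in> face N ` {a, - a, b, - b}"
    using isometry_facet[OF iso] facets by blast+
  have noa: False if "(*v) A ` face N a = face N d" "d = a \<or> d = - a" for d
  proof -
    have "d \<bullet> (A *v (A *v e1)) = a \<bullet> (A *v e1)" "d \<bullet> (A *v e1) = a \<bullet> e1" using facet_image_a[OF that(1)] by auto
    then show False using that(2) by (auto simp: AA)
  qed
  have nob: False if "(*v) A ` face N b = face N d" "d = b \<or> d = - b" for d
  proof -
    have "d \<bullet> (A *v (A *v e2)) = b \<bullet> (A *v e2)" "d \<bullet> (A *v e2) = b \<bullet> e2" using facet_image_b[OF that(1)] by auto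
    then show False using that(2) by (auto simp: AA)
  qed
  show ?thesis by (rule swapping_coords) (use fa fb noa nob in blast)+
qed

end

section \<open>Rigidity in a parallelogram norm\<close>

text \<open>
  The edges whose length is measured by the functional \<open>a\<close>. Exchanging
  \<open>a\<close> and \<open>b\<close> gives the other colour.
\<close>

definition dominant :: "real^2 \<Rightarrow> real^2 \<Rightarrow> (real^2)^'v \<Rightarrow> 'v::finite set set \<Rightarrow> 'v set set" where
  "dominant a b p H = {e \<in> H. \<exists>v w. e = {v, w} \<and> \<bar>b \<bullet> (p $ v - p $ w)\<bar> < \<bar>a \<bullet> (p $ v - p $ w)\<bar>}"

lemma dominant_iff:
  "{v, w} \<in> dominant a b p H \<longleftrightarrow> {v, w} \<in> H \<and> \<bar>b \<bullet> (p $ v - p $ w)\<bar> < \<bar>a \<bullet> (p $ v - p $ w)\<bar>"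
proof -
  have "\<bar>c \<bullet> (p $ w - p $ v)\<bar> = \<bar>c \<bullet> (p $ v - p $ w)\<bar>" for c
    by (simp add: inner_diff_right abs_minus_commute)
  then show ?thesis unfolding dominant_def by (auto simp: doubleton_eq_iff)
qed

text \<open>
  Well-positioned frameworks, in coordinates.
\<close>

definition unambiguous :: "real^2 \<Rightarrow> real^2 \<Rightarrow> (real^2)^'v \<Rightarrow> 'v::finite set set \<Rightarrow> bool" where
  "unambiguous a b p H \<longleftrightarrow> (\<forall>v w. {v, w} \<in> H \<longrightarrow> \<bar>a \<bullet> (p $ v - p $ w)\<bar> \<noteq> \<bar>b \<bullet> (p $ v - p $ w)\<bar>)"

lemma unambiguous_commute: "unambiguous a b p H \<longleftrightarrow> unambiguous b a p H"
  unfolding unambiguous_def by metis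

lemma unambiguous_subset: "unambiguous a b p H \<Longrightarrow> H' \<subseteq> H \<Longrightarrow> unambiguous a b p H'"
  unfolding unambiguous_def by blast

lemma unambiguousD:
  "unambiguous a b p H \<Longrightarrow> {v, w} \<in> H \<Longrightarrow> {v, w} \<in> dominant a b p H \<or> {v, w} \<in> dominant b a p H"
  unfolding unambiguous_def dominant_iff by (meson linorder_neqE)

lemma has_derivative_cart:
  fixes f :: "'a::real_normed_vector \<Rightarrow> real^'n"
  assumes "\<And>i. ((\<lambda>x. f x $ i) has_derivative (\<lambda>h. f' h $ i)) (at x)"
  shows "(f has_derivative f') (at x)"
  unfolding has_derivative_componentwise_within[of f f' x UNIV]
  using assms by (auto simp: Basis_vec_def inner_axis)

context quad_norm
begin

text \<open>
  Near a well-positioned edge the norm coincides with one of the functionals up to sign.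
\<close>

lemma length_derivative:
  fixes p :: "(real^2)^'v::finite"
  assumes "\<bar>b \<bullet> (p $ v - p $ w)\<bar> < \<bar>a \<bullet> (p $ v - p $ w)\<bar>"
  shows "\<exists>s. s \<noteq> 0 \<and> ((\<lambda>x. N (x $ v - x $ w)) has_derivative (\<lambda>u. s * (a \<bullet> (u $ v - u $ w)))) (at p)"
proof -
  define s where "s = sgn (a \<bullet> (p $ v - p $ w))"
  let ?f = "\<lambda>x::(real^2)^'v. s * (a \<bullet> (x $ v - x $ w))"
  have nz: "a \<bullet> (p $ v - p $ w) \<noteq> 0" using assms by auto
  have s: "\<bar>s\<bar> = 1" using nz by (simp add: s_def)
  have fp: "?f p = \<bar>a \<bullet> (p $ v - p $ w)\<bar>" by (simp add: s_def sgn_mult_abs abs_sgn mult.commute)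
  define U where "U = {x :: (real^2)^'v. \<bar>b \<bullet> (x $ v - x $ w)\<bar> < ?f x}"
  have 1: "open U" unfolding U_def by (intro open_Collect_less continuous_intros)
  have 2: "p \<in> U" unfolding U_def using assms fp by auto
  have 3: "(?f has_derivative ?f) (at p)"
    by (intro bounded_linear_imp_has_derivative linear_conv_bounded_linear[THEN iffD1] linearI)
      (simp_all add: inner_diff_right inner_add_right algebra_simps)
  have 4: "?f x = N (x $ v - x $ w)" if "x \<in> U" for x
  proof -
    have "\<bar>?f x\<bar> = \<bar>a \<bullet> (x $ v - x $ w)\<bar>" using s by (simp add: abs_mult)
    moreover have "?f x > 0" using that unfolding U_def by auto
    ultimately show ?thesis using that unfolding N U_def by (auto simp: max_def)
  qed
  have "((\<lambda>x. N (x $ v - x $ w)) has_derivative ?f) (at p)"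
    by (rule has_derivative_transform_within_open[OF 3 1 2 4])
  then show ?thesis using s by (intro exI[of _ s]) auto
qed


text \<open>
  The constraints decouple: edges of the first colour only see the \<open>a\<close>-coordinate
  of the velocities, those of the second only the \<open>b\<close>-coordinate.
\<close>

lemma infinitesimal_flex_iff:
  fixes p u :: "(real^2)^'v::finite"
  assumes H: "simple_graph H" and wp: "unambiguous a b p H"
  shows "infinitesimal_flex N H p u \<longleftrightarrow>
    (\<forall>v w. {v, w} \<in> dominant a b p H \<longrightarrow> a \<bullet> u $ v = a \<bullet> u $ w) \<and>
    (\<forall>v w. {v, w} \<in> dominant b a p H \<longrightarrow> b \<bullet> u $ v = b \<bullet> u $ w)"
proof -
  define C where "C c d e u \<longleftrightarrow> (\<forall>v w. e = {v, w} \<longrightarrow> e \<in> dominant c d p H \<longrightarrow> c \<bullet> u $ v = c \<bullet> u $ w)"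
    for c d e and u :: "(real^2)^'v"
  have "\<exists>D. ((\<lambda>x. rigidity_map N H x $ e) has_derivative D) (at p) \<and> (\<forall>u. D u = 0 \<longleftrightarrow> C a b e u \<and> C b a e u)" for e
  proof (cases "e \<in> H")
    case False
    then show ?thesis
      by (intro exI[of _ "\<lambda>_. 0"]) (auto simp: rigidity_map_def C_def dominant_def)
  next
    case True
    then have "card e = 2" using H by (simp add: simple_graph_def)
    then obtain v w where e: "e = {v, w}" by (auto simp: card_2_iff)
    have rm: "(\<lambda>x. rigidity_map N H x $ e) = (\<lambda>x. N (x $ v - x $ w))"
      using True norm by (simp add: rigidity_map_def e edge_length_doubleton)
    have CC: "C c d e u \<longleftrightarrow> (\<bar>d \<bullet> (p $ v - p $ w)\<bar> < \<bar>c \<bullet> (p $ v - p $ w)\<bar> \<longrightarrow> c \<bullet> (u $ v - u $ w) = 0)" for c d u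
      unfolding C_def e dominant_iff using True e by (auto simp: doubleton_eq_iff inner_diff_right)
    consider "\<bar>b \<bullet> (p $ v - p $ w)\<bar> < \<bar>a \<bullet> (p $ v - p $ w)\<bar>" | "\<bar>a \<bullet> (p $ v - p $ w)\<bar> < \<bar>b \<bullet> (p $ v - p $ w)\<bar>"
      using unambiguousD[OF wp, of v w] True e unfolding dominant_iff by blast
    then show ?thesis
    proof cases
      case 1
      from length_derivative[OF 1] show ?thesis unfolding rm CC using 1 by auto
    next
      case 2
      from quad_norm.length_derivative[OF flip_names 2] show ?thesis unfolding rm CC using 2 by auto
    qed
  qed
  then obtain D where D: "\<And>e. ((\<lambda>x. rigidity_map N H x $ e) has_derivative D e) (at p)"
    "\<And>e u. D e u = 0 \<longleftrightarrow> C a b e u \<and> C b a e u" by metis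
  have "(rigidity_map N H has_derivative (\<lambda>u. \<chi> e. D e u)) (at p)"
    by (rule has_derivative_cart) (simp add: D(1))
  then have "frechet_derivative (rigidity_map N H) (at p) = (\<lambda>u. \<chi> e. D e u)"
    by (rule frechet_derivative_at[symmetric])
  then have "infinitesimal_flex N H p u \<longleftrightarrow> (\<forall>e. C a b e u \<and> C b a e u)"
    unfolding infinitesimal_flex_def by (simp add: vec_eq_iff D(2))
  then show ?thesis unfolding C_def by blast
qed

text \<open>
  At first the \<open>a\<close>-coordinate keeps dominating by continuity, so the preserved norm
  is its absolute value, and its sign cannot jump.
\<close>

lemma motion_keeps_coordinate:
  assumes m: "rigid_motion N \<delta> \<alpha>" and dom: "\<bar>b \<bullet> (x - z)\<bar> < \<bar>a \<bullet> (x - z)\<bar>"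
  shows "\<forall>\<^sub>F t in at 0. a \<bullet> (\<alpha> x t - \<alpha> z t) = a \<bullet> (x - z)"
proof -
  have \<delta>: "\<delta> > 0" and \<alpha>0: "\<And>y. \<alpha> y 0 = y"
    and pres: "\<And>t. t \<in> {-\<delta><..<\<delta>} \<Longrightarrow> N (\<alpha> x t - \<alpha> z t) = N (x - z)"
    using m unfolding rigid_motion_def by auto
  have "isCont (\<alpha> y) 0" for y
    using m \<delta> continuous_on_eq_continuous_at[of "{-\<delta><..<\<delta>}" "\<alpha> y"] unfolding rigid_motion_def by auto
  then have lim: "((\<lambda>t. c \<bullet> (\<alpha> x t - \<alpha> z t)) \<longlongrightarrow> c \<bullet> (x - z)) (at 0)" for c
    unfolding isCont_def \<alpha>0 by (intro tendsto_intros)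
  let ?f = "\<lambda>t. a \<bullet> (\<alpha> x t - \<alpha> z t)" and ?g = "\<lambda>t. b \<bullet> (\<alpha> x t - \<alpha> z t)"
  let ?r = "\<bar>a \<bullet> (x - z)\<bar>"
  have "\<forall>\<^sub>F t in at 0. t \<in> {-\<delta><..<\<delta>}" using \<delta> by (intro eventually_at_in_open') auto
  moreover have "\<forall>\<^sub>F t in at 0. \<bar>?g t\<bar> < ?r"
    using tendsto_rabs[OF lim[of b]] dom by (rule order_tendstoD(2))
  moreover have "\<forall>\<^sub>F t in at 0. \<bar>?f t - a \<bullet> (x - z)\<bar> < ?r"
    using tendstoD[OF lim[of a], of ?r] dom by (simp add: dist_real_def)
  ultimately show ?thesis
  proof eventually_elim
    case (elim t)
    have "max \<bar>?f t\<bar> \<bar>?g t\<bar> = ?r" using pres[OF elim(1)] dom unfolding N by (simp add: max_def)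
    then have "\<bar>?f t\<bar> = ?r" using elim(2) by (auto simp: max_def split: if_splits)
    then show "?f t = a \<bullet> (x - z)" using elim(3) by linarith
  qed
qed

text \<open>
  Two arbitrary points are compared with a third one, far away in the direction of
  \<open>e1\<close>, for which the \<open>a\<close>-coordinate dominates both differences.
\<close>

lemma motion_derivative:
  assumes m: "rigid_motion N \<delta> \<alpha>"
    and "(\<alpha> x has_vector_derivative u) (at 0)" "(\<alpha> y has_vector_derivative w) (at 0)"
  shows "a \<bullet> u = a \<bullet> w"
proof -
  define M where "M = \<bar>a \<bullet> (x - y)\<bar> + \<bar>b \<bullet> (x - y)\<bar> + 1"
  define z where "z = x + M *\<^sub>R e1"
  have z: "a \<bullet> (x - z) = - M" "b \<bullet> (x - z) = 0" "a \<bullet> (y - z) = - (a \<bullet> (x - y)) - M" "b \<bullet> (y - z) = - (b \<bullet> (x - y))"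
    by (simp_all add: z_def inner_diff_right inner_add_right)
  have "\<bar>b \<bullet> (x - z)\<bar> < \<bar>a \<bullet> (x - z)\<bar>" "\<bar>b \<bullet> (y - z)\<bar> < \<bar>a \<bullet> (y - z)\<bar>"
    unfolding z by (simp_all add: M_def)
  from motion_keeps_coordinate[OF m this(1)] motion_keeps_coordinate[OF m this(2)]
  have ev: "\<forall>\<^sub>F t in at 0. a \<bullet> (\<alpha> x t - \<alpha> y t) = a \<bullet> (x - y)"
    by eventually_elim (simp add: inner_diff_right)
  have d: "((\<lambda>t. a \<bullet> (\<alpha> x t - \<alpha> y t)) has_vector_derivative a \<bullet> (u - w)) (at 0)"
    by (intro bounded_linear.has_vector_derivative[OF bounded_linear_inner_right] has_vector_derivative_diff assms)
  have "((\<lambda>t. a \<bullet> (x - y)) has_vector_derivative a \<bullet> (u - w)) (at 0)"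
    using d unfolding has_vector_derivative_def
    by (rule has_derivative_transform_eventually) (use ev m in \<open>simp_all add: rigid_motion_def\<close>)
  then have "a \<bullet> (u - w) = 0" using vector_derivative_unique_at has_vector_derivative_const by blast
  then show ?thesis by (simp add: inner_diff_right)
qed


text \<open>
  To first order, every continuous rigid motion is a translation.
\<close>

lemma trivial_flex_iff: "trivial_flex N p u \<longleftrightarrow> (\<forall>v w. u $ v = u $ w)"
proof
  assume "trivial_flex N p u"
  then obtain \<delta> \<alpha> where m: "rigid_motion N \<delta> \<alpha>" "\<And>v. (\<alpha> (p $ v) has_vector_derivative u $ v) (at 0)"
    unfolding trivial_flex_def by blast
  have "a \<bullet> u $ v = a \<bullet> u $ w" "b \<bullet> u $ v = b \<bullet> u $ w" for v w
    using motion_derivative[OF m(1) m(2) m(2)] quad_norm.motion_derivative[OF flip_names m(1) m(2) m(2)] by blast+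
  then show "\<forall>v w. u $ v = u $ w" using coord_eqI by blast
next
  assume c: "\<forall>v w. u $ v = u $ w"
  fix v0 :: 'a
  have "rigid_motion N 1 (\<lambda>x t. x + t *\<^sub>R u $ v0)"
    unfolding rigid_motion_def by (auto intro!: continuous_intros)
  moreover have "((\<lambda>t. p $ v + t *\<^sub>R u $ v0) has_vector_derivative u $ v) (at 0)" for v
    using c by (auto intro!: derivative_eq_intros simp: has_vector_derivative_def)
  ultimately show "trivial_flex N p u" unfolding trivial_flex_def by blast
qed

text \<open>
  If the edges of one colour leave the graph disconnected, a component can be moved along
  \<open>e1\<close>, a direction that the edges of the other colour do not notice.
\<close>

lemma infinitesimally_rigid_connected:
  fixes p :: "(real^2)^'v::finite"
  assumes H: "simple_graph H" and wp: "unambiguous a b p H"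
    and rigid: "infinitesimally_rigid N H p"
  shows "connected_graph (dominant a b p H)"
  unfolding connected_graph_def
proof (intro allI)
  fix x y
  let ?R = "(adj (dominant a b p H))\<^sup>*"
  define u :: "(real^2)^'v" where "u = (\<chi> v. if (x, v) \<in> ?R then e1 else 0)"
  have "infinitesimal_flex N H p u"
    unfolding infinitesimal_flex_iff[OF H wp]
  proof (intro conjI allI impI)
    fix v w assume vw: "{v, w} \<in> dominant a b p H"
    then have "(v, w) \<in> adj (dominant a b p H)" "(w, v) \<in> adj (dominant a b p H)"
      by (simp_all add: insert_commute)
    then have "(x, v) \<in> ?R \<longleftrightarrow> (x, w) \<in> ?R" by (meson rtrancl.rtrancl_into_rtrancl)
    then show "a \<bullet> u $ v = a \<bullet> u $ w" by (simp add: u_def)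
  qed (auto simp: u_def)
  then have "u $ x = u $ y" using rigid trivial_flex_iff unfolding infinitesimally_rigid_def by blast
  moreover have "e1 \<noteq> 0" using dual(1) by (metis inner_zero_right zero_neq_one)
  ultimately show "(x, y) \<in> ?R" unfolding u_def by (auto split: if_splits)
qed

lemma connected_constant:
  assumes "connected_graph H" "\<And>v w. {v, w} \<in> H \<Longrightarrow> f v = f w"
  shows "f v = f w"
proof -
  have "(v, w) \<in> (adj H)\<^sup>*" using assms(1) unfolding connected_graph_def by blast
  then show ?thesis by (induction rule: rtrancl_induct) (use assms(2) in auto)
qed

lemma infinitesimally_rigid_iff:
  fixes p :: "(real^2)^'v::finite"
  assumes H: "simple_graph H" and wp: "unambiguous a b p H"
  shows "infinitesimally_rigid N H p \<longleftrightarrow>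
    connected_graph (dominant a b p H) \<and> connected_graph (dominant b a p H)"
proof
  assume "infinitesimally_rigid N H p"
  then show "connected_graph (dominant a b p H) \<and> connected_graph (dominant b a p H)"
    using infinitesimally_rigid_connected[OF H wp] quad_norm.infinitesimally_rigid_connected[OF flip_names H]
      wp unambiguous_commute by blast
next
  assume c: "connected_graph (dominant a b p H) \<and> connected_graph (dominant b a p H)"
  show "infinitesimally_rigid N H p"
    unfolding infinitesimally_rigid_def trivial_flex_iff infinitesimal_flex_iff[OF H wp]
  proof (intro allI impI)
    fix u v w
    assume u: "(\<forall>v w. {v, w} \<in> dominant a b p H \<longrightarrow> a \<bullet> u $ v = a \<bullet> u $ w) \<and>
      (\<forall>v w. {v, w} \<in> dominant b a p H \<longrightarrow> b \<bullet> u $ v = b \<bullet> u $ w)"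
    have "a \<bullet> u $ v = a \<bullet> u $ w" by (rule connected_constant[OF conjunct1[OF c]]) (use u in blast)
    moreover have "b \<bullet> u $ v = b \<bullet> u $ w" by (rule connected_constant[OF conjunct2[OF c]]) (use u in blast)
    ultimately show "u $ v = u $ w" by (rule coord_eqI)
  qed
qed

lemma no_removable_edge:
  fixes p :: "(real^2)^'v::finite"
  assumes E: "simple_graph E" and wp: "unambiguous a b p E"
    and iso: "isostatic N E p"
  shows "\<nexists>vs. is_cycle (dominant a b p E) vs"
proof
  have conn: "connected_graph (dominant a b p E)" "connected_graph (dominant b a p E)"
    using iso infinitesimally_rigid_iff[OF E wp] unfolding isostatic_def by auto
  assume "\<exists>vs. is_cycle (dominant a b p E) vs"
  then obtain e where e: "e \<in> dominant a b p E" "connected_graph (dominant a b p E - {e})"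
    using cycle_edge_removable[OF conn(1)] by blast
  let ?H = "E - {e}"
  have "e \<in> E" using e(1) by (simp add: dominant_def)
  moreover have "card e = 2" using E \<open>e \<in> E\<close> by (simp add: simple_graph_def)
  then obtain v w where vw: "e = {v, w}" by (auto simp: card_2_iff)
  ultimately have "e \<notin> dominant b a p E" using e(1) unfolding vw dominant_iff by linarith
  then have "dominant b a p ?H = dominant b a p E" by (auto simp: dominant_def)
  moreover have "dominant a b p ?H = dominant a b p E - {e}" by (auto simp: dominant_def)
  moreover have "simple_graph ?H" using E by (simp add: simple_graph_def)
  ultimately have "infinitesimally_rigid N ?H p"
    using infinitesimally_rigid_iff[of ?H p] unambiguous_subset[OF wp, of ?H] e(2) conn(2) by auto
  moreover have "?H \<subset> E" using \<open>e \<in> E\<close> by blast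
  ultimately show False using iso unfolding isostatic_def by blast
qed

text \<open>
  Infinitesimal rigidity means that both colours are connected, so minimality means that both
  are spanning trees.
\<close>

lemma isostatic_iff_trees:
  fixes p :: "(real^2)^'v::finite"
  assumes E: "simple_graph E" and wp: "unambiguous a b p E"
  shows "isostatic N E p \<longleftrightarrow> tree (dominant a b p E) \<and> tree (dominant b a p E)"
proof
  assume iso: "isostatic N E p"
  have "\<nexists>vs. is_cycle (dominant b a p E) vs"
    by (rule quad_norm.no_removable_edge[OF flip_names E wp[unfolded unambiguous_commute[of a]] iso])
  moreover have "connected_graph (dominant a b p E)" "connected_graph (dominant b a p E)"
    using iso infinitesimally_rigid_iff[OF E wp] unfolding isostatic_def by auto
  moreover have "\<forall>e\<in>dominant c d p E. card e = 2" for c d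
    using E by (auto simp: simple_graph_def dominant_def)
  ultimately show "tree (dominant a b p E) \<and> tree (dominant b a p E)"
    using no_removable_edge[OF E wp iso] unfolding tree_def by blast
next
  assume T: "tree (dominant a b p E) \<and> tree (dominant b a p E)"
  show "isostatic N E p"
    unfolding isostatic_def
  proof (intro conjI allI impI)
    show "infinitesimally_rigid N E p" using T infinitesimally_rigid_iff[OF E wp] by (simp add: tree_def)
    fix H assume H: "H \<subset> E"
    have sub: "dominant a b p H \<subseteq> dominant a b p E" "dominant b a p H \<subseteq> dominant b a p E"
      using H by (auto simp: dominant_def)
    show "\<not> infinitesimally_rigid N H p"
    proof
      assume "infinitesimally_rigid N H p"
      moreover have "simple_graph H" using H E by (auto simp: simple_graph_def)
      ultimately have "connected_graph (dominant a b p H)" "connected_graph (dominant b a p H)"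
        using infinitesimally_rigid_iff[of H p] unambiguous_subset[OF wp, of H] H by auto
      then have eq: "dominant a b p H = dominant a b p E" "dominant b a p H = dominant b a p E"
        using tree_minimal T sub by (metis psubsetI)+
      obtain e where e: "e \<in> E" "e \<notin> H" using H by blast
      then have "card e = 2" using E by (simp add: simple_graph_def)
      then obtain v w where vw: "e = {v, w}" by (auto simp: card_2_iff)
      have "e \<in> dominant a b p E \<or> e \<in> dominant b a p E"
        using unambiguousD[OF wp] e(1) unfolding vw by blast
      then have "e \<in> H" unfolding eq[symmetric] by (auto simp: dominant_def)
      then show False using e by blast
    qed
  qed
qed

lemma well_positioned_iff:
  fixes p :: "(real^2)^'v::finite"
  assumes E: "simple_graph E" and p: "placement p"
  shows "well_positioned N E p \<longleftrightarrow> unambiguous a b p E"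
proof -
  have "p $ v - p $ w \<noteq> 0" if "{v, w} \<in> E" for v w
  proof -
    have "card {v, w} = 2" using E that by (simp add: simple_graph_def)
    then have "v \<noteq> w" by auto
    then show ?thesis using p by (auto simp: placement_def inj_def)
  qed
  then show ?thesis unfolding well_positioned_def unambiguous_def using unique_facet_iff by metis
qed

end

section \<open>Drawing symmetric pairs of spanning trees\<close>

text \<open>
  Both trees have the same number of fixed edges: one each if no vertex is fixed, and otherwise
  one less than the number of fixed vertices. Two fixed edges in total together with a fixed
  vertex would mean that exactly two vertices are fixed, and these would be joined in both
  trees.
\<close>

lemma disjoint_trees_fixed_edges:
  fixes T1 T2 :: "'v::finite set set"
  assumes T: "tree T1" "tree T2" "T1 \<inter> T2 = {}"
    and h: "\<And>v. h (h v) = v" and hT: "\<And>e. e \<in> T1 \<Longrightarrow> h ` e \<in> T1" "\<And>e. e \<in> T2 \<Longrightarrow> h ` e \<in> T2"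
  shows "fixed_edges (T1 \<union> T2) h = {} \<Longrightarrow> card {v. h v = v} = 1"
    and "card (fixed_edges (T1 \<union> T2) h) = 2 \<Longrightarrow> h v \<noteq> v"
    and "card {v. h v = v} \<le> 1 \<Longrightarrow> fixed_edges (T1 \<union> T2) h = {} \<or> card (fixed_edges (T1 \<union> T2) h) = 2"
proof -
  let ?f1 = "{e \<in> T1. h ` e = e}" and ?f2 = "{e \<in> T2. h ` e = e}"
  have split: "fixed_edges (T1 \<union> T2) h = ?f1 \<union> ?f2" by (auto simp: fixed_edges_def)
  have card_split: "card (fixed_edges (T1 \<union> T2) h) = card ?f1 + card ?f2"
    unfolding split using T(3) by (intro card_Un_disjoint) auto
  have free: "card ?f1 = 1 \<and> card ?f2 = 1" if "\<And>v. h v \<noteq> v"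
    using tree_involution_free[of T1 h, OF T(1) h hT(1) that] tree_involution_free[of T2 h, OF T(2) h hT(2) that] by simp
  have nonfree: "Suc (card ?f1) = card {v. h v = v} \<and> Suc (card ?f2) = card {v. h v = v}" if "h r = r" for r
    using tree_involution_fixed_vertex(2)[of T1 h r, OF T(1) h hT(1) that]
      tree_involution_fixed_vertex(2)[of T2 h r, OF T(2) h hT(2) that] by simp
  show "card {v. h v = v} = 1" if e: "fixed_edges (T1 \<union> T2) h = {}"
  proof -
    have z: "card ?f1 = 0" using e split by simp
    have "\<exists>r. h r = r"
    proof (rule ccontr)
      assume "\<nexists>r. h r = r"
      then have "card ?f1 = 1 \<and> card ?f2 = 1" by (intro free) blast
      then show False using z by linarith
    qed
    then obtain r where "h r = r" ..
    from nonfree[OF this] show ?thesis unfolding z by linarith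
  qed
  show "h v \<noteq> v" if two: "card (fixed_edges (T1 \<union> T2) h) = 2" for v
  proof
    assume v: "h v = v"
    have c: "card ?f1 = 1" "card ?f2 = 1" "card {v. h v = v} = 2"
      using nonfree[OF v] two card_split by linarith+
    have key: "e = {v. h v = v}" if e: "tree T" "e \<in> T" "h ` e = e" "\<And>w. {w, h w} \<notin> T" for e T
    proof -
      have e2: "card e = 2" using e(1,2) unfolding tree_def by blast
      then obtain x y where xy: "e = {x, y}" "x \<noteq> y" by (auto simp: card_2_iff)
      have "h x = x \<or> h x = y" "h y = x \<or> h y = y" using e(3) xy by auto
      moreover have "h x \<noteq> y" "h y \<noteq> x"
        using e(2) e(4)[of x] e(4)[of y] unfolding xy(1) by (auto simp: insert_commute)
      ultimately have "e \<subseteq> {v. h v = v}" using xy by auto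
      then show ?thesis using e2 c(3) by (metis card_subset_eq finite)
    qed
    obtain e1 where f1: "?f1 = {e1}" using c(1) by (rule card_1_singletonE)
    have "e1 \<in> ?f1" unfolding f1 by simp
    then have e1: "e1 \<in> T1" "h ` e1 = e1" by simp_all
    obtain e2 where f2: "?f2 = {e2}" using c(2) by (rule card_1_singletonE)
    have "e2 \<in> ?f2" unfolding f2 by simp
    then have e2: "e2 \<in> T2" "h ` e2 = e2" by simp_all
    have "{w, h w} \<notin> T1" "{w, h w} \<notin> T2" for w
      using tree_involution_fixed_vertex(1)[of T1 h v w, OF T(1) h hT(1) v]
        tree_involution_fixed_vertex(1)[of T2 h v w, OF T(2) h hT(2) v] by simp_all
    then have "e1 = e2" using key[OF T(1) e1] key[OF T(2) e2] by simp
    then show False using e1(1) e2(1) T(3) by blast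
  qed
  show "fixed_edges (T1 \<union> T2) h = {} \<or> card (fixed_edges (T1 \<union> T2) h) = 2" if le: "card {v. h v = v} \<le> 1"
  proof (cases "\<exists>r. h r = r")
    case True
    then obtain r where "h r = r" by blast
    from nonfree[OF this] le have "card ?f1 = 0" "card ?f2 = 0" by linarith+
    then have "card (fixed_edges (T1 \<union> T2) h) = 0" using card_split by linarith
    then show ?thesis by simp
  next
    case False
    then have "card ?f1 = 1 \<and> card ?f2 = 1" by (intro free) blast
    then show ?thesis using card_split by linarith
  qed
qed

text \<open>
  Two edge-disjoint spanning trees with a symmetry. A pair without fixed edges satisfies the
  conditions of \<open>sym_pair\<close>, but one edge in each tree may be fixed by the half turn
  \<open>h\<close>; such an edge is a forbidden diameter and has to be removed first.
\<close>

locale symmetric_trees =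
  fixes ty :: plane_sym and g :: "'v::finite \<Rightarrow> 'v" and F :: "bool \<Rightarrow> 'v set set"
  assumes tree_F: "tree (F c)"
    and disjoint: "F True \<inter> F False = {}"
    and g_period: "(g ^^ period ty) v = v"
    and edge_g: "e \<in> F c \<Longrightarrow> g ` e \<in> F (c \<noteq> swaps_colours ty)"
begin

definition h :: "'v \<Rightarrow> 'v" where "h = g ^^ (period ty div 2)"

lemma edge_card: "e \<in> F c \<Longrightarrow> card e = 2"
  using tree_F by (auto simp: tree_def)

lemma inj_g: "inj g"
proof (rule injI)
  fix x y assume "g x = g y"
  obtain k where k: "period ty = Suc k" using period_pos[of ty] by (metis Suc_pred)
  have "(g ^^ k) (g x) = x" "(g ^^ k) (g y) = y"
    using g_period[of x] g_period[of y] by (simp_all add: k funpow_swap1)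
  then show "x = y" using \<open>g x = g y\<close> by metis
qed

lemma h_commute: "h (g v) = g (h v)"
  unfolding h_def by (simp add: funpow_swap1)

lemma central_cases: "central ty \<Longrightarrow> (h = g \<and> period ty = 2 \<and> \<not> swaps_colours ty) \<or> (ty = Quarter \<and> h = g \<circ> g)"
proof -
  assume c: "central ty"
  have "g ^^ 2 = g \<circ> g" by (simp add: numeral_2_eq_2 fun_eq_iff)
  then show ?thesis using c unfolding h_def by (cases ty) (simp_all add: central_def swaps_colours_def)
qed

lemma h_involution: "central ty \<Longrightarrow> h (h v) = v"
  using central_cases g_period[of v] by (auto simp: numeral_2_eq_2 eval_nat_numeral)

lemma h_edge:
  assumes "central ty" "e \<in> F c" shows "h ` e \<in> F c"
proof -
  have "g ` g ` e \<in> F ((c \<noteq> swaps_colours ty) \<noteq> swaps_colours ty)" by (intro edge_g assms)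
  then have "(g \<circ> g) ` e \<in> F c" unfolding image_comp by (cases "swaps_colours ty") auto
  then show ?thesis using central_cases[OF assms(1)] edge_g[OF assms(2)] by auto
qed

lemma iterate_fixed:
  assumes c: "central ty" and j: "0 < j" "j < period ty" "(g ^^ j) v = v"
  shows "h v = v \<and> (g v = v \<or> (ty = Quarter \<and> j = 2))"
proof -
  consider "h = g" "period ty = 2" | "ty = Quarter" "h = g \<circ> g" using central_cases[OF c] by blast
  then show ?thesis
  proof cases
    case 1
    then have "j = 1" using j by simp
    then have "g v = v" using j(3) by simp
    then show ?thesis unfolding 1 by simp
  next
    case 2
    have g4: "g (g (g (g v))) = v" using g_period[of v] 2 by (simp add: eval_nat_numeral)
    consider "j = 1" | "j = 2" | "j = 3" using j 2 by fastforce
    then show ?thesis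
    proof cases
      case 3
      then have "g (g (g v)) = v" using j by (simp add: eval_nat_numeral)
      then show ?thesis using 2 g4 by auto
    qed (use 2 j in \<open>auto simp: eval_nat_numeral\<close>)
  qed
qed

lemma realizable_Swap:
  assumes "ty = Swap" shows "\<exists>p. realizes ty UNIV g F p"
proof -
  interpret sym_pair ty UNIV g F
  proof
    show "e \<in> F c \<Longrightarrow> e \<subseteq> UNIV \<and> card e = 2" for e c using edge_card by auto
    show "sparse UNIV (F c)" for c by (rule tree_sparse[OF tree_F])
    show "0 < j \<Longrightarrow> j < period ty \<Longrightarrow> (g ^^ j) x = x \<Longrightarrow> g x = x" for x j using assms less2[of j] by auto
  qed (use g_period edge_g assms in \<open>auto simp: central_def\<close>)
  show ?thesis by (rule sym_pair_realizable[OF sym_pair_axioms disjoint])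
qed

lemma realizable_no_fixed_edge:
  assumes c: "central ty" and nofix: "fixed_edges (F True \<union> F False) h = {}"
  shows "\<exists>p. realizes ty UNIV g F p"
proof -
  have "card {v. h v = v} = 1"
    by (rule disjoint_trees_fixed_edges(1)[OF tree_F tree_F disjoint h_involution[OF c] h_edge[OF c] h_edge[OF c] nofix])
  then obtain r where r: "{v. h v = v} = {r}" by (rule card_1_singletonE)
  have one: "x = y" if "h x = x" "h y = y" for x y
  proof -
    have "x \<in> {v. h v = v}" "y \<in> {v. h v = v}" using that by (simp_all only: mem_Collect_eq)
    then show ?thesis unfolding r by simp
  qed
  have gh: "h x = x" if "g x = x" for x
    using central_cases[OF c] that by (elim disjE conjE) simp_all
  interpret sym_pair ty UNIV g F
  proof
    show "e \<in> F c \<Longrightarrow> e \<subseteq> UNIV \<and> card e = 2" for e c using edge_card by auto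
    show "sparse UNIV (F c)" for c by (rule tree_sparse[OF tree_F])
    show "g x = x" if "0 < j" "j < period ty" "(g ^^ j) x = x" for x j
    proof -
      have "h x = x" using iterate_fixed[OF c that] by blast
      moreover from this have "h (g x) = g x" by (simp add: h_commute)
      ultimately show ?thesis using one by blast
    qed
    show "x = y" if "g x = x" "g y = y" for x y using one gh that by blast
    show "{x, (g ^^ (period ty div 2)) x} \<notin> F d" for x d
    proof
      assume "{x, (g ^^ (period ty div 2)) x} \<in> F d"
      then have "{x, h x} \<in> F d" unfolding h_def .
      moreover have "h ` {x, h x} = {x, h x}" using h_involution[OF c] by auto
      ultimately have "{x, h x} \<in> fixed_edges (F True \<union> F False) h"
        unfolding fixed_edges_def by (cases d) auto
      then show False using nofix by blast
    qed
  qed (use g_period edge_g in auto)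
  show ?thesis by (rule sym_pair_realizable[OF sym_pair_axioms disjoint])
qed

text \<open>
  A fixed edge is drawn through the origin. It is replaced by the two edges that join its ends
  to a new fixed vertex, \<open>None\<close>, at the origin.
\<close>

definition centred :: "bool \<Rightarrow> 'v option set set" where
  "centred c = (\<lambda>e. Some ` e) ` {e \<in> F c. h ` e \<noteq> e} \<union> (\<lambda>u. {None, Some u}) ` {u. {u, h u} \<in> F c}"

lemma centred_cases:
  assumes "x \<in> centred c"
  obtains e where "x = Some ` e" "e \<in> F c" "h ` e \<noteq> e" | u where "x = {None, Some u}" "{u, h u} \<in> F c"
  using assms unfolding centred_def by blast

lemma Some_in_centred: "Some ` e \<in> centred c \<longleftrightarrow> e \<in> F c \<and> h ` e \<noteq> e"
proof
  assume "Some ` e \<in> centred c"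
  then show "e \<in> F c \<and> h ` e \<noteq> e"
  proof (cases rule: centred_cases)
    case (1 e')
    then have "e = e'" by (simp add: inj_image_eq_iff)
    then show ?thesis using 1 by simp
  next
    case (2 u)
    have "None \<in> {None, Some u}" by simp
    then have "None \<in> Some ` e" unfolding 2(1) .
    then show ?thesis by blast
  qed
next
  assume "e \<in> F c \<and> h ` e \<noteq> e"
  then show "Some ` e \<in> centred c" unfolding centred_def by (intro UnI1 imageI CollectI)
qed

lemma spoke_in_centred: "{None, Some u} \<in> centred c \<longleftrightarrow> {u, h u} \<in> F c"
proof
  assume "{None, Some u} \<in> centred c"
  then show "{u, h u} \<in> F c"
  proof (cases rule: centred_cases)
    case (1 e)
    have "None \<in> {None, Some u}" by simp
    then show ?thesis unfolding 1(1) by blast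
  next
    case (2 w)
    then have "u = w" by (simp add: doubleton_eq_iff)
    then show ?thesis using 2(2) by simp
  qed
qed (simp add: centred_def)


text \<open>
  A set that contains \<open>None\<close> and both ends of the fixed edge trades this edge for
  two, but has one vertex more.
\<close>

lemma sparse_centred:
  assumes c: "central ty" and free: "\<And>v. h v \<noteq> v"
  shows "sparse UNIV (centred d)"
  unfolding sparse_def
proof (intro allI impI)
  fix U :: "'v option set" assume U: "U \<noteq> {}"
  define V where "V = {v. Some v \<in> U}"
  have hF: "e \<in> F d \<Longrightarrow> h ` e \<in> F d" for e by (rule h_edge[OF c])
  have "card {e \<in> F d. h ` e = e} = 1"
    by (rule tree_involution_free[OF tree_F h_involution[OF c] hF free])
  then obtain e0 where e0: "{e \<in> F d. h ` e = e} = {e0}" by (metis card_1_singletonE)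
  have "e0 \<in> {e \<in> F d. h ` e = e}" unfolding e0 by simp
  then have e0F: "e0 \<in> F d" "h ` e0 = e0" by simp_all
  have c0: "card e0 = 2" by (rule edge_card[OF e0F(1)])
  let ?A = "(\<lambda>e. Some ` e) ` (edges_in (F d) V - {e0})"
  let ?B = "(\<lambda>u. {None, Some u}) ` (e0 \<inter> V)"
  have spoke: "u \<in> e0" if "{u, h u} \<in> F d" for u
  proof -
    have "h ` {u, h u} = {u, h u}" using h_involution[OF c] by auto
    then have "{u, h u} \<in> {e \<in> F d. h ` e = e}" using that by blast
    then show ?thesis unfolding e0 by blast
  qed
  have sub: "edges_in (centred d) U \<subseteq> ?A \<union> (if None \<in> U then ?B else {})"
  proof
    fix x assume "x \<in> edges_in (centred d) U"
    then have x: "x \<in> centred d" "x \<subseteq> U" by (auto simp: edges_in_def)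
    from x(1) show "x \<in> ?A \<union> (if None \<in> U then ?B else {})"
    proof (cases rule: centred_cases)
      case (1 e)
      have "e \<subseteq> V" using x(2) unfolding 1(1) by (auto simp: V_def)
      moreover have "e \<noteq> e0" using 1(3) e0F(2) by metis
      ultimately show ?thesis using 1 by (auto simp: edges_in_def)
    next
      case (2 u)
      then show ?thesis using x(2) spoke[OF 2(2)] by (auto simp: V_def)
    qed
  qed
  have cU: "card U = card V + (if None \<in> U then 1 else 0)"
  proof (cases "None \<in> U")
    case True
    have "x \<in> insert None (Some ` V) \<longleftrightarrow> x \<in> U" for x using True by (cases x) (auto simp: V_def)
    then have "U = insert None (Some ` V)" by blast
    moreover have "card (insert None (Some ` V)) = Suc (card V)"
      by (subst card_insert_disjoint) (auto simp: card_image)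
    ultimately show ?thesis by simp
  next
    case False
    have "x \<in> Some ` V \<longleftrightarrow> x \<in> U" for x using False by (cases x) (auto simp: V_def)
    then have "U = Some ` V" by blast
    then have "card U = card V" by (simp add: card_image)
    then show ?thesis using False by simp
  qed
  have cA: "card ?A \<le> card (edges_in (F d) V - {e0})" by (rule card_image_le) simp
  have cB: "card ?B \<le> card (e0 \<inter> V)" by (rule card_image_le) simp
  have le: "card (edges_in (centred d) U) \<le> card ?A + card (if None \<in> U then ?B else {})"
    using card_mono[OF _ sub] card_Un_le[of ?A "if None \<in> U then ?B else {}"] by (meson finite le_trans)
  show "card (edges_in (centred d) U) < card U"
  proof (cases "V = {}")
    case True
    then have "None \<in> U" using U by (auto simp: V_def) (metis not_None_eq)
    moreover have "edges_in (F d) V = {}" using edge_card True by (fastforce simp: edges_in_def)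
    ultimately show ?thesis using le True cU by simp
  next
    case False
    have lt: "card (edges_in (F d) V) < card V" by (rule sparseD[OF tree_sparse[OF tree_F]]) (use False in auto)
    have le1: "card (edges_in (F d) V - {e0}) \<le> card (edges_in (F d) V)" by (rule card_mono) auto
    show ?thesis
    proof (cases "None \<in> U")
      case False
      then show ?thesis using le cA le1 lt cU by simp
    next
      case True
      have "card (edges_in (F d) V - {e0}) + card (e0 \<inter> V) \<le> card V"
      proof (cases "e0 \<subseteq> V")
        case True
        then have "e0 \<in> edges_in (F d) V" using e0F(1) by (simp add: edges_in_def)
        then have "Suc (card (edges_in (F d) V - {e0})) = card (edges_in (F d) V)" by (intro card_Suc_Diff1) auto
        moreover have "card (e0 \<inter> V) \<le> 2" using c0 by (metis card_mono finite inf_le1)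
        ultimately show ?thesis using lt by linarith
      next
        case False
        then have "e0 \<inter> V \<subset> e0" by blast
        then have "card (e0 \<inter> V) < 2" using c0 by (metis psubset_card_mono finite)
        then show ?thesis using le1 lt by linarith
      qed
      then show ?thesis using True le cA cB cU by simp
    qed
  qed
qed

lemma map_option_funpow: "map_option g ^^ k = map_option (g ^^ k)"
proof
  show "(map_option g ^^ k) x = map_option (g ^^ k) x" for x
    by (cases x; induction k) auto
qed

text \<open>
  In the drawing of the enlarged pair the new vertex is at the origin. If the position of
  \<open>P\<close> to the origin has colour \<open>d\<close>, so has its position to $-P$; hence
  the new vertex may be dropped.
\<close>

lemma realizable_two_fixed_edges:
  assumes c: "ty = Half \<or> ty = Quarter" and two: "card (fixed_edges (F True \<union> F False) h) = 2"
  shows "\<exists>p. realizes ty UNIV g F p"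
proof -
  have cen: "central ty" using c by (auto simp: central_def)
  have free: "h v \<noteq> v" for v
    by (rule disjoint_trees_fixed_edges(2)[OF tree_F tree_F disjoint h_involution[OF cen] h_edge[OF cen] h_edge[OF cen] two])
  have fixed_edge: "h ` {u, h u} = {u, h u}" for u using h_involution[OF cen] by auto
  interpret O: sym_pair ty UNIV "map_option g" centred
  proof
    show "(map_option g ^^ period ty) x = x" for x
      unfolding map_option_funpow using g_period by (cases x) auto
    show "x \<subseteq> UNIV \<and> card x = 2" if "x \<in> centred d" for x d
      using that by (cases rule: centred_cases) (auto simp: card_image edge_card)
    show "sparse UNIV (centred d)" for d by (rule sparse_centred[OF cen free])
    show "map_option g ` x \<in> centred (d \<noteq> swaps_colours ty)" if "x \<in> centred d" for x d
      using that
    proof (cases rule: centred_cases)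
      case (1 e)
      have "g ` e \<in> F (d \<noteq> swaps_colours ty)" using edge_g 1 by blast
      moreover have "h ` g ` e \<noteq> g ` e"
      proof
        assume "h ` g ` e = g ` e"
        then have "g ` h ` e = g ` e" unfolding image_image by (simp add: h_commute)
        then show False using 1 inj_g by (simp add: inj_image_eq_iff)
      qed
      moreover have "map_option g ` x = Some ` g ` e" unfolding 1 image_image by simp
      ultimately show ?thesis by (simp only: Some_in_centred not_False_eq_True simp_thms)
    next
      case (2 u)
      have "g ` {u, h u} \<in> F (d \<noteq> swaps_colours ty)" using edge_g 2 by blast
      then have "{g u, h (g u)} \<in> F (d \<noteq> swaps_colours ty)" by (simp add: h_commute)
      moreover have "map_option g ` x = {None, Some (g u)}" unfolding 2 by simp
      ultimately show ?thesis by (simp only: spoke_in_centred)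
    qed
    show "map_option g x = x" if "0 < j" "j < period ty" "(map_option g ^^ j) x = x" for x j
      using that iterate_fixed[OF cen that(1,2)] free unfolding map_option_funpow by (cases x) auto
    show "x = y" if "map_option g x = x" "map_option g y = y" for x y
    proof -
      have "g v \<noteq> v" for v using iterate_fixed[OF cen, of 1 v] c free by auto
      then show ?thesis using that by (cases x; cases y) auto
    qed
    show "{x, (map_option g ^^ (period ty div 2)) x} \<notin> centred d" for x d
    proof (cases x)
      case None
      then show ?thesis unfolding map_option_funpow centred_def by auto
    next
      case (Some v)
      have "{x, (map_option g ^^ (period ty div 2)) x} = Some ` {v, h v}"
        unfolding map_option_funpow Some h_def by simp
      then show ?thesis using fixed_edge[of v] by (simp only: Some_in_centred) blast
    qed
  qed auto
  have "centred True \<inter> centred False = {}"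
  proof (rule ccontr)
    assume "centred True \<inter> centred False \<noteq> {}"
    then obtain x where x: "x \<in> centred True" "x \<in> centred False" by blast
    from x(1) show False
    proof (cases rule: centred_cases)
      case (1 e)
      then show False using x(2) disjoint unfolding 1(1) Some_in_centred by blast
    next
      case (2 u)
      then show False using x(2) disjoint unfolding 2(1) spoke_in_centred by blast
    qed
  qed
  from sym_pair_realizable[OF O.sym_pair_axioms this]
  obtain q where "realizes ty UNIV (map_option g) centred q" by blast
  then have q: "inj q" "\<And>x. q (map_option g x) = act ty (q x)"
    "\<And>c x y. {x, y} \<in> centred c \<Longrightarrow> rel c (q x) (q y)"
    unfolding realizes_def by auto
  have q0: "q None = 0"
  proof -
    have fix0: "P = 0" if P: "fst (act ty P) = fst P" "snd (act ty P) = snd P" for P :: point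
      using c
    proof
      assume "ty = Half"
      then show ?thesis using P by (simp add: prod_eq_iff)
    next
      assume "ty = Quarter"
      then have "snd P = fst P" "- fst P = snd P" using P by simp_all
      then show ?thesis by (simp add: prod_eq_iff)
    qed
    have "q (map_option g None) = act ty (q None)" by (rule q(2))
    then have "act ty (q None) = q None" by simp
    then show ?thesis by (intro fix0) (simp_all only:)
  qed
  define p where "p v = q (Some v)" for v
  have pg: "p (g v) = act ty (p v)" for v using q(2)[of "Some v"] by (simp add: p_def)
  have ph: "p (h v) = (- fst (p v), - snd (p v))" for v
    using c central_cases[OF cen] pg by auto
  have "rel d (p x) (p y)" if xy: "{x, y} \<in> F d" for d x y
  proof (cases "h ` {x, y} = {x, y}")
    case False
    then have "Some ` {x, y} \<in> centred d" using xy by (simp only: Some_in_centred) simp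
    then show ?thesis using q(3) by (simp add: p_def)
  next
    case True
    then have "h x \<in> {x, y}" by (metis imageI insertI1)
    then have "h x = y" using free[of x] by simp
    then have "{None, Some x} \<in> centred d" using xy by (simp add: spoke_in_centred)
    from q(3)[OF this] show ?thesis
      unfolding \<open>h x = y\<close>[symmetric] ph q0 p_def[symmetric]
      by (auto simp: rel_def zero_less_mult_iff mult_less_0_iff split: if_splits)
  qed
  then have "realizes ty UNIV g F p"
    unfolding realizes_def using pg q(1) by (auto simp: p_def inj_def)
  then show ?thesis by blast
qed

end

section \<open>The symmetries as isometries\<close>

text \<open>
  The coordinates in which the position of two points is an order type.
\<close>

definition coords :: "real^2 \<Rightarrow> real^2 \<Rightarrow> real^2 \<Rightarrow> point" where
  "coords a b x = (a \<bullet> x + b \<bullet> x, a \<bullet> x - b \<bullet> x)"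

lemma linear_coords: "linear (coords a b)"
  by (intro linearI) (simp_all add: coords_def inner_add_right algebra_simps)

lemma linear_act: "linear (act ty)"
  by (intro linearI) (simp_all add: act_add act_scale)

context quad_norm
begin

definition plane :: "point \<Rightarrow> real^2" where
  "plane P = ((fst P + snd P) / 2) *\<^sub>R e1 + ((fst P - snd P) / 2) *\<^sub>R e2"

lemma linear_plane: "linear plane"
  by (intro linearI) (simp_all add: plane_def algebra_simps add_divide_distrib diff_divide_distrib)

lemma inner_plane_coords [simp]: "a \<bullet> plane P = (fst P + snd P) / 2" "b \<bullet> plane P = (fst P - snd P) / 2"
  by (simp_all add: plane_def inner_add_right)

lemma coords_plane [simp]: "coords a b (plane P) = P"
  by (simp add: coords_def prod_eq_iff field_simps)

lemma plane_coords [simp]: "plane (coords a b x) = x"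
  by (rule coord_eqI) (simp_all add: coords_def field_simps)

lemma plane_eq_iff [simp]: "plane P = plane Q \<longleftrightarrow> P = Q"
  by (metis coords_plane)

text \<open>
  For $s = x + y$ and $t = x - y$ the sign of $st = x^2 - y^2$ decides which of the two
  functionals dominates.
\<close>

lemma rel_plane:
  "rel True P Q \<longleftrightarrow> \<bar>b \<bullet> (plane P - plane Q)\<bar> < \<bar>a \<bullet> (plane P - plane Q)\<bar>"
  "rel False P Q \<longleftrightarrow> \<bar>a \<bullet> (plane P - plane Q)\<bar> < \<bar>b \<bullet> (plane P - plane Q)\<bar>"
proof -
  define s t where "s = fst P - fst Q" and "t = snd P - snd Q"
  have ab: "a \<bullet> (plane P - plane Q) = (s + t) / 2" "b \<bullet> (plane P - plane Q) = (s - t) / 2"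
    by (simp_all add: inner_diff_right s_def t_def field_simps)
  have sq: "\<bar>x / 2\<bar> < \<bar>y / 2\<bar> \<longleftrightarrow> x\<^sup>2 < y\<^sup>2" for x y :: real
    using abs_le_square_iff[of y x] by auto
  have st: "(s - t)\<^sup>2 < (s + t)\<^sup>2 \<longleftrightarrow> 0 < s * t" "(s + t)\<^sup>2 < (s - t)\<^sup>2 \<longleftrightarrow> s * t < 0"
    by (simp_all add: power2_eq_square algebra_simps)
  have "rel True P Q \<longleftrightarrow> 0 < s * t" "rel False P Q \<longleftrightarrow> s * t < 0"
    by (auto simp: rel_def s_def t_def)
  then show "rel True P Q \<longleftrightarrow> \<bar>b \<bullet> (plane P - plane Q)\<bar> < \<bar>a \<bullet> (plane P - plane Q)\<bar>"
    "rel False P Q \<longleftrightarrow> \<bar>a \<bullet> (plane P - plane Q)\<bar> < \<bar>b \<bullet> (plane P - plane Q)\<bar>"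
    unfolding ab sq st by simp_all
qed

definition sym_matrix :: "plane_sym \<Rightarrow> real^2^2" where
  "sym_matrix ty = matrix (plane \<circ> act ty \<circ> coords a b)"

lemma sym_matrix: "sym_matrix ty *v x = plane (act ty (coords a b x))"
proof -
  have "linear (plane \<circ> act ty \<circ> coords a b)"
    by (intro linear_compose linear_plane linear_act linear_coords)
  from fun_cong[OF matrix_vector_mul(2)[OF this], of x] show ?thesis by (simp add: sym_matrix_def)
qed

lemma N_plane: "N (plane P) = max \<bar>(fst P + snd P) / 2\<bar> \<bar>(fst P - snd P) / 2\<bar>"
  by (simp add: N)

lemma norm_sym_matrix: "N (sym_matrix ty *v x) = N x"
proof -
  have "N (plane (act ty P)) = N (plane P)" for P
    unfolding N_plane by (cases ty; simp; smt (verit) field_sum_of_halves)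
  from this[of "coords a b x"] show ?thesis by (simp add: sym_matrix)
qed

end

fun matrix_pow :: "real^2^2 \<Rightarrow> nat \<Rightarrow> real^2^2" where
  "matrix_pow A 0 = mat 1"
| "matrix_pow A (Suc k) = A ** matrix_pow A k"

lemma matrix_pow_add: "matrix_pow A (i + j) = matrix_pow A i ** matrix_pow A j"
  by (induction i) (simp_all add: matrix_mul_assoc)

lemma matrix_pow_mod:
  assumes "matrix_pow A n = mat 1" shows "matrix_pow A i = matrix_pow A (i mod n)"
proof -
  have "matrix_pow A (k * n) = mat 1" for k
    by (induction k) (simp_all add: matrix_pow_add assms)
  then have "matrix_pow A (i div n * n + i mod n) = matrix_pow A (i mod n)"
    by (simp only: matrix_pow_add matrix_mul_lid)
  then show ?thesis by simp
qed

lemma matrix_pow_apply: "matrix_pow A i *v x = ((*v) A ^^ i) x"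
  by (induction i) (simp_all add: matrix_vector_mul_assoc[symmetric])

lemma (in quad_norm) sym_matrix_period: "matrix_pow (sym_matrix ty) (period ty) = mat 1"
proof -
  have "((*v) (sym_matrix ty) ^^ i) x = plane ((act ty ^^ i) (coords a b x))" for i x
    by (induction i) (simp_all add: sym_matrix)
  then show ?thesis by (simp add: matrix_eq matrix_pow_apply act_period)
qed

section \<open>Cyclic group actions on the graph\<close>

lemma graph_action_simps:
  assumes n: "n > 0" and act: "graph_action n E \<theta>"
  shows "x \<in> {0..<int n} \<Longrightarrow> bij (\<theta> x)"
    and "x \<in> {0..<int n} \<Longrightarrow> {\<theta> x v, \<theta> x w} \<in> E \<longleftrightarrow> {v, w} \<in> E"
    and "x \<in> {0..<int n} \<Longrightarrow> y \<in> {0..<int n} \<Longrightarrow> \<theta> ((x + y) mod int n) v = \<theta> x (\<theta> y v)"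
    and "\<theta> 0 v = v"
proof -
  have car: "carrier (integer_mod_group n) = {0..<int n}" using n by (simp add: carrier_integer_mod_group)
  have hom: "\<theta> \<in> hom (integer_mod_group n) (graph_aut E)" using act by (simp add: graph_action_def)
  have mem: "\<theta> x \<in> Bij UNIV \<and> (\<forall>v w. {\<theta> x v, \<theta> x w} \<in> E \<longleftrightarrow> {v, w} \<in> E)" if "x \<in> {0..<int n}" for x
    using hom_in_carrier[OF hom, of x] that unfolding car by (simp add: graph_aut_def)
  show b: "bij (\<theta> x)" if "x \<in> {0..<int n}" for x using mem[OF that] by (simp add: Bij_def)
  show "{\<theta> x v, \<theta> x w} \<in> E \<longleftrightarrow> {v, w} \<in> E" if "x \<in> {0..<int n}" for x v w using mem[OF that] by blast
  show add: "\<theta> ((x + y) mod int n) v = \<theta> x (\<theta> y v)" if xy: "x \<in> {0..<int n}" "y \<in> {0..<int n}" for x y v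
  proof -
    have "\<theta> (x \<otimes>\<^bsub>integer_mod_group n\<^esub> y) = \<theta> x \<otimes>\<^bsub>graph_aut E\<^esub> \<theta> y"
      by (rule hom_mult[OF hom]) (use xy in \<open>simp_all add: car\<close>)
    then show ?thesis using mem[OF xy(1)] mem[OF xy(2)]
      by (simp add: graph_aut_def BijGroup_def compose_def)
  qed
  have "\<theta> 0 (\<theta> 0 v) = \<theta> 0 v" using add[of 0 0 v] n by simp
  then show "\<theta> 0 v = v" using b[of 0] n by (simp add: bij_def inj_def)
qed

text \<open>
  A generator is odd, since the even residues form a proper subgroup.
\<close>

lemma generator_cases:
  assumes n: "n \<in> {2, 4}" and \<gamma>: "\<gamma> \<in> carrier (integer_mod_group n)"
    and gen: "generate (integer_mod_group n) {\<gamma>} = carrier (integer_mod_group n)"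
  shows "(n = 2 \<and> \<gamma> = 1) \<or> (n = 4 \<and> (\<gamma> = 1 \<or> \<gamma> = 3))"
proof -
  have car: "carrier (integer_mod_group n) = {0..<int n}" using n by (auto simp: carrier_integer_mod_group)
  have "odd \<gamma>"
  proof
    assume ev: "even \<gamma>"
    let ?H = "{x. even x} \<inter> {0..<int n}"
    have "even ((- x) mod int n)" "even ((x + y) mod int n)" if "even x" "even y" for x y
      using that n by (auto simp: dvd_mod)
    then have "subgroup ?H (integer_mod_group n)"
      using n car by (intro subgroup.intro) (auto simp: carrier_integer_mod_group)
    then have "generate (integer_mod_group n) {\<gamma>} \<subseteq> ?H"
      by (intro group.generate_subgroup_incl) (use ev \<gamma> car in auto)
    moreover have "1 \<in> {0..<int n}" using n by auto
    ultimately have "1 \<in> ?H" unfolding gen car by blast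
    then show False by simp
  qed
  then show ?thesis using n \<gamma> unfolding car by (auto simp: eval_nat_numeral) presburger+
qed

text \<open>
  All elements of the group are powers of the generator, so the action is that of the single
  permutation \<open>g\<close>.
\<close>

locale symmetric_graph = quad_norm +
  fixes E :: "'v::finite set set" and n :: nat and \<theta> :: "int \<Rightarrow> 'v \<Rightarrow> 'v" and \<gamma> :: int
  assumes simple: "simple_graph E"
    and action: "graph_action n E \<theta>"
    and gen: "(n = 2 \<and> \<gamma> = 1) \<or> (n = 4 \<and> (\<gamma> = 1 \<or> \<gamma> = 3))"
begin

abbreviation "g \<equiv> \<theta> \<gamma>"

lemma n_pos: "n > 0" and \<gamma>_in: "\<gamma> \<in> {0..<int n}" and carrier: "carrier (integer_mod_group n) = {0..<int n}"
  using gen by (auto simp: carrier_integer_mod_group)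

lemmas theta = graph_action_simps[OF n_pos action]

lemma theta_power: "\<theta> ((int m * \<gamma>) mod int n) v = (g ^^ m) v"
proof (induction m)
  case (Suc m)
  have "\<theta> ((\<gamma> + (int m * \<gamma>) mod int n) mod int n) v = g (\<theta> ((int m * \<gamma>) mod int n) v)"
    by (rule theta(3)) (use \<gamma>_in n_pos in auto)
  then show ?case using Suc by (simp add: mod_add_right_eq algebra_simps)
qed (simp add: theta(4))

text \<open>
  The generator is its own inverse modulo \<open>n\<close>, so \<open>x\<close> is the multiple
  of \<open>\<gamma>\<close> by \<open>\<gamma> * x\<close>.
\<close>

lemma theta_eq:
  assumes "x \<in> {0..<int n}" shows "\<theta> x v = (g ^^ nat (\<gamma> * x)) v"
proof -
  have "(int (nat (\<gamma> * x)) * \<gamma>) mod int n = x"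
  proof -
    have "\<gamma> * x \<ge> 0" using assms \<gamma>_in by auto
    then have eq: "int (nat (\<gamma> * x)) * \<gamma> = (\<gamma> * \<gamma>) * x" by simp
    have "((\<gamma> * \<gamma>) * x) mod int n = x"
      using gen assms by (elim disjE conjE; simp) presburger
    then show ?thesis unfolding eq .
  qed
  then show ?thesis using theta_power[of "nat (\<gamma> * x)" v] by simp
qed

lemma g_period: "(g ^^ n) v = v"
  using theta_power[of n v] theta(4) by simp

lemma inj_g: "inj g" using theta(1)[OF \<gamma>_in] by (rule bij_is_inj)

lemma edge_card: "e \<in> E \<Longrightarrow> card e = 2" using simple by (simp add: simple_graph_def)

lemma edgeE:
  assumes "e \<in> E" obtains v w where "e = {v, w}" "v \<noteq> w"
  using edge_card[OF assms] by (auto simp: card_2_iff)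

lemma g_edge: "e \<in> E \<Longrightarrow> g ` e \<in> E"
proof -
  assume e: "e \<in> E"
  then obtain v w where "e = {v, w}" by (rule edgeE)
  then show "g ` e \<in> E" using e theta(2)[OF \<gamma>_in, of v w] by simp
qed

lemma graph_image_eq:
  assumes "graph_image g T1 \<subseteq> T2" "graph_image g T2 \<subseteq> T1" shows "graph_image g T1 = T2"
proof -
  have "card (graph_image g T) = card T" for T
    unfolding graph_image_def by (rule card_image) (simp add: inj_on_def inj_image_eq_iff[OF inj_g])
  then have "card T1 \<le> card T2" "card T2 \<le> card T1" "card (graph_image g T1) = card T1"
    using card_mono[OF _ assms(1)] card_mono[OF _ assms(2)] by (metis finite)+
  then show ?thesis using assms(1) by (intro card_subset_eq) auto
qed

lemma tree_of_spanning_tree: "spanning_tree E T \<Longrightarrow> tree T"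
  using edge_card unfolding spanning_tree_def tree_def by blast

lemma spanning_tree_of_tree: "tree T \<Longrightarrow> T \<subseteq> E \<Longrightarrow> spanning_tree E T"
  unfolding spanning_tree_def tree_def by blast

lemma symmetric_subgraph_iff:
  assumes "n = 2" shows "symmetric_subgraph n \<theta> T \<longleftrightarrow> graph_image g T = T"
proof -
  have "{0..<int n} = {0, 1}" using assms by auto
  moreover have "\<gamma> = 1" using gen assms by auto
  moreover have "graph_image (\<theta> 0) T = T" by (simp add: graph_image_def theta(4))
  ultimately show ?thesis unfolding symmetric_subgraph_def carrier by auto
qed

text \<open>
  A drawing of the two trees is an isostatic framework, and the powers of the matrix of the
  symmetry form the representation.
\<close>

lemma sufficient:
  assumes ty: "period ty = n" and q: "realizes ty UNIV g F q"
    and F: "tree (F True)" "tree (F False)" "E = F True \<union> F False"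
  shows "\<exists>\<tau> p. symmetric_isostatic_framework N E n \<theta> \<tau> p \<and> \<tau> \<gamma> = sym_matrix ty"
proof -
  let ?M = "sym_matrix ty"
  define p :: "(real^2)^'v" where "p = (\<chi> v. plane (q v))"
  define \<tau> where "\<tau> x = matrix_pow ?M (nat (\<gamma> * x))" for x
  have inj: "inj q" and qg: "\<And>v. q (g v) = act ty (q v)" and qrel: "\<And>c v w. {v, w} \<in> F c \<Longrightarrow> rel c (q v) (q w)"
    using q by (auto simp: realizes_def)
  have Mn: "matrix_pow ?M n = mat 1" using sym_matrix_period[of ty] ty by simp
  have place: "placement p" using inj by (auto simp: placement_def p_def inj_def)
  have relE: "rel True (q v) (q w) \<longleftrightarrow> {v, w} \<in> F True" "rel False (q v) (q w) \<longleftrightarrow> {v, w} \<in> F False"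
    if "{v, w} \<in> E" for v w
    using qrel[of v w True] qrel[of v w False] that unfolding F(3) by (auto simp: rel_def)
  have domT: "{v, w} \<in> dominant a b p E \<longleftrightarrow> {v, w} \<in> F True" and domF: "{v, w} \<in> dominant b a p E \<longleftrightarrow> {v, w} \<in> F False"
    for v w
    unfolding dominant_iff using relE[of v w] F(3)
    by (simp_all add: p_def rel_plane[symmetric]) blast+
  have two: "\<exists>v w. e = {v, w}" if "e \<in> E" for e using edgeE[OF that] by metis
  have D: "dominant a b p E = F True" "dominant b a p E = F False"
  proof -
    have "e \<in> dominant a b p E \<longleftrightarrow> e \<in> F True" "e \<in> dominant b a p E \<longleftrightarrow> e \<in> F False" for e
    proof -
      have "e \<in> dominant a b p E \<or> e \<in> F True \<or> e \<in> dominant b a p E \<or> e \<in> F False \<Longrightarrow> e \<in> E"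
        unfolding dominant_def using F(3) by blast
      then show "e \<in> dominant a b p E \<longleftrightarrow> e \<in> F True" "e \<in> dominant b a p E \<longleftrightarrow> e \<in> F False"
        using two[of e] domT domF by metis+
    qed
    then show "dominant a b p E = F True" "dominant b a p E = F False" by blast+
  qed
  have un: "unambiguous a b p E"
    unfolding unambiguous_def
  proof (intro allI impI)
    fix v w assume "{v, w} \<in> E"
    then have "{v, w} \<in> dominant a b p E \<or> {v, w} \<in> dominant b a p E" unfolding D using F(3) by blast
    then show "\<bar>a \<bullet> (p $ v - p $ w)\<bar> \<noteq> \<bar>b \<bullet> (p $ v - p $ w)\<bar>" unfolding dominant_iff by auto
  qed
  have wp: "well_positioned N E p" using well_positioned_iff[OF simple place] un by simp
  have iso: "isostatic N E p" unfolding isostatic_iff_trees[OF simple un] D using F by simp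
  have addM: "matrix_pow ?M i = matrix_pow ?M j" if "i mod n = j mod n" for i j
    using matrix_pow_mod[OF Mn] that by metis
  have rep: "representation n \<tau>"
    unfolding representation_def
  proof (rule homI)
    fix x assume x: "x \<in> carrier (integer_mod_group n)"
    have "matrix_pow ?M i ** matrix_pow ?M (i * (n - 1)) = mat 1" for i
    proof -
      have "i + i * (n - 1) = i * n" using n_pos by (cases n) auto
      then show ?thesis unfolding matrix_pow_add[symmetric] using addM[of "i * n" 0] by simp
    qed
    then have "invertible (\<tau> x)" unfolding \<tau>_def invertible_right_inverse by blast
    then show "\<tau> x \<in> carrier GL2" by (simp add: GL2_def)
    fix y assume y: "y \<in> carrier (integer_mod_group n)"
    have nn: "\<gamma> * x \<ge> 0" "\<gamma> * y \<ge> 0" "\<gamma> * ((x + y) mod int n) \<ge> 0"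
      using x y \<gamma>_in n_pos unfolding carrier by auto
    have "int (nat (\<gamma> * ((x + y) mod int n)) mod n) = int ((nat (\<gamma> * x) + nat (\<gamma> * y)) mod n)"
      using nn by (simp add: zmod_int mod_mult_right_eq algebra_simps)
    then have "nat (\<gamma> * ((x + y) mod int n)) mod n = (nat (\<gamma> * x) + nat (\<gamma> * y)) mod n" by linarith
    from addM[OF this] show "\<tau> (x \<otimes>\<^bsub>integer_mod_group n\<^esub> y) = \<tau> x \<otimes>\<^bsub>GL2\<^esub> \<tau> y"
      unfolding \<tau>_def by (simp add: GL2_def matrix_pow_add)
  qed
  have "symmetric_framework N n \<theta> \<tau> p"
    unfolding symmetric_framework_def
  proof (intro ballI conjI allI)
    fix x assume x: "x \<in> carrier (integer_mod_group n)"
    have "N (matrix_pow ?M i *v y) = N y" for i y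
      by (induction i) (simp_all add: matrix_vector_mul_assoc[symmetric] norm_sym_matrix)
    then show "isometry N (\<tau> x)"
      unfolding isometry_def \<tau>_def by (simp add: matrix_vector_mult_diff_distrib[symmetric])
    fix v
    have "matrix_pow ?M i *v p $ v = p $ ((g ^^ i) v)" for i
      by (induction i) (simp_all add: matrix_vector_mul_assoc[symmetric] sym_matrix p_def qg)
    then show "\<tau> x *v p $ v = p $ \<theta> x v"
      unfolding \<tau>_def using theta_eq x carrier by simp
  qed
  then have "symmetric_isostatic_framework N E n \<theta> \<tau> p"
    unfolding symmetric_isostatic_framework_def using rep place wp iso by blast
  moreover have "\<tau> \<gamma> = ?M"
  proof -
    have "nat (\<gamma> * \<gamma>) mod n = 1 mod n" using gen by auto
    from addM[OF this] show ?thesis unfolding \<tau>_def by simp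
  qed
  ultimately show ?thesis by blast
qed

end

section \<open>Fixed edges of symmetric frameworks\<close>

text \<open>
  A reflection that negates the first functional allows no edge of the first colour on its axis
  and no edge of the second colour that it reverses. By the count of fixed edges the second tree
  needs a fixed vertex, and the first tree then forbids more than one.
\<close>

lemma reflected_trees_no_fixed_edge:
  fixes T1 T2 :: "'v::finite set set"
  assumes T: "tree T1" "tree T2"
    and g: "\<And>v. g (g v) = v" and gT: "\<And>e. e \<in> T1 \<Longrightarrow> g ` e \<in> T1" "\<And>e. e \<in> T2 \<Longrightarrow> g ` e \<in> T2"
    and no_pointwise: "\<And>v w. {v, w} \<in> T1 \<Longrightarrow> g v = v \<Longrightarrow> g w = w \<Longrightarrow> False"
    and no_reversed: "\<And>v. {v, g v} \<in> T2 \<Longrightarrow> False"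
  shows "fixed_edges (T1 \<union> T2) g = {}"
proof -
  let ?f1 = "{e \<in> T1. g ` e = e}" and ?f2 = "{e \<in> T2. g ` e = e}"
  have ends: "\<exists>v w. e = {v, w} \<and> ((g v = v \<and> g w = w) \<or> g v = w)" if e: "e \<in> T" "tree T" "g ` e = e" for e T
  proof -
    have "card e = 2" using e(1,2) unfolding tree_def by blast
    then obtain v w where vw: "e = {v, w}" "v \<noteq> w" by (auto simp: card_2_iff)
    have im: "g v \<in> {v, w}" "g w \<in> {v, w}" using e(3) unfolding vw(1) by blast+
    have "g v \<noteq> g w" using vw(2) g[of v] g[of w] by metis
    then have "(g v = v \<and> g w = w) \<or> g v = w" using im by (cases "g v = v") simp_all
    then show ?thesis using vw(1) by blast
  qed
  have "\<exists>r. g r = r"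
  proof (rule ccontr)
    assume "\<nexists>r. g r = r"
    then have nofix: "\<And>v. g v \<noteq> v" by blast
    have "card ?f2 = 1" by (rule tree_involution_free[of T2 g, OF T(2) g gT(2) nofix])
    then obtain e where f: "?f2 = {e}" by (rule card_1_singletonE)
    have "e \<in> ?f2" unfolding f by simp
    then have e: "e \<in> T2" "g ` e = e" by simp_all
    from ends[OF e(1) T(2) e(2)] obtain v w where vw: "e = {v, w}" "(g v = v \<and> g w = w) \<or> g v = w" by blast
    then have "g v = w" using nofix by blast
    then show False using no_reversed[of v] e(1) vw(1) by simp
  qed
  then obtain r where r: "g r = r" ..
  note rev1 = tree_involution_fixed_vertex(1)[of T1 g r, OF T(1) g gT(1) r]
  have f1: "?f1 = {}"
  proof (rule ccontr)
    assume "?f1 \<noteq> {}"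
    then obtain e where e: "e \<in> T1" "g ` e = e" by blast
    from ends[OF e(1) T(1) e(2)] obtain v w where vw: "e = {v, w}" "(g v = v \<and> g w = w) \<or> g v = w" by blast
    then show False using no_pointwise[of v w] rev1[of v] e(1) by blast
  qed
  have "Suc (card ?f1) = card {v. g v = v}"
    by (rule tree_involution_fixed_vertex(2)[of T1 g r, OF T(1) g gT(1) r])
  moreover have "Suc (card ?f2) = card {v. g v = v}"
    by (rule tree_involution_fixed_vertex(2)[of T2 g r, OF T(2) g gT(2) r])
  ultimately have "card ?f2 = card ?f1" by linarith
  then have "card ?f2 = 0" by (simp only: f1 card.empty)
  then have f2: "?f2 = {}" by simp
  have "fixed_edges (T1 \<union> T2) g = ?f1 \<union> ?f2" unfolding fixed_edges_def by blast
  then show ?thesis unfolding f1 f2 by simp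
qed

text \<open>
  The projection is $x \mapsto (c \cdot x)\, d$.
\<close>

lemma is_reflectionI:
  fixes A :: "real^2^2"
  assumes cd: "c \<bullet> d = 1" and A: "\<And>x. A *v x = x - (2 * (c \<bullet> x)) *\<^sub>R d"
  shows "is_reflection A"
proof -
  have lin: "linear (\<lambda>x. (c \<bullet> x) *\<^sub>R d)"
    by (intro linearI) (simp_all add: inner_add_right algebra_simps)
  define P where "P = matrix (\<lambda>x. (c \<bullet> x) *\<^sub>R d)"
  have P: "P *v x = (c \<bullet> x) *\<^sub>R d" for x
    using fun_cong[OF matrix_vector_mul(2)[OF lin], of x] by (simp add: P_def)
  have "P ** P = P" unfolding matrix_eq by (simp add: matrix_vector_mul_assoc[symmetric] P cd)
  moreover have "rank P = 1"
  proof -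
    have "range ((*v) P) = span {d}"
      unfolding span_singleton
    proof (intro equalityI subsetI)
      fix y assume "y \<in> range (\<lambda>k. k *\<^sub>R d)"
      then obtain k where "y = k *\<^sub>R d" by blast
      then have "y = P *v (k *\<^sub>R d)" by (simp add: P cd)
      then show "y \<in> range ((*v) P)" by blast
    qed (auto simp: P)
    moreover have "d \<noteq> 0" using cd by auto
    then have "independent {d}" by simp
    ultimately show ?thesis unfolding rank_dim_range by (simp add: dim_span_eq_card_independent)
  qed
  moreover have "A = mat 1 - 2 *\<^sub>R P"
    unfolding matrix_eq
    by (simp add: matrix_vector_mult_diff_rdistrib scaleR_matrix_vector_assoc[symmetric] P A)
  ultimately show ?thesis unfolding is_reflection_def by blast
qed

context quad_norm
begin

text \<open>
  The identity and $-1$ are not reflections, since the projection would have rank zero or two.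
\<close>

lemma reflection_signs:
  assumes refl: "is_reflection A" and s: "\<bar>s\<bar> = 1" "\<bar>t\<bar> = 1"
    and A: "\<And>x. a \<bullet> (A *v x) = s * (a \<bullet> x) \<and> b \<bullet> (A *v x) = t * (b \<bullet> x)"
  shows "(s = -1 \<and> t = 1) \<or> (s = 1 \<and> t = -1)"
proof (rule ccontr)
  assume "\<not> ?thesis"
  then have st: "s = t" using s by auto
  obtain P where P: "rank P = 1" "A = mat 1 - 2 *\<^sub>R P" using refl unfolding is_reflection_def by blast
  have PA: "2 *\<^sub>R (P *v x) = x - A *v x" for x
    by (simp add: P(2) matrix_vector_mult_diff_rdistrib scaleR_matrix_vector_assoc[symmetric])
  have Ax: "A *v x = s *\<^sub>R x" for x using A[of x] st by (intro coord_eqI) simp_all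
  show False
  proof (cases "s = 1")
    case True
    then have "P *v x = 0" for x using PA[of x] Ax[of x] by simp
    then have "P = 0" by (simp add: matrix_eq)
    then show False using P(1) by (simp add: rank_eq_0)
  next
    case False
    then have "s = -1" using s by auto
    then have "2 *\<^sub>R (P *v x) = 2 *\<^sub>R x" for x using PA[of x] Ax[of x] by (simp add: scaleR_2)
    then have "P = mat 1" by (simp add: matrix_eq)
    then show False using P(1) by (simp add: rank_I)
  qed
qed

lemma face_image_involution:
  assumes "\<And>x. A *v (A *v x) = x" "\<And>x. N (A *v x) = N x" "\<And>x. c \<bullet> (A *v x) = d \<bullet> x"
  shows "(*v) A ` face N c = face N d"
proof (intro equalityI subsetI)
  fix y assume "y \<in> (*v) A ` face N c"
  then obtain x where x: "y = A *v x" "x \<in> face N c" by blast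
  have "d \<bullet> y = c \<bullet> x" unfolding x(1) using assms(3)[of "A *v x"] assms(1) by simp
  then show "y \<in> face N d" using x assms(2) by (simp add: face_def)
next
  fix y assume "y \<in> face N d"
  then have "A *v y \<in> face N c" by (simp add: face_def assms)
  then show "y \<in> (*v) A ` face N c" using assms(1)[of y] by (metis imageI)
qed

lemma sym_matrix_Mirror:
  "a \<bullet> (sym_matrix Mirror *v x) = - (a \<bullet> x)" "b \<bullet> (sym_matrix Mirror *v x) = b \<bullet> x"
  by (simp_all add: sym_matrix coords_def field_simps)

lemma sym_matrix_Swap:
  "a \<bullet> (sym_matrix Swap *v x) = b \<bullet> x" "b \<bullet> (sym_matrix Swap *v x) = a \<bullet> x"
  by (simp_all add: sym_matrix coords_def field_simps)

lemma Mirror_reflection: "is_reflection (sym_matrix Mirror)" "preserves_facets N (sym_matrix Mirror)"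
proof -
  show "is_reflection (sym_matrix Mirror)"
    by (rule is_reflectionI[of a e1], simp, rule coord_eqI)
      (simp_all add: sym_matrix_Mirror inner_diff_right)
  have inv: "sym_matrix Mirror *v (sym_matrix Mirror *v x) = x" for x
    by (rule coord_eqI) (simp_all add: sym_matrix_Mirror)
  have img: "(*v) (sym_matrix Mirror) ` face N c = face N d"
    if "\<And>x. c \<bullet> (sym_matrix Mirror *v x) = d \<bullet> x" for c d
    using inv norm_sym_matrix that by (rule face_image_involution)
  have "(*v) (sym_matrix Mirror) ` face N a = face N (- a)" "(*v) (sym_matrix Mirror) ` face N (- a) = face N a"
    "(*v) (sym_matrix Mirror) ` face N b = face N b" "(*v) (sym_matrix Mirror) ` face N (- b) = face N (- b)"
    by (rule img, simp add: sym_matrix_Mirror)+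
  then show "preserves_facets N (sym_matrix Mirror)"
    unfolding preserves_facets_def facets by (simp add: facet_class_def uminus_face)
qed

lemma Swap_reflection: "is_reflection (sym_matrix Swap)" "swaps_facets N (sym_matrix Swap)"
proof -
  show "is_reflection (sym_matrix Swap)"
  proof (rule is_reflectionI[of "(1 / 2) *\<^sub>R (a - b)" "e1 - e2"])
    show "(1 / 2) *\<^sub>R (a - b) \<bullet> (e1 - e2) = 1" by (simp add: inner_diff_left inner_diff_right)
    show "sym_matrix Swap *v x = x - (2 * ((1 / 2) *\<^sub>R (a - b) \<bullet> x)) *\<^sub>R (e1 - e2)" for x
      by (rule coord_eqI) (simp_all add: sym_matrix_Swap inner_diff_right inner_diff_left, simp_all add: field_simps)
  qed
  have inv: "sym_matrix Swap *v (sym_matrix Swap *v x) = x" for x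
    by (rule coord_eqI) (simp_all add: sym_matrix_Swap)
  have img: "(*v) (sym_matrix Swap) ` face N c = face N d"
    if "\<And>x. c \<bullet> (sym_matrix Swap *v x) = d \<bullet> x" for c d
    using inv norm_sym_matrix that by (rule face_image_involution)
  have "(*v) (sym_matrix Swap) ` face N a = face N b" "(*v) (sym_matrix Swap) ` face N b = face N a"
    by (rule img, simp add: sym_matrix_Swap)+
  moreover have "facets N = facet_class (face N a) \<union> facet_class (face N b)"
    unfolding facets facet_class_def uminus_face by auto
  ultimately show "swaps_facets N (sym_matrix Swap)"
    unfolding swaps_facets_def by (intro exI[of _ "face N a"] exI[of _ "face N b"]) (simp add: facet_class_def)
qed

lemma Half_half_turn: "half_turn (sym_matrix Half)"
proof -
  have "sym_matrix Half *v x = (- mat 1) *v x" for x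
  proof -
    have "(- mat 1) *v x = - x" by (simp add: vec_eq_iff matrix_vector_mult_def forall_2 sum_2 mat_def)
    moreover have "sym_matrix Half *v x = - x"
      by (rule coord_eqI) (simp_all add: sym_matrix coords_def field_simps)
    ultimately show ?thesis by simp
  qed
  then show ?thesis unfolding half_turn_def matrix_eq by blast
qed

lemma Quarter_quarter_turn: "quarter_turn (sym_matrix Quarter)"
proof -
  have "(sym_matrix Quarter ** sym_matrix Quarter) *v x = (- mat 1) *v x" for x
  proof -
    have "(- mat 1) *v x = - x" by (simp add: vec_eq_iff matrix_vector_mult_def forall_2 sum_2 mat_def)
    moreover have "sym_matrix Quarter *v (sym_matrix Quarter *v x) = - x"
      by (rule coord_eqI) (simp_all add: sym_matrix coords_def field_simps)
    ultimately show ?thesis by (simp add: matrix_vector_mul_assoc[symmetric])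
  qed
  then show ?thesis unfolding quarter_turn_def matrix_eq by blast
qed

end

context symmetric_graph
begin

text \<open>
  An isostatic framework colours the edges by the dominant functional, and the two colour
  classes are the two spanning trees.
\<close>

lemma framework_facts:
  assumes "symmetric_isostatic_framework N E n \<theta> \<tau> p"
  shows "\<tau> \<gamma> *v p $ v = p $ g v" "isometry N (\<tau> \<gamma>)" "p $ v = p $ w \<Longrightarrow> v = w"
    "tree (dominant a b p E)" "tree (dominant b a p E)"
    "dominant a b p E \<inter> dominant b a p E = {}" "E = dominant a b p E \<union> dominant b a p E"
    "edge_disjoint_spanning_trees E (dominant a b p E) (dominant b a p E)"
proof -
  have fw: "placement p" "well_positioned N E p" "isostatic N E p" "symmetric_framework N n \<theta> \<tau> p"
    using assms unfolding symmetric_isostatic_framework_def by auto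
  show "\<tau> \<gamma> *v p $ v = p $ g v" "isometry N (\<tau> \<gamma>)"
    using fw(4) \<gamma>_in unfolding symmetric_framework_def carrier by auto
  show "p $ v = p $ w \<Longrightarrow> v = w" using fw(1) by (auto simp: placement_def inj_def)
  have un: "unambiguous a b p E" using well_positioned_iff[OF simple fw(1)] fw(2) by simp
  show T: "tree (dominant a b p E)" "tree (dominant b a p E)"
    using isostatic_iff_trees[OF simple un] fw(3) by simp_all
  show D: "dominant a b p E \<inter> dominant b a p E = {}"
  proof (rule ccontr)
    assume "dominant a b p E \<inter> dominant b a p E \<noteq> {}"
    then obtain e where e: "e \<in> dominant a b p E" "e \<in> dominant b a p E" by blast
    then have "e \<in> E" by (simp add: dominant_def)
    then obtain v w where "e = {v, w}" by (rule edgeE)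
    then show False using e by (simp add: dominant_iff)
  qed
  show U: "E = dominant a b p E \<union> dominant b a p E"
  proof (intro equalityI subsetI)
    fix e assume e: "e \<in> E"
    then obtain v w where "e = {v, w}" by (rule edgeE)
    then show "e \<in> dominant a b p E \<union> dominant b a p E" using unambiguousD[OF un, of v w] e by simp
  qed (auto simp: dominant_def)
  have "dominant a b p E \<subseteq> E" "dominant b a p E \<subseteq> E" by (auto simp: dominant_def)
  then show "edge_disjoint_spanning_trees E (dominant a b p E) (dominant b a p E)"
    unfolding edge_disjoint_spanning_trees_def using T D U spanning_tree_of_tree by blast
qed

lemma dominant_image:
  assumes Ap: "\<And>v. A *v p $ v = p $ g v"
    and A: "\<And>x. \<bar>a' \<bullet> (A *v x)\<bar> = \<bar>c \<bullet> x\<bar>" "\<And>x. \<bar>b' \<bullet> (A *v x)\<bar> = \<bar>d \<bullet> x\<bar>"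
    and e: "e \<in> dominant c d p E"
  shows "g ` e \<in> dominant a' b' p E"
proof -
  have "e \<in> E" using e by (simp add: dominant_def)
  then obtain v w where vw: "e = {v, w}" by (rule edgeE)
  have "p $ g v - p $ g w = A *v (p $ v - p $ w)" by (simp add: matrix_vector_mult_diff_distrib Ap)
  moreover have "{g v, g w} \<in> E" using g_edge[OF \<open>e \<in> E\<close>] by (simp add: vw)
  ultimately have "{g v, g w} \<in> dominant a' b' p E"
    using e A[of "p $ v - p $ w"] unfolding vw dominant_iff by simp
  then show ?thesis by (simp add: vw)
qed

text \<open>
  An isometry that permutes the functionals up to sign permutes the colours accordingly.
\<close>

lemma graph_image_dominant:
  assumes Ap: "\<And>v. A *v p $ v = p $ g v"
    and A: "\<And>x. \<bar>a' \<bullet> (A *v x)\<bar> = \<bar>c \<bullet> x\<bar>" "\<And>x. \<bar>b' \<bullet> (A *v x)\<bar> = \<bar>d \<bullet> x\<bar>"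
      "\<And>x. \<bar>c \<bullet> (A *v x)\<bar> = \<bar>a' \<bullet> x\<bar>" "\<And>x. \<bar>d \<bullet> (A *v x)\<bar> = \<bar>b' \<bullet> x\<bar>"
  shows "graph_image g (dominant c d p E) = dominant a' b' p E"
proof (rule graph_image_eq)
  show "graph_image g (dominant c d p E) \<subseteq> dominant a' b' p E"
    using dominant_image[of A p a' c b' d, OF Ap A(1,2)] unfolding graph_image_def by blast
  show "graph_image g (dominant a' b' p E) \<subseteq> dominant c d p E"
    using dominant_image[of A p c a' d b', OF Ap A(3,4)] unfolding graph_image_def by blast
qed

lemma graph_imageD: "graph_image g T1 = T2 \<Longrightarrow> e \<in> T1 \<Longrightarrow> g ` e \<in> T2"
  unfolding graph_image_def by blast

lemma preserving_reflection_necessary: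
  assumes n: "n = 2" and fw: "symmetric_isostatic_framework N E n \<theta> \<tau> p"
    and refl: "is_reflection (\<tau> \<gamma>)" and pres: "preserves_facets N (\<tau> \<gamma>)"
  shows "(\<exists>G1 G2. edge_disjoint_spanning_trees E G1 G2 \<and> symmetric_subgraph n \<theta> G1 \<and> symmetric_subgraph n \<theta> G2) \<and>
    fixed_edges E g = {}"
proof -
  let ?A = "\<tau> \<gamma>" and ?G1 = "dominant a b p E" and ?G2 = "dominant b a p E"
  note ff = framework_facts[OF fw]
  obtain s t where st: "\<bar>s\<bar> = 1" "\<bar>t\<bar> = 1" and A: "\<And>x. a \<bullet> (?A *v x) = s * (a \<bullet> x) \<and> b \<bullet> (?A *v x) = t * (b \<bullet> x)"
    using preserves_facets_coords[OF pres] by blast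
  have abs: "\<bar>a \<bullet> (?A *v x)\<bar> = \<bar>a \<bullet> x\<bar>" "\<bar>b \<bullet> (?A *v x)\<bar> = \<bar>b \<bullet> x\<bar>" for x
    using A[of x] st by (simp_all add: abs_mult)
  have img: "graph_image g ?G1 = ?G1" "graph_image g ?G2 = ?G2"
    by (rule graph_image_dominant[OF ff(1)], (rule abs)+)+
  have gg: "g (g v) = v" for v using g_period[of v] n by (simp add: numeral_2_eq_2)
  have no_rev: "{v, g v} \<notin> dominant c d p E" if "\<And>x. c \<bullet> (?A *v x) = c \<bullet> x" for c d v
    using that[of "p $ v"] unfolding dominant_iff ff(1) by (simp add: inner_diff_right)
  have no_pt: False if "\<And>x. c \<bullet> (?A *v x) = - (c \<bullet> x)" "{v, w} \<in> dominant c d p E" "g v = v" "g w = w" for c d v w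
    using that(1)[of "p $ v"] that(1)[of "p $ w"] that(2-4) unfolding dominant_iff ff(1) by (simp add: inner_diff_right)
  have "fixed_edges E g = {}"
    using reflection_signs[OF refl st A]
  proof
    assume s: "s = -1 \<and> t = 1"
    have "fixed_edges (?G1 \<union> ?G2) g = {}"
    proof (rule reflected_trees_no_fixed_edge[OF ff(4,5) gg graph_imageD[OF img(1)] graph_imageD[OF img(2)]])
      show False if "{v, w} \<in> ?G1" "g v = v" "g w = w" for v w
        by (rule no_pt[OF _ that]) (use A s in simp)
      show False if "{v, g v} \<in> ?G2" for v using no_rev[where c = b and d = a and v = v] that A s by simp
    qed
    then show ?thesis using ff(7) by simp
  next
    assume s: "s = 1 \<and> t = -1"
    have "fixed_edges (?G2 \<union> ?G1) g = {}"
    proof (rule reflected_trees_no_fixed_edge[OF ff(5,4) gg graph_imageD[OF img(2)] graph_imageD[OF img(1)]])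
      show False if "{v, w} \<in> ?G2" "g v = v" "g w = w" for v w
        by (rule no_pt[OF _ that]) (use A s in simp)
      show False if "{v, g v} \<in> ?G1" for v using no_rev[where c = a and d = b and v = v] that A s by simp
    qed
    then show ?thesis using ff(7) by (simp add: Un_commute)
  qed
  then show ?thesis using ff(8) img symmetric_subgraph_iff[OF n] by blast
qed

lemma swapped_trees:
  assumes fw: "symmetric_isostatic_framework N E n \<theta> \<tau> p" and st: "\<bar>s\<bar> = 1" "\<bar>t\<bar> = 1"
    and A: "\<forall>x. a \<bullet> (\<tau> \<gamma> *v x) = s * (b \<bullet> x) \<and> b \<bullet> (\<tau> \<gamma> *v x) = t * (a \<bullet> x)"
  shows "graph_image g (dominant a b p E) = dominant b a p E" "graph_image g (dominant b a p E) = dominant a b p E"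
proof -
  have abs: "\<bar>a \<bullet> (\<tau> \<gamma> *v x)\<bar> = \<bar>b \<bullet> x\<bar>" "\<bar>b \<bullet> (\<tau> \<gamma> *v x)\<bar> = \<bar>a \<bullet> x\<bar>" for x
    using A st by (simp_all add: abs_mult)
  show "graph_image g (dominant a b p E) = dominant b a p E" "graph_image g (dominant b a p E) = dominant a b p E"
    by (rule graph_image_dominant[OF framework_facts(1)[OF fw]], (rule abs)+)+
qed

lemma swapping_reflection_necessary:
  assumes fw: "symmetric_isostatic_framework N E n \<theta> \<tau> p" and swap: "swaps_facets N (\<tau> \<gamma>)"
  shows "(\<exists>G1 G2. edge_disjoint_spanning_trees E G1 G2 \<and> G1 = graph_image g G2 \<and> G2 = graph_image g G1) \<and>
    fixed_edges E g = {}"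
proof -
  note ff = framework_facts[OF fw]
  obtain s t where st: "\<bar>s\<bar> = 1" "\<bar>t\<bar> = 1"
    "\<forall>x. a \<bullet> (\<tau> \<gamma> *v x) = s * (b \<bullet> x) \<and> b \<bullet> (\<tau> \<gamma> *v x) = t * (a \<bullet> x)"
    using swaps_facets_coords[OF swap] by blast
  note img = swapped_trees[OF fw st]
  have "g ` e \<noteq> e" if "e \<in> E" for e
  proof -
    have "e \<in> dominant a b p E \<or> e \<in> dominant b a p E" using that ff(7) by blast
    then show ?thesis using graph_imageD[OF img(1), of e] graph_imageD[OF img(2), of e] ff(6) by auto
  qed
  then have "fixed_edges E g = {}" unfolding fixed_edges_def by blast
  then show ?thesis using ff(8) img by metis
qed

text \<open>
  A vertex fixed by the half turn is at the origin, so there is at most one.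
\<close>

lemma point_reflection_fixed_edges:
  assumes fw: "symmetric_isostatic_framework N E n \<theta> \<tau> p" and ph: "\<And>v. p $ h v = - p $ v"
    and h: "\<And>v. h (h v) = v"
    and hT: "\<And>e. e \<in> dominant a b p E \<Longrightarrow> h ` e \<in> dominant a b p E" "\<And>e. e \<in> dominant b a p E \<Longrightarrow> h ` e \<in> dominant b a p E"
  shows "fixed_edges E h = {} \<or> card (fixed_edges E h) = 2"
proof -
  note ff = framework_facts[OF fw]
  have zero: "p $ v = 0" if "h v = v" for v
  proof -
    have "p $ v = - p $ v" using ph[of v] that by simp
    then show ?thesis by (simp add: vec_eq_iff)
  qed
  have "card {v. h v = v} \<le> 1"
    unfolding One_nat_def by (subst card_le_Suc0_iff_eq) (auto intro: ff(3) simp: zero)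
  from disjoint_trees_fixed_edges(3)[OF ff(4-6) h hT this] show ?thesis using ff(7) by simp
qed

lemma half_turn_necessary:
  assumes n: "n = 2" and fw: "symmetric_isostatic_framework N E n \<theta> \<tau> p" and half: "half_turn (\<tau> \<gamma>)"
  shows "(\<exists>G1 G2. edge_disjoint_spanning_trees E G1 G2 \<and> symmetric_subgraph n \<theta> G1 \<and> symmetric_subgraph n \<theta> G2) \<and>
    (fixed_edges E g = {} \<or> card (fixed_edges E g) = 2)"
proof -
  note ff = framework_facts[OF fw]
  have A: "\<tau> \<gamma> *v x = - x" for x
    using half unfolding half_turn_def by (simp add: vec_eq_iff matrix_vector_mult_def forall_2 sum_2 mat_def)
  have img: "graph_image g (dominant a b p E) = dominant a b p E" "graph_image g (dominant b a p E) = dominant b a p E"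
    by (rule graph_image_dominant[OF ff(1)], simp_all add: A)+
  have gg: "g (g v) = v" for v using g_period[of v] n by (simp add: numeral_2_eq_2)
  have pg: "p $ g v = - p $ v" for v using ff(1)[of v] A by simp
  have "fixed_edges E g = {} \<or> card (fixed_edges E g) = 2"
    by (rule point_reflection_fixed_edges[OF fw pg gg graph_imageD[OF img(1)] graph_imageD[OF img(2)]])
  then show ?thesis using ff(8) img symmetric_subgraph_iff[OF n] by blast
qed

lemma quarter_turn_necessary:
  assumes n: "n = 4" and fw: "symmetric_isostatic_framework N E n \<theta> \<tau> p" and quarter: "quarter_turn (\<tau> \<gamma>)"
  shows "(\<exists>G1 G2. edge_disjoint_spanning_trees E G1 G2 \<and> G1 = graph_image g G2 \<and> G2 = graph_image g G1) \<and>
    (fixed_edges E (g \<circ> g) = {} \<or> card (fixed_edges E (g \<circ> g)) = 2)"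
proof -
  note ff = framework_facts[OF fw]
  obtain s t where st: "\<bar>s\<bar> = 1" "\<bar>t\<bar> = 1"
    "\<forall>x. a \<bullet> (\<tau> \<gamma> *v x) = s * (b \<bullet> x) \<and> b \<bullet> (\<tau> \<gamma> *v x) = t * (a \<bullet> x)"
    using quarter_turn_coords[OF ff(2) quarter] by blast
  note img = swapped_trees[OF fw st]
  have AA: "\<tau> \<gamma> *v (\<tau> \<gamma> *v x) = - x" for x
    using quarter unfolding quarter_turn_def matrix_vector_mul_assoc
    by (simp add: vec_eq_iff matrix_vector_mult_def forall_2 sum_2 mat_def)
  have "fixed_edges E (g \<circ> g) = {} \<or> card (fixed_edges E (g \<circ> g)) = 2"
  proof (rule point_reflection_fixed_edges[OF fw])
    show "p $ (g \<circ> g) v = - p $ v" for v using AA[of "p $ v"] by (simp add: ff(1))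
    show "(g \<circ> g) ((g \<circ> g) v) = v" for v using g_period[of v] n by (simp add: eval_nat_numeral)
    show "(g \<circ> g) ` e \<in> dominant a b p E" if "e \<in> dominant a b p E" for e
      using graph_imageD[OF img(2) graph_imageD[OF img(1) that]] by (simp add: image_comp)
    show "(g \<circ> g) ` e \<in> dominant b a p E" if "e \<in> dominant b a p E" for e
      using graph_imageD[OF img(1) graph_imageD[OF img(2) that]] by (simp add: image_comp)
  qed
  then show ?thesis using ff(8) img by metis
qed

section \<open>The four equivalences\<close>

lemma symmetric_treesI:
  assumes n: "period ty = n" and G: "edge_disjoint_spanning_trees E G1 G2"
    and img: "graph_image g G1 = (if swaps_colours ty then G2 else G1)" "graph_image g G2 = (if swaps_colours ty then G1 else G2)"
  shows "symmetric_trees ty g (\<lambda>c. if c then G1 else G2)"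
proof
  show "tree (if c then G1 else G2)" for c
    using G tree_of_spanning_tree unfolding edge_disjoint_spanning_trees_def by auto
  show "(if True then G1 else G2) \<inter> (if False then G1 else G2) = {}"
    using G unfolding edge_disjoint_spanning_trees_def by simp
  show "(g ^^ period ty) v = v" for v using g_period n by simp
  show "g ` e \<in> (if c \<noteq> swaps_colours ty then G1 else G2)" if "e \<in> (if c then G1 else G2)" for e c
    using graph_imageD[OF img(1), of e] graph_imageD[OF img(2), of e] that
    by (cases c; cases "swaps_colours ty") simp_all
qed

lemma realized:
  assumes n: "period ty = n" and G: "edge_disjoint_spanning_trees E G1 G2"
    and q: "\<exists>q. realizes ty UNIV g (\<lambda>c. if c then G1 else G2) q"
  shows "\<exists>\<tau> p. symmetric_isostatic_framework N E n \<theta> \<tau> p \<and> \<tau> \<gamma> = sym_matrix ty"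
proof -
  obtain q where q: "realizes ty UNIV g (\<lambda>c. if c then G1 else G2) q" using q by blast
  show ?thesis
    by (rule sufficient[OF n q]) (use G tree_of_spanning_tree in \<open>auto simp: edge_disjoint_spanning_trees_def\<close>)
qed

text \<open>
  The half turn is the generator itself for order two and its square for order four; the two
  cases share the argument.
\<close>

lemma central_sufficient:
  assumes n: "period ty = n" and ty: "ty = Half \<or> ty = Quarter" and G: "edge_disjoint_spanning_trees E G1 G2"
    and img: "graph_image g G1 = (if swaps_colours ty then G2 else G1)" "graph_image g G2 = (if swaps_colours ty then G1 else G2)"
    and fixed: "fixed_edges E (g ^^ (n div 2)) = {} \<or> card (fixed_edges E (g ^^ (n div 2))) = 2"
  shows "\<exists>\<tau> p. symmetric_isostatic_framework N E n \<theta> \<tau> p \<and> \<tau> \<gamma> = sym_matrix ty"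
proof -
  interpret T: symmetric_trees ty g "\<lambda>c. if c then G1 else G2" by (rule symmetric_treesI[OF n G img])
  have E: "E = G1 \<union> G2" using G by (simp add: edge_disjoint_spanning_trees_def)
  have cen: "central ty" using ty by (auto simp: central_def)
  show ?thesis
    using fixed
  proof
    assume "fixed_edges E (g ^^ (n div 2)) = {}"
    then show ?thesis
      by (intro realized[OF n G] T.realizable_no_fixed_edge[OF cen]) (simp add: E T.h_def n)
  next
    assume "card (fixed_edges E (g ^^ (n div 2))) = 2"
    then show ?thesis
      by (intro realized[OF n G] T.realizable_two_fixed_edges[OF ty]) (simp add: E T.h_def n)
  qed
qed

lemma Mirror_sufficient:
  assumes n: "n = 2" and G: "edge_disjoint_spanning_trees E G1 G2"
    and img: "graph_image g G1 = G1" "graph_image g G2 = G2" and fixed: "fixed_edges E g = {}"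
  shows "\<exists>\<tau> p. symmetric_isostatic_framework N E n \<theta> \<tau> p \<and> \<tau> \<gamma> = sym_matrix Mirror"
proof -
  have p: "period Mirror = n" using n by simp
  interpret T: symmetric_trees Mirror g "\<lambda>c. if c then G1 else G2"
    by (rule symmetric_treesI[OF p G]) (simp_all add: swaps_colours_def img)
  have E: "E = G1 \<union> G2" using G by (simp add: edge_disjoint_spanning_trees_def)
  show ?thesis
    using fixed by (intro realized[OF p G] T.realizable_no_fixed_edge) (simp_all add: central_def E T.h_def)
qed

lemma Swap_sufficient:
  assumes n: "n = 2" and G: "edge_disjoint_spanning_trees E G1 G2"
    and img: "G1 = graph_image g G2" "G2 = graph_image g G1"
  shows "\<exists>\<tau> p. symmetric_isostatic_framework N E n \<theta> \<tau> p \<and> \<tau> \<gamma> = sym_matrix Swap"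
proof -
  have p: "period Swap = n" using n by simp
  interpret T: symmetric_trees Swap g "\<lambda>c. if c then G1 else G2"
    by (rule symmetric_treesI[OF p G]) (simp_all only: img[symmetric] swaps_colours_def simp_thms if_True)
  show ?thesis by (intro realized[OF p G] T.realizable_Swap) simp
qed

end

theorem theorem1p1:
  fixes N :: "real^2 \<Rightarrow> real"
    and E :: "'v::finite set set"
    and n :: nat
    and \<theta> :: "int \<Rightarrow> 'v \<Rightarrow> 'v"
    and \<gamma> :: int
  assumes "is_norm N" and "quadrilateral_ball N"
    and "simple_graph E"
    and "n \<in> {2, 4}"
    and "graph_action n E \<theta>"
    and "\<gamma> \<in> carrier (integer_mod_group n)"
    and "generate (integer_mod_group n) {\<gamma>} = carrier (integer_mod_group n)"
  shows
    "(n = 2 \<longrightarrow>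
       ((\<exists>\<tau> p. symmetric_isostatic_framework N E n \<theta> \<tau> p \<and>
               is_reflection (\<tau> \<gamma>) \<and> preserves_facets N (\<tau> \<gamma>))
        \<longleftrightarrow>
        ((\<exists>G1 G2. edge_disjoint_spanning_trees E G1 G2 \<and>
               symmetric_subgraph n \<theta> G1 \<and> symmetric_subgraph n \<theta> G2) \<and>
         fixed_edges E (\<theta> \<gamma>) = {})))
     \<and>
     (n = 2 \<longrightarrow>
       ((\<exists>\<tau> p. symmetric_isostatic_framework N E n \<theta> \<tau> p \<and>
               is_reflection (\<tau> \<gamma>) \<and> swaps_facets N (\<tau> \<gamma>))
        \<longleftrightarrow>
        ((\<exists>G1 G2. edge_disjoint_spanning_trees E G1 G2 \<and>
               G1 = graph_image (\<theta> \<gamma>) G2 \<and> G2 = graph_image (\<theta> \<gamma>) G1) \<and>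
         fixed_edges E (\<theta> \<gamma>) = {})))
     \<and>
     (n = 2 \<longrightarrow>
       ((\<exists>\<tau> p. symmetric_isostatic_framework N E n \<theta> \<tau> p \<and> half_turn (\<tau> \<gamma>))
        \<longleftrightarrow>
        ((\<exists>G1 G2. edge_disjoint_spanning_trees E G1 G2 \<and>
               symmetric_subgraph n \<theta> G1 \<and> symmetric_subgraph n \<theta> G2) \<and>
         (fixed_edges E (\<theta> \<gamma>) = {} \<or> card (fixed_edges E (\<theta> \<gamma>)) = 2))))
     \<and>
     (n = 4 \<longrightarrow>
       ((\<exists>\<tau> p. symmetric_isostatic_framework N E n \<theta> \<tau> p \<and> quarter_turn (\<tau> \<gamma>))
        \<longleftrightarrow>
        ((\<exists>G1 G2. edge_disjoint_spanning_trees E G1 G2 \<and>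
               G1 = graph_image (\<theta> \<gamma>) G2 \<and> G2 = graph_image (\<theta> \<gamma>) G1) \<and>
         (fixed_edges E (\<theta> (\<gamma> [^]\<^bsub>integer_mod_group n\<^esub> (2::nat))) = {} \<or>
          card (fixed_edges E (\<theta> (\<gamma> [^]\<^bsub>integer_mod_group n\<^esub> (2::nat)))) = 2))))"
proof -
  obtain a b e1 e2 where "quad_norm N a b e1 e2" using quad_norm_exists[OF assms(1,2)] by blast
  then interpret quad_norm N a b e1 e2 .
  interpret symmetric_graph N a b e1 e2 E n \<theta> \<gamma>
    by unfold_locales (use assms(3,5) generator_cases[OF assms(4,6,7)] in auto)
  have square: "\<theta> (\<gamma> [^]\<^bsub>integer_mod_group n\<^esub> (2::nat)) = \<theta> \<gamma> \<circ> \<theta> \<gamma>"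
  proof
    have "\<gamma> [^]\<^bsub>integer_mod_group n\<^esub> (2::nat) = (int 2 * \<gamma>) mod int n" by (rule pow_integer_mod_group)
    then show "\<theta> (\<gamma> [^]\<^bsub>integer_mod_group n\<^esub> (2::nat)) v = (\<theta> \<gamma> \<circ> \<theta> \<gamma>) v" for v
      using theta_power[of 2 v] by (simp add: numeral_2_eq_2)
  qed
  show ?thesis
    unfolding square
  proof (intro conjI impI iffI)
    assume n: "n = 2"
    {
      assume "\<exists>\<tau> p. symmetric_isostatic_framework N E n \<theta> \<tau> p \<and> is_reflection (\<tau> \<gamma>) \<and> preserves_facets N (\<tau> \<gamma>)"
      then show "\<exists>G1 G2. edge_disjoint_spanning_trees E G1 G2 \<and> symmetric_subgraph n \<theta> G1 \<and> symmetric_subgraph n \<theta> G2"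
        and "fixed_edges E (\<theta> \<gamma>) = {}"
        using preserving_reflection_necessary[OF n] by blast+
    next
      assume "(\<exists>G1 G2. edge_disjoint_spanning_trees E G1 G2 \<and> symmetric_subgraph n \<theta> G1 \<and> symmetric_subgraph n \<theta> G2) \<and>
        fixed_edges E (\<theta> \<gamma>) = {}"
      then obtain \<tau> p where "symmetric_isostatic_framework N E n \<theta> \<tau> p" "\<tau> \<gamma> = sym_matrix Mirror"
        using Mirror_sufficient[OF n] unfolding symmetric_subgraph_iff[OF n] by blast
      then show "\<exists>\<tau> p. symmetric_isostatic_framework N E n \<theta> \<tau> p \<and> is_reflection (\<tau> \<gamma>) \<and> preserves_facets N (\<tau> \<gamma>)"
        using Mirror_reflection by metis
    next
      assume "\<exists>\<tau> p. symmetric_isostatic_framework N E n \<theta> \<tau> p \<and> is_reflection (\<tau> \<gamma>) \<and> swaps_facets N (\<tau> \<gamma>)"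
      then show "\<exists>G1 G2. edge_disjoint_spanning_trees E G1 G2 \<and> G1 = graph_image (\<theta> \<gamma>) G2 \<and> G2 = graph_image (\<theta> \<gamma>) G1"
        and "fixed_edges E (\<theta> \<gamma>) = {}"
        using swapping_reflection_necessary by blast+
    next
      assume "(\<exists>G1 G2. edge_disjoint_spanning_trees E G1 G2 \<and> G1 = graph_image (\<theta> \<gamma>) G2 \<and> G2 = graph_image (\<theta> \<gamma>) G1) \<and>
        fixed_edges E (\<theta> \<gamma>) = {}"
      then obtain \<tau> p where "symmetric_isostatic_framework N E n \<theta> \<tau> p" "\<tau> \<gamma> = sym_matrix Swap"
        using Swap_sufficient[OF n] by blast
      then show "\<exists>\<tau> p. symmetric_isostatic_framework N E n \<theta> \<tau> p \<and> is_reflection (\<tau> \<gamma>) \<and> swaps_facets N (\<tau> \<gamma>)"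
        using Swap_reflection by metis
    next
      assume "\<exists>\<tau> p. symmetric_isostatic_framework N E n \<theta> \<tau> p \<and> half_turn (\<tau> \<gamma>)"
      then show "\<exists>G1 G2. edge_disjoint_spanning_trees E G1 G2 \<and> symmetric_subgraph n \<theta> G1 \<and> symmetric_subgraph n \<theta> G2"
        and "fixed_edges E (\<theta> \<gamma>) = {} \<or> card (fixed_edges E (\<theta> \<gamma>)) = 2"
        using half_turn_necessary[OF n] by blast+
    next
      assume r: "(\<exists>G1 G2. edge_disjoint_spanning_trees E G1 G2 \<and> symmetric_subgraph n \<theta> G1 \<and> symmetric_subgraph n \<theta> G2) \<and>
        (fixed_edges E (\<theta> \<gamma>) = {} \<or> card (fixed_edges E (\<theta> \<gamma>)) = 2)"
      then obtain G1 G2 where G: "edge_disjoint_spanning_trees E G1 G2"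
        and img: "graph_image (\<theta> \<gamma>) G1 = G1" "graph_image (\<theta> \<gamma>) G2 = G2"
        unfolding symmetric_subgraph_iff[OF n] by blast
      have "\<exists>\<tau> p. symmetric_isostatic_framework N E n \<theta> \<tau> p \<and> \<tau> \<gamma> = sym_matrix Half"
        by (rule central_sufficient[OF _ _ G]) (use n img conjunct2[OF r] in \<open>simp_all add: swaps_colours_def\<close>)
      then show "\<exists>\<tau> p. symmetric_isostatic_framework N E n \<theta> \<tau> p \<and> half_turn (\<tau> \<gamma>)"
        using Half_half_turn by metis
    }
  next
    assume n: "n = 4"
    {
      assume "\<exists>\<tau> p. symmetric_isostatic_framework N E n \<theta> \<tau> p \<and> quarter_turn (\<tau> \<gamma>)"
      then show "\<exists>G1 G2. edge_disjoint_spanning_trees E G1 G2 \<and> G1 = graph_image (\<theta> \<gamma>) G2 \<and> G2 = graph_image (\<theta> \<gamma>) G1"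
        and "fixed_edges E (\<theta> \<gamma> \<circ> \<theta> \<gamma>) = {} \<or> card (fixed_edges E (\<theta> \<gamma> \<circ> \<theta> \<gamma>)) = 2"
        using quarter_turn_necessary[OF n] by blast+
    next
      assume r: "(\<exists>G1 G2. edge_disjoint_spanning_trees E G1 G2 \<and> G1 = graph_image (\<theta> \<gamma>) G2 \<and> G2 = graph_image (\<theta> \<gamma>) G1) \<and>
        (fixed_edges E (\<theta> \<gamma> \<circ> \<theta> \<gamma>) = {} \<or> card (fixed_edges E (\<theta> \<gamma> \<circ> \<theta> \<gamma>)) = 2)"
      then obtain G1 G2 where G: "edge_disjoint_spanning_trees E G1 G2"
        and img: "G1 = graph_image (\<theta> \<gamma>) G2 \<and> G2 = graph_image (\<theta> \<gamma>) G1" by blast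
      have "\<theta> \<gamma> ^^ (n div 2) = \<theta> \<gamma> \<circ> \<theta> \<gamma>" using n by (simp add: numeral_2_eq_2[symmetric]) (simp add: numeral_2_eq_2 fun_eq_iff)
      moreover have "graph_image (\<theta> \<gamma>) G1 = (if swaps_colours Quarter then G2 else G1)"
        "graph_image (\<theta> \<gamma>) G2 = (if swaps_colours Quarter then G1 else G2)"
        by (simp_all only: img[THEN conjunct1, symmetric] img[THEN conjunct2, symmetric] swaps_colours_def simp_thms if_True)
      ultimately have "\<exists>\<tau> p. symmetric_isostatic_framework N E n \<theta> \<tau> p \<and> \<tau> \<gamma> = sym_matrix Quarter"
        using n conjunct2[OF r] by (intro central_sufficient[OF _ _ G]) simp_all
      then show "\<exists>\<tau> p. symmetric_isostatic_framework N E n \<theta> \<tau> p \<and> quarter_turn (\<tau> \<gamma>)"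
        using Quarter_quarter_turn by metis
    }
  qed
qed

end
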